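(* Let $d\ge 1$, let $0<\beta\le 2$ and $L>0$, and suppose that the probability density $p_0$ on $\mathbb{R}^d$ is $\sigma_0$-sub-Gaussian and belongs to the Sobolev class of densities $\mathcal{P}_{\mathcal S}(\beta,L)$. Let $t_0=n^{-\frac{2}{2\beta+d}}$ and $T=n^{\frac{2\beta}{2\beta+d}}$. Then there exists a score estimator $\hat s_t$, constructed from $n$ i.i.d. samples from $p_0$, such that the output $\widehat{\boldsymbol Y}_{T-t_0}$ of the Brownian diffusion model run with $\hat s_t$ satisfies $$\mathbb{E}\left[\mathrm{TV}\left(\boldsymbol X_0,\widehat{\boldsymbol Y}_{T-t_0}\right)\right]\ \lesssim\ \mathrm{polylog}(n)\,n^{-\frac{\beta}{2\beta+d}},$$ where $\boldsymbol X_0\sim p_0$.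
   Context: Sub-Gaussian: for a real random variable $Y$, $\|Y\|_{\psi_2}=\inf\{C>0:\mathbb{E}[e^{Y^2/C^2}-1]\le 1\}$; for a random vector $X\in\mathbb{R}^d$, $\|X\|_{\psi_2}=\sup_{v\in S^{d-1}}\|\langle X,v\rangle\|_{\psi_2}$. $X$ (or its law/density) is $\sigma$-sub-Gaussian if $\sigma=\|X\|_{\psi_2}<\infty$. Sobolev class: with $\mathcal F[p](\omega)=\int_{\mathbb{R}^d}p(x)e^{-i\langle\omega,x\rangle}dx$ and $\omega^\alpha=\prod_{i=1}^d\omega_i^{\alpha_i}$, $$\mathcal P_{\mathcal S}(\beta,L)=\Big\{p\in L^1(\mathbb{R}^d): p\ge0,\ \int p=1,\ \forall \alpha\in[0,\infty)^d\text{ with }\sum_{i=1}^d\alpha_i=\beta:\ \int|\omega^\alpha|^2|\mathcal F[p](\omega)|^2d\omega\le(2\pi)^dL^2\Big\},$$ where the $\alpha_i$ may be non-integer nonnegative reals and $|\omega^\alpha|=\prod_i|\omega_i|^{\alpha_i}$. A score estimator is a rule which, for each sample size $n\ge 2$ and time $t>0$, produces a function $\hat s_t:\mathbb{R}^d\to\mathbb{R}^d$ from $n$ i.i.d. samples from $p_0$, possibly using auxiliary randomness independent of the samples; the rule itself does not depend on the unknown $p_0$. Brownian diffusion model: given $\hat s_t$, an early stopping time $t_0$ and a terminal time $T$, draw $\widehat{\boldsymbol Y}_0\sim\mathcal N(0,TI_d)$ and solve, on $[0,T-t_0]$, the SDE $d\widehat{\boldsymbol Y}_t=\hat s_{T-t}(\widehat{\boldsymbol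 Y}_t)\,dt+d\boldsymbol B_t$, where $\boldsymbol B$ is a standard Brownian motion in $\mathbb{R}^d$ independent of the samples and of $\widehat{\boldsymbol Y}_0$ (no time discretization). The output is $\widehat{\boldsymbol Y}_{T-t_0}$. $\mathrm{TV}(p,q)=\frac12\int|p-q|$ denotes total variation distance between laws; $\mathrm{TV}(\boldsymbol X_0,\widehat{\boldsymbol Y}_{T-t_0})$ is the distance between $p_0$ and the law of $\widehat{\boldsymbol Y}_{T-t_0}$ conditional on the estimator $\hat s$, and the expectation $\mathbb{E}$ is over the samples and auxiliary randomness used to build $\hat s$. $\mathrm{polylog}(n):=(\log n)^C$ for some constant $C$; the constants hidden in $\lesssim$ and $C$ may depend on $p_0,d,\beta,L$ but not on $n$. *)

theory Defs
  imports "HOL-Probability.Probability"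
begin

section \<open>Sub-Gaussian densities\<close>

text \<open>The infimum is taken in \<^typ>\<open>ennreal\<close>, so the norm is infinite if no constant is admissible.\<close>

definition psi2_norm :: "'a measure \<Rightarrow> ('a \<Rightarrow> real) \<Rightarrow> ennreal" where
  "psi2_norm M Y =
     Inf (ennreal ` {C. 0 < C \<and> (\<integral>\<^sup>+ \<omega>. ennreal (exp ((Y \<omega>)\<^sup>2 / C\<^sup>2) - 1) \<partial>M) \<le> 1})"

definition psi2_norm_vec :: "'a measure \<Rightarrow> ('a \<Rightarrow> real ^ 'd) \<Rightarrow> ennreal" where
  "psi2_norm_vec M X = (SUP v \<in> {v. norm v = 1}. psi2_norm M (\<lambda>\<omega>. X \<omega> \<bullet> v))"

definition sub_gaussian_density :: "real \<Rightarrow> (real ^ 'd \<Rightarrow> real) \<Rightarrow> bool" where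
  "sub_gaussian_density \<sigma> p \<longleftrightarrow>
     0 \<le> \<sigma> \<and> psi2_norm_vec (density lborel (\<lambda>x. ennreal (p x))) (\<lambda>x. x) = ennreal \<sigma>"


section \<open>Sobolev class of densities\<close>

definition fourier :: "(real ^ 'd \<Rightarrow> real) \<Rightarrow> real ^ 'd \<Rightarrow> complex" where
  "fourier p \<omega> = (LINT x|lborel. complex_of_real (p x) * exp (- (\<i> * complex_of_real (\<omega> \<bullet> x))))"

text \<open>In HOL \<open>0 powr 0 = 0\<close>, hence the case distinction: a vanishing exponent contributes the factor 1.\<close>

definition abs_monomial :: "real ^ 'd \<Rightarrow> real ^ 'd \<Rightarrow> real" where
  "abs_monomial \<alpha> \<omega> = (\<Prod>i\<in>UNIV. if \<alpha> $ i = 0 then 1 else \<bar>\<omega> $ i\<bar> powr (\<alpha> $ i))"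

definition sobolev_densities :: "real \<Rightarrow> real \<Rightarrow> (real ^ 'd \<Rightarrow> real) set" where
  "sobolev_densities \<beta> L =
     {p. integrable lborel p \<and> (AE x in lborel. 0 \<le> p x) \<and> (LINT x|lborel. p x) = 1 \<and>
         (\<forall>\<alpha>. (\<forall>i. 0 \<le> \<alpha> $ i) \<and> (\<Sum>i\<in>UNIV. \<alpha> $ i) = \<beta> \<longrightarrow>
            (\<integral>\<^sup>+ \<omega>. ennreal ((abs_monomial \<alpha> \<omega>)\<^sup>2 * (cmod (fourier p \<omega>))\<^sup>2) \<partial>lborel)
              \<le> ennreal ((2 * pi) ^ CARD('d) * L\<^sup>2))}"


section \<open>Score estimators\<close>

text \<open>
  A score estimator is a rule \<open>s n t xs u x\<close>: from \<open>n\<close> samples \<open>xs\<close>, stored as an extensional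
  function on \<open>{..<n}\<close>, and auxiliary randomness \<open>u\<close> with law \<open>Q\<close>, it produces at time \<open>t > 0\<close>
  a function of \<open>x\<close>. Any auxiliary randomness in a standard Borel space can be encoded by a real number.
\<close>

type_synonym 'd score_rule =
  "nat \<Rightarrow> real \<Rightarrow> (nat \<Rightarrow> real ^ 'd) \<Rightarrow> real \<Rightarrow> real ^ 'd \<Rightarrow> real ^ 'd"

definition score_estimator :: "real measure \<Rightarrow> 'd::finite score_rule \<Rightarrow> bool" where
  "score_estimator Q s \<longleftrightarrow>
     prob_space Q \<and> sets Q = sets borel \<and>
     (\<forall>n\<ge>2. (\<lambda>(t, xs, u, x). s n t xs u x) \<in> borel_measurable
        (restrict_space borel {0<..} \<Otimes>\<^sub>M (\<Pi>\<^sub>M i\<in>{..<n}. borel) \<Otimes>\<^sub>M borel \<Otimes>\<^sub>M borel))"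


section \<open>Brownian motion\<close>

text \<open>Unlike \<^const>\<open>prob_space.indep_var\<close>, this allows random variables with values in different types.\<close>

definition indep_rv ::
    "'w measure \<Rightarrow> 'a measure \<Rightarrow> ('w \<Rightarrow> 'a) \<Rightarrow> 'b measure \<Rightarrow> ('w \<Rightarrow> 'b) \<Rightarrow> bool" where
  "indep_rv M N V N' V' \<longleftrightarrow>
     V \<in> measurable M N \<and> V' \<in> measurable M N' \<and>
     prob_space.indep_set M (sets (vimage_algebra (space M) V N))
                            (sets (vimage_algebra (space M) V' N'))"

text \<open>Density of the centred normal law with covariance \<open>v\<close> times the identity.\<close>

definition gaussian_density :: "real \<Rightarrow> real ^ 'd \<Rightarrow> real" where
  "gaussian_density v x = (\<Prod>i\<in>UNIV. normal_density 0 (sqrt v) (x $ i))"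

definition brownian_motion :: "'w measure \<Rightarrow> (real \<Rightarrow> 'w \<Rightarrow> real ^ 'd) \<Rightarrow> bool" where
  "brownian_motion M B \<longleftrightarrow>
     (\<forall>t\<ge>0. B t \<in> borel_measurable M) \<and>
     (AE \<omega> in M. B 0 \<omega> = 0) \<and>
     (AE \<omega> in M. continuous_on {0..} (\<lambda>t. B t \<omega>)) \<and>
     (\<forall>r t. 0 \<le> r \<and> r < t \<longrightarrow>
        distributed M lborel (\<lambda>\<omega>. B t \<omega> - B r \<omega>) (\<lambda>x. ennreal (gaussian_density (t - r) x)) \<and>
        indep_rv M (\<Pi>\<^sub>M u\<in>{0..r}. borel) (\<lambda>\<omega>. \<lambda>u\<in>{0..r}. B u \<omega>)
                   borel (\<lambda>\<omega>. B t \<omega> - B r \<omega>))"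


section \<open>The Brownian diffusion model\<close>

definition samples :: "nat \<Rightarrow> (nat \<Rightarrow> 'w \<Rightarrow> real ^ 'd) \<Rightarrow> 'w \<Rightarrow> nat \<Rightarrow> real ^ 'd" where
  "samples n X \<omega> = (\<lambda>i\<in>{..<n}. X i \<omega>)"

text \<open>
  The random input: i.i.d. samples \<open>X\<close> from \<open>p\<close>, auxiliary randomness \<open>U\<close>, initial value \<open>Y0\<close> and
  driving Brownian motion \<open>B\<close>. The last three independence conditions, taken successively, say that
  the samples, \<open>U\<close>, \<open>Y0\<close> and \<open>B\<close> are mutually independent.
\<close>

definition diffusion_input ::
    "'w measure \<Rightarrow> nat \<Rightarrow> (real ^ 'd \<Rightarrow> real) \<Rightarrow> real measure \<Rightarrow> real \<Rightarrow>
     (nat \<Rightarrow> 'w \<Rightarrow> real ^ 'd) \<Rightarrow> ('w \<Rightarrow> real) \<Rightarrow> ('w \<Rightarrow> real ^ 'd) \<Rightarrow>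
     (real \<Rightarrow> 'w \<Rightarrow> real ^ 'd) \<Rightarrow> bool" where
  "diffusion_input M n p Q T X U Y0 B \<longleftrightarrow>
     prob_space M \<and>
     (\<forall>i<n. distributed M lborel (X i) (\<lambda>x. ennreal (p x))) \<and>
     prob_space.indep_vars M (\<lambda>_. borel) X {..<n} \<and>
     U \<in> borel_measurable M \<and> distr M borel U = Q \<and>
     distributed M lborel Y0 (\<lambda>x. ennreal (gaussian_density T x)) \<and>
     brownian_motion M B \<and>
     indep_rv M (\<Pi>\<^sub>M i\<in>{..<n}. borel) (samples n X) borel U \<and>
     indep_rv M ((\<Pi>\<^sub>M i\<in>{..<n}. borel) \<Otimes>\<^sub>M borel) (\<lambda>\<omega>. (samples n X \<omega>, U \<omega>)) borel Y0 \<and>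
     indep_rv M ((\<Pi>\<^sub>M i\<in>{..<n}. borel) \<Otimes>\<^sub>M borel \<Otimes>\<^sub>M borel) (\<lambda>\<omega>. (samples n X \<omega>, U \<omega>, Y0 \<omega>))
                (\<Pi>\<^sub>M u\<in>{0..}. borel) (\<lambda>\<omega>. \<lambda>u\<in>{0..}. B u \<omega>)"

text \<open>The sigma-algebra generated by the samples, \<open>U\<close>, \<open>Y0\<close> and \<open>B\<close> up to time \<open>t\<close>.\<close>

definition input_history ::
    "'w measure \<Rightarrow> nat \<Rightarrow> (nat \<Rightarrow> 'w \<Rightarrow> real ^ 'd) \<Rightarrow> ('w \<Rightarrow> real) \<Rightarrow> ('w \<Rightarrow> real ^ 'd) \<Rightarrow>
     (real \<Rightarrow> 'w \<Rightarrow> real ^ 'd) \<Rightarrow> real \<Rightarrow> 'w measure" where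
  "input_history M n X U Y0 B t =
     vimage_algebra (space M) (\<lambda>\<omega>. (samples n X \<omega>, U \<omega>, Y0 \<omega>, \<lambda>u\<in>{0..t}. B u \<omega>))
       ((\<Pi>\<^sub>M i\<in>{..<n}. borel) \<Otimes>\<^sub>M borel \<Otimes>\<^sub>M borel \<Otimes>\<^sub>M (\<Pi>\<^sub>M u\<in>{0..t}. borel))"

text \<open>
  \<open>Y\<close> solves \<open>dY\<^sub>t = s\<^sub>T\<^sub>-\<^sub>t(Y\<^sub>t) dt + dB\<^sub>t\<close> on \<open>[0, H]\<close> with initial value \<open>Y0\<close>. As the noise is
  additive, the equation is a pathwise integral equation. The second condition states that \<open>Y\<close> is
  adapted to the filtration of the input, augmented by null sets.
\<close>

definition diffusion_solution ::
    "'w measure \<Rightarrow> nat \<Rightarrow> 'd::finite score_rule \<Rightarrow> real \<Rightarrow> real \<Rightarrow>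
     (nat \<Rightarrow> 'w \<Rightarrow> real ^ 'd) \<Rightarrow> ('w \<Rightarrow> real) \<Rightarrow> ('w \<Rightarrow> real ^ 'd) \<Rightarrow>
     (real \<Rightarrow> 'w \<Rightarrow> real ^ 'd) \<Rightarrow> (real \<Rightarrow> 'w \<Rightarrow> real ^ 'd) \<Rightarrow> bool" where
  "diffusion_solution M n s T H X U Y0 B Y \<longleftrightarrow>
     (\<forall>t\<in>{0..H}. Y t \<in> borel_measurable M) \<and>
     (\<forall>t\<in>{0..H}. \<exists>Z \<in> borel_measurable (input_history M n X U Y0 B t). AE \<omega> in M. Y t \<omega> = Z \<omega>) \<and>
     (AE \<omega> in M.
        continuous_on {0..H} (\<lambda>t. Y t \<omega>) \<and>
        set_integrable lborel {0..H} (\<lambda>u. s n (T - u) (samples n X \<omega>) (U \<omega>) (Y u \<omega>)) \<and>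
        (\<forall>t\<in>{0..H}. Y t \<omega> =
           Y0 \<omega> + (LINT u:{0..t}|lborel. s n (T - u) (samples n X \<omega>) (U \<omega>) (Y u \<omega>)) + B t \<omega>))"


section \<open>Total variation and conditional densities\<close>

definition tv_dist :: "(real ^ 'd \<Rightarrow> real) \<Rightarrow> (real ^ 'd \<Rightarrow> real) \<Rightarrow> ennreal" where
  "tv_dist p q = (\<integral>\<^sup>+ x. ennreal \<bar>p x - q x\<bar> \<partial>lborel) / 2"

text \<open>\<open>q z\<close> is the Lebesgue density of the conditional law of \<open>V\<close> given \<open>Z = z\<close>.\<close>

definition conditional_density ::
    "'w measure \<Rightarrow> 'z measure \<Rightarrow> ('w \<Rightarrow> 'z) \<Rightarrow> ('w \<Rightarrow> real ^ 'd) \<Rightarrow> ('z \<Rightarrow> real ^ 'd \<Rightarrow> real) \<Rightarrow> bool"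
  where
  "conditional_density M N Z V q \<longleftrightarrow>
     Z \<in> measurable M N \<and> (\<forall>z y. 0 \<le> q z y) \<and>
     (\<lambda>(z, y). q z y) \<in> borel_measurable (N \<Otimes>\<^sub>M lborel) \<and>
     distributed M (distr M N Z \<Otimes>\<^sub>M lborel) (\<lambda>\<omega>. (Z \<omega>, V \<omega>)) (\<lambda>(z, y). ennreal (q z y))"

end

theory Submission
  imports Defs
begin

text \<open>
  The score is ours to choose, so it is built to make the output an explicit density estimator.
  At first the drift \<open>- n\<^sup>1\<^sup>0 x\<close> forces the diffusion close to the origin. During a final period of length
  \<open>r = c t\<^sub>0\<close> the drift is the gradient of \<open>ln h\<close>, where
  \<open>h \<theta> x = (\<Sum>i. exp (a\<^sub>i \<bullet> x - |a\<^sub>i|\<^sup>2 \<theta> / 2))\<close> with \<open>a\<^sub>i = X\<^sub>i / r\<close> solves the backward heat equation.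
  This is Doob's \<open>h\<close>-transform of Brownian motion (a Foellmer drift): started at the origin, it ends
  with the law given by the mean of the normal laws with centres \<open>X\<^sub>i\<close> and variance \<open>r\<close>, that is, with the
  Gaussian kernel density estimator.

  The kernel estimator has the claimed rate. Its bias is estimated in \<open>L\<^sup>2\<close> on the Fourier side, where
  \<open>\<beta> \<le> 2\<close> permits comparing \<open>(1 - exp (- |\<omega>|\<^sup>2 r / 2))\<^sup>2\<close> with \<open>r\<^sup>\<beta> |\<omega>|\<^sup>2\<^sup>\<beta>\<close>; its variance is of order
  \<open>n\<^sup>-\<^sup>1 r\<^sup>-\<^sup>d\<^sup>/\<^sup>2\<close>, which the choice of \<open>t\<^sub>0\<close> balances with the squared bias. The Cauchy-Schwarz inequality on a
  cube of side \<open>2 ln n\<close> turns both into \<open>L\<^sup>1\<close> bounds, and outside the cube the sub-Gaussian tails are of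
  order \<open>1 / n\<close>.
\<close>

section \<open>Isotropic Gaussian measures\<close>

text \<open>Two obstacles shape the proof. The bound must hold for every adapted solution, so the
  law at the end is identified without stochastic calculus: quotients of plane waves by
  \<open>h\<close> have constant mean along any solution, because one step of length \<delta>
  changes the mean by at most a multiple of \<open>\<delta> * sqrt \<delta>\<close>; test functions
  of the samples make the identification conditional. Moreover, the start is the wide law N(0, T),
  whereas the \<open>h\<close>-transform yields equal weights only from the origin. Hence the strong
  contraction beforehand; what it leaves enters through an L1 bound linear in the starting point.
  The sites are truncated at norm \<open>n\<close> to make the drift globally Lipschitz, and an
  additional site 0 keeps \<open>h\<close> at least 1, so that \<open>1 / h\<close> is bounded. Both
  change the estimator by O(1/n) in mean L1 distance. The bias is not read off from the density
  directly. Two Gaussian smoothings at levels e and r are compared, where Plancherel's identity is a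
  computation with Gaussian integrals; then e tends to 0, first for continuous test functions and at
  last for Borel sets. The Sobolev condition is applied to the exponents \<beta> e_j.\<close>

lemma Basis_vec_range: "(Basis :: (real ^ 'd) set) = range (\<lambda>i. axis i 1)"
  by (auto simp: Basis_vec_def)

lemma prod_Basis_vec:
  fixes f :: "real ^ 'd \<Rightarrow> 'b::comm_monoid_mult"
  shows "(\<Prod>b\<in>Basis. f b) = (\<Prod>i\<in>UNIV. f (axis i 1))"
  unfolding Basis_vec_range by (subst prod.reindex) (auto simp: inj_on_def axis_eq_axis)

lemma integral_lborel_vec_prod:
  fixes f :: "'d::finite \<Rightarrow> real \<Rightarrow> 'b::{real_normed_field,banach,second_countable_topology}"
  assumes f: "\<And>i. integrable lborel (f i)"
  shows "integrable lborel (\<lambda>x :: real ^ 'd. \<Prod>i\<in>UNIV. f i (x $ i))"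
    and "(LINT x|lborel. (\<Prod>i\<in>UNIV. f i ((x :: real ^ 'd) $ i))) = (\<Prod>i\<in>UNIV. (LINT x|lborel. f i x))"
proof -
  interpret product_sigma_finite "\<lambda>_ :: real ^ 'd. lborel :: real measure" by standard
  \<comment> \<open>\<open>lborel_eq\<close> labels the coordinates by basis vectors;
    \<open>THE\<close> translates such a vector back into an index of type 'd.\<close>
  let ?g = "\<lambda>b. f (THE i. b = axis i (1::real))"
  have g: "?g (axis i 1) = f i" for i
    by (rule arg_cong[where f=f]) (auto simp: axis_eq_axis)
  have m[measurable]: "f i \<in> borel_measurable borel" for i
    using borel_measurable_integrable[OF f[of i]] by simp
  have eq: "(\<Prod>i\<in>UNIV. f i ((\<Sum>b\<in>Basis. y b *\<^sub>R b) $ i)) = (\<Prod>b\<in>Basis. ?g b (y b))" for y :: "real ^ 'd \<Rightarrow> real"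
  proof -
    have "(\<Sum>b\<in>Basis. y b *\<^sub>R b) $ i = y (axis i 1)" for i
    proof -
      have "(\<Sum>b\<in>Basis. y b *\<^sub>R b) $ i = (\<Sum>b\<in>Basis. y b *\<^sub>R b) \<bullet> axis i 1"
        by (simp add: inner_axis)
      also have "\<dots> = y (axis i 1)" by (subst inner_sum_left_Basis) (auto simp: Basis_vec_range)
      finally show ?thesis .
    qed
    then show ?thesis by (simp add: prod_Basis_vec g)
  qed
  have int: "integrable (\<Pi>\<^sub>M b\<in>(Basis :: (real ^ 'd) set). lborel) (\<lambda>y. \<Prod>b\<in>Basis. ?g b (y b))"
    by (rule product_integrable_prod) (auto simp: f)
  show "integrable lborel (\<lambda>x :: real ^ 'd. \<Prod>i\<in>UNIV. f i (x $ i))"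
    by (subst lborel_eq, subst integrable_distr_eq, measurable, simp only: eq int)
  have "(LINT x|lborel. (\<Prod>i\<in>UNIV. f i ((x :: real ^ 'd) $ i))) =
        (LINT y|(\<Pi>\<^sub>M b\<in>(Basis :: (real ^ 'd) set). lborel). (\<Prod>b\<in>Basis. ?g b (y b)))"
    by (subst lborel_eq, subst integral_distr, measurable, simp only: eq)
  also have "\<dots> = (\<Prod>b\<in>(Basis :: (real ^ 'd) set). (LINT x|lborel. ?g b x))"
    by (rule product_integral_prod) (auto simp: f)
  also have "\<dots> = (\<Prod>i\<in>UNIV. (LINT x|lborel. f i x))" by (simp add: prod_Basis_vec g)
  finally show "(LINT x|lborel. (\<Prod>i\<in>UNIV. f i ((x :: real ^ 'd) $ i))) = (\<Prod>i\<in>UNIV. (LINT x|lborel. f i x))" .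
qed

lemma gaussian_density_eq:
  fixes x :: "real ^ 'd"
  assumes "0 < v"
  shows "gaussian_density v x = (1 / sqrt (2 * pi * v)) ^ CARD('d) * exp (- (norm x)\<^sup>2 / (2 * v))"
proof -
  have "gaussian_density v x = (\<Prod>i\<in>UNIV. (1 / sqrt (2 * pi * v)) * exp (- (x $ i)\<^sup>2 / (2 * v)))"
    unfolding gaussian_density_def normal_density_def using assms by simp
  also have "\<dots> = (1 / sqrt (2 * pi * v)) ^ CARD('d) * exp (\<Sum>i\<in>UNIV. - (x $ i)\<^sup>2 / (2 * v))"
    by (simp only: prod.distrib prod_constant exp_sum[OF finite])
  also have "(\<Sum>i\<in>UNIV. - (x $ i)\<^sup>2 / (2 * v)) = - (norm x)\<^sup>2 / (2 * v)"
    by (simp add: norm_vec_def L2_set_def sum_nonneg sum_divide_distrib sum_negf)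
  finally show ?thesis .
qed

lemma gaussian_density_nonneg[simp]: "0 \<le> gaussian_density v x"
  by (simp add: gaussian_density_def prod_nonneg)

lemma borel_measurable_gaussian_density[measurable]:
  "gaussian_density v \<in> borel_measurable borel"
  unfolding gaussian_density_def[abs_def] by measurable

lemma gaussian_density_uminus[simp]: "gaussian_density v (- x) = gaussian_density v x"
  by (simp add: gaussian_density_def normal_density_def)

lemma gaussian_density_minus_commute: "gaussian_density v (x - y) = gaussian_density v (y - x)"
  using gaussian_density_uminus[of v "x - y"] by simp

lemma gaussian_density_le:
  fixes x :: "real ^ 'd"
  assumes "0 < v"
  shows "gaussian_density v x \<le> (1 / sqrt (2 * pi * v)) ^ CARD('d)"
  unfolding gaussian_density_eq[OF assms] using assms by (simp add: mult_le_cancel_left1)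

lemma integrable_gaussian_density: "0 < v \<Longrightarrow> integrable lborel (gaussian_density v)"
  unfolding gaussian_density_def[abs_def] by (rule integral_lborel_vec_prod) auto

lemma integral_gaussian_density: "0 < v \<Longrightarrow> (LINT x|lborel. gaussian_density v x) = 1"
  unfolding gaussian_density_def[abs_def] by (subst integral_lborel_vec_prod) auto

definition gauss :: "real \<Rightarrow> (real ^ 'd) measure" where
  "gauss v = density lborel (\<lambda>x. ennreal (gaussian_density v x))"

lemma sets_gauss[measurable_cong, simp]: "sets (gauss v) = sets borel"
  and space_gauss[simp]: "space (gauss v) = UNIV"
  by (simp_all add: gauss_def)

lemma prob_space_gauss: "0 < v \<Longrightarrow> prob_space (gauss v)"
  unfolding gauss_def
  by (intro prob_spaceI)
     (simp add: emeasure_density nn_integral_eq_integral integrable_gaussian_density integral_gaussian_density)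

lemma integral_gauss:
  fixes f :: "real ^ 'd \<Rightarrow> 'b::{banach,second_countable_topology}"
  assumes [measurable]: "f \<in> borel_measurable borel"
  shows "(LINT x|gauss v. f x) = (LINT x|lborel. gaussian_density v x *\<^sub>R f x)"
  unfolding gauss_def by (subst integral_density) auto

lemma integrable_gauss:
  fixes f :: "real ^ 'd \<Rightarrow> 'b::{banach,second_countable_topology}"
  assumes [measurable]: "f \<in> borel_measurable borel"
  shows "integrable (gauss v) f \<longleftrightarrow> integrable lborel (\<lambda>x. gaussian_density v x *\<^sub>R f x)"
  unfolding gauss_def by (subst integrable_density) auto

lemma nn_integral_gauss:
  assumes [measurable]: "f \<in> borel_measurable borel"
  shows "(\<integral>\<^sup>+x. f x \<partial>gauss v) = (\<integral>\<^sup>+x. ennreal (gaussian_density v x) * f x \<partial>lborel)"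
  unfolding gauss_def by (subst nn_integral_density) auto

section \<open>Translations and exponential weights of Gaussian measures\<close>

lemma
  fixes f :: "'a::euclidean_space \<Rightarrow> 'b::{banach,second_countable_topology}" and c :: 'a
  shows integrable_lborel_shift: "integrable lborel (\<lambda>x. f (c + x)) \<longleftrightarrow> integrable lborel f"
    and integral_lborel_shift: "(LINT x|lborel. f (c + x)) = (LINT x|lborel. f x)"
proof -
  have *: "integrable lborel (\<lambda>x. f (c + x))" if f: "integrable lborel f" for f :: "'a \<Rightarrow> 'b" and c
  proof -
    have [measurable]: "f \<in> borel_measurable borel" using borel_measurable_integrable[OF f] by simp
    show ?thesis using f by (subst (asm) lborel_distr_plus[of c, symmetric], subst (asm) integrable_distr_eq) auto
  qed
  show iff: "integrable lborel (\<lambda>x. f (c + x)) \<longleftrightarrow> integrable lborel f"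
    using *[of f c] *[of "\<lambda>x. f (c + x)" "- c"] by auto
  show "(LINT x|lborel. f (c + x)) = (LINT x|lborel. f x)"
  proof (cases "integrable lborel f")
    case True
    then have [measurable]: "f \<in> borel_measurable borel" using borel_measurable_integrable by force
    show ?thesis by (subst (2) lborel_distr_plus[of c, symmetric], subst integral_distr) auto
  next
    case False then show ?thesis using iff by (simp add: not_integrable_integral_eq)
  qed
qed

lemma nn_integral_lborel_shift:
  fixes c :: "'a::euclidean_space"
  assumes [measurable]: "f \<in> borel_measurable borel"
  shows "(\<integral>\<^sup>+x. f (c + x) \<partial>lborel) = (\<integral>\<^sup>+x. f x \<partial>lborel)"
  by (subst (2) lborel_distr_plus[of c, symmetric], subst nn_integral_distr) auto

text \<open>Completing the square. The correction \<open>(norm b)\<^sup>2 * v / 2\<close> is the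
  logarithm of the Gaussian mean of \<open>exp (b \<bullet> w)\<close>, so the weight has mean
  one.\<close>

lemma gaussian_density_tilt:
  fixes b w :: "real ^ 'd"
  assumes "0 < v"
  shows "exp (b \<bullet> (v *\<^sub>R b + w) - (norm b)\<^sup>2 * v / 2) * gaussian_density v (v *\<^sub>R b + w) = gaussian_density v w"
proof -
  have "b \<bullet> (v *\<^sub>R b + w) - (norm b)\<^sup>2 * v / 2 + - (norm (v *\<^sub>R b + w))\<^sup>2 / (2 * v) = - (norm w)\<^sup>2 / (2 * v)"
    using assms unfolding power2_norm_eq_inner
    by (simp add: inner_simps field_simps inner_commute power2_eq_square)
  then show ?thesis unfolding gaussian_density_eq[OF assms]
    by (simp add: exp_add[symmetric] mult.left_commute)
qed

text \<open>The finite-dimensional Cameron-Martin formula. It is used in both directions: to move a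
  drift into a weight, and to evaluate a weighted mean by a shift.\<close>

lemma tilt_gauss:
  fixes b :: "real ^ 'd" and f :: "real ^ 'd \<Rightarrow> 'b::{banach,second_countable_topology}"
  assumes v: "0 < v" and [measurable]: "f \<in> borel_measurable borel"
  shows integrable_gauss_tilt: "integrable (gauss v) (\<lambda>w. exp (b \<bullet> w - (norm b)\<^sup>2 * v / 2) *\<^sub>R f w)
           \<longleftrightarrow> integrable (gauss v) (\<lambda>w. f (v *\<^sub>R b + w))"
    and integral_gauss_tilt: "(LINT w|gauss v. exp (b \<bullet> w - (norm b)\<^sup>2 * v / 2) *\<^sub>R f w) =
         (LINT w|gauss v. f (v *\<^sub>R b + w))"
proof -
  have *: "gaussian_density v (v *\<^sub>R b + w) *\<^sub>R exp (b \<bullet> (v *\<^sub>R b + w) - (norm b)\<^sup>2 * v / 2) *\<^sub>R f (v *\<^sub>R b + w)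
    = gaussian_density v w *\<^sub>R f (v *\<^sub>R b + w)" for w
    using gaussian_density_tilt[OF v, of b w] by (simp add: mult.commute)
  show "integrable (gauss v) (\<lambda>w. exp (b \<bullet> w - (norm b)\<^sup>2 * v / 2) *\<^sub>R f w)
           \<longleftrightarrow> integrable (gauss v) (\<lambda>w. f (v *\<^sub>R b + w))"
    by (subst (1 2) integrable_gauss, simp, simp, subst integrable_lborel_shift[of _ "v *\<^sub>R b", symmetric], simp only: *)
  show "(LINT w|gauss v. exp (b \<bullet> w - (norm b)\<^sup>2 * v / 2) *\<^sub>R f w) =
         (LINT w|gauss v. f (v *\<^sub>R b + w))"
    by (subst (1 2) integral_gauss, simp, simp, subst integral_lborel_shift[of _ "v *\<^sub>R b", symmetric], simp only: *)
qed

section \<open>Fourier transform and Fourier inversion for Gaussians\<close>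

lemma cis_inner_eq_prod:
  fixes x \<xi> :: "real ^ 'd"
  shows "cis (\<xi> \<bullet> x) = (\<Prod>i\<in>UNIV. cis (\<xi> $ i * x $ i))"
proof -
  have "(\<Prod>i\<in>A. cis (f i)) = cis (\<Sum>i\<in>A. f i)" if "finite A" for f and A :: "'d set"
    using that by induction (auto simp: cis_mult)
  then show ?thesis by (simp add: inner_vec_def)
qed

lemma char_normal_density:
  assumes "0 < \<sigma>"
  shows "(LINT x|lborel. normal_density 0 \<sigma> x *\<^sub>R cis (t * x)) = complex_of_real (exp (- (\<sigma> * t)\<^sup>2 / 2))"
proof -
  have "(LINT x|lborel. normal_density 0 \<sigma> x *\<^sub>R cis (t * x)) =
     \<bar>\<sigma>\<bar> *\<^sub>R (LINT x|lborel. normal_density 0 \<sigma> (0 + \<sigma> * x) *\<^sub>R cis (t * (0 + \<sigma> * x)))"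
    by (rule lborel_integral_real_affine) (use assms in auto)
  also have "\<dots> = (LINT x|lborel. \<sigma> *\<^sub>R normal_density 0 \<sigma> (\<sigma> * x) *\<^sub>R cis (t * (\<sigma> * x)))"
    using assms by (simp del: scaleR_scaleR)
  also have "(\<lambda>x. \<sigma> *\<^sub>R normal_density 0 \<sigma> (\<sigma> * x) *\<^sub>R cis (t * (\<sigma> * x))) = (\<lambda>x. std_normal_density x *\<^sub>R iexp ((\<sigma> * t) * x))"
    using assms by (auto simp: fun_eq_iff normal_density_def cis_conv_exp real_sqrt_mult power_mult_distrib ac_simps)
  also have "(LINT x|lborel. std_normal_density x *\<^sub>R iexp ((\<sigma> * t) * x)) = char std_normal_distribution (\<sigma> * t)"
    unfolding char_def by (subst integral_density) auto
  finally show ?thesis by (simp add: char_std_normal_distribution)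
qed

lemma integral_gauss_cis:
  fixes \<xi> :: "real ^ 'd"
  assumes "0 < v"
  shows "(LINT x|gauss v. cis (\<xi> \<bullet> x)) = complex_of_real (exp (- (norm \<xi>)\<^sup>2 * v / 2))"
proof -
  have [measurable]: "(\<lambda>x. cis (\<xi> \<bullet> x)) \<in> borel_measurable (borel :: (real ^ 'd) measure)"
    by (intro borel_measurable_continuous_onI continuous_intros)
  have meas: "(\<lambda>x. cis (c * x)) \<in> borel_measurable (borel :: real measure)" for c
    by (intro borel_measurable_continuous_onI continuous_intros)
  have int: "integrable lborel (\<lambda>x. normal_density 0 (sqrt v) x *\<^sub>R cis (c * x))" for c
    by (rule Bochner_Integration.integrable_bound[of _ "normal_density 0 (sqrt v)"])
       (use assms meas in \<open>auto intro!: borel_measurable_scaleR\<close>)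
  have "(LINT x|gauss v. cis (\<xi> \<bullet> x)) =
     (LINT x|lborel. (\<Prod>i\<in>UNIV. normal_density 0 (sqrt v) (x $ i) *\<^sub>R cis (\<xi> $ i * x $ i)))"
    by (subst integral_gauss) (auto simp: gaussian_density_def cis_inner_eq_prod[symmetric] scaleR_conv_of_real prod.distrib)
  also have "\<dots> = (\<Prod>i\<in>UNIV. complex_of_real (exp (- (sqrt v * \<xi> $ i)\<^sup>2 / 2)))"
    using assms by (subst integral_lborel_vec_prod(2)[OF int]) (simp add: char_normal_density)
  also have "\<dots> = complex_of_real (exp (\<Sum>i\<in>UNIV. - (sqrt v * \<xi> $ i)\<^sup>2 / 2))"
    by (simp add: exp_sum)
  also have "(\<Sum>i\<in>UNIV. - (sqrt v * \<xi> $ i)\<^sup>2 / 2) = - (norm \<xi>)\<^sup>2 * v / 2"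
    using assms by (simp add: norm_vec_def L2_set_def sum_nonneg power_mult_distrib sum_distrib_left mult.commute
         flip: sum_divide_distrib sum_negf)
  finally show ?thesis .
qed

text \<open>Fourier inversion for a single Gaussian. Since the transform is again a multiple of a
  Gaussian density, now of variance \<open>1/v\<close>, a second application of
  \<open>integral_gauss_cis\<close> leads back.\<close>

lemma gaussian_density_fourier:
  fixes x :: "real ^ 'd"
  assumes v: "0 < v"
  shows "integrable lborel (\<lambda>\<xi>::real ^ 'd. exp (- (norm \<xi>)\<^sup>2 * v / 2))"
   and "complex_of_real (gaussian_density v x) =
    (LINT \<xi>|lborel. complex_of_real (exp (- (norm \<xi>)\<^sup>2 * v / 2)) * cis (x \<bullet> \<xi>)) / (2 * pi) ^ CARD('d)"
proof -
  let ?c = "(1 / sqrt (2 * pi / v)) ^ CARD('d)"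
  have c: "?c > 0" using v by simp
  have eq: "exp (- (norm \<xi>)\<^sup>2 * v / 2) = gaussian_density (1/v) \<xi> / ?c" for \<xi> :: "real ^ 'd"
  proof -
    have "gaussian_density (1/v) \<xi> = ?c * exp (- (norm \<xi>)\<^sup>2 * v / 2)"
      using v gaussian_density_eq[of "1/v" \<xi>] by simp
    moreover have "?c * y / ?c = y" for y using c by (metis nonzero_mult_div_cancel_left less_irrefl)
    ultimately show ?thesis by metis
  qed
  show "integrable lborel (\<lambda>\<xi>::real ^ 'd. exp (- (norm \<xi>)\<^sup>2 * v / 2))"
    unfolding eq using v by (intro integrable_divide integrable_gaussian_density) auto
  have [measurable]: "(\<lambda>\<xi>. cis (x \<bullet> \<xi>)) \<in> borel_measurable (borel :: (real ^ 'd) measure)"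
    by (intro borel_measurable_continuous_onI continuous_intros)
  have "(LINT \<xi>|lborel. complex_of_real (exp (- (norm \<xi>)\<^sup>2 * v / 2)) * cis (x \<bullet> \<xi>)) =
     (LINT \<xi>|gauss (1/v). cis (x \<bullet> \<xi>)) / complex_of_real ?c"
  proof -
    have "(LINT \<xi>|lborel. complex_of_real (exp (- (norm \<xi>)\<^sup>2 * v / 2)) * cis (x \<bullet> \<xi>)) =
      (LINT \<xi>|lborel. (gaussian_density (1/v) \<xi> *\<^sub>R cis (x \<bullet> \<xi>)) / complex_of_real ?c)"
      by (rule Bochner_Integration.integral_cong) (simp_all only: eq scaleR_conv_of_real of_real_divide times_divide_eq_left)
    then show ?thesis by (subst integral_gauss) (simp_all only: integral_divide_zero, measurable)
  qed
  also have "\<dots> = complex_of_real (exp (- (norm x)\<^sup>2 / (2 * v)) / ?c)"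
    using v by (subst integral_gauss_cis) auto
  finally have *: "(LINT \<xi>|lborel. complex_of_real (exp (- (norm \<xi>)\<^sup>2 * v / 2)) * cis (x \<bullet> \<xi>)) =
    complex_of_real (exp (- (norm x)\<^sup>2 / (2 * v)) / ?c)" .
  have "(1 / sqrt (2 * pi * v)) ^ CARD('d) * ?c = 1 / (2 * pi) ^ CARD('d)"
  proof -
    have "1 / sqrt (2 * pi * v) * (1 / sqrt (2 * pi / v)) = 1 / (2 * pi)"
      using v by (simp add: real_sqrt_mult real_sqrt_divide power2_eq_square[symmetric] power_mult_distrib)
    then show ?thesis by (metis power_mult_distrib power_one_over)
  qed
  then have "(1 / sqrt (2 * pi * v)) ^ CARD('d) = 1 / (2 * pi) ^ CARD('d) / ?c"
    using c by (subst eq_divide_eq) auto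
  then have "gaussian_density v x = exp (- (norm x)\<^sup>2 / (2 * v)) / ?c / (2 * pi) ^ CARD('d)"
    unfolding gaussian_density_eq[OF v] by (simp only: divide_inverse mult_ac mult_1)
  then show "complex_of_real (gaussian_density v x) =
    (LINT \<xi>|lborel. complex_of_real (exp (- (norm \<xi>)\<^sup>2 * v / 2)) * cis (x \<bullet> \<xi>)) / (2 * pi) ^ CARD('d)"
    unfolding * by simp
qed

section \<open>Convolution, scaling and exponential moments of Gaussians\<close>

lemma nn_integral_gaussian_conv:
  fixes x :: "real ^ 'd"
  assumes "0 < s" "0 < t"
  shows "(\<integral>\<^sup>+z. ennreal (gaussian_density s (x - z) * gaussian_density t z) \<partial>lborel) = gaussian_density (s + t) x"
proof -
  let ?f = "\<lambda>i z. ennreal (normal_density 0 (sqrt s) (x $ i - z) * normal_density 0 (sqrt t) z)"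
  let ?g = "\<lambda>b. ?f (THE i. b = axis i (1::real))"
  have g: "?g (axis i 1) = ?f i" for i
    by (rule arg_cong[where f="?f"]) (auto simp: axis_eq_axis)
  have "(\<integral>\<^sup>+z. ennreal (gaussian_density s (x - z) * gaussian_density t z) \<partial>lborel) =
     (\<integral>\<^sup>+z. (\<Prod>b\<in>Basis. ?g b (z \<bullet> b)) \<partial>lborel)"
    by (intro nn_integral_cong, subst prod_Basis_vec)
      (simp add: gaussian_density_def prod.distrib[symmetric] prod_ennreal inner_axis g del: prod.distrib, simp add: axis_eq_axis)
  also have "\<dots> = (\<Prod>i\<in>UNIV. ennreal (normal_density 0 (sqrt (s + t)) (x $ i)))"
  proof -
    have "(\<integral>\<^sup>+z. ?f i z \<partial>lborel) = ennreal (normal_density 0 (sqrt (s + t)) (x $ i))" for i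
      using fun_cong[OF conv_normal_density_zero_mean[of "sqrt s" "sqrt t"], of "x $ i"] assms by simp
    then show ?thesis by (subst nn_integral_lborel_prod) (auto simp: prod_Basis_vec g axis_eq_axis)
  qed
  finally show ?thesis by (simp add: gaussian_density_def prod_ennreal)
qed

text \<open>Pulls integrals back to the standard Gaussian, so that bounds become uniform in
  \<open>v\<close> or show its power explicitly.\<close>

lemma distr_gauss_scale:
  assumes v: "0 < v"
  shows "distr (gauss 1) borel (\<lambda>z. sqrt v *\<^sub>R z) = (gauss v :: (real ^ 'd) measure)"
proof -
  have eq: "gaussian_density 1 x = gaussian_density v (sqrt v *\<^sub>R x) * \<bar>sqrt v\<bar> ^ CARD('d)" for x :: "real ^ 'd"
  proof -
    have "(1 / sqrt (2 * pi * v)) * \<bar>sqrt v\<bar> = 1 / sqrt (2 * pi * 1)"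
      using v by (simp add: real_sqrt_mult)
    then have A: "(1 / sqrt (2 * pi * v)) ^ CARD('d) * \<bar>sqrt v\<bar> ^ CARD('d) = (1 / sqrt (2 * pi * 1)) ^ CARD('d)"
      by (simp only: power_mult_distrib[symmetric])
    have B: "- (norm (sqrt v *\<^sub>R x))\<^sup>2 / (2 * v) = - (norm x)\<^sup>2 / (2 * 1)"
      using v by (simp add: power_mult_distrib)
    show ?thesis
      unfolding gaussian_density_eq[OF v] gaussian_density_eq[OF zero_less_one] A[symmetric] B by (simp only: ac_simps)
  qed
  have "(gauss v :: (real ^ 'd) measure) = density (density (distr lborel borel (\<lambda>x. 0 + sqrt v *\<^sub>R x)) (\<lambda>_. ennreal (\<bar>sqrt v\<bar> ^ DIM(real ^ 'd))))
     (\<lambda>x. ennreal (gaussian_density v x))"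
    unfolding gauss_def using v
    by (subst lborel_affine[where c="sqrt v" and t="0 :: real ^ 'd"]) (auto simp: ennreal_power)
  also have "\<dots> = density (distr lborel borel (\<lambda>x. sqrt v *\<^sub>R x))
     (\<lambda>x. ennreal (gaussian_density v x * \<bar>sqrt v\<bar> ^ CARD('d)))"
    by (subst density_density_eq) (auto simp: ennreal_mult' mult.commute)
  also have "\<dots> = distr (gauss 1) borel (\<lambda>z. sqrt v *\<^sub>R z)"
    unfolding gauss_def eq by (subst density_distr) auto
  finally show ?thesis by simp
qed

lemma integrable_normal_exp_abs:
  "integrable lborel (\<lambda>x. std_normal_density x * exp (c * \<bar>x\<bar>))"
proof (rule Bochner_Integration.integrable_bound)
  \<comment> \<open>Completing the square: the product is a multiple of the normal density with mean
    \<open>k\<close>.\<close>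
  have *: "integrable lborel (\<lambda>x. std_normal_density x * exp (k * x))" for k
  proof -
    have "integrable lborel (normal_density k 1)" by auto
    then have "integrable lborel (\<lambda>x. exp (k\<^sup>2 / 2) * normal_density k 1 x)" by (intro integrable_mult_right)
    moreover have "exp (k\<^sup>2 / 2) * normal_density k 1 x = std_normal_density x * exp (k * x)" for x
      by (simp add: normal_density_def exp_add[symmetric] power2_eq_square field_simps)
    ultimately show ?thesis by simp
  qed
  show "integrable lborel (\<lambda>x. std_normal_density x * exp (c * x) + std_normal_density x * exp ((- c) * x))"
    by (intro Bochner_Integration.integrable_add *)
  show "AE x in lborel. norm (std_normal_density x * exp (c * \<bar>x\<bar>))
      \<le> norm (std_normal_density x * exp (c * x) + std_normal_density x * exp ((- c) * x))"
  proof (intro AE_I2)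
    fix x
    have "exp (c * \<bar>x\<bar>) \<le> exp (c * x) + exp ((- c) * x)" by (auto simp: abs_if)
    then have "std_normal_density x * exp (c * \<bar>x\<bar>) \<le> std_normal_density x * (exp (c * x) + exp ((- c) * x))"
      by (intro mult_left_mono) auto
    then show "norm (std_normal_density x * exp (c * \<bar>x\<bar>))
      \<le> norm (std_normal_density x * exp (c * x) + std_normal_density x * exp ((- c) * x))"
      by (simp add: distrib_left abs_mult)
  qed
qed auto

lemma integrable_gauss_exp_norm:
  "integrable (gauss 1 :: (real ^ 'd) measure) (\<lambda>z. exp (c * norm z))"
proof -
  have "integrable lborel (\<lambda>z :: real ^ 'd. \<Prod>i\<in>UNIV. std_normal_density (z $ i) * exp (\<bar>c\<bar> * \<bar>z $ i\<bar>))"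
    by (rule integral_lborel_vec_prod(1)[OF integrable_normal_exp_abs])
  then have *: "integrable (gauss 1 :: (real ^ 'd) measure) (\<lambda>z. exp (\<bar>c\<bar> * (\<Sum>i\<in>UNIV. \<bar>z $ i\<bar>)))"
    by (subst integrable_gauss) (auto simp: gaussian_density_def prod.distrib exp_sum sum_distrib_left)
  show ?thesis
  proof (rule Bochner_Integration.integrable_bound[OF *])
    have "c * norm z \<le> \<bar>c\<bar> * (\<Sum>i\<in>UNIV. \<bar>z $ i\<bar>)" for z :: "real ^ 'd"
      by (rule order_trans[OF _ mult_left_mono[OF norm_le_l1_cart]]) (auto intro: mult_right_mono)
    then show "AE z in (gauss 1 :: (real ^ 'd) measure). norm (exp (c * norm z)) \<le> norm (exp (\<bar>c\<bar> * (\<Sum>i\<in>UNIV. \<bar>z $ i\<bar>)))"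
      by (simp only: real_norm_def abs_exp_cancel exp_le_cancel_iff always_eventually simp_thms)
  qed simp
qed

section \<open>Exponential tilting\<close>

lemma cmod_cis_minus_one_le: "cmod (cis x - 1) \<le> \<bar>x\<bar>"
  using iexp_approx1[of x 0] by (simp add: cis_conv_exp)

lemma cmod_cis_diff_le: "cmod (cis x - cis y) \<le> \<bar>x - y\<bar>"
proof -
  have "cis x - cis y = cis y * (cis (x - y) - 1)"
    by (simp add: right_diff_distrib cis_mult)
  then show ?thesis using cmod_cis_minus_one_le[of "x - y"] by (simp add: norm_mult)
qed

lemma cmod_cis_linear_le: "cmod (cis x - 1 - \<i> * x) \<le> x\<^sup>2 / 2"
  using iexp_approx1[of x 1] by (simp add: cis_conv_exp numeral_2_eq_2 algebra_simps)

lemma abs_exp_minus_one_le: "\<bar>exp x - 1\<bar> \<le> \<bar>x\<bar> * exp \<bar>x\<bar>" for x :: real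
proof (cases "x \<ge> 0")
  case True
  have "1 - x \<le> exp (- x)" by (metis exp_ge_add_one_self uminus_add_conv_diff add.commute)
  then have "(1 - x) * exp x \<le> 1" using mult_right_mono[of "1 - x" "exp (-x)" "exp x"] by (simp add: exp_minus)
  then show ?thesis using True by (simp add: algebra_simps)
next
  case False
  have "1 + x \<le> exp x" by (rule exp_ge_add_one_self)
  moreover have "exp x \<le> 1" using False by simp
  ultimately have "\<bar>exp x - 1\<bar> \<le> \<bar>x\<bar> * 1" using False by linarith
  also have "\<dots> \<le> \<bar>x\<bar> * exp \<bar>x\<bar>" by (intro mult_left_mono) auto
  finally show ?thesis .
qed

lemma abs_exp_minus_linear_le: "\<bar>exp x - 1 - x\<bar> \<le> x\<^sup>2 * exp \<bar>x\<bar>" for x :: real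
proof -
  have "\<bar>exp x - 1 - x\<bar> \<le> \<bar>x\<bar> * \<bar>exp x - 1\<bar>"
  proof -
    have "1 - x \<le> exp (- x)" by (metis exp_ge_add_one_self uminus_add_conv_diff add.commute)
    then have "(1 - x) * exp x \<le> 1" using mult_right_mono[of "1 - x" "exp (-x)" "exp x"] by (simp add: exp_minus)
    then have "exp x - 1 - x \<le> x * (exp x - 1)" by (simp add: algebra_simps)
    moreover have "0 \<le> x * (exp x - 1)" by (cases "x \<ge> 0") (auto simp: mult_nonpos_nonpos)
    moreover have "0 \<le> exp x - 1 - x" using exp_ge_add_one_self[of x] by linarith
    ultimately show ?thesis by (simp add: abs_mult[symmetric])
  qed
  also have "\<dots> \<le> \<bar>x\<bar> * (\<bar>x\<bar> * exp \<bar>x\<bar>)" by (intro mult_left_mono abs_exp_minus_one_le) auto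
  finally show ?thesis by (simp add: power2_eq_square mult.assoc[symmetric])
qed

lemma exp_le_one_plus_double: "0 \<le> y \<Longrightarrow> y \<le> 1 \<Longrightarrow> exp y \<le> 1 + 2 * y" for y :: real
  using exp_bound[of y] by (simp add: power2_eq_square) (smt (verit) mult_left_le)

text \<open>A change of the exponents by at most \<open>m\<close> changes each weight by at most a
  factor \<open>exp (2 * m)\<close>, one \<open>exp m\<close> coming from the numerator and one from
  the normalisation. This gives the claim for \<open>m \<le> 1 / 2\<close>; beyond that, the
  distance of two probability vectors is at most 2 anyway. The constant is independent of the number
  of indices, which later is the sample size.\<close>

lemma softmax_diff_le:
  fixes l k :: "'i \<Rightarrow> real"
  assumes I: "finite I" "I \<noteq> {}" and m: "\<And>i. i \<in> I \<Longrightarrow> \<bar>l i - k i\<bar> \<le> m"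
  shows "(\<Sum>i\<in>I. \<bar>exp (l i) / (\<Sum>j\<in>I. exp (l j)) - exp (k i) / (\<Sum>j\<in>I. exp (k j))\<bar>) \<le> 4 * m"
proof -
  define A B where "A = (\<Sum>j\<in>I. exp (l j))" and "B = (\<Sum>j\<in>I. exp (k j))"
  have pos: "A > 0" "B > 0" unfolding A_def B_def using I by (auto intro!: sum_pos)
  have m0: "m \<ge> 0" using I m by (meson abs_ge_zero ex_in_conv order_trans)
  have up: "exp (l i) \<le> exp m * exp (k i)" "exp (k i) \<le> exp m * exp (l i)" if "i \<in> I" for i
    using m[OF that] unfolding exp_add[symmetric] by auto
  have AB: "A \<le> exp m * B" "B \<le> exp m * A"
    unfolding A_def B_def sum_distrib_left by (intro sum_mono up; simp)+
  have sum1: "(\<Sum>i\<in>I. exp (l i) / A) = 1" "(\<Sum>i\<in>I. exp (k i) / B) = 1"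
    using pos unfolding A_def B_def by (auto simp flip: sum_divide_distrib)
  have tr: "(\<Sum>i\<in>I. \<bar>exp (l i) / A - exp (k i) / B\<bar>) \<le> 2"
  proof -
    have "(\<Sum>i\<in>I. \<bar>exp (l i) / A - exp (k i) / B\<bar>) \<le> (\<Sum>i\<in>I. exp (l i) / A + exp (k i) / B)"
      using pos by (intro sum_mono) (smt (verit) divide_nonneg_pos exp_ge_zero)
    then show ?thesis by (simp add: sum.distrib sum1)
  qed
  show ?thesis
  proof (cases "m \<le> 1 / 2")
    case True
    have e: "exp (2 * m) \<le> 1 + 4 * m" using exp_le_one_plus_double[of "2 * m"] True m0 by simp
    have "\<bar>exp (l i) / A - exp (k i) / B\<bar> \<le> (exp (k i) / B) * (4 * m)" if i: "i \<in> I" for i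
    proof -
      have 1: "exp (l i) / A \<le> exp (2 * m) * (exp (k i) / B)"
      proof -
        have "exp (l i) * B \<le> (exp m * exp (k i)) * (exp m * A)"
          by (intro mult_mono up AB i) (use pos in auto)
        then show ?thesis using pos by (simp add: field_simps exp_add[symmetric] mult_exp_exp)
      qed
      have 2: "exp (k i) / B \<le> exp (2 * m) * (exp (l i) / A)"
      proof -
        have "exp (k i) * A \<le> (exp m * exp (l i)) * (exp m * B)"
          by (intro mult_mono up AB i) (use pos in auto)
        then show ?thesis using pos by (simp add: field_simps exp_add[symmetric] mult_exp_exp)
      qed
      define u v where "u = exp (l i) / A" and "v = exp (k i) / B"
      have uv: "u > 0" "v > 0" using pos by (auto simp: u_def v_def)
      have "u \<le> (1 + 4 * m) * v" using 1 mult_right_mono[OF e, of v] uv by (simp add: u_def v_def)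
      moreover have "v * (1 - 4 * m) \<le> u"
      proof -
        have a: "v \<le> (1 + 4 * m) * u" using 2 mult_right_mono[OF e, of u] uv by (simp add: u_def v_def)
        show ?thesis
        proof (cases "1 - 4 * m \<ge> 0")
          case True
          have "v * (1 - 4 * m) \<le> ((1 + 4 * m) * u) * (1 - 4 * m)" using a True by (rule mult_right_mono)
          also have "\<dots> = u * (1 - (4 * m)\<^sup>2)" by (simp add: algebra_simps power2_eq_square)
          also have "\<dots> \<le> u * 1" using uv by (intro mult_left_mono) auto
          finally show ?thesis by simp
        next
          case False then show ?thesis using uv by (smt (verit) mult_pos_neg)
        qed
      qed
      ultimately show ?thesis unfolding u_def[symmetric] v_def[symmetric]
        by (simp add: algebra_simps abs_le_iff)
    qed
    then have "(\<Sum>i\<in>I. \<bar>exp (l i) / A - exp (k i) / B\<bar>) \<le> (\<Sum>i\<in>I. (exp (k i) / B) * (4 * m))"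
      by (rule sum_mono)
    also have "\<dots> = 4 * m" by (simp only: sum_distrib_right[symmetric] sum1 mult_1)
    finally show ?thesis by (simp add: A_def B_def)
  next
    case False then show ?thesis using tr by (simp add: A_def B_def)
  qed
qed

section \<open>The function \<open>h\<close> of the overview, its weights and its drift\<close>

definition tilt_sum :: "nat \<Rightarrow> (nat \<Rightarrow> real ^ 'd) \<Rightarrow> real \<Rightarrow> real ^ 'd \<Rightarrow> real" where
  "tilt_sum n a \<theta> x = (\<Sum>i\<le>n. exp (a i \<bullet> x - (norm (a i))\<^sup>2 * \<theta> / 2))"

text \<open>The posterior law of an unknown constant drift, uniform on the sites a priori, of a
  Brownian motion that started at 0 and is found at \<open>x\<close> at time \<theta>. The drift
  \<open>tilt_drift\<close> is its mean, and also the gradient of \<open>ln\<close> of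
  \<open>tilt_sum\<close> in \<open>x\<close>.\<close>

definition tilt_weight :: "nat \<Rightarrow> (nat \<Rightarrow> real ^ 'd) \<Rightarrow> real \<Rightarrow> real ^ 'd \<Rightarrow> nat \<Rightarrow> real" where
  "tilt_weight n a \<theta> x i = exp (a i \<bullet> x - (norm (a i))\<^sup>2 * \<theta> / 2) / tilt_sum n a \<theta> x"

definition tilt_drift :: "nat \<Rightarrow> (nat \<Rightarrow> real ^ 'd) \<Rightarrow> real \<Rightarrow> real ^ 'd \<Rightarrow> real ^ 'd" where
  "tilt_drift n a \<theta> x = (\<Sum>i\<le>n. tilt_weight n a \<theta> x i *\<^sub>R a i)"

lemma tilt_sum_pos: "0 < tilt_sum n a \<theta> x"
  unfolding tilt_sum_def by (intro sum_pos) auto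

text \<open>The site 0 contributes the constant 1. This is the reason for the one index more than
  there are samples: it bounds \<open>1 / tilt_sum\<close>, and with it all quotients by
  \<open>tilt_sum\<close> whose numerator is bounded.\<close>

lemma tilt_sum_ge_one:
  assumes "0 \<in> a ` {..n}"
  shows "1 \<le> tilt_sum n a \<theta> x"
proof -
  obtain j where "j \<le> n" "a j = 0" using assms by auto
  have "exp (a j \<bullet> x - (norm (a j))\<^sup>2 * \<theta> / 2) \<le> tilt_sum n a \<theta> x"
    unfolding tilt_sum_def using \<open>j \<le> n\<close> by (intro member_le_sum) auto
  then show ?thesis using \<open>a j = 0\<close> by simp
qed

lemma tilt_weight_nonneg: "0 \<le> tilt_weight n a \<theta> x i"
  unfolding tilt_weight_def using tilt_sum_pos[of n a \<theta> x] by simp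

lemma sum_tilt_weight: "(\<Sum>i\<le>n. tilt_weight n a \<theta> x i) = 1"
  using tilt_sum_pos[of n a \<theta> x] unfolding tilt_weight_def
  by (simp add: sum_divide_distrib[symmetric]) (simp add: tilt_sum_def)

lemma norm_tilt_drift_le:
  assumes "\<And>i. i \<le> n \<Longrightarrow> norm (a i) \<le> R"
  shows "norm (tilt_drift n a \<theta> x) \<le> R"
proof -
  have "norm (tilt_drift n a \<theta> x) \<le> (\<Sum>i\<le>n. tilt_weight n a \<theta> x i * R)"
    unfolding tilt_drift_def
    by (intro sum_norm_le) (auto simp: tilt_weight_nonneg intro!: mult_left_mono assms)
  then show ?thesis by (simp add: sum_distrib_right[symmetric] sum_tilt_weight)
qed

lemma tilt_weight_diff_le:
  fixes a :: "nat \<Rightarrow> real ^ 'd"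
  assumes a: "\<And>i. i \<le> n \<Longrightarrow> norm (a i) \<le> R"
  shows "(\<Sum>i\<le>n. \<bar>tilt_weight n a \<theta> x i - tilt_weight n a \<theta>' x' i\<bar>) \<le> 4 * (R * norm (x - x') + R\<^sup>2 * \<bar>\<theta> - \<theta>'\<bar> / 2)"
  unfolding tilt_weight_def tilt_sum_def
proof (rule softmax_diff_le)
  fix i assume "i \<in> {..n}"
  then have i: "norm (a i) \<le> R" using a by simp
  have "\<bar>a i \<bullet> x - (norm (a i))\<^sup>2 * \<theta> / 2 - (a i \<bullet> x' - (norm (a i))\<^sup>2 * \<theta>' / 2)\<bar>
      = \<bar>a i \<bullet> (x - x') - (norm (a i))\<^sup>2 * (\<theta> - \<theta>') / 2\<bar>"
    by (simp add: inner_diff_right right_diff_distrib diff_divide_distrib)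
  also have "\<dots> \<le> \<bar>a i \<bullet> (x - x')\<bar> + \<bar>(norm (a i))\<^sup>2 * (\<theta> - \<theta>') / 2\<bar>" by (rule abs_triangle_ineq4)
  also have "\<dots> \<le> R * norm (x - x') + R\<^sup>2 * \<bar>\<theta> - \<theta>'\<bar> / 2"
  proof (rule add_mono)
    show "\<bar>a i \<bullet> (x - x')\<bar> \<le> R * norm (x - x')"
      using Cauchy_Schwarz_ineq2[of "a i" "x - x'"] mult_right_mono[OF i, of "norm (x - x')"] by simp
    have "(norm (a i))\<^sup>2 \<le> R\<^sup>2" using i by (intro power_mono) auto
    then show "\<bar>(norm (a i))\<^sup>2 * (\<theta> - \<theta>') / 2\<bar> \<le> R\<^sup>2 * \<bar>\<theta> - \<theta>'\<bar> / 2"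
      by (simp add: abs_mult mult_right_mono)
  qed
  finally show "\<bar>a i \<bullet> x - (norm (a i))\<^sup>2 * \<theta> / 2 - (a i \<bullet> x' - (norm (a i))\<^sup>2 * \<theta>' / 2)\<bar> \<le> R * norm (x - x') + R\<^sup>2 * \<bar>\<theta> - \<theta>'\<bar> / 2" .
qed auto

lemma tilt_drift_diff_le:
  fixes a :: "nat \<Rightarrow> real ^ 'd"
  assumes a: "\<And>i. i \<le> n \<Longrightarrow> norm (a i) \<le> R"
  shows "norm (tilt_drift n a \<theta> x - tilt_drift n a \<theta>' x') \<le> 4 * R\<^sup>2 * norm (x - x') + 2 * R ^ 3 * \<bar>\<theta> - \<theta>'\<bar>"
proof -
  have R: "0 \<le> R" using a[of 0] norm_ge_zero[of "a 0"] by linarith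
  have "norm (tilt_drift n a \<theta> x - tilt_drift n a \<theta>' x')
    = norm (\<Sum>i\<le>n. (tilt_weight n a \<theta> x i - tilt_weight n a \<theta>' x' i) *\<^sub>R a i)"
    by (simp add: tilt_drift_def sum_subtractf scaleR_diff_left)
  also have "\<dots> \<le> (\<Sum>i\<le>n. \<bar>tilt_weight n a \<theta> x i - tilt_weight n a \<theta>' x' i\<bar> * R)"
    by (intro sum_norm_le) (auto intro!: mult_left_mono a)
  also have "\<dots> \<le> 4 * (R * norm (x - x') + R\<^sup>2 * \<bar>\<theta> - \<theta>'\<bar> / 2) * R"
    unfolding sum_distrib_right[symmetric] using R by (intro mult_right_mono tilt_weight_diff_le a) auto
  finally show ?thesis by (simp add: algebra_simps power2_eq_square power3_eq_cube)
qed

text \<open>Expresses the growth of \<open>h\<close> over a step as a mean under the current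
  weights, so that the analysis of one step is a computation with a fixed probability
  vector.\<close>

lemma tilt_sum_add:
  fixes a :: "nat \<Rightarrow> real ^ 'd"
  shows "tilt_sum n a (\<theta> + \<delta>) (x + w) = tilt_sum n a \<theta> x * (\<Sum>i\<le>n. tilt_weight n a \<theta> x i * exp (a i \<bullet> w - (norm (a i))\<^sup>2 * \<delta> / 2))"
proof -
  have "tilt_sum n a \<theta> x * (\<Sum>i\<le>n. tilt_weight n a \<theta> x i * exp (a i \<bullet> w - (norm (a i))\<^sup>2 * \<delta> / 2)) =
      (\<Sum>i\<le>n. exp (a i \<bullet> x - (norm (a i))\<^sup>2 * \<theta> / 2) * exp (a i \<bullet> w - (norm (a i))\<^sup>2 * \<delta> / 2))"
    using tilt_sum_pos[of n a \<theta> x] by (simp add: tilt_weight_def sum_distrib_left)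
  also have "\<dots> = tilt_sum n a (\<theta> + \<delta>) (x + w)" unfolding tilt_sum_def
    by (intro sum.cong refl) (simp add: exp_add[symmetric] inner_add_right algebra_simps add_divide_distrib)
  finally show ?thesis by simp
qed

lemma borel_measurable_tilt_sum[measurable (raw)]:
  assumes [measurable]: "\<And>i. i \<le> n \<Longrightarrow> (\<lambda>z. a z i) \<in> borel_measurable M" "t \<in> borel_measurable M" "x \<in> borel_measurable M"
  shows "(\<lambda>z. tilt_sum n (a z) (t z) (x z)) \<in> borel_measurable M"
  unfolding tilt_sum_def by measurable

lemma borel_measurable_tilt_weight[measurable (raw)]:
  assumes [measurable]: "\<And>i. i \<le> n \<Longrightarrow> (\<lambda>z. a z i) \<in> borel_measurable M" "t \<in> borel_measurable M" "x \<in> borel_measurable M"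
   and j: "j \<le> n"
  shows "(\<lambda>z. tilt_weight n (a z) (t z) (x z) j) \<in> borel_measurable M"
  unfolding tilt_weight_def using assms(1)[OF j] by measurable

lemma borel_measurable_tilt_drift[measurable (raw)]:
  assumes [measurable]: "\<And>i. i \<le> n \<Longrightarrow> (\<lambda>z. a z i) \<in> borel_measurable M" "t \<in> borel_measurable M" "x \<in> borel_measurable M"
  shows "(\<lambda>z. tilt_drift n (a z) (t z) (x z)) \<in> borel_measurable M"
  unfolding tilt_drift_def by measurable

text \<open>
  A plane wave solving the backward heat equation, divided by the solution \<^const>\<open>tilt_sum\<close>. Such a
  quotient is a martingale along the diffusion with drift \<^const>\<open>tilt_drift\<close>, and the plane waves
  determine the law.
\<close>

definition wave_ratio :: "nat \<Rightarrow> (nat \<Rightarrow> real ^ 'd) \<Rightarrow> real ^ 'd \<Rightarrow> real \<Rightarrow> real ^ 'd \<Rightarrow> complex" where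
  "wave_ratio n a \<xi> \<theta> x = exp ((norm \<xi>)\<^sup>2 * \<theta> / 2) *\<^sub>R cis (\<xi> \<bullet> x) / tilt_sum n a \<theta> x"

lemma borel_measurable_cis[measurable]: "cis \<in> borel_measurable borel"
  by (intro borel_measurable_continuous_onI continuous_intros)

lemma borel_measurable_wave_ratio[measurable (raw)]:
  assumes [measurable]: "\<And>i. i \<le> n \<Longrightarrow> (\<lambda>z. a z i) \<in> borel_measurable M" "t \<in> borel_measurable M" "x \<in> borel_measurable M"
  shows "(\<lambda>z. wave_ratio n (a z) \<xi> (t z) (x z)) \<in> borel_measurable M"
  unfolding wave_ratio_def by measurable

lemma norm_wave_ratio_le:
  assumes "0 \<in> a ` {..n}" "\<theta> \<le> r"
  shows "cmod (wave_ratio n a \<xi> \<theta> x) \<le> exp ((norm \<xi>)\<^sup>2 * r / 2)"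
proof -
  have "cmod (wave_ratio n a \<xi> \<theta> x) = exp ((norm \<xi>)\<^sup>2 * \<theta> / 2) / tilt_sum n a \<theta> x"
    using tilt_sum_pos[of n a \<theta> x] by (simp add: wave_ratio_def norm_divide)
  also have "\<dots> \<le> exp ((norm \<xi>)\<^sup>2 * \<theta> / 2) / 1"
    using tilt_sum_ge_one[OF assms(1)] by (intro divide_left_mono) (auto simp: tilt_sum_pos)
  also have "\<dots> \<le> exp ((norm \<xi>)\<^sup>2 * r / 2)" using assms(2) by (auto intro: mult_left_mono)
  finally show ?thesis .
qed

text \<open>The logarithm of \<open>tilt_sum\<close> is Lipschitz in space with constant
  \<open>R\<close>. For \<open>R * norm (x - y) \<le> 1\<close> this is linearised; otherwise both
  reciprocals lie between 0 and 1 and the bound is trivial.\<close>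

lemma inverse_tilt_sum_diff_le:
  fixes a :: "nat \<Rightarrow> real ^ 'd"
  assumes a: "\<And>i. i \<le> n \<Longrightarrow> norm (a i) \<le> R" and j: "0 \<in> a ` {..n}"
  shows "\<bar>1 / tilt_sum n a \<theta> x - 1 / tilt_sum n a \<theta> y\<bar> \<le> 2 * R * norm (x - y)"
proof -
  define m where "m = R * norm (x - y)"
  have R: "0 \<le> R" using a[of 0] norm_ge_zero[of "a 0"] by linarith
  then have m0: "0 \<le> m" by (simp add: m_def)
  have le: "tilt_sum n a \<theta> x \<le> exp m * tilt_sum n a \<theta> y" if m: "m = R * norm (x - y)" for x y
    unfolding tilt_sum_def sum_distrib_left
  proof (intro sum_mono)
    fix i assume "i \<in> {..n}"
    then have "a i \<bullet> (x - y) \<le> m"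
      using Cauchy_Schwarz_ineq2[of "a i" "x - y"] mult_right_mono[OF a[of i], of "norm (x - y)"] m by auto
    then show "exp (a i \<bullet> x - (norm (a i))\<^sup>2 * \<theta> / 2) \<le> exp m * exp (a i \<bullet> y - (norm (a i))\<^sup>2 * \<theta> / 2)"
      unfolding exp_add[symmetric] by (simp add: inner_diff_right)
  qed
  define A B where "A = tilt_sum n a \<theta> x" and "B = tilt_sum n a \<theta> y"
  have AB: "1 \<le> A" "1 \<le> B" unfolding A_def B_def using tilt_sum_ge_one[OF j] by auto
  have c: "A \<le> exp m * B" "B \<le> exp m * A"
    using le[of x y] le[of y x] by (auto simp: A_def B_def m_def norm_minus_commute)
  have "\<bar>1 / A - 1 / B\<bar> \<le> 2 * m"
  proof (cases "m \<le> 1")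
    case True
    have e: "exp m \<le> 1 + 2 * m" using exp_le_one_plus_double[OF m0 True] .
    have "A - B \<le> 2 * m * B" "B - A \<le> 2 * m * A"
      using c mult_right_mono[OF e, of A] mult_right_mono[OF e, of B] AB by (auto simp: algebra_simps)
    moreover have "2 * m * B \<le> 2 * m * (A * B)" "2 * m * A \<le> 2 * m * (A * B)"
      using m0 AB by (auto intro!: mult_left_mono)
    ultimately have "\<bar>B - A\<bar> \<le> 2 * m * (A * B)" by linarith
    moreover have "1 / A - 1 / B = (B - A) / (A * B)" using AB by (simp add: field_simps)
    moreover have "A * B > 0" using AB by simp
    ultimately show ?thesis by (simp add: abs_divide pos_divide_le_eq)
  next
    case False
    have "0 \<le> 1 / A" "1 / A \<le> 1" "0 \<le> 1 / B" "1 / B \<le> 1" using AB by auto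
    then show ?thesis using False by linarith
  qed
  then show ?thesis by (simp add: A_def B_def m_def)
qed

text \<open>Product estimate for the wave and \<open>1 / tilt_sum\<close>. It turns the error of
  position in an Euler step into an error of the quotient.\<close>

lemma wave_ratio_lipschitz:
  fixes a :: "nat \<Rightarrow> real ^ 'd"
  assumes a: "\<And>i. i \<le> n \<Longrightarrow> norm (a i) \<le> R" and j: "0 \<in> a ` {..n}" and r: "\<theta> \<le> r"
  shows "cmod (wave_ratio n a \<xi> \<theta> x - wave_ratio n a \<xi> \<theta> y) \<le> exp ((norm \<xi>)\<^sup>2 * r / 2) * (norm \<xi> + 2 * R) * norm (x - y)"
proof -
  define A B where "A = tilt_sum n a \<theta> x" and "B = tilt_sum n a \<theta> y"
  have AB: "1 \<le> A" "1 \<le> B" unfolding A_def B_def using tilt_sum_ge_one[OF j] by auto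
  have "wave_ratio n a \<xi> \<theta> x - wave_ratio n a \<xi> \<theta> y =
    exp ((norm \<xi>)\<^sup>2 * \<theta> / 2) *\<^sub>R ((cis (\<xi> \<bullet> x) - cis (\<xi> \<bullet> y)) * complex_of_real (1 / A) + cis (\<xi> \<bullet> y) * complex_of_real (1 / A - 1 / B))"
    by (simp add: wave_ratio_def A_def B_def scaleR_conv_of_real algebra_simps)
  also have "cmod \<dots> = exp ((norm \<xi>)\<^sup>2 * \<theta> / 2) * cmod ((cis (\<xi> \<bullet> x) - cis (\<xi> \<bullet> y)) * complex_of_real (1 / A) + cis (\<xi> \<bullet> y) * complex_of_real (1 / A - 1 / B))"
    by simp
  also have "\<dots> \<le> exp ((norm \<xi>)\<^sup>2 * r / 2) * ((norm \<xi> + 2 * R) * norm (x - y))"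
  proof (rule mult_mono)
    have "cmod ((cis (\<xi> \<bullet> x) - cis (\<xi> \<bullet> y)) * complex_of_real (1 / A) + cis (\<xi> \<bullet> y) * complex_of_real (1 / A - 1 / B))
      \<le> cmod (cis (\<xi> \<bullet> x) - cis (\<xi> \<bullet> y)) * \<bar>1 / A\<bar> + \<bar>1 / A - 1 / B\<bar>"
      by (rule order_trans[OF norm_triangle_ineq]) (simp only: norm_mult norm_of_real norm_cis mult_1_left order_refl)
    also have "\<dots> \<le> (norm \<xi> * norm (x - y)) * 1 + 2 * R * norm (x - y)"
    proof (intro add_mono mult_mono)
      have "\<bar>\<xi> \<bullet> x - \<xi> \<bullet> y\<bar> \<le> norm \<xi> * norm (x - y)"
        using Cauchy_Schwarz_ineq2[of \<xi> "x - y"] by (simp add: inner_diff_right)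
      then show "cmod (cis (\<xi> \<bullet> x) - cis (\<xi> \<bullet> y)) \<le> norm \<xi> * norm (x - y)"
        using cmod_cis_diff_le[of "\<xi> \<bullet> x" "\<xi> \<bullet> y"] by linarith
      show "\<bar>1 / A - 1 / B\<bar> \<le> 2 * R * norm (x - y)"
        unfolding A_def B_def by (rule inverse_tilt_sum_diff_le[OF a j])
    qed (use AB in auto)
    finally show "cmod ((cis (\<xi> \<bullet> x) - cis (\<xi> \<bullet> y)) * complex_of_real (1 / A) + cis (\<xi> \<bullet> y) * complex_of_real (1 / A - 1 / B))
      \<le> (norm \<xi> + 2 * R) * norm (x - y)" by (simp add: algebra_simps)
    show "exp ((norm \<xi>)\<^sup>2 * \<theta> / 2) \<le> exp ((norm \<xi>)\<^sup>2 * r / 2)" using r by (auto intro: mult_left_mono)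
  qed auto
  finally show ?thesis by (simp add: mult.assoc)
qed

lemma integrable_wave_ratio_gauss:
  fixes a :: "nat \<Rightarrow> real ^ 'd"
  assumes "0 < v" "0 \<in> a ` {..n}"
  shows "integrable (gauss v) (\<lambda>w. wave_ratio n a \<xi> \<theta> (x + w))"
proof -
  interpret prob_space "gauss v :: (real ^ 'd) measure" by (rule prob_space_gauss) fact
  show ?thesis
    by (rule integrable_const_bound[where B="exp ((norm \<xi>)\<^sup>2 * \<theta> / 2)"])
       (auto intro!: norm_wave_ratio_le assms)
qed

text \<open>
  As the error is of smaller order than \<open>\<delta>\<close>, the mean of \<^const>\<open>wave_ratio\<close> along the diffusion has derivative zero.
  This replaces stochastic calculus.
\<close>

lemma wave_ratio_step:
  fixes \<xi> :: "real ^ 'd" and R r :: real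
  assumes R: "0 \<le> R"
  shows "\<exists>C\<ge>0. \<forall>n (a :: nat \<Rightarrow> real ^ 'd) \<theta> x \<delta>. (\<forall>i\<le>n. norm (a i) \<le> R) \<longrightarrow> 0 \<in> a ` {..n} \<longrightarrow> \<theta> \<le> r \<longrightarrow> 0 < \<delta> \<longrightarrow> \<delta> \<le> 1 \<longrightarrow>
     cmod ((LINT w|gauss \<delta>. wave_ratio n a \<xi> (\<theta> + \<delta>) (x + \<delta> *\<^sub>R tilt_drift n a \<theta> x + w)) - wave_ratio n a \<xi> \<theta> x)
       \<le> C * (\<delta> * sqrt \<delta>)"
proof -
  define C0 where "C0 = (LINT z|(gauss 1 :: (real ^ 'd) measure). exp (5 * (R * norm z + R\<^sup>2)))"
  have int0: "integrable (gauss 1 :: (real ^ 'd) measure) (\<lambda>z. exp (5 * (R * norm z + R\<^sup>2)))"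
    using integrable_mult_right[OF integrable_gauss_exp_norm[of "5 * R", where 'd='d], of "exp (5 * R\<^sup>2)"]
    by (simp add: exp_add[symmetric] algebra_simps)
  have C0: "0 \<le> C0" unfolding C0_def by (intro integral_nonneg_AE) auto
  define K where "K = exp ((norm \<xi>)\<^sup>2 * r / 2)"
  define K1 where "K1 = exp ((norm \<xi>)\<^sup>2 / 2)"
  \<comment> \<open>The first summand comes from the first-order term \<open>T1\<close>, the second
    from the remainder of expanding \<open>1 / H\<close>.\<close>
  define C where "C = K * ((norm \<xi>)\<^sup>2 * R\<^sup>2) + K * K1 * ((R\<^sup>2 + 2) * C0)"
  have "C \<ge> 0" unfolding C_def K_def K1_def using C0 R by (intro add_nonneg_nonneg mult_nonneg_nonneg) auto
  moreover have "cmod ((LINT w|gauss \<delta>. wave_ratio n a \<xi> (\<theta> + \<delta>) (x + \<delta> *\<^sub>R tilt_drift n a \<theta> x + w)) - wave_ratio n a \<xi> \<theta> x)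
       \<le> C * (\<delta> * sqrt \<delta>)"
    if a: "\<And>i. i \<le> n \<Longrightarrow> norm (a i) \<le> R" and j: "0 \<in> a ` {..n}" and r: "\<theta> \<le> r" and d: "0 < \<delta>" "\<delta> \<le> 1"
    for n and a :: "nat \<Rightarrow> real ^ 'd" and \<theta> x \<delta>
  proof -
    interpret prob_space "gauss \<delta> :: (real ^ 'd) measure" by (rule prob_space_gauss) fact
    define b where "b = tilt_drift n a \<theta> x"
    define q where "q = tilt_weight n a \<theta> x"
    define h0 where "h0 = tilt_sum n a \<theta> x"
    \<comment> \<open>\<open>E c\<close> is the Cameron-Martin weight of a shift by
      \<open>\<delta> *\<^sub>R c\<close>. \<open>H\<close> is the factor by which
      \<open>tilt_sum\<close> grows over the step, and \<open>X\<close> the factor of the numerator,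
      which has mean one under the centred noise.\<close>
    define E where "E c w = exp (c \<bullet> w - (norm c)\<^sup>2 * \<delta> / 2)" for c w :: "real ^ 'd"
    define H where "H w = (\<Sum>i\<le>n. q i * E (a i) w)" for w
    define X where "X w = exp ((norm \<xi>)\<^sup>2 * \<delta> / 2) *\<^sub>R cis (\<xi> \<bullet> w)" for w
    define e0 where "e0 = exp ((norm \<xi>)\<^sup>2 * \<theta> / 2) *\<^sub>R cis (\<xi> \<bullet> x)"
    have h0: "1 \<le> h0" unfolding h0_def by (rule tilt_sum_ge_one[OF j])
    have e0: "cmod e0 \<le> K" unfolding e0_def K_def using r by (auto intro: mult_left_mono)
    have q0: "0 \<le> q i" for i by (simp add: q_def tilt_weight_nonneg)
    have q1: "(\<Sum>i\<le>n. q i) = 1" by (simp add: q_def sum_tilt_weight)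
    have bR: "norm b \<le> R" unfolding b_def by (rule norm_tilt_drift_le) (rule a)
    have hH: "tilt_sum n a (\<theta> + \<delta>) (x + w) = h0 * H w" for w
      by (simp add: tilt_sum_add h0_def H_def q_def E_def)
    have hH1: "1 \<le> h0 * H w" for w using tilt_sum_ge_one[OF j, of "\<theta> + \<delta>" "x + w"] by (simp add: hH)
    have Hpos: "0 < H w" for w using hH1[of w] h0 by (smt (verit) mult_nonneg_nonpos)
    have [measurable]: "H \<in> borel_measurable borel" "\<And>c. E c \<in> borel_measurable borel" "X \<in> borel_measurable borel"
      unfolding H_def[abs_def] E_def[abs_def] X_def[abs_def] by measurable
    have K1: "cmod (X w) \<le> K1" for w
      unfolding X_def K1_def using d by (auto intro: mult_left_le)
    have intE: "integrable (gauss \<delta>) (\<lambda>w. E c w *\<^sub>R X w)" for c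
      unfolding E_def by (subst integrable_gauss_tilt) (use d K1 in \<open>auto intro!: integrable_const_bound[where B=K1]\<close>)
    have X1: "(LINT w|gauss \<delta>. X w) = 1"
      unfolding X_def using d
      by (simp add: integral_gauss_cis scaleR_conv_of_real of_real_mult[symmetric] exp_add[symmetric] del: of_real_mult)
    have EX: "(LINT w|gauss \<delta>. E c w *\<^sub>R X w) = cis (\<delta> * (\<xi> \<bullet> c))" for c
    proof -
      have "(LINT w|gauss \<delta>. E c w *\<^sub>R X w) = (LINT w|gauss \<delta>. X (\<delta> *\<^sub>R c + w))"
        unfolding E_def by (rule integral_gauss_tilt) (use d in auto)
      also have "\<dots> = (LINT w|gauss \<delta>. cis (\<delta> * (\<xi> \<bullet> c)) * X w)"
        by (intro Bochner_Integration.integral_cong) (auto simp: X_def inner_add_right cis_mult[symmetric])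
      also have "\<dots> = cis (\<delta> * (\<xi> \<bullet> c))" by (subst integral_mult_right_zero) (simp add: X1)
      finally show ?thesis .
    qed
    have wr: "wave_ratio n a \<xi> (\<theta> + \<delta>) (x + w) = (e0 / h0) * (X w / H w)" for w
      unfolding wave_ratio_def hH e0_def X_def
      by (simp add: inner_add_right cis_mult[symmetric] scaleR_conv_of_real distrib_left add_divide_distrib exp_add)
    have wr0: "wave_ratio n a \<xi> \<theta> x = e0 / h0" by (simp add: wave_ratio_def e0_def h0_def)
    have intA: "integrable (gauss \<delta>) (\<lambda>w. E b w *\<^sub>R ((e0 / h0) * (X w / H w)))"
      unfolding E_def wr[symmetric]
      by (subst integrable_gauss_tilt)
        (use d integrable_wave_ratio_gauss[OF d(1) j, of \<xi> "\<theta> + \<delta>" "x + \<delta> *\<^sub>R b"] in \<open>auto simp: add.assoc\<close>)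
    \<comment> \<open>The drift of the step becomes the weight \<open>E b\<close>, so that
      everything is a mean over centred noise.\<close>
    have "(LINT w|gauss \<delta>. wave_ratio n a \<xi> (\<theta> + \<delta>) (x + \<delta> *\<^sub>R b + w)) =
       (LINT w|gauss \<delta>. E b w *\<^sub>R wave_ratio n a \<xi> (\<theta> + \<delta>) (x + w))"
      unfolding E_def by (subst integral_gauss_tilt) (use d in \<open>auto simp: add.assoc\<close>)
    also have "\<dots> = (LINT w|gauss \<delta>. E b w *\<^sub>R ((e0 / h0) * (X w / H w)))" by (simp only: wr)
    finally have S1: "(LINT w|gauss \<delta>. wave_ratio n a \<xi> (\<theta> + \<delta>) (x + \<delta> *\<^sub>R b + w)) = \<dots>" .
    have intX: "integrable (gauss \<delta>) X" by (rule integrable_const_bound[where B=K1]) (auto simp: K1)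
    have intEb: "integrable (gauss \<delta>) (\<lambda>w. (E b w - H w) *\<^sub>R X w)"
    proof -
      have "(\<lambda>w. (E b w - H w) *\<^sub>R X w) = (\<lambda>w. E b w *\<^sub>R X w - (\<Sum>i\<le>n. q i *\<^sub>R (E (a i) w *\<^sub>R X w)))"
        by (simp add: fun_eq_iff H_def scaleR_diff_left scaleR_sum_left)
      then show ?thesis by (simp only:) (intro Bochner_Integration.integrable_diff Bochner_Integration.integrable_sum integrable_scaleR_right intE)
    qed
    define T1 where "T1 = (LINT w|gauss \<delta>. (E b w - H w) *\<^sub>R X w)"
    have T1: "T1 = cis (\<delta> * (\<xi> \<bullet> b)) - (\<Sum>i\<le>n. q i *\<^sub>R cis (\<delta> * (\<xi> \<bullet> a i)))"
    proof -
      have "T1 = (LINT w|gauss \<delta>. E b w *\<^sub>R X w - (\<Sum>i\<le>n. q i *\<^sub>R (E (a i) w *\<^sub>R X w)))"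
        unfolding T1_def by (simp add: H_def scaleR_diff_left scaleR_sum_left)
      also have "\<dots> = (LINT w|gauss \<delta>. E b w *\<^sub>R X w) - (\<Sum>i\<le>n. (LINT w|gauss \<delta>. q i *\<^sub>R (E (a i) w *\<^sub>R X w)))"
        by (subst Bochner_Integration.integral_diff, intro intE, intro Bochner_Integration.integrable_sum integrable_scaleR_right intE,
            subst Bochner_Integration.integral_sum, intro integrable_scaleR_right intE) simp
      finally show ?thesis by (simp add: EX del: scaleR_scaleR)
    qed
    have T1_le: "cmod T1 \<le> (norm \<xi>)\<^sup>2 * R\<^sup>2 * (\<delta> * sqrt \<delta>)"
    proof -
      \<comment> \<open>\<open>L c\<close> is the second-order remainder of the plane wave under a
        shift. In \<open>T1\<close> the constant and the linear terms cancel because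
        \<open>b\<close> is the mean of the sites under \<open>q\<close>.\<close>
      define L where "L c = cis (\<delta> * (\<xi> \<bullet> c)) - 1 - \<i> * complex_of_real (\<delta> * (\<xi> \<bullet> c))" for c
      have L: "cmod (L c) \<le> (\<delta> * (norm \<xi> * R))\<^sup>2 / 2" if "norm c \<le> R" for c
      proof -
        have "\<bar>\<xi> \<bullet> c\<bar> \<le> norm \<xi> * R"
          using Cauchy_Schwarz_ineq2[of \<xi> c] mult_left_mono[OF that, of "norm \<xi>"] by simp
        then have "\<bar>\<delta> * (\<xi> \<bullet> c)\<bar> \<le> \<delta> * (norm \<xi> * R)" using d by (simp add: abs_mult)
        then have "(\<delta> * (\<xi> \<bullet> c))\<^sup>2 \<le> (\<delta> * (norm \<xi> * R))\<^sup>2" by (metis abs_le_square_iff abs_of_nonneg abs_ge_zero order_trans)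
        then show ?thesis unfolding L_def using cmod_cis_linear_le[of "\<delta> * (\<xi> \<bullet> c)"] by simp
      qed
      have qa: "\<xi> \<bullet> b = (\<Sum>i\<le>n. q i * (\<xi> \<bullet> a i))"
        by (simp add: b_def tilt_drift_def q_def inner_sum_right)
      have q1c: "(\<Sum>i\<le>n. complex_of_real (q i)) = 1" using q1 by (metis of_real_1 of_real_sum)
      have "T1 = L b - (\<Sum>i\<le>n. q i *\<^sub>R L (a i))"
      proof -
        have "(\<Sum>i\<le>n. q i *\<^sub>R L (a i)) = (\<Sum>i\<le>n. q i *\<^sub>R cis (\<delta> * (\<xi> \<bullet> a i))) - (\<Sum>i\<le>n. complex_of_real (q i))
           - \<i> * \<delta> * complex_of_real (\<Sum>i\<le>n. q i * (\<xi> \<bullet> a i))"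
          by (simp add: L_def scaleR_conv_of_real sum_subtractf[symmetric] sum_distrib_left algebra_simps)
        then show ?thesis by (simp add: T1 q1c qa[symmetric] L_def)
      qed
      also have "cmod \<dots> \<le> (\<delta> * (norm \<xi> * R))\<^sup>2 / 2 + (\<Sum>i\<le>n. q i * ((\<delta> * (norm \<xi> * R))\<^sup>2 / 2))"
      proof (rule order_trans[OF norm_triangle_ineq4], rule add_mono, rule L[OF bR], rule sum_norm_le)
        fix i assume "i \<in> {..n}"
        then show "cmod (q i *\<^sub>R L (a i)) \<le> q i * ((\<delta> * (norm \<xi> * R))\<^sup>2 / 2)"
          unfolding norm_scaleR abs_of_nonneg[OF q0] by (intro mult_left_mono L a q0) simp
      qed
      also have "\<dots> = (\<delta> * (norm \<xi> * R))\<^sup>2" by (simp only: sum_distrib_right[symmetric] q1 mult_1 field_sum_of_halves)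
      also have "\<dots> = (norm \<xi>)\<^sup>2 * R\<^sup>2 * (\<delta> * \<delta>)" by (simp add: power_mult_distrib power2_eq_square)
      also have "\<dots> \<le> (norm \<xi>)\<^sup>2 * R\<^sup>2 * (\<delta> * sqrt \<delta>)"
        using d by (intro mult_left_mono) (auto simp: real_le_rsqrt power2_eq_square mult_left_le)
      finally show ?thesis .
    qed
    \<comment> \<open>The exact identity
      \<open>E b / H = 1 + (E b - H) - (E b - H) * (H - 1) / H\<close>, multiplied by
      \<open>X\<close> and integrated. The middle term gives \<open>T1\<close>; the last one
      contains two small factors.\<close>
    have S2: "(LINT w|gauss \<delta>. E b w *\<^sub>R ((e0 / h0) * (X w / H w))) - e0 / h0 =
        (e0 / h0) * T1 - (LINT w|gauss \<delta>. e0 * ((E b w - H w) * (H w - 1)) *\<^sub>R (X w / (h0 * H w)))"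
    proof -
      have eq: "E b w *\<^sub>R ((e0 / h0) * (X w / H w)) - (e0 / h0) * X w - (e0 / h0) * ((E b w - H w) *\<^sub>R X w)
        = - (e0 * ((E b w - H w) * (H w - 1)) *\<^sub>R (X w / (h0 * H w)))" for w
        using Hpos[of w] h0 by (simp add: scaleR_conv_of_real field_simps)
      have "(LINT w|gauss \<delta>. E b w *\<^sub>R ((e0 / h0) * (X w / H w)) - (e0 / h0) * X w - (e0 / h0) * ((E b w - H w) *\<^sub>R X w))
        = (LINT w|gauss \<delta>. E b w *\<^sub>R ((e0 / h0) * (X w / H w))) - (e0 / h0) * (LINT w|gauss \<delta>. X w) - (e0 / h0) * T1"
        unfolding T1_def
        by (subst Bochner_Integration.integral_diff, intro Bochner_Integration.integrable_diff intA integrable_mult_right intX,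
            intro integrable_mult_right intEb,
            subst Bochner_Integration.integral_diff, intro intA, intro integrable_mult_right intX, simp only: integral_mult_right_zero)
      then have m: "- (LINT w|gauss \<delta>. e0 * ((E b w - H w) * (H w - 1)) *\<^sub>R (X w / (h0 * H w)))
        = (LINT w|gauss \<delta>. E b w *\<^sub>R ((e0 / h0) * (X w / H w))) - (e0 / h0) * 1 - (e0 / h0) * T1"
        unfolding eq X1 integral_minus .
      have "A - k = k * t - I" if "- I = A - k * 1 - k * t" for A k t I :: complex
        using that by (simp add: algebra_simps)
      from this[OF m] show ?thesis .
    qed
    \<comment> \<open>With \<open>w\<close> of size \<open>sqrt \<delta>\<close>, the factor
      \<open>H - 1\<close> is of order \<open>sqrt \<delta>\<close> and \<open>E b - H\<close> of
      order \<delta>, its linear part being cancelled. The powers of \<open>norm z\<close> that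
      arise are absorbed into an exponential, which is integrable under the standard
      Gaussian.\<close>
    have bound: "\<bar>(E b w - H w) * (H w - 1)\<bar> \<le> (\<delta> * sqrt \<delta>) * ((R\<^sup>2 + 2) * exp (5 * (R * norm z + R\<^sup>2)))"
      if w: "w = sqrt \<delta> *\<^sub>R z" for w z
    proof -
      define Y1 where "Y1 = R * norm z + R\<^sup>2"
      define Y where "Y = sqrt \<delta> * Y1"
      have Y1: "0 \<le> Y1" using R by (simp add: Y1_def)
      have sd: "0 \<le> sqrt \<delta>" "sqrt \<delta> \<le> 1" "sqrt \<delta> * sqrt \<delta> = \<delta>" using d by auto
      have Y: "0 \<le> Y" "Y \<le> Y1" using Y1 sd by (auto simp: Y_def mult_left_le_one_le)
      define y where "y c = c \<bullet> w - (norm c)\<^sup>2 * \<delta> / 2" for c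
      have yY: "\<bar>y c\<bar> \<le> Y" if c: "norm c \<le> R" for c
      proof -
        have "\<bar>c \<bullet> w\<bar> \<le> R * norm w"
          using Cauchy_Schwarz_ineq2[of c w] mult_right_mono[OF c, of "norm w"] by simp
        moreover have "(norm c)\<^sup>2 \<le> R\<^sup>2" using c by (intro power_mono) auto
        then have "(norm c)\<^sup>2 * \<delta> \<le> R\<^sup>2 * \<delta>" using d by (intro mult_right_mono) auto
        moreover have "R\<^sup>2 * \<delta> \<le> R\<^sup>2 * sqrt \<delta>" using d by (intro mult_left_mono) (auto simp: real_le_rsqrt power2_eq_square mult_left_le)
        moreover have "0 \<le> (norm c)\<^sup>2 * \<delta>" using d by simp
        moreover have "R * norm w + R\<^sup>2 * sqrt \<delta> = Y" using d by (simp add: Y_def Y1_def w algebra_simps)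
        ultimately show ?thesis unfolding y_def by linarith
      qed
      have E1: "\<bar>E c w - 1\<bar> \<le> Y * exp Y" if c: "norm c \<le> R" for c
      proof -
        have "\<bar>E c w - 1\<bar> \<le> \<bar>y c\<bar> * exp \<bar>y c\<bar>" unfolding E_def y_def by (rule abs_exp_minus_one_le)
        also have "\<dots> \<le> Y * exp Y" using yY[OF c] Y by (intro mult_mono) auto
        finally show ?thesis .
      qed
      have E2: "\<bar>E c w - 1 - y c\<bar> \<le> Y\<^sup>2 * exp Y" if c: "norm c \<le> R" for c
      proof -
        have "\<bar>E c w - 1 - y c\<bar> \<le> (y c)\<^sup>2 * exp \<bar>y c\<bar>" unfolding E_def y_def by (rule abs_exp_minus_linear_le)
        also have "\<dots> \<le> Y\<^sup>2 * exp Y"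
          using yY[OF c] Y by (intro mult_mono) (auto simp: abs_le_square_iff[symmetric])
        finally show ?thesis .
      qed
      have qs: "(\<Sum>i\<le>n. q i * k) = k" for k by (simp only: sum_distrib_right[symmetric] q1 mult_1 field_sum_of_halves)
      have H1: "\<bar>H w - 1\<bar> \<le> Y * exp Y"
      proof -
        have "H w - 1 = (\<Sum>i\<le>n. q i * (E (a i) w - 1))"
          by (simp add: H_def right_diff_distrib sum_subtractf q1)
        also have "\<bar>\<dots>\<bar> \<le> (\<Sum>i\<le>n. q i * (Y * exp Y))"
          by (rule order_trans[OF sum_abs], rule sum_mono) (use q0 a E1 in \<open>auto simp: abs_mult intro!: mult_left_mono\<close>)
        finally show ?thesis by (simp only: qs)
      qed
      have H2: "\<bar>E b w - H w\<bar> \<le> R\<^sup>2 * \<delta> + 2 * (Y\<^sup>2 * exp Y)"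
      proof -
        have bw: "b \<bullet> w = (\<Sum>i\<le>n. q i * (a i \<bullet> w))"
          by (simp add: b_def tilt_drift_def q_def inner_sum_left)
        \<comment> \<open>The terms linear in \<open>w\<close> cancel once more; only the quadratic
          corrections, of order \<delta>, are left.\<close>
        have yb: "y b - (\<Sum>i\<le>n. q i * y (a i)) = (\<Sum>i\<le>n. q i * ((norm (a i))\<^sup>2 * \<delta> / 2)) - (norm b)\<^sup>2 * \<delta> / 2"
          by (simp add: y_def bw right_diff_distrib sum_subtractf)
        have s0: "0 \<le> (\<Sum>i\<le>n. q i * ((norm (a i))\<^sup>2 * \<delta> / 2))" using q0 d by (intro sum_nonneg) auto
        have "(\<Sum>i\<le>n. q i * ((norm (a i))\<^sup>2 * \<delta> / 2)) \<le> (\<Sum>i\<le>n. q i * (R\<^sup>2 * \<delta> / 2))"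
          using q0 d a by (intro sum_mono mult_left_mono divide_right_mono mult_right_mono power_mono) auto
        then have s1: "(\<Sum>i\<le>n. q i * ((norm (a i))\<^sup>2 * \<delta> / 2)) \<le> R\<^sup>2 * \<delta> / 2" by (simp only: qs)
        have s2: "0 \<le> (norm b)\<^sup>2 * \<delta> / 2" "(norm b)\<^sup>2 * \<delta> / 2 \<le> R\<^sup>2 * \<delta> / 2"
          using bR d by (auto intro!: divide_right_mono mult_right_mono power_mono)
        have s3: "\<bar>\<Sum>i\<le>n. q i * (E (a i) w - 1 - y (a i))\<bar> \<le> Y\<^sup>2 * exp Y"
        proof -
          have "\<bar>\<Sum>i\<le>n. q i * (E (a i) w - 1 - y (a i))\<bar> \<le> (\<Sum>i\<le>n. q i * (Y\<^sup>2 * exp Y))"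
            by (rule order_trans[OF sum_abs], rule sum_mono) (use q0 a E2 in \<open>auto simp: abs_mult intro!: mult_left_mono\<close>)
          then show ?thesis by (simp only: qs)
        qed
        have "(\<Sum>i\<le>n. q i * (E (a i) w - 1 - y (a i))) = H w - 1 - (\<Sum>i\<le>n. q i * y (a i))"
          by (simp add: H_def right_diff_distrib sum_subtractf q1)
        then have "E b w - H w = (E b w - 1 - y b) - (\<Sum>i\<le>n. q i * (E (a i) w - 1 - y (a i))) + (y b - (\<Sum>i\<le>n. q i * y (a i)))"
          by simp
        moreover have "0 \<le> R\<^sup>2 * \<delta>" using d by simp
        ultimately show ?thesis using E2[OF bR] s0 s1 s2 s3 yb by linarith
      qed
      have Ye: "Y1 \<le> exp Y1" using exp_ge_add_one_self[of Y1] by linarith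
      have e1: "1 \<le> exp Y1" using Y1 by simp
      have "\<bar>(E b w - H w) * (H w - 1)\<bar> \<le> (R\<^sup>2 * \<delta> + 2 * (Y\<^sup>2 * exp Y)) * (Y * exp Y)"
        unfolding abs_mult using H1 H2 Y d by (intro mult_mono) auto
      also have "\<dots> \<le> (R\<^sup>2 * \<delta> + 2 * (Y\<^sup>2 * exp Y1)) * (Y * exp Y1)"
        using Y d by (intro mult_mono add_left_mono mult_left_mono) auto
      also have "\<dots> = (\<delta> * sqrt \<delta>) * ((R\<^sup>2 + 2 * (Y1\<^sup>2 * exp Y1)) * (Y1 * exp Y1))"
        using d by (simp add: Y_def power_mult_distrib algebra_simps)
      \<comment> \<open>Replacing \<open>Y1\<close> by \<open>exp Y1\<close> leaves three
        exponentials in one factor and two in the other, which explains the 5 in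
        \<open>C0\<close>.\<close>
      also have "\<dots> \<le> (\<delta> * sqrt \<delta>) * ((R\<^sup>2 * (exp Y1 * exp Y1 * exp Y1) + 2 * (exp Y1 * exp Y1 * exp Y1)) * (exp Y1 * exp Y1))"
      proof (rule mult_left_mono)
        have "1 \<le> exp Y1 * exp Y1 * exp Y1" using mult_mono[OF mult_mono[OF e1 e1] e1] by simp
        then have A1: "R\<^sup>2 \<le> R\<^sup>2 * (exp Y1 * exp Y1 * exp Y1)"
          using mult_left_mono[of 1 "exp Y1 * exp Y1 * exp Y1" "R\<^sup>2"] by simp
        have A2: "Y1\<^sup>2 * exp Y1 \<le> exp Y1 * exp Y1 * exp Y1"
          unfolding power2_eq_square using Ye Y1 by (intro mult_mono) auto
        show "(R\<^sup>2 + 2 * (Y1\<^sup>2 * exp Y1)) * (Y1 * exp Y1) \<le> (R\<^sup>2 * (exp Y1 * exp Y1 * exp Y1) + 2 * (exp Y1 * exp Y1 * exp Y1)) * (exp Y1 * exp Y1)"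
        proof (rule mult_mono)
          show "R\<^sup>2 + 2 * (Y1\<^sup>2 * exp Y1) \<le> R\<^sup>2 * (exp Y1 * exp Y1 * exp Y1) + 2 * (exp Y1 * exp Y1 * exp Y1)"
            using A1 A2 by linarith
          show "Y1 * exp Y1 \<le> exp Y1 * exp Y1" using Ye by (intro mult_right_mono) auto
        qed (use Y1 in auto)
      qed (use d in auto)
      also have "\<dots> = (\<delta> * sqrt \<delta>) * ((R\<^sup>2 + 2) * exp (5 * Y1))"
        by (simp add: exp_add[symmetric] algebra_simps)
      finally show ?thesis by (simp add: Y1_def)
    qed
    define G where "G w = (\<delta> * sqrt \<delta>) * ((R\<^sup>2 + 2) * exp (5 * (R * norm ((1 / sqrt \<delta>) *\<^sub>R w) + R\<^sup>2)))" for w :: "real ^ 'd"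
    have Gz: "G (sqrt \<delta> *\<^sub>R z) = (\<delta> * sqrt \<delta>) * ((R\<^sup>2 + 2) * exp (5 * (R * norm z + R\<^sup>2)))" for z
      using d by (simp add: G_def)
    have [measurable]: "G \<in> borel_measurable borel" unfolding G_def[abs_def] by measurable
    have intG: "integrable (gauss \<delta>) G"
      unfolding distr_gauss_scale[OF d(1), symmetric]
      by (subst integrable_distr_eq, measurable, simp only: Gz, intro integrable_mult_right int0)
    have intGv: "(LINT w|gauss \<delta>. G w) = (\<delta> * sqrt \<delta>) * ((R\<^sup>2 + 2) * C0)"
      unfolding distr_gauss_scale[OF d(1), symmetric] C0_def
      by (subst integral_distr, measurable, simp only: Gz integral_mult_right_zero)
    have T2: "cmod (LINT w|gauss \<delta>. e0 * ((E b w - H w) * (H w - 1)) *\<^sub>R (X w / (h0 * H w))) \<le> (LINT w|gauss \<delta>. K * K1 * G w)"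
    proof (rule Bochner_Integration.integral_norm_bound_integral)
      have bnd: "cmod (e0 * ((E b w - H w) * (H w - 1)) *\<^sub>R (X w / (h0 * H w))) \<le> K * K1 * G w" for w
      proof -
        have "w = sqrt \<delta> *\<^sub>R ((1 / sqrt \<delta>) *\<^sub>R w)" using d by simp
        from bound[OF this] have 1: "\<bar>(E b w - H w) * (H w - 1)\<bar> \<le> G w" by (simp only: G_def)
        have 2: "cmod (X w / (h0 * H w)) \<le> K1"
        proof -
          have "cmod (X w / (h0 * H w)) = cmod (X w) / (h0 * H w)"
            using hH1[of w] unfolding norm_divide norm_of_real by simp
          also have "\<dots> \<le> cmod (X w) / 1" using hH1[of w] by (intro divide_left_mono) auto
          finally show ?thesis using K1[of w] by simp
        qed
        have "cmod (e0 * ((E b w - H w) * (H w - 1)) *\<^sub>R (X w / (h0 * H w))) =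
          cmod e0 * (\<bar>(E b w - H w) * (H w - 1)\<bar> * cmod (X w / (h0 * H w)))"
          by (simp only: norm_mult norm_scaleR)
        also have "\<dots> \<le> K * (G w * K1)"
          using e0 1 2 by (intro mult_mono) (auto simp: K_def intro: order_trans[OF abs_ge_zero])
        finally show ?thesis by (simp add: mult_ac)
      qed
      show "integrable (gauss \<delta>) (\<lambda>w. K * K1 * G w)" using intG by (intro integrable_mult_right)
      then show "integrable (gauss \<delta>) (\<lambda>w. e0 * ((E b w - H w) * (H w - 1)) *\<^sub>R (X w / (h0 * H w)))"
        by (rule Bochner_Integration.integrable_bound) (measurable, rule AE_I2, rule order_trans[OF bnd], simp only: real_norm_def abs_ge_self)
      show "cmod (e0 * ((E b w - H w) * (H w - 1)) *\<^sub>R (X w / (h0 * H w))) \<le> K * K1 * G w" for w by (rule bnd)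
    qed
    have "cmod ((LINT w|gauss \<delta>. wave_ratio n a \<xi> (\<theta> + \<delta>) (x + \<delta> *\<^sub>R b + w)) - wave_ratio n a \<xi> \<theta> x)
      \<le> cmod ((e0 / h0) * T1) + cmod (LINT w|gauss \<delta>. e0 * ((E b w - H w) * (H w - 1)) *\<^sub>R (X w / (h0 * H w)))"
      unfolding S1 wr0 S2 by (rule norm_triangle_ineq4)
    also have "\<dots> \<le> K * ((norm \<xi>)\<^sup>2 * R\<^sup>2 * (\<delta> * sqrt \<delta>)) + K * K1 * ((\<delta> * sqrt \<delta>) * ((R\<^sup>2 + 2) * C0))"
    proof (rule add_mono)
      have "cmod (e0 / h0) \<le> K"
      proof -
        have "cmod (e0 / h0) = cmod e0 / h0" using h0 by (simp add: norm_divide)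
        also have "\<dots> \<le> cmod e0 / 1" using h0 by (intro divide_left_mono) auto
        finally show ?thesis using e0 by simp
      qed
      then show "cmod ((e0 / h0) * T1) \<le> K * ((norm \<xi>)\<^sup>2 * R\<^sup>2 * (\<delta> * sqrt \<delta>))"
        unfolding norm_mult using T1_le by (intro mult_mono) (auto simp: K_def)
      show "cmod (LINT w|gauss \<delta>. e0 * ((E b w - H w) * (H w - 1)) *\<^sub>R (X w / (h0 * H w))) \<le> K * K1 * ((\<delta> * sqrt \<delta>) * ((R\<^sup>2 + 2) * C0))"
        using T2 by (simp add: intGv)
    qed
    also have "\<dots> = C * (\<delta> * sqrt \<delta>)" by (simp add: C_def algebra_simps)
    finally show ?thesis unfolding b_def .
  qed
  ultimately show ?thesis by blast
qed

section \<open>Increments of the driving Brownian motion\<close>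

lemma indep_rv_measurable:
  assumes "indep_rv M N V N' V'"
  shows "V \<in> measurable M N" "V' \<in> measurable M N'"
  using assms unfolding indep_rv_def by blast+

lemma indep_rv_emeasure:
  assumes M: "prob_space M" and i: "indep_rv M N V N' V'" and A: "A \<in> sets N" and A': "A' \<in> sets N'"
  shows "emeasure M ((V -` A \<inter> space M) \<inter> (V' -` A' \<inter> space M)) = emeasure M (V -` A \<inter> space M) * emeasure M (V' -` A' \<inter> space M)"
proof -
  interpret prob_space M by fact
  have "indep_set (sets (vimage_algebra (space M) V N)) (sets (vimage_algebra (space M) V' N'))"
    using i unfolding indep_rv_def by blast
  from indep_setD[OF this in_vimage_algebra[OF A] in_vimage_algebra[OF A']]
  show ?thesis by (simp add: emeasure_eq_measure ennreal_mult)
qed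

text \<open>Converts independence, given for generated sigma-algebras, into a product law and so
  into Fubini's theorem.\<close>

lemma indep_rv_distr:
  assumes M: "prob_space M" and i: "indep_rv M N V N' V'"
  shows "distr M (N \<Otimes>\<^sub>M N') (\<lambda>\<omega>. (V \<omega>, V' \<omega>)) = distr M N V \<Otimes>\<^sub>M distr M N' V'"
proof -
  interpret prob_space M by fact
  note [measurable] = indep_rv_measurable[OF i]
  interpret V: prob_space "distr M N V" by (rule prob_space_distr) measurable
  interpret V': prob_space "distr M N' V'" by (rule prob_space_distr) measurable
  show ?thesis
  proof (rule pair_measure_eqI[symmetric])
    fix A A' assume A: "A \<in> sets (distr M N V)" "A' \<in> sets (distr M N' V')"
    then have [measurable]: "A \<in> sets N" "A' \<in> sets N'" by auto
    have "emeasure M ((V -` A \<inter> space M) \<inter> (V' -` A' \<inter> space M)) = emeasure M (V -` A \<inter> space M) * emeasure M (V' -` A' \<inter> space M)"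
      using A by (intro indep_rv_emeasure[OF M i]) auto
    moreover have "(\<lambda>\<omega>. (V \<omega>, V' \<omega>)) -` (A \<times> A') \<inter> space M = (V -` A \<inter> space M) \<inter> (V' -` A' \<inter> space M)" by auto
    ultimately show "emeasure (distr M N V) A * emeasure (distr M N' V') A' = emeasure (distr M (N \<Otimes>\<^sub>M N') (\<lambda>\<omega>. (V \<omega>, V' \<omega>))) (A \<times> A')"
      by (simp add: emeasure_distr)
  qed (simp_all add: V.sigma_finite_measure_axioms V'.sigma_finite_measure_axioms cong: sets_pair_measure_cong)
qed

section \<open>The history of the input and the Brownian increments\<close>

locale diffusion = prob_space M
  for M :: "'w measure" +
  fixes n :: nat and p :: "real ^ 'd::finite \<Rightarrow> real" and Q :: "real measure" and T :: real
    and X :: "nat \<Rightarrow> 'w \<Rightarrow> real ^ 'd" and U :: "'w \<Rightarrow> real" and Y0 :: "'w \<Rightarrow> real ^ 'd"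
    and B :: "real \<Rightarrow> 'w \<Rightarrow> real ^ 'd"
  assumes input: "diffusion_input M n p Q T X U Y0 B"
begin

abbreviation "H \<equiv> input_history M n X U Y0 B"

abbreviation "SU \<equiv> (\<Pi>\<^sub>M i\<in>{..<n}. (borel :: (real ^ 'd) measure)) \<Otimes>\<^sub>M (borel :: real measure)"

abbreviation "Z \<omega> \<equiv> (samples n X \<omega>, U \<omega>)"

lemma brownian: "brownian_motion M B"
  using input by (simp add: diffusion_input_def)

lemma measurable_B: "0 \<le> t \<Longrightarrow> B t \<in> borel_measurable M"
  using brownian by (simp add: brownian_motion_def)

lemma measurable_U[measurable]: "U \<in> borel_measurable M"
  using input by (simp add: diffusion_input_def)

lemma measurable_Y0[measurable]: "Y0 \<in> borel_measurable M"
  using input by (auto simp: diffusion_input_def distributed_def)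

lemma measurable_X: "i < n \<Longrightarrow> X i \<in> borel_measurable M"
  using input by (auto simp: diffusion_input_def distributed_def)

lemma measurable_samples[measurable]: "samples n X \<in> measurable M (\<Pi>\<^sub>M i\<in>{..<n}. borel)"
  unfolding samples_def[abs_def] by (intro measurable_restrict) (auto intro: measurable_X)

lemma AE_B0: "AE \<omega> in M. B 0 \<omega> = 0"
  and AE_continuous_B: "AE \<omega> in M. continuous_on {0..} (\<lambda>t. B t \<omega>)"
  using brownian by (simp_all add: brownian_motion_def)

lemma distr_increment:
  assumes "0 \<le> s" "s < t"
  shows "distr M borel (\<lambda>\<omega>. B t \<omega> - B s \<omega>) = gauss (t - s)"
proof -
  have "distributed M lborel (\<lambda>\<omega>. B t \<omega> - B s \<omega>) (\<lambda>x. ennreal (gaussian_density (t - s) x))"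
    using brownian assms unfolding brownian_motion_def by blast
  then have "distr M lborel (\<lambda>\<omega>. B t \<omega> - B s \<omega>) = gauss (t - s)"
    by (simp add: distributed_def gauss_def)
  moreover have "distr M borel (\<lambda>\<omega>. B t \<omega> - B s \<omega>) = distr M lborel (\<lambda>\<omega>. B t \<omega> - B s \<omega>)"
    by (rule distr_cong) auto
  ultimately show ?thesis by simp
qed

lemma measurable_path: "(\<lambda>\<omega>. \<lambda>u\<in>{0..}. B u \<omega>) \<in> measurable M (\<Pi>\<^sub>M u\<in>{0..}. borel)"
  by (intro measurable_restrict) (auto intro: measurable_B)

lemma measurable_history_map:
  "(\<lambda>\<omega>. (samples n X \<omega>, U \<omega>, Y0 \<omega>, \<lambda>u\<in>{0..t}. B u \<omega>)) \<in>
    measurable M ((\<Pi>\<^sub>M i\<in>{..<n}. borel) \<Otimes>\<^sub>M borel \<Otimes>\<^sub>M borel \<Otimes>\<^sub>M (\<Pi>\<^sub>M u\<in>{0..t}. borel))"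
  by (intro measurable_Pair measurable_restrict) (auto intro: measurable_B)

lemma space_H[simp]: "space (H t) = space M"
  by (simp add: input_history_def)

lemma measurable_history_map':
  "(\<lambda>\<omega>. (samples n X \<omega>, U \<omega>, Y0 \<omega>, \<lambda>u\<in>{0..t}. B u \<omega>)) \<in>
    measurable (H t) ((\<Pi>\<^sub>M i\<in>{..<n}. borel) \<Otimes>\<^sub>M borel \<Otimes>\<^sub>M borel \<Otimes>\<^sub>M (\<Pi>\<^sub>M u\<in>{0..t}. borel))"
  unfolding input_history_def
  by (rule measurable_vimage_algebra1) (use measurable_space[OF measurable_history_map] in auto)

lemma history_id: "(\<lambda>\<omega>. \<omega>) \<in> measurable M (H t)"
  unfolding input_history_def
  by (rule measurable_vimage_algebra2) (use measurable_history_map in auto)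

lemma measurable_from_H: "f \<in> measurable (H t) N \<Longrightarrow> f \<in> measurable M N"
  using measurable_compose[OF history_id] by auto

lemma measurable_H_samples: "samples n X \<in> measurable (H t) (\<Pi>\<^sub>M i\<in>{..<n}. borel)"
  and measurable_H_U: "U \<in> measurable (H t) borel"
  and measurable_H_Y0: "Y0 \<in> measurable (H t) borel"
  using measurable_compose[OF measurable_history_map'[of t] measurable_fst]
    measurable_compose[OF measurable_compose[OF measurable_history_map'[of t] measurable_snd] measurable_fst]
    measurable_compose[OF measurable_compose[OF measurable_compose[OF measurable_history_map'[of t] measurable_snd] measurable_snd] measurable_fst]
  by auto

lemma measurable_H_B:
  assumes u: "u \<in> {0..t}"
  shows "B u \<in> measurable (H t) borel"
  using measurable_compose[OF measurable_compose[OF measurable_compose[OF measurable_compose[OF measurable_history_map'[of t] measurable_snd] measurable_snd] measurable_snd]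
      measurable_component_singleton[OF u]] u
  by auto

lemma history_indep:
  assumes st: "0 \<le> s" "s < t" and A: "A \<in> sets (H s)" and C[measurable]: "C \<in> sets borel"
  shows "emeasure M (A \<inter> {\<omega> \<in> space M. B t \<omega> - B s \<omega> \<in> C}) = emeasure M A * emeasure M {\<omega> \<in> space M. B t \<omega> - B s \<omega> \<in> C}"
proof -
  let ?P = "\<Pi>\<^sub>M i\<in>{..<n}. (borel :: (real ^ 'd) measure)"
  let ?PB = "\<Pi>\<^sub>M u\<in>{0::real..}. (borel :: (real ^ 'd) measure)"
  let ?Ps = "\<Pi>\<^sub>M u\<in>{0::real..s}. (borel :: (real ^ 'd) measure)"
  let ?N3 = "?P \<Otimes>\<^sub>M borel \<Otimes>\<^sub>M (borel :: (real ^ 'd) measure)"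
  let ?W = "\<lambda>\<omega>. (samples n X \<omega>, U \<omega>, Y0 \<omega>)"
  let ?\<beta> = "\<lambda>\<omega>. \<lambda>u\<in>{0..}. B u \<omega>"
  have [measurable]: "B t \<in> borel_measurable M" "B s \<in> borel_measurable M" using st by (auto intro: measurable_B)
  have [measurable]: "?\<beta> \<in> measurable M ?PB" by (rule measurable_path)
  have W[measurable]: "?W \<in> measurable M ?N3" by measurable
  have i: "indep_rv M ?N3 ?W ?PB ?\<beta>" using input by (simp add: diffusion_input_def)
  have D: "distr M (?N3 \<Otimes>\<^sub>M ?PB) (\<lambda>\<omega>. (?W \<omega>, ?\<beta> \<omega>)) = distr M ?N3 ?W \<Otimes>\<^sub>M distr M ?PB ?\<beta>"
    by (rule indep_rv_distr[OF prob_space_axioms i])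
  interpret W: prob_space "distr M ?N3 ?W" by (rule prob_space_distr) measurable
  interpret \<beta>: prob_space "distr M ?PB ?\<beta>" by (rule prob_space_distr) measurable
  interpret pair_sigma_finite "distr M ?N3 ?W" "distr M ?PB ?\<beta>" ..
  from A obtain E where E[measurable]: "E \<in> sets (?P \<Otimes>\<^sub>M borel \<Otimes>\<^sub>M borel \<Otimes>\<^sub>M ?Ps)"
    and AE: "A = (\<lambda>\<omega>. (samples n X \<omega>, U \<omega>, Y0 \<omega>, \<lambda>u\<in>{0..s}. B u \<omega>)) -` E \<inter> space M"
    unfolding input_history_def
    using measurable_space[OF measurable_history_map[of s]] by (subst (asm) sets_vimage_algebra2) auto
  \<comment> \<open>Reassembles a history from frozen values of samples, \<open>U\<close>,
    \<open>Y0\<close> and a whole path, of which it retains the part up to \<open>s\<close>.\<close>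
  define \<phi> where "\<phi> z b = (case z of (x, u, y) \<Rightarrow> (x, u, y, restrict b {0..s}))" for z :: "(nat \<Rightarrow> real ^ 'd) \<times> real \<times> (real ^ 'd)" and b :: "real \<Rightarrow> real ^ 'd"
  have r[measurable]: "(\<lambda>b. restrict b {0..s}) \<in> measurable ?PB ?Ps"
    by (rule measurable_restrict_subset) auto
  have \<phi>[measurable]: "case_prod \<phi> \<in> measurable (?N3 \<Otimes>\<^sub>M ?PB) (?P \<Otimes>\<^sub>M borel \<Otimes>\<^sub>M borel \<Otimes>\<^sub>M ?Ps)"
    unfolding \<phi>_def[abs_def] split_beta' by measurable
  have [measurable]: "(\<lambda>b. b t - b s) \<in> measurable ?PB borel"
    using st by (intro borel_measurable_diff measurable_component_singleton) auto
  let ?f = "\<lambda>(z, b). indicator E (\<phi> z b) * (indicator C (b t - b s) :: ennreal)"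
  have f[measurable]: "?f \<in> borel_measurable (?N3 \<Otimes>\<^sub>M ?PB)"
    unfolding split_beta' by measurable
  have sW: "?W \<omega> \<in> space ?N3" if "\<omega> \<in> space M" for \<omega> using measurable_space[OF W that] .
  have \<phi>W: "\<phi> (?W \<omega>) (?\<beta> \<omega>) = (samples n X \<omega>, U \<omega>, Y0 \<omega>, \<lambda>u\<in>{0..s}. B u \<omega>)" for \<omega>
    by (auto simp: \<phi>_def restrict_def fun_eq_iff)
  \<comment> \<open>With \<open>z\<close> frozen, both factors are events of the path, one of them
    of the path up to \<open>s\<close>.\<close>
  have inner: "(\<integral>\<^sup>+\<omega>. ?f (z, ?\<beta> \<omega>) \<partial>M) = (\<integral>\<^sup>+\<omega>. indicator E (\<phi> z (?\<beta> \<omega>)) \<partial>M) * emeasure M {\<omega> \<in> space M. B t \<omega> - B s \<omega> \<in> C}"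
    if z: "z \<in> space ?N3" for z
  proof -
    let ?E = "{b \<in> space ?Ps. (fst z, fst (snd z), snd (snd z), b) \<in> E}"
    have z': "fst z \<in> space ?P" using z by (auto simp: space_pair_measure)
    have [measurable]: "(\<lambda>b. (fst z, fst (snd z), snd (snd z), b)) \<in> measurable ?Ps (?P \<Otimes>\<^sub>M borel \<Otimes>\<^sub>M borel \<Otimes>\<^sub>M ?Ps)"
      using z' by measurable
    have Em[measurable]: "?E \<in> sets ?Ps" by measurable
    have ind: "indep_rv M ?Ps (\<lambda>\<omega>. \<lambda>u\<in>{0..s}. B u \<omega>) borel (\<lambda>\<omega>. B t \<omega> - B s \<omega>)"
      using brownian st unfolding brownian_motion_def by blast
    have mr[measurable]: "(\<lambda>\<omega>. \<lambda>u\<in>{0..s}. B u \<omega>) \<in> measurable M ?Ps"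
      by (rule indep_rv_measurable[OF ind])
    let ?E1 = "(\<lambda>\<omega>. \<lambda>u\<in>{0..s}. B u \<omega>) -` ?E \<inter> space M" and ?E2 = "(\<lambda>\<omega>. B t \<omega> - B s \<omega>) -` C \<inter> space M"
    have pe: "emeasure M (?E1 \<inter> ?E2) = emeasure M ?E1 * emeasure M ?E2"
      by (rule indep_rv_emeasure[OF prob_space_axioms ind Em C])
    have res: "restrict (?\<beta> \<omega>) {0..s} = (\<lambda>u\<in>{0..s}. B u \<omega>)" for \<omega> by (auto simp: restrict_def fun_eq_iff)
    have iE: "indicator E (\<phi> z (?\<beta> \<omega>)) = (indicator ?E1 \<omega> :: ennreal)" if w: "\<omega> \<in> space M" for \<omega>
      using w measurable_space[OF mr w] by (auto simp: \<phi>_def split_beta' res split: split_indicator)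
    have iC: "indicator C (?\<beta> \<omega> t - ?\<beta> \<omega> s) = (indicator ?E2 \<omega> :: ennreal)" if w: "\<omega> \<in> space M" for \<omega>
      using w st by (auto split: split_indicator)
    have m12: "?E1 \<in> sets M" "?E2 \<in> sets M"
      by (rule measurable_sets[OF mr Em], rule measurable_sets[OF indep_rv_measurable(2)[OF ind] C])
    have "(\<integral>\<^sup>+\<omega>. ?f (z, ?\<beta> \<omega>) \<partial>M) = (\<integral>\<^sup>+\<omega>. indicator (?E1 \<inter> ?E2) \<omega> \<partial>M)"
    proof (rule nn_integral_cong)
      fix \<omega> assume w: "\<omega> \<in> space M"
      show "?f (z, ?\<beta> \<omega>) = indicator (?E1 \<inter> ?E2) \<omega>"
        unfolding split iE[OF w] iC[OF w] by (rule indicator_inter_arith[symmetric])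
    qed
    also have "\<dots> = emeasure M (?E1 \<inter> ?E2)" by (rule nn_integral_indicator[OF sets.Int[OF m12]])
    also have "\<dots> = (\<integral>\<^sup>+\<omega>. indicator ?E1 \<omega> \<partial>M) * emeasure M ?E2" unfolding pe nn_integral_indicator[OF m12(1)] ..
    also have "(\<integral>\<^sup>+\<omega>. indicator ?E1 \<omega> \<partial>M) = (\<integral>\<^sup>+\<omega>. indicator E (\<phi> z (?\<beta> \<omega>)) \<partial>M)"
      by (intro nn_integral_cong) (rule iE[symmetric])
    also have "?E2 = {\<omega> \<in> space M. B t \<omega> - B s \<omega> \<in> C}" by auto
    finally show ?thesis .
  qed
  \<comment> \<open>Fubini's theorem: the path may be drawn independently of the samples,
    \<open>U\<close> and \<open>Y0\<close>, hence the separate variable for each.\<close>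
  have main: "(\<integral>\<^sup>+\<omega>. g (?W \<omega>, ?\<beta> \<omega>) \<partial>M) = (\<integral>\<^sup>+\<omega>'. (\<integral>\<^sup>+\<omega>. g (?W \<omega>', ?\<beta> \<omega>) \<partial>M) \<partial>M)"
    if g[measurable]: "g \<in> borel_measurable (?N3 \<Otimes>\<^sub>M ?PB)" for g :: "_ \<Rightarrow> ennreal"
  proof -
    have "(\<integral>\<^sup>+\<omega>. g (?W \<omega>, ?\<beta> \<omega>) \<partial>M) = (\<integral>\<^sup>+x. g x \<partial>distr M (?N3 \<Otimes>\<^sub>M ?PB) (\<lambda>\<omega>. (?W \<omega>, ?\<beta> \<omega>)))"
      by (subst nn_integral_distr) measurable
    also have "\<dots> = (\<integral>\<^sup>+z. (\<integral>\<^sup>+b. g (z, b) \<partial>distr M ?PB ?\<beta>) \<partial>distr M ?N3 ?W)"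
      unfolding D by (subst \<beta>.nn_integral_fst) simp_all
    also have "\<dots> = (\<integral>\<^sup>+\<omega>'. (\<integral>\<^sup>+b. g (?W \<omega>', b) \<partial>distr M ?PB ?\<beta>) \<partial>M)"
    proof (rule nn_integral_distr[OF W])
      have "g \<in> borel_measurable (?N3 \<Otimes>\<^sub>M distr M ?PB ?\<beta>)"
        using g by (simp cong: measurable_cong_sets sets_pair_measure_cong)
      from \<beta>.borel_measurable_nn_integral_fst[OF this]
      show "(\<lambda>z. \<integral>\<^sup>+b. g (z, b) \<partial>distr M ?PB ?\<beta>) \<in> borel_measurable (distr M ?N3 ?W)" by simp
    qed
    also have "\<dots> = (\<integral>\<^sup>+\<omega>'. (\<integral>\<^sup>+\<omega>. g (?W \<omega>', ?\<beta> \<omega>) \<partial>M) \<partial>M)"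
      using sW by (intro nn_integral_cong, subst nn_integral_distr) measurable
    finally show ?thesis .
  qed
  have iA: "indicator A \<omega> = (indicator E (\<phi> (?W \<omega>) (?\<beta> \<omega>)) :: ennreal)" if "\<omega> \<in> space M" for \<omega>
    using that by (simp only: \<phi>W AE) (auto split: split_indicator)
  have Am[measurable]: "A \<in> sets M" using measurable_sets[OF history_id A] sets.sets_into_space[OF A] by (simp add: Int_absorb2)
  have "emeasure M (A \<inter> {\<omega> \<in> space M. B t \<omega> - B s \<omega> \<in> C}) = (\<integral>\<^sup>+\<omega>. indicator A \<omega> * indicator {\<omega> \<in> space M. B t \<omega> - B s \<omega> \<in> C} \<omega> \<partial>M)"
    unfolding indicator_inter_arith[symmetric] by (rule nn_integral_indicator[symmetric]) measurable
  also have "\<dots> = (\<integral>\<^sup>+\<omega>. ?f (?W \<omega>, ?\<beta> \<omega>) \<partial>M)"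
    using st by (intro nn_integral_cong) (auto simp: iA split: split_indicator)
  also have "\<dots> = (\<integral>\<^sup>+\<omega>'. (\<integral>\<^sup>+\<omega>. ?f (?W \<omega>', ?\<beta> \<omega>) \<partial>M) \<partial>M)" by (rule main) measurable
  also have "\<dots> = (\<integral>\<^sup>+\<omega>'. (\<integral>\<^sup>+\<omega>. indicator E (\<phi> (?W \<omega>') (?\<beta> \<omega>)) \<partial>M) * emeasure M {\<omega> \<in> space M. B t \<omega> - B s \<omega> \<in> C} \<partial>M)"
    by (intro nn_integral_cong inner sW)
  also have "\<dots> = (\<integral>\<^sup>+\<omega>'. (\<integral>\<^sup>+\<omega>. indicator E (\<phi> (?W \<omega>') (?\<beta> \<omega>)) \<partial>M) \<partial>M) * emeasure M {\<omega> \<in> space M. B t \<omega> - B s \<omega> \<in> C}"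
    by (rule nn_integral_multc) measurable
  also have "(\<integral>\<^sup>+\<omega>'. (\<integral>\<^sup>+\<omega>. indicator E (\<phi> (?W \<omega>') (?\<beta> \<omega>)) \<partial>M) \<partial>M) = (\<integral>\<^sup>+\<omega>. indicator E (\<phi> (?W \<omega>) (?\<beta> \<omega>)) \<partial>M)"
    using main[of "\<lambda>x. indicator E (case_prod \<phi> x)"] by simp
  also have "\<dots> = (\<integral>\<^sup>+\<omega>. indicator A \<omega> \<partial>M)" by (intro nn_integral_cong) (simp only: iA)
  also have "\<dots> = emeasure M A" by simp
  finally show ?thesis .
qed

text \<open>The form of independence that the Euler step uses: \<open>f\<close> may depend on the
  history and on the increment jointly, and the increment is integrated out as Gaussian noise with
  the history held fixed.\<close>

lemma
  assumes st: "0 \<le> s" "s < t" and f[measurable]: "f \<in> borel_measurable (H s \<Otimes>\<^sub>M borel)"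
  shows nn_integral_increment:
    "(\<integral>\<^sup>+\<omega>. f (\<omega>, B t \<omega> - B s \<omega>) \<partial>M) = (\<integral>\<^sup>+\<omega>. (\<integral>\<^sup>+w. f (\<omega>, w) \<partial>gauss (t - s)) \<partial>M)" (is ?A)
  and distr_history_increment: "distr M (H s \<Otimes>\<^sub>M borel) (\<lambda>\<omega>. (\<omega>, B t \<omega> - B s \<omega>)) = distr M (H s) (\<lambda>\<omega>. \<omega>) \<Otimes>\<^sub>M gauss (t - s)" (is ?B)
proof -
  have [measurable]: "B t \<in> borel_measurable M" "B s \<in> borel_measurable M" using st by (auto intro: measurable_B)
  have [measurable]: "(\<lambda>\<omega>. \<omega>) \<in> measurable M (H s)" by (rule history_id)
  interpret P: prob_space "distr M (H s) (\<lambda>\<omega>. \<omega>)" by (rule prob_space_distr) measurable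
  interpret G: prob_space "gauss (t - s) :: (real ^ 'd) measure" by (rule prob_space_gauss) (use st in simp)
  show ?B
  proof (rule pair_measure_eqI[symmetric])
    fix A C assume A: "A \<in> sets (distr M (H s) (\<lambda>\<omega>. \<omega>))" and C: "C \<in> sets (gauss (t - s) :: (real ^ 'd) measure)"
    then have C'[measurable]: "C \<in> sets borel" and A': "A \<in> sets (H s)" by auto
    have Asp: "(\<lambda>\<omega>. \<omega>) -` A \<inter> space M = A" using sets.sets_into_space[OF A'] by auto
    have "(\<lambda>\<omega>. (\<omega>, B t \<omega> - B s \<omega>)) -` (A \<times> C) \<inter> space M = A \<inter> {\<omega> \<in> space M. B t \<omega> - B s \<omega> \<in> C}"
      using sets.sets_into_space[OF A'] by auto
    moreover have "emeasure (gauss (t - s)) C = emeasure M {\<omega> \<in> space M. B t \<omega> - B s \<omega> \<in> C}"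
      unfolding distr_increment[OF st, symmetric] by (subst emeasure_distr) (auto intro!: arg_cong[where f="emeasure M"])
    ultimately show "emeasure (distr M (H s) (\<lambda>\<omega>. \<omega>)) A * emeasure (gauss (t - s)) C = emeasure (distr M (H s \<Otimes>\<^sub>M borel) (\<lambda>\<omega>. (\<omega>, B t \<omega> - B s \<omega>))) (A \<times> C)"
      using history_indep[OF st A' C'] A' sets.sets_into_space[OF A']
      by (simp add: emeasure_distr Int_absorb2)
  qed (simp_all add: P.sigma_finite_measure_axioms G.sigma_finite_measure_axioms cong: sets_pair_measure_cong)
  have "(\<integral>\<^sup>+\<omega>. f (\<omega>, B t \<omega> - B s \<omega>) \<partial>M) = (\<integral>\<^sup>+x. f x \<partial>distr M (H s \<Otimes>\<^sub>M borel) (\<lambda>\<omega>. (\<omega>, B t \<omega> - B s \<omega>)))"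
    by (subst nn_integral_distr) auto
  also have "\<dots> = (\<integral>\<^sup>+\<omega>. (\<integral>\<^sup>+w. f (\<omega>, w) \<partial>gauss (t - s)) \<partial>distr M (H s) (\<lambda>\<omega>. \<omega>))"
    unfolding \<open>?B\<close> by (subst G.nn_integral_fst) auto
  also have "\<dots> = (\<integral>\<^sup>+\<omega>. (\<integral>\<^sup>+w. f (\<omega>, w) \<partial>gauss (t - s)) \<partial>M)"
    by (subst nn_integral_distr) (auto intro!: G.borel_measurable_nn_integral_fst)
  finally show ?A .
qed

lemma integral_increment:
  fixes f :: "'w \<times> (real ^ 'd) \<Rightarrow> 'b::{banach,second_countable_topology}"
  assumes st: "0 \<le> s" "s < t" and f[measurable]: "f \<in> borel_measurable (H s \<Otimes>\<^sub>M borel)"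
    and bnd: "\<And>x. norm (f x) \<le> K"
  shows "(LINT \<omega>|M. f (\<omega>, B t \<omega> - B s \<omega>)) = (LINT \<omega>|M. (LINT w|gauss (t - s). f (\<omega>, w)))"
proof -
  have [measurable]: "B t \<in> borel_measurable M" "B s \<in> borel_measurable M" using st by (auto intro: measurable_B)
  have [measurable]: "(\<lambda>\<omega>. \<omega>) \<in> measurable M (H s)" by (rule history_id)
  interpret P: prob_space "distr M (H s) (\<lambda>\<omega>. \<omega>)" by (rule prob_space_distr) measurable
  interpret G: prob_space "gauss (t - s) :: (real ^ 'd) measure" by (rule prob_space_gauss) (use st in simp)
  interpret PG: pair_prob_space "distr M (H s) (\<lambda>\<omega>. \<omega>)" "gauss (t - s) :: (real ^ 'd) measure" ..
  have "(LINT \<omega>|M. f (\<omega>, B t \<omega> - B s \<omega>)) = (LINT x|distr M (H s \<Otimes>\<^sub>M borel) (\<lambda>\<omega>. (\<omega>, B t \<omega> - B s \<omega>)). f x)"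
    by (subst integral_distr) auto
  also have "\<dots> = (LINT x|(distr M (H s) (\<lambda>\<omega>. \<omega>) \<Otimes>\<^sub>M gauss (t - s)). f x)"
    by (subst distr_history_increment[OF st, of "\<lambda>_. 0"]) auto
  also have "\<dots> = (LINT \<omega>|distr M (H s) (\<lambda>\<omega>. \<omega>). (LINT w|gauss (t - s). f (\<omega>, w)))"
    by (subst PG.integral_fst') (auto intro!: PG.integrable_const_bound[where B=K] bnd)
  also have "\<dots> = (LINT \<omega>|M. (LINT w|gauss (t - s). f (\<omega>, w)))"
    by (subst integral_distr) (auto intro!: G.borel_measurable_lebesgue_integral)
  finally show ?thesis .
qed

end

text \<open>
  A version that is jointly measurable in \<open>\<omega>\<close> and \<open>u\<close>, as needed for Fubini: Brownian motion is only
  assumed to be continuous almost everywhere.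
\<close>

definition path_version :: "(real \<Rightarrow> 'w \<Rightarrow> 'a::metric_space) \<Rightarrow> 'w \<Rightarrow> real \<Rightarrow> 'a" where
  "path_version B \<omega> u = lim (\<lambda>k. B (real (nat \<lfloor>real (Suc k) * u\<rfloor>) / real (Suc k)) \<omega>)"

lemma grid_LIMSEQ:
  assumes "0 \<le> u"
  shows "(\<lambda>k. real (nat \<lfloor>real (Suc k) * u\<rfloor>) / real (Suc k)) \<longlonglongrightarrow> u"
proof (rule tendsto_sandwich[of "\<lambda>k. u - 1 / real (Suc k)" _ _ "\<lambda>k. u"])
  have a: "real (nat \<lfloor>real (Suc k) * u\<rfloor>) \<le> real (Suc k) * u" for k
    using assms by simp
  have b: "real (Suc k) * u - 1 \<le> real (nat \<lfloor>real (Suc k) * u\<rfloor>)" for k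
    using assms by linarith
  show "\<forall>\<^sub>F k in sequentially. u - 1 / real (Suc k) \<le> real (nat \<lfloor>real (Suc k) * u\<rfloor>) / real (Suc k)"
  proof (intro always_eventually allI)
    fix k
    have "u - 1 / real (Suc k) = (real (Suc k) * u - 1) / real (Suc k)" by (simp add: diff_divide_distrib del: of_nat_Suc)
    then show "u - 1 / real (Suc k) \<le> real (nat \<lfloor>real (Suc k) * u\<rfloor>) / real (Suc k)"
      by (simp only:) (intro divide_right_mono b, simp)
  qed
  show "\<forall>\<^sub>F k in sequentially. real (nat \<lfloor>real (Suc k) * u\<rfloor>) / real (Suc k) \<le> u"
    using a by (intro always_eventually allI) (simp add: field_simps del: of_nat_Suc)
  show "(\<lambda>k. u - 1 / real (Suc k)) \<longlonglongrightarrow> u" by real_asymp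
qed simp

lemma path_version_eq:
  assumes "continuous_on {0..} (\<lambda>t. B t \<omega>)" "0 \<le> u"
  shows "path_version B \<omega> u = B u \<omega>"
  unfolding path_version_def
  by (intro limI continuous_on_tendsto_compose[OF assms(1) grid_LIMSEQ[OF assms(2)]]) (use assms(2) in auto)

text \<open>The grid points are rounded down, hence lie between 0 and \<open>g z\<close>, and only
  values of \<open>B\<close> up to time \<open>t\<close> are read. Applied over \<open>H t\<close>,
  the version is therefore adapted as well as jointly measurable.\<close>

lemma measurable_path_version:
  fixes B :: "real \<Rightarrow> 'w \<Rightarrow> 'a::{banach,second_countable_topology}"
  assumes B: "\<And>v. v \<in> {0..t} \<Longrightarrow> (\<lambda>z. B v (W z)) \<in> borel_measurable N"
    and g[measurable]: "g \<in> borel_measurable N" and gt: "\<And>z. z \<in> space N \<Longrightarrow> g z \<in> {0..t}"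
  shows "(\<lambda>z. path_version B (W z) (g z)) \<in> borel_measurable N"
  unfolding path_version_def
proof (rule borel_measurable_lim_metric)
  fix k
  let ?I = "{j. real j / real (Suc k) \<le> t}"
  show "(\<lambda>z. B (real (nat \<lfloor>real (Suc k) * g z\<rfloor>) / real (Suc k)) (W z)) \<in> borel_measurable N"
  proof (rule measurable_compose_countable'[where f="\<lambda>j z. B (real j / real (Suc k)) (W z)" and I="?I" and g="\<lambda>z. nat \<lfloor>real (Suc k) * g z\<rfloor>"])
    fix j assume "j \<in> ?I"
    then show "(\<lambda>z. B (real j / real (Suc k)) (W z)) \<in> borel_measurable N" by (intro B) auto
  next
    show "(\<lambda>z. nat \<lfloor>real (Suc k) * g z\<rfloor>) \<in> measurable N (count_space ?I)"
    proof (rule measurable_count_space_extend)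
      show "(\<lambda>z. nat \<lfloor>real (Suc k) * g z\<rfloor>) \<in> space N \<rightarrow> ?I"
      proof
        fix z assume z: "z \<in> space N"
        have "real (nat \<lfloor>real (Suc k) * g z\<rfloor>) \<le> real (Suc k) * g z" using gt[OF z] by simp
        also have "\<dots> \<le> real (Suc k) * t" using gt[OF z] by (intro mult_left_mono) auto
        finally show "nat \<lfloor>real (Suc k) * g z\<rfloor> \<in> ?I" by (simp add: field_simps del: of_nat_Suc)
      qed
      show "(\<lambda>z. nat \<lfloor>real (Suc k) * g z\<rfloor>) \<in> measurable N (count_space UNIV)" by measurable
    qed auto
  qed auto
qed

section \<open>Gaussian smoothing and characteristic functions\<close>

definition gauss_abs :: "'d::finite itself \<Rightarrow> real" where
  "gauss_abs _ = (LINT z|(gauss 1 :: (real ^ 'd) measure). norm z)"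

lemma integrable_gauss_norm: "integrable (gauss 1 :: (real ^ 'd) measure) norm"
  by (rule Bochner_Integration.integrable_bound[OF integrable_gauss_exp_norm[of 1]])
    (auto intro!: AE_I2 intro: order_trans[OF _ exp_ge_add_one_self])

lemma gauss_abs_nonneg: "0 \<le> gauss_abs TYPE('d::finite)"
  unfolding gauss_abs_def by (rule integral_nonneg_AE) auto

lemma nn_integral_gauss_norm:
  assumes "0 < v"
  shows "(\<integral>\<^sup>+z. ennreal (norm z) \<partial>(gauss v :: (real ^ 'd) measure)) = ennreal (sqrt v * gauss_abs TYPE('d))"
proof -
  have "(\<integral>\<^sup>+z. ennreal (norm z) \<partial>(gauss v :: (real ^ 'd) measure)) = (\<integral>\<^sup>+z. ennreal (sqrt v) * ennreal (norm z) \<partial>(gauss 1 :: (real ^ 'd) measure))"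
    unfolding distr_gauss_scale[OF assms, symmetric]
    by (subst nn_integral_distr) (use assms in \<open>auto simp: ennreal_mult\<close>)
  also have "\<dots> = ennreal (sqrt v) * ennreal (gauss_abs TYPE('d))"
    unfolding gauss_abs_def
    by (subst nn_integral_cmult) (auto simp: nn_integral_eq_integral[OF integrable_gauss_norm])
  finally show ?thesis using assms by (simp add: ennreal_mult gauss_abs_nonneg)
qed

lemma gauss_smoothing_tendsto:
  fixes f :: "real ^ 'd \<Rightarrow> real"
  assumes f: "continuous_on UNIV f" "\<And>x. \<bar>f x\<bar> \<le> K"
    and v: "\<And>k. 0 < v k" "v \<longlonglongrightarrow> 0"
  shows "(\<lambda>k. LINT w|gauss (v k). f (x + w)) \<longlonglongrightarrow> f x"
proof -
  interpret prob_space "gauss 1 :: (real ^ 'd) measure" by (rule prob_space_gauss) simp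
  have [measurable]: "f \<in> borel_measurable borel" using f(1) by (rule borel_measurable_continuous_onI)
  have "(\<lambda>k. LINT z|gauss 1. f (x + sqrt (v k) *\<^sub>R z)) \<longlonglongrightarrow> (LINT z|(gauss 1 :: (real ^ 'd) measure). f x)"
  proof (rule integral_dominated_convergence[where w="\<lambda>_. K"])
    have "(\<lambda>k. sqrt (v k)) \<longlonglongrightarrow> 0" using tendsto_real_sqrt[OF v(2)] by simp
    then have "(\<lambda>k. x + sqrt (v k) *\<^sub>R z) \<longlonglongrightarrow> x + 0 *\<^sub>R z" for z by (intro tendsto_intros)
    then show "AE z in gauss 1. (\<lambda>k. f (x + sqrt (v k) *\<^sub>R z)) \<longlonglongrightarrow> f x"
      by (intro AE_I2 continuous_on_tendsto_compose[OF f(1)]) auto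
  qed (use f(2) in auto)
  moreover have "(LINT z|gauss 1. f (x + sqrt (v k) *\<^sub>R z)) = (LINT w|gauss (v k). f (x + w))" for k
    unfolding distr_gauss_scale[OF v(1), symmetric] by (subst integral_distr) auto
  moreover have "prob UNIV = 1"
    using prob_space by simp
  ultimately show ?thesis by simp
qed

text \<open>Fubini's theorem moves the smoothing from the test function to the measure, where it
  produces a Lebesgue density.\<close>

lemma nn_integral_gauss_smoothing:
  fixes f :: "real ^ 'd \<Rightarrow> ennreal"
  assumes "sigma_finite_measure \<mu>" and s[measurable_cong]: "sets \<mu> = sets borel" and f[measurable]: "f \<in> borel_measurable borel"
  shows "(\<integral>\<^sup>+x. (\<integral>\<^sup>+w. f (x + w) \<partial>gauss v) \<partial>\<mu>) = (\<integral>\<^sup>+y. f y * (\<integral>\<^sup>+x. ennreal (gaussian_density v (y - x)) \<partial>\<mu>) \<partial>lborel)"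
proof -
  interpret \<mu>: sigma_finite_measure \<mu> by fact
  interpret pair_sigma_finite \<mu> "lborel :: (real ^ 'd) measure" ..
  have "(\<integral>\<^sup>+w. f (x + w) \<partial>gauss v) = (\<integral>\<^sup>+y. f y * ennreal (gaussian_density v (y - x)) \<partial>lborel)" for x
  proof -
    have "(\<integral>\<^sup>+w. f (x + w) \<partial>gauss v) = (\<integral>\<^sup>+w. f (x + w) * ennreal (gaussian_density v ((x + w) - x)) \<partial>lborel)"
      by (subst nn_integral_gauss) (auto simp: mult.commute)
    also have "\<dots> = (\<integral>\<^sup>+y. f y * ennreal (gaussian_density v (y - x)) \<partial>lborel)"
      by (rule nn_integral_lborel_shift[of "\<lambda>y. f y * ennreal (gaussian_density v (y - x))"]) measurable
    finally show ?thesis .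
  qed
  then have "(\<integral>\<^sup>+x. (\<integral>\<^sup>+w. f (x + w) \<partial>gauss v) \<partial>\<mu>) = (\<integral>\<^sup>+x. (\<integral>\<^sup>+y. f y * ennreal (gaussian_density v (y - x)) \<partial>lborel) \<partial>\<mu>)"
    by simp
  also have "\<dots> = (\<integral>\<^sup>+y. (\<integral>\<^sup>+x. f y * ennreal (gaussian_density v (y - x)) \<partial>\<mu>) \<partial>lborel)"
    by (rule Fubini'[symmetric]) measurable
  also have "\<dots> = (\<integral>\<^sup>+y. f y * (\<integral>\<^sup>+x. ennreal (gaussian_density v (y - x)) \<partial>\<mu>) \<partial>lborel)"
    by (intro nn_integral_cong nn_integral_cmult) measurable
  finally show ?thesis .
qed

text \<open>Writes the Gaussian as a Fourier integral and exchanges the integrals, the factor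
  \<open>exp\<close> providing integrability. Thus a Gaussian convolution is determined by the
  characteristic function; both the uniqueness theorem and the Fourier formula for the bias rest on
  this.\<close>

lemma gaussian_transform_char:
  fixes y :: "real ^ 'd"
  assumes \<mu>: "finite_measure \<mu>" and s[measurable_cong]: "sets \<mu> = sets borel" and v: "0 < v"
  shows "complex_of_real (LINT x|\<mu>. gaussian_density v (y - x)) =
    (LINT \<xi>|lborel. complex_of_real (exp (- (norm \<xi>)\<^sup>2 * v / 2)) * (cis (y \<bullet> \<xi>) * (LINT x|\<mu>. cis ((- \<xi>) \<bullet> x)))) / (2 * pi) ^ CARD('d)"
proof -
  interpret \<mu>: finite_measure \<mu> by fact
  interpret pair_sigma_finite \<mu> "lborel :: (real ^ 'd) measure" ..
  have E: "integrable lborel (\<lambda>\<xi>::real ^ 'd. exp (- (norm \<xi>)\<^sup>2 * v / 2))" by (rule gaussian_density_fourier(1)[OF v])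
  let ?f = "\<lambda>x \<xi>. complex_of_real (exp (- (norm \<xi>)\<^sup>2 * v / 2)) * (cis (y \<bullet> \<xi>) * cis ((- \<xi>) \<bullet> x))"
  have [measurable]: "case_prod ?f \<in> borel_measurable (\<mu> \<Otimes>\<^sub>M lborel)" by measurable
  have int: "integrable (\<mu> \<Otimes>\<^sub>M lborel) (case_prod ?f)"
  proof (rule Fubini_integrable)
    have "(\<lambda>x. LINT \<xi>|lborel. norm (case_prod ?f (x, \<xi>))) = (\<lambda>x. LINT \<xi>|lborel. exp (- (norm (\<xi> :: real ^ 'd))\<^sup>2 * v / 2))"
      by (simp add: norm_mult)
    then show "integrable \<mu> (\<lambda>x. LINT \<xi>|lborel. norm (case_prod ?f (x, \<xi>)))" by simp
    have "integrable lborel (?f x)" for x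
      by (rule Bochner_Integration.integrable_bound[OF E]) (auto simp: norm_mult)
    then show "AE x in \<mu>. integrable lborel (\<lambda>\<xi>. case_prod ?f (x, \<xi>))" by auto
  qed measurable
  have g: "complex_of_real (gaussian_density v (y - x)) = (LINT \<xi>|lborel. ?f x \<xi>) / (2 * pi) ^ CARD('d)" for x
    by (subst gaussian_density_fourier(2)[OF v]) (simp add: cis_mult inner_diff_left inner_diff_right inner_commute)
  have "complex_of_real (LINT x|\<mu>. gaussian_density v (y - x)) = (LINT x|\<mu>. complex_of_real (gaussian_density v (y - x)))"
    by (rule integral_complex_of_real[symmetric])
  also have "\<dots> = (LINT x|\<mu>. (LINT \<xi>|lborel. ?f x \<xi>)) / (2 * pi) ^ CARD('d)"
    unfolding g by (rule integral_divide_zero)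
  also have "(LINT x|\<mu>. (LINT \<xi>|lborel. ?f x \<xi>)) = (LINT \<xi>|lborel. (LINT x|\<mu>. ?f x \<xi>))"
    by (rule Fubini_integral[OF int, symmetric])
  also have "\<dots> = (LINT \<xi>|lborel. complex_of_real (exp (- (norm \<xi>)\<^sup>2 * v / 2)) * (cis (y \<bullet> \<xi>) * (LINT x|\<mu>. cis ((- \<xi>) \<bullet> x))))"
    by (simp only: integral_mult_right_zero)
  finally show ?thesis .
qed

section \<open>Continuous approximation of closed sets and uniqueness of characteristic
  functions\<close>

definition bump :: "'a::metric_space set \<Rightarrow> nat \<Rightarrow> 'a \<Rightarrow> real" where
  "bump A k x = max 0 (1 - real k * infdist x A)"

lemma bump_bounds: "0 \<le> bump A k x" "bump A k x \<le> 1" "\<bar>bump A k x\<bar> \<le> 1"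
  by (auto simp: bump_def infdist_nonneg)

lemma continuous_on_bump: "continuous_on UNIV (bump A k)"
  unfolding bump_def[abs_def] by (intro continuous_intros)

lemma borel_measurable_bump[measurable]: "bump A k \<in> borel_measurable borel"
  by (intro borel_measurable_continuous_onI continuous_on_bump)

lemma bump_LIMSEQ:
  assumes "closed A" "A \<noteq> {}"
  shows "(\<lambda>k. bump A k x) \<longlonglongrightarrow> indicator A x"
proof (cases "x \<in> A")
  case True then show ?thesis by (simp add: bump_def)
next
  case False
  then have pos: "0 < infdist x A"
    using assms infdist_nonneg[of x A] in_closed_iff_infdist_zero[of A x] by fastforce
  obtain k0 where k0: "1 / infdist x A < real k0" using reals_Archimedean2 by blast
  have "bump A k x = 0" if "k \<ge> k0" for k
  proof -
    have "1 < real k0 * infdist x A" using k0 pos by (simp add: pos_divide_less_eq)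
    also have "\<dots> \<le> real k * infdist x A" using that pos by (intro mult_right_mono) auto
    finally show ?thesis by (simp add: bump_def)
  qed
  then have "\<forall>\<^sub>F k in sequentially. bump A k x = 0" by (auto simp: eventually_sequentially)
  then show ?thesis using False by (simp add: tendsto_eventually)
qed

lemma integral_bump_LIMSEQ:
  assumes "finite_measure \<mu>" and s[measurable_cong]: "sets \<mu> = sets borel" and A: "closed A" "A \<noteq> {}"
  shows "(\<lambda>k. LINT x|\<mu>. bump A k x) \<longlonglongrightarrow> measure \<mu> A"
proof -
  interpret finite_measure \<mu> by fact
  have [measurable]: "A \<in> sets borel" using A by auto
  have "(\<lambda>k. LINT x|\<mu>. bump A k x) \<longlonglongrightarrow> (LINT x|\<mu>. indicator A x)"
    by (rule integral_dominated_convergence[where w="\<lambda>_. 1"])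
       (auto simp: bump_bounds intro!: AE_I2 bump_LIMSEQ[OF A])
  moreover have "space \<mu> = UNIV" using sets_eq_imp_space_eq[OF s] by simp
  ultimately show ?thesis by simp
qed

text \<open>Equal characteristic functions give equal convolutions with every Gaussian. Letting the
  variance tend to 0 yields equal integrals of continuous functions with values in [0, 1], then
  equal measures of closed sets through \<open>bump\<close>, and closed sets are an
  intersection-stable generator.\<close>

lemma measure_eqI_char:
  fixes \<mu> \<nu> :: "(real ^ 'd) measure"
  assumes \<mu>: "finite_measure \<mu>" "sets \<mu> = sets borel" and \<nu>: "finite_measure \<nu>" "sets \<nu> = sets borel"
    and eq: "\<And>\<xi>. (LINT x|\<mu>. cis (\<xi> \<bullet> x)) = (LINT x|\<nu>. cis (\<xi> \<bullet> x))"
  shows "\<mu> = \<nu>"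
proof -
  interpret \<mu>: finite_measure \<mu> by fact
  interpret \<nu>: finite_measure \<nu> by fact
  have sp: "space \<mu> = UNIV" "space \<nu> = UNIV" using sets_eq_imp_space_eq[OF \<mu>(2)] sets_eq_imp_space_eq[OF \<nu>(2)] by auto
  have G: "(LINT x|\<mu>. gaussian_density v (y - x)) = (LINT x|\<nu>. gaussian_density v (y - x))" if "0 < v" for v y
    using gaussian_transform_char[OF \<mu> that, of y] gaussian_transform_char[OF \<nu> that, of y]
    unfolding eq by (metis of_real_eq_iff)
  have nnG: "(\<integral>\<^sup>+x. ennreal (gaussian_density v (y - x)) \<partial>\<mu>) = (\<integral>\<^sup>+x. ennreal (gaussian_density v (y - x)) \<partial>\<nu>)" if v: "0 < v" for v y
  proof -
    have "integrable m (\<lambda>x. gaussian_density v (y - x))" if m: "finite_measure m" "sets m = sets borel" for m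
    proof -
      interpret finite_measure m by fact
      note [measurable_cong] = m(2)
      show ?thesis
        by (rule integrable_const_bound[where B="(1 / sqrt (2 * pi * v)) ^ CARD('d)"])
           (use gaussian_density_le[OF v] in auto)
    qed
    from this[OF \<mu>] this[OF \<nu>] G[OF v, of y] show ?thesis by (simp add: nn_integral_eq_integral)
  qed
  have cont: "(LINT x|\<mu>. f x) = (LINT x|\<nu>. f x)"
    if f: "continuous_on UNIV f" "\<And>x. 0 \<le> f x" "\<And>x. f x \<le> 1" for f :: "real ^ 'd \<Rightarrow> real"
  proof -
    have [measurable]: "f \<in> borel_measurable borel" using f(1) by (rule borel_measurable_continuous_onI)
    define v where "v k = 1 / real (Suc k)" for k
    have v: "0 < v k" for k by (simp add: v_def)
    have v0: "v \<longlonglongrightarrow> 0" unfolding v_def by (rule LIMSEQ_Suc[OF lim_const_over_n])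
    define F where "F k x = (LINT w|gauss (v k). f (x + w))" for k x
    have [measurable]: "F k \<in> borel_measurable borel" for k
    proof -
      interpret prob_space "gauss (v k) :: (real ^ 'd) measure" by (rule prob_space_gauss[OF v])
      show ?thesis unfolding F_def[abs_def] by measurable
    qed
    have F01: "0 \<le> F k x" "F k x \<le> 1" and Fnn: "ennreal (F k x) = (\<integral>\<^sup>+w. ennreal (f (x + w)) \<partial>gauss (v k))" for k x
    proof -
      interpret prob_space "gauss (v k) :: (real ^ 'd) measure" by (rule prob_space_gauss[OF v])
      have i: "integrable (gauss (v k)) (\<lambda>w. f (x + w))"
        by (rule integrable_const_bound[where B=1]) (use f in auto)
      show "0 \<le> F k x" unfolding F_def by (rule integral_nonneg_AE) (use f in auto)
      show "F k x \<le> 1" unfolding F_def by (rule integral_le_const[OF i]) (use f in auto)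
      show "ennreal (F k x) = (\<integral>\<^sup>+w. ennreal (f (x + w)) \<partial>gauss (v k))"
        unfolding F_def by (rule nn_integral_eq_integral[symmetric, OF i]) (use f in auto)
    qed
    have lim: "(\<lambda>k. F k x) \<longlonglongrightarrow> f x" for x unfolding F_def
      by (rule gauss_smoothing_tendsto[where K=1]) (use f v v0 in \<open>auto simp: abs_le_iff intro: order_trans[of _ 0]\<close>)
    have limi: "(\<lambda>k. LINT x|m. F k x) \<longlonglongrightarrow> (LINT x|m. f x)" if m: "finite_measure m" "sets m = sets borel" for m
    proof -
      interpret finite_measure m by fact
      note [measurable_cong] = m(2)
      show ?thesis
        by (rule integral_dominated_convergence[where w="\<lambda>_. 1"]) (use lim F01 in auto)
    qed
    have Feq: "(LINT x|\<mu>. F k x) = (LINT x|\<nu>. F k x)" for k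
    proof -
      have nn: "ennreal (LINT x|m. F k x) = (\<integral>\<^sup>+y. ennreal (f y) * (\<integral>\<^sup>+x. ennreal (gaussian_density (v k) (y - x)) \<partial>m) \<partial>lborel)"
        if m: "finite_measure m" "sets m = sets borel" for m
      proof -
        interpret finite_measure m by fact
        note [measurable_cong] = m(2)
        have "ennreal (LINT x|m. F k x) = (\<integral>\<^sup>+x. ennreal (F k x) \<partial>m)"
          by (rule nn_integral_eq_integral[symmetric]) (use F01 in \<open>auto intro!: integrable_const_bound[where B=1]\<close>)
        also have "\<dots> = (\<integral>\<^sup>+y. ennreal (f y) * (\<integral>\<^sup>+x. ennreal (gaussian_density (v k) (y - x)) \<partial>m) \<partial>lborel)"
          unfolding Fnn by (rule nn_integral_gauss_smoothing) (auto simp: m sigma_finite_measure_axioms)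
        finally show ?thesis .
      qed
      have "ennreal (LINT x|\<mu>. F k x) = ennreal (LINT x|\<nu>. F k x)"
        unfolding nn[OF \<mu>] nn[OF \<nu>] nnG[OF v] ..
      moreover have "0 \<le> (LINT x|m. F k x)" for m by (rule integral_nonneg_AE) (use F01 in auto)
      ultimately show ?thesis by simp
    qed
    show ?thesis by (rule LIMSEQ_unique[OF limi[OF \<mu>, unfolded Feq] limi[OF \<nu>]])
  qed
  have meas: "measure \<mu> A = measure \<nu> A" if A: "closed A" for A
  proof (cases "A = {}")
    case False
    have beq: "(LINT x|\<mu>. bump A k x) = (LINT x|\<nu>. bump A k x)" for k
      by (rule cont) (auto simp: continuous_on_bump bump_bounds)
    show ?thesis
      by (rule LIMSEQ_unique[OF integral_bump_LIMSEQ[OF \<mu> A False, unfolded beq] integral_bump_LIMSEQ[OF \<nu> A False]])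
  qed simp
  show ?thesis
  proof (rule measure_eqI_generator_eq[where E="Collect closed" and \<Omega>=UNIV and A="\<lambda>_. UNIV"])
    show "Int_stable (Collect closed :: (real ^ 'd) set set)" by (auto simp: Int_stable_def)
    show "emeasure \<mu> A = emeasure \<nu> A" if "A \<in> Collect closed" for A
      using meas[of A] that by (simp add: \<mu>.emeasure_eq_measure \<nu>.emeasure_eq_measure)
    show "sets \<mu> = sigma_sets UNIV (Collect closed)" "sets \<nu> = sigma_sets UNIV (Collect closed)"
      using \<mu>(2) \<nu>(2) by (simp_all add: borel_eq_closed)
  qed auto
qed

section \<open>The tilted diffusion\<close>

lemma continuous_on_tilt_drift:
  assumes [continuous_intros]: "continuous_on S f" "continuous_on S y"
  shows "continuous_on S (\<lambda>u. tilt_drift n a (f u) (y u))"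
proof -
  have "(\<Sum>i\<le>n. exp (a i \<bullet> y u - (norm (a i))\<^sup>2 * f u / 2)) \<noteq> 0" for u
    using tilt_sum_pos[of n a "f u" "y u"] unfolding tilt_sum_def by linarith
  then show ?thesis
    unfolding tilt_drift_def tilt_weight_def tilt_sum_def by (intro continuous_intros) simp_all
qed

text \<open>Pathwise error of an Euler step: by the Lipschitz bound, the drift varies over the step
  no more than time and position do. The integral of the noise displacement stays in the bound,
  because it is small only in mean.\<close>

lemma tilt_path_step:
  fixes y c :: "real \<Rightarrow> real ^ 'd"
  assumes a: "\<And>i. i \<le> n \<Longrightarrow> norm (a i) \<le> R"
    and y: "continuous_on {t1..t2} y"
    and inc: "\<And>s t. t1 \<le> s \<Longrightarrow> s \<le> t \<Longrightarrow> t \<le> t2 \<Longrightarrow> y t - y s = (LINT u:{s..t}|lborel. tilt_drift n a (u - t1) (y u)) + (c t - c s)"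
    and st: "t1 \<le> s" "s \<le> t" "t \<le> t2"
    and c: "continuous_on {s..t} c"
  shows "ennreal (norm (y t - y s - (t - s) *\<^sub>R tilt_drift n a (s - t1) (y s) - (c t - c s)))
    \<le> ennreal (6 * R ^ 3 * (t - s)\<^sup>2) + ennreal (4 * R\<^sup>2) * (\<integral>\<^sup>+u. indicator {s..t} u * ennreal (norm (c u - c s)) \<partial>lborel)"
proof -
  define g where "g u = tilt_drift n a (u - t1) (y u)" for u
  have R: "0 \<le> R" using a[of 0] norm_ge_zero[of "a 0"] by linarith
  have gR: "norm (g u) \<le> R" for u unfolding g_def by (rule norm_tilt_drift_le) (rule a)
  have cg: "continuous_on {t1..t2} g"
    unfolding g_def by (intro continuous_on_tilt_drift continuous_intros y)
  have ig: "set_integrable lborel {s..u} g" if "u \<le> t" for u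
    by (rule borel_integrable_atLeastAtMost') (use that st in \<open>auto intro: continuous_on_subset[OF cg]\<close>)
  have yd: "norm (y u - y s) \<le> R * (u - s) + norm (c u - c s)" if u: "s \<le> u" "u \<le> t" for u
  proof -
    have "norm (LINT u:{s..u}|lborel. g u) \<le> (LINT u:{s..u}|lborel. R)"
      unfolding set_lebesgue_integral_def
      by (rule Bochner_Integration.integral_norm_bound_integral)
        (use ig[OF u(2)] gR R in \<open>auto simp: set_integrable_def emeasure_lborel_Icc_eq split: split_indicator intro!: integrable_scaleR_left integrable_real_indicator\<close>)
    also have "\<dots> = R * (u - s)" using u by (simp add: set_lebesgue_integral_def mult.commute)
    finally have "norm (LINT u:{s..u}|lborel. g u) \<le> R * (u - s)" .
    moreover have "y u - y s = (LINT u:{s..u}|lborel. g u) + (c u - c s)"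
      unfolding g_def by (rule inc) (use u st in auto)
    ultimately show ?thesis by (metis add_right_mono norm_triangle_le)
  qed
  \<comment> \<open>Of the coefficient \<open>6 * R ^ 3\<close>, the part 4 is due to the motion by
    the drift itself and the part 2 to the explicit dependence on time.\<close>
  have gd: "norm (g u - g s) \<le> 6 * R ^ 3 * (t - s) + 4 * R\<^sup>2 * norm (c u - c s)" if u: "s \<le> u" "u \<le> t" for u
  proof -
    have "norm (g u - g s) \<le> 4 * R\<^sup>2 * norm (y u - y s) + 2 * R ^ 3 * \<bar>(u - t1) - (s - t1)\<bar>"
      unfolding g_def by (rule tilt_drift_diff_le) (rule a)
    also have "\<dots> \<le> 4 * R\<^sup>2 * (R * (u - s) + norm (c u - c s)) + 2 * R ^ 3 * (u - s)"
      using yd[OF u] u R by (intro add_mono mult_left_mono) auto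
    also have "\<dots> = 6 * R ^ 3 * (u - s) + 4 * R\<^sup>2 * norm (c u - c s)"
      by (simp add: algebra_simps power2_eq_square power3_eq_cube)
    also have "\<dots> \<le> 6 * R ^ 3 * (t - s) + 4 * R\<^sup>2 * norm (c u - c s)"
      using u R by (intro add_mono mult_left_mono) auto
    finally show ?thesis .
  qed
  have "y t - y s - (t - s) *\<^sub>R g s - (c t - c s) = (LINT u:{s..t}|lborel. g u) - (LINT u:{s..t}|lborel. g s)"
    using inc[OF st] st by (simp add: g_def set_lebesgue_integral_def)
  also have "\<dots> = (LINT u:{s..t}|lborel. g u - g s)"
    using ig[of t] by (subst set_integral_diff) (auto simp: set_integrable_def intro!: integrable_scaleR_left integrable_real_indicator simp: emeasure_lborel_Icc_eq)
  also have "ennreal (norm \<dots>) \<le> (\<integral>\<^sup>+u. norm (indicator {s..t} u *\<^sub>R (g u - g s)) \<partial>lborel)"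
    unfolding set_lebesgue_integral_def
    by (rule integral_norm_bound_ennreal) (use set_integral_diff(1)[OF ig[of t], of "\<lambda>_. g s"] in
      \<open>auto simp: set_integrable_def emeasure_lborel_Icc_eq intro!: integrable_scaleR_left integrable_real_indicator\<close>)
  also have "\<dots> \<le> (\<integral>\<^sup>+u. ennreal (6 * R ^ 3 * (t - s)) * indicator {s..t} u + ennreal (4 * R\<^sup>2) * (indicator {s..t} u * ennreal (norm (c u - c s))) \<partial>lborel)"
  proof (intro nn_integral_mono)
    fix u
    show "ennreal (norm (indicator {s..t} u *\<^sub>R (g u - g s))) \<le> ennreal (6 * R ^ 3 * (t - s)) * indicator {s..t} u + ennreal (4 * R\<^sup>2) * (indicator {s..t} u * ennreal (norm (c u - c s)))"
      using gd[of u] st R by (auto simp: indicator_def ennreal_mult[symmetric] ennreal_plus[symmetric] simp del: ennreal_plus intro!: ennreal_leI)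
  qed
  also have "\<dots> = ennreal (6 * R ^ 3 * (t - s)) * (\<integral>\<^sup>+u. indicator {s..t} u \<partial>lborel) + ennreal (4 * R\<^sup>2) * (\<integral>\<^sup>+u. indicator {s..t} u * ennreal (norm (c u - c s)) \<partial>lborel)"
  proof -
    have "(\<lambda>u. indicator {s..t} u *\<^sub>R (c u - c s)) \<in> borel_measurable borel"
      by (rule borel_measurable_continuous_on_indicator) (auto intro!: continuous_intros c)
    then have "(\<lambda>u. ennreal (norm (indicator {s..t} u *\<^sub>R (c u - c s)))) \<in> borel_measurable borel" by measurable
    moreover have "(\<lambda>u. ennreal (norm (indicator {s..t} u *\<^sub>R (c u - c s)))) = (\<lambda>u. indicator {s..t} u * ennreal (norm (c u - c s)))"
      by (auto simp: fun_eq_iff indicator_def)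
    ultimately have [measurable]: "(\<lambda>u. indicator {s..t} u * ennreal (norm (c u - c s))) \<in> borel_measurable borel" by (simp only:)
    show ?thesis
      by (subst nn_integral_add) (auto simp: nn_integral_cmult)
  qed
  also have "ennreal (6 * R ^ 3 * (t - s)) * (\<integral>\<^sup>+u. indicator {s..t} u \<partial>lborel) = ennreal (6 * R ^ 3 * (t - s)\<^sup>2)"
    using st R by (simp add: ennreal_mult[symmetric] power2_eq_square)
  finally show ?thesis by (simp add: g_def)
qed

section \<open>Mean displacement of the noise over an interval\<close>

context diffusion
begin

text \<open>Fubini's theorem and the law of the increments. As the paths are continuous only almost
  everywhere, the pathwise integral is measurable only up to a null set; \<open>J\<close> is a
  measurable representative. The weight \<open>k\<close> is constant for the Euler error and an
  exponential kernel for the contraction.\<close>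

lemma nn_integral_path_diff:
  assumes k[measurable]: "k \<in> borel_measurable borel" and a: "0 \<le> a" and c: "0 \<le> c"
  shows "\<exists>J\<in>borel_measurable M.
     (AE \<omega> in M. (\<integral>\<^sup>+u. k u * (indicator {a..b} u * ennreal (norm (B u \<omega> - B c \<omega>))) \<partial>lborel) = J \<omega>) \<and>
     (\<integral>\<^sup>+\<omega>. J \<omega> \<partial>M) = (\<integral>\<^sup>+u. k u * (indicator {a..b} u * ennreal (sqrt \<bar>u - c\<bar> * gauss_abs TYPE('d))) \<partial>lborel)"
proof -
  interpret pair_sigma_finite M "lborel :: real measure" ..
  \<comment> \<open>Times outside the interval are sent to 0, so that \<open>path_version\<close> is
    evaluated on a bounded set of nonnegative times.\<close>
  define cl where "cl u = (if u \<in> {a..b} then u else 0)" for u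
  have cl: "cl u \<in> {0..max 0 b}" for u using a by (auto simp: cl_def)
  have [measurable]: "cl \<in> borel_measurable borel" unfolding cl_def by measurable
  have [measurable]: "(\<lambda>z. path_version B (fst z) (cl (snd z))) \<in> borel_measurable (M \<Otimes>\<^sub>M lborel)"
    by (rule measurable_path_version[where t="max 0 b"])
       (use cl in \<open>auto intro!: measurable_compose[OF measurable_fst measurable_B] simp del: max.bounded_iff\<close>)
  have [measurable]: "B c \<in> borel_measurable M" using c by (rule measurable_B)
  have AEc: "AE \<omega> in M. \<forall>u\<in>{a..b}. B u \<omega> = path_version B \<omega> (cl u)"
    using AE_continuous_B
  proof eventually_elim
    case (elim \<omega>)
    show ?case using path_version_eq[where B=B and \<omega>=\<omega>, OF elim] a by (auto simp: cl_def)
  qed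
  define J where "J \<omega> = (\<integral>\<^sup>+u. k u * (indicator {a..b} u * ennreal (norm (path_version B \<omega> (cl u) - B c \<omega>))) \<partial>lborel)" for \<omega>
  have Jm: "J \<in> borel_measurable M"
    unfolding J_def[abs_def] by (rule lborel.borel_measurable_nn_integral) (simp add: split_beta', measurable)
  have JAE: "AE \<omega> in M. (\<integral>\<^sup>+u. k u * (indicator {a..b} u * ennreal (norm (B u \<omega> - B c \<omega>))) \<partial>lborel) = J \<omega>"
    using AEc by eventually_elim (auto simp: J_def intro!: nn_integral_cong split: split_indicator)
  have "(\<integral>\<^sup>+\<omega>. J \<omega> \<partial>M)
     = (\<integral>\<^sup>+\<omega>. (\<integral>\<^sup>+u. k u * (indicator {a..b} u * ennreal (norm (path_version B \<omega> (cl u) - B c \<omega>))) \<partial>lborel) \<partial>M)"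
    by (simp add: J_def)
  also have "\<dots> = (\<integral>\<^sup>+u. (\<integral>\<^sup>+\<omega>. k u * (indicator {a..b} u * ennreal (norm (path_version B \<omega> (cl u) - B c \<omega>))) \<partial>M) \<partial>lborel)"
    by (rule Fubini'[symmetric]) (simp add: split_beta', measurable)
  also have "\<dots> = (\<integral>\<^sup>+u. k u * (indicator {a..b} u * ennreal (sqrt \<bar>u - c\<bar> * gauss_abs TYPE('d))) \<partial>lborel)"
  proof (intro nn_integral_cong)
    fix u
    show "(\<integral>\<^sup>+\<omega>. k u * (indicator {a..b} u * ennreal (norm (path_version B \<omega> (cl u) - B c \<omega>))) \<partial>M) =
      k u * (indicator {a..b} u * ennreal (sqrt \<bar>u - c\<bar> * gauss_abs TYPE('d)))"
    proof (cases "u \<in> {a..b}")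
      case True
      then have u: "0 \<le> u" using a by auto
      have [measurable]: "B u \<in> borel_measurable M" using u by (rule measurable_B)
      have E: "(\<integral>\<^sup>+\<omega>. ennreal (norm (B t \<omega> - B s \<omega>)) \<partial>M) = ennreal (sqrt (t - s) * gauss_abs TYPE('d))" if "0 \<le> s" "s < t" for s t
      proof -
        have [measurable]: "B s \<in> borel_measurable M" "B t \<in> borel_measurable M" using that by (auto intro: measurable_B)
        have "(\<integral>\<^sup>+\<omega>. ennreal (norm (B t \<omega> - B s \<omega>)) \<partial>M) = (\<integral>\<^sup>+x. ennreal (norm x) \<partial>distr M borel (\<lambda>\<omega>. B t \<omega> - B s \<omega>))"
          by (subst nn_integral_distr) auto
        then show ?thesis unfolding distr_increment[OF that] using that by (simp add: nn_integral_gauss_norm)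
      qed
      have "(\<integral>\<^sup>+\<omega>. k u * (indicator {a..b} u * ennreal (norm (path_version B \<omega> (cl u) - B c \<omega>))) \<partial>M) =
        (\<integral>\<^sup>+\<omega>. k u * ennreal (norm (B u \<omega> - B c \<omega>)) \<partial>M)"
      proof (rule nn_integral_cong_AE)
        show "AE \<omega> in M. k u * (indicator {a..b} u * ennreal (norm (path_version B \<omega> (cl u) - B c \<omega>))) = k u * ennreal (norm (B u \<omega> - B c \<omega>))"
          using AEc by eventually_elim (use True in auto)
      qed
      also have "\<dots> = k u * (\<integral>\<^sup>+\<omega>. ennreal (norm (B u \<omega> - B c \<omega>)) \<partial>M)" by (rule nn_integral_cmult) measurable
      also have "(\<integral>\<^sup>+\<omega>. ennreal (norm (B u \<omega> - B c \<omega>)) \<partial>M) = ennreal (sqrt \<bar>u - c\<bar> * gauss_abs TYPE('d))"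
        using E[OF c, of u] E[OF u, of c] by (cases u c rule: linorder_cases) (auto simp: norm_minus_commute)
      finally show ?thesis using True by simp
    qed simp
  qed
  finally show ?thesis using Jm JAE by blast
qed

end

text \<open>Isolates what the final period needs from a solution. The equation is stated for
  increments, so it does not matter how the position at \<open>t1\<close> was reached; the sites may
  be any bounded function of the samples and \<open>U\<close> that takes the value 0 among its
  sites.\<close>

locale tilt_phase = diffusion M n p Q T X U Y0 B
  for M :: "'w measure" and n :: nat and p :: "real ^ 'd::finite \<Rightarrow> real" and Q :: "real measure" and T :: real
    and X :: "nat \<Rightarrow> 'w \<Rightarrow> real ^ 'd" and U :: "'w \<Rightarrow> real" and Y0 :: "'w \<Rightarrow> real ^ 'd"
    and B :: "real \<Rightarrow> 'w \<Rightarrow> real ^ 'd" +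
  fixes N :: nat and R r t1 :: real and \<alpha> :: "(nat \<Rightarrow> real ^ 'd) \<times> real \<Rightarrow> nat \<Rightarrow> real ^ 'd"
    and Y :: "real \<Rightarrow> 'w \<Rightarrow> real ^ 'd"
  assumes r: "0 < r" and t1: "0 \<le> t1"
    and bound: "\<And>z i. i \<le> N \<Longrightarrow> norm (\<alpha> z i) \<le> R"
    and zero: "\<And>z. 0 \<in> \<alpha> z ` {..N}"
    and \<alpha>[measurable]: "\<And>i. i \<le> N \<Longrightarrow> (\<lambda>z. \<alpha> z i) \<in> borel_measurable SU"
    and Ym: "\<And>t. t1 \<le> t \<Longrightarrow> t \<le> t1 + r \<Longrightarrow> Y t \<in> borel_measurable M"
    and Yad: "\<And>t. t1 \<le> t \<Longrightarrow> t \<le> t1 + r \<Longrightarrow> \<exists>V \<in> borel_measurable (H t). AE \<omega> in M. Y t \<omega> = V \<omega>"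
    and sol: "AE \<omega> in M. continuous_on {t1..t1 + r} (\<lambda>t. Y t \<omega>) \<and>
       (\<forall>s t. t1 \<le> s \<and> s \<le> t \<and> t \<le> t1 + r \<longrightarrow>
          Y t \<omega> - Y s \<omega> = (LINT u:{s..t}|lborel. tilt_drift N (\<alpha> (Z \<omega>)) (u - t1) (Y u \<omega>)) + (B t \<omega> - B s \<omega>))"
begin

lemma R_nonneg: "0 \<le> R"
  using bound[of 0 undefined] norm_ge_zero[of "\<alpha> undefined 0"] by linarith

lemma measurable_H_Z: "Z \<in> measurable (H t) SU"
  using measurable_H_samples[of t] measurable_H_U[of t] by measurable

lemma measurable_Z[measurable]: "Z \<in> measurable M SU"
  by measurable

text \<open>The position after a step is compared with its Euler approximation through the Lipschitz
  bound and the mean Euler error; for the approximation, the increment is integrated out and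
  \<open>wave_ratio_step\<close> applies. Both errors are of order
  \<open>\<delta> * sqrt \<delta>\<close>, uniformly in \<open>s\<close> so that they can be summed.
  The factor \<open>g\<close> carries the conditioning on the samples and \<open>U\<close>.\<close>

lemma wave_ratio_mean_step:
  "\<exists>C\<ge>0. \<forall>s \<delta> g. t1 \<le> s \<longrightarrow> 0 < \<delta> \<longrightarrow> \<delta> \<le> 1 \<longrightarrow> s + \<delta> \<le> t1 + r \<longrightarrow> g \<in> borel_measurable SU \<longrightarrow> (\<forall>z. \<bar>g z\<bar> \<le> (1::real)) \<longrightarrow>
    cmod ((LINT \<omega>|M. g (Z \<omega>) *\<^sub>R wave_ratio N (\<alpha> (Z \<omega>)) \<xi> (s + \<delta> - t1) (Y (s + \<delta>) \<omega>))
      - (LINT \<omega>|M. g (Z \<omega>) *\<^sub>R wave_ratio N (\<alpha> (Z \<omega>)) \<xi> (s - t1) (Y s \<omega>))) \<le> C * (\<delta> * sqrt \<delta>)"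
proof -
  obtain C1 where C1: "0 \<le> C1" "\<And>n (a :: nat \<Rightarrow> real ^ 'd) \<theta> x \<delta>. (\<forall>i\<le>n. norm (a i) \<le> R) \<Longrightarrow> 0 \<in> a ` {..n} \<Longrightarrow> \<theta> \<le> r \<Longrightarrow> 0 < \<delta> \<Longrightarrow> \<delta> \<le> 1 \<Longrightarrow>
     cmod ((LINT w|gauss \<delta>. wave_ratio n a \<xi> (\<theta> + \<delta>) (x + \<delta> *\<^sub>R tilt_drift n a \<theta> x + w)) - wave_ratio n a \<xi> \<theta> x)
       \<le> C1 * (\<delta> * sqrt \<delta>)"
    using wave_ratio_step[OF R_nonneg, of r \<xi>] by metis
  define K where "K = exp ((norm \<xi>)\<^sup>2 * r / 2)"
  define Lp where "Lp = K * (norm \<xi> + 2 * R)"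
  define C where "C = C1 + Lp * (6 * R ^ 3 + 4 * R\<^sup>2 * gauss_abs TYPE('d))"
  have Lp: "0 \<le> Lp" using R_nonneg by (simp add: Lp_def K_def)
  have C: "0 \<le> C" unfolding C_def using C1(1) Lp R_nonneg gauss_abs_nonneg[where 'd='d] by (intro add_nonneg_nonneg mult_nonneg_nonneg) auto
  have K0: "0 \<le> K" by (simp add: K_def)
  have main: "cmod ((LINT \<omega>|M. g (Z \<omega>) *\<^sub>R wave_ratio N (\<alpha> (Z \<omega>)) \<xi> (s + \<delta> - t1) (Y (s + \<delta>) \<omega>))
      - (LINT \<omega>|M. g (Z \<omega>) *\<^sub>R wave_ratio N (\<alpha> (Z \<omega>)) \<xi> (s - t1) (Y s \<omega>))) \<le> C * (\<delta> * sqrt \<delta>)"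
    if s: "t1 \<le> s" and d: "0 < \<delta>" "\<delta> \<le> 1" "s + \<delta> \<le> t1 + r" and gm[measurable]: "g \<in> borel_measurable SU" and g1: "\<And>z. \<bar>g z\<bar> \<le> (1::real)" for s \<delta> g
  proof -
    have s0: "0 \<le> s" using s t1 by simp
    define \<theta> where "\<theta> = s - t1"
    have \<theta>: "\<theta> \<le> r" "\<theta> + \<delta> \<le> r" "s + \<delta> - t1 = \<theta> + \<delta>" using d s by (auto simp: \<theta>_def)
    \<comment> \<open>\<open>Y s\<close> is adapted only up to null sets, whereas
      \<open>integral_increment\<close> asks for genuine measurability with respect to the history;
      \<open>V\<close> is such a version.\<close>
    obtain V where V[measurable]: "V \<in> borel_measurable (H s)" and YV: "AE \<omega> in M. Y s \<omega> = V \<omega>"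
      using Yad[of s] s d by auto
    note VM[measurable] = measurable_from_H[OF V]
    have [measurable]: "Y s \<in> borel_measurable M" "Y (s + \<delta>) \<in> borel_measurable M" using s d by (auto intro!: Ym)
    have [measurable]: "B s \<in> borel_measurable M" "B (s + \<delta>) \<in> borel_measurable M" using s0 d by (auto intro!: measurable_B)
    note HZ[measurable] = measurable_H_Z[of s]
    let ?a = "\<lambda>\<omega>. \<alpha> (Z \<omega>)"
    define W where "W \<omega> = B (s + \<delta>) \<omega> - B s \<omega>" for \<omega>
    have [measurable]: "W \<in> borel_measurable M" unfolding W_def[abs_def] by measurable
    define f where "f x = g (Z (fst x)) *\<^sub>R wave_ratio N (?a (fst x)) \<xi> (\<theta> + \<delta>) (V (fst x) + \<delta> *\<^sub>R tilt_drift N (?a (fst x)) \<theta> (V (fst x)) + snd x)" for x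
    have [measurable]: "f \<in> borel_measurable (H s \<Otimes>\<^sub>M borel)" unfolding f_def[abs_def] by measurable
    have wK: "cmod (wave_ratio N (?a \<omega>) \<xi> t x) \<le> K" if "t \<le> r" for \<omega> t x
      unfolding K_def by (rule norm_wave_ratio_le[OF zero that])
    have gK: "cmod (g z *\<^sub>R wave_ratio N (?a \<omega>) \<xi> t x) \<le> K" if "t \<le> r" for z \<omega> t x
      using mult_mono[OF g1[of z] wK[OF that, of \<omega> x]] by simp
    have fK: "cmod (f x) \<le> K" for x unfolding f_def by (rule gK[OF \<theta>(2)])
    have fW[measurable]: "(\<lambda>\<omega>. f (\<omega>, W \<omega>)) \<in> borel_measurable M" unfolding f_def[abs_def] by measurable
    \<comment> \<open>\<open>E1\<close> and \<open>E2\<close> treat the Euler step started at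
      \<open>V\<close>, \<open>E3\<close> its distance from the true position, and \<open>E4\<close>
      returns from \<open>V\<close> to \<open>Y s\<close>.\<close>
    have E1: "(LINT \<omega>|M. f (\<omega>, W \<omega>)) = (LINT \<omega>|M. (LINT w|gauss \<delta>. f (\<omega>, w)))"
      unfolding W_def using integral_increment[OF s0, of "s + \<delta>" f K] d fK by simp
    interpret G: prob_space "gauss \<delta> :: (real ^ 'd) measure" by (rule prob_space_gauss) (use d in simp)
    have [measurable]: "(\<lambda>\<omega>. (LINT w|gauss \<delta>. f (\<omega>, w))) \<in> borel_measurable M"
      by (rule measurable_from_H[of _ s]) measurable
    have E2: "cmod ((LINT \<omega>|M. (LINT w|gauss \<delta>. f (\<omega>, w))) - (LINT \<omega>|M. g (Z \<omega>) *\<^sub>R wave_ratio N (?a \<omega>) \<xi> \<theta> (V \<omega>))) \<le> C1 * (\<delta> * sqrt \<delta>)"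
    proof -
      have bK: "cmod (LINT w|gauss \<delta>. f (\<omega>, w)) \<le> K" for \<omega>
      proof -
        have "cmod (LINT w|gauss \<delta>. f (\<omega>, w)) \<le> (LINT w|gauss \<delta>. cmod (f (\<omega>, w)))" by (rule integral_norm_bound)
        also have "\<dots> \<le> (LINT w|(gauss \<delta> :: (real ^ 'd) measure). K)"
          by (rule integral_mono') (use fK K0 in auto)
        also have "\<dots> = K" using G.prob_space by simp
        finally show ?thesis .
      qed
      have "cmod ((LINT w|gauss \<delta>. f (\<omega>, w)) - g (Z \<omega>) *\<^sub>R wave_ratio N (?a \<omega>) \<xi> \<theta> (V \<omega>)) \<le> C1 * (\<delta> * sqrt \<delta>)" for \<omega>
      proof -
        have "(LINT w|gauss \<delta>. f (\<omega>, w)) - g (Z \<omega>) *\<^sub>R wave_ratio N (?a \<omega>) \<xi> \<theta> (V \<omega>)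
          = g (Z \<omega>) *\<^sub>R ((LINT w|gauss \<delta>. wave_ratio N (?a \<omega>) \<xi> (\<theta> + \<delta>) (V \<omega> + \<delta> *\<^sub>R tilt_drift N (?a \<omega>) \<theta> (V \<omega>) + w)) - wave_ratio N (?a \<omega>) \<xi> \<theta> (V \<omega>))"
          by (simp add: f_def scaleR_diff_right)
        also have "cmod \<dots> \<le> 1 * (C1 * (\<delta> * sqrt \<delta>))"
          unfolding norm_scaleR
          by (intro mult_mono g1 C1(2)) (use bound zero \<theta> d in auto)
        finally show ?thesis by simp
      qed
      then have "cmod (LINT \<omega>|M. (LINT w|gauss \<delta>. f (\<omega>, w)) - g (Z \<omega>) *\<^sub>R wave_ratio N (?a \<omega>) \<xi> \<theta> (V \<omega>)) \<le> C1 * (\<delta> * sqrt \<delta>)"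
        by (intro order_trans[OF integral_norm_bound] integral_le_const integrable_norm integrable_const_bound[where B="C1 * (\<delta> * sqrt \<delta>)"]) auto
      then show ?thesis
        by (subst (asm) Bochner_Integration.integral_diff) (auto intro!: integrable_const_bound[where B=K] bK gK \<theta>)
    qed
    have E3: "cmod ((LINT \<omega>|M. g (Z \<omega>) *\<^sub>R wave_ratio N (?a \<omega>) \<xi> (\<theta> + \<delta>) (Y (s + \<delta>) \<omega>)) - (LINT \<omega>|M. f (\<omega>, W \<omega>)))
      \<le> Lp * (6 * R ^ 3 + 4 * R\<^sup>2 * gauss_abs TYPE('d)) * (\<delta> * sqrt \<delta>)"
    proof -
      have "\<exists>J\<in>borel_measurable M.
         (AE \<omega> in M. (\<integral>\<^sup>+u. 1 * (indicator {s..s + \<delta>} u * ennreal (norm (B u \<omega> - B s \<omega>))) \<partial>lborel) = J \<omega>) \<and>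
         (\<integral>\<^sup>+\<omega>. J \<omega> \<partial>M) = (\<integral>\<^sup>+u. 1 * (indicator {s..s + \<delta>} u * ennreal (sqrt \<bar>u - s\<bar> * gauss_abs TYPE('d))) \<partial>lborel)"
        by (rule nn_integral_path_diff) (use s0 in auto)
      then obtain J where J[measurable]: "J \<in> borel_measurable M"
        and JAE: "AE \<omega> in M. (\<integral>\<^sup>+u. indicator {s..s + \<delta>} u * ennreal (norm (B u \<omega> - B s \<omega>)) \<partial>lborel) = J \<omega>"
        and Ji: "(\<integral>\<^sup>+\<omega>. J \<omega> \<partial>M) = (\<integral>\<^sup>+u. indicator {s..s + \<delta>} u * ennreal (sqrt \<bar>u - s\<bar> * gauss_abs TYPE('d)) \<partial>lborel)"
        by auto
      have dif: "AE \<omega> in M. ennreal (cmod (g (Z \<omega>) *\<^sub>R wave_ratio N (?a \<omega>) \<xi> (\<theta> + \<delta>) (Y (s + \<delta>) \<omega>) - f (\<omega>, W \<omega>)))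
          \<le> ennreal Lp * (ennreal (6 * R ^ 3 * \<delta>\<^sup>2) + ennreal (4 * R\<^sup>2) * J \<omega>)"
        using sol AE_continuous_B YV JAE
      proof eventually_elim
        case (elim \<omega>)
        have st: "ennreal (norm (Y (s + \<delta>) \<omega> - Y s \<omega> - (s + \<delta> - s) *\<^sub>R tilt_drift N (?a \<omega>) (s - t1) (Y s \<omega>) - (B (s + \<delta>) \<omega> - B s \<omega>)))
          \<le> ennreal (6 * R ^ 3 * (s + \<delta> - s)\<^sup>2) + ennreal (4 * R\<^sup>2) * (\<integral>\<^sup>+u. indicator {s..s+\<delta>} u * ennreal (norm (B u \<omega> - B s \<omega>)) \<partial>lborel)"
          by (rule tilt_path_step[where ?t1.0=t1 and ?t2.0="t1 + r" and y="\<lambda>t. Y t \<omega>" and c="\<lambda>t. B t \<omega>"])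
            (use elim bound s d s0 in \<open>auto intro: continuous_on_subset[of "{0..}"]\<close>)
        let ?D = "Y (s + \<delta>) \<omega> - (V \<omega> + \<delta> *\<^sub>R tilt_drift N (?a \<omega>) \<theta> (V \<omega>) + W \<omega>)"
        have D: "ennreal (norm ?D) \<le> ennreal (6 * R ^ 3 * \<delta>\<^sup>2) + ennreal (4 * R\<^sup>2) * J \<omega>"
          using st elim by (simp add: W_def \<theta>_def diff_diff_eq)
        have "cmod (g (Z \<omega>) *\<^sub>R wave_ratio N (?a \<omega>) \<xi> (\<theta> + \<delta>) (Y (s + \<delta>) \<omega>) - f (\<omega>, W \<omega>))
           = \<bar>g (Z \<omega>)\<bar> * cmod (wave_ratio N (?a \<omega>) \<xi> (\<theta> + \<delta>) (Y (s + \<delta>) \<omega>) - wave_ratio N (?a \<omega>) \<xi> (\<theta> + \<delta>) (V \<omega> + \<delta> *\<^sub>R tilt_drift N (?a \<omega>) \<theta> (V \<omega>) + W \<omega>))"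
          by (simp add: f_def scaleR_diff_right[symmetric])
        also have "\<dots> \<le> 1 * (Lp * norm ?D)"
          unfolding Lp_def K_def by (intro mult_mono g1 wave_ratio_lipschitz) (use bound zero \<theta> in auto)
        finally have "ennreal (cmod (g (Z \<omega>) *\<^sub>R wave_ratio N (?a \<omega>) \<xi> (\<theta> + \<delta>) (Y (s + \<delta>) \<omega>) - f (\<omega>, W \<omega>))) \<le> ennreal (Lp * norm ?D)"
          by (simp add: ennreal_leI)
        also have "\<dots> = ennreal Lp * ennreal (norm ?D)" using Lp by (simp add: ennreal_mult)
        also have "\<dots> \<le> ennreal Lp * (ennreal (6 * R ^ 3 * \<delta>\<^sup>2) + ennreal (4 * R\<^sup>2) * J \<omega>)" by (intro mult_left_mono D) simp
        finally show ?case .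
      qed
      have Jint: "(\<integral>\<^sup>+\<omega>. J \<omega> \<partial>M) \<le> ennreal (gauss_abs TYPE('d) * (\<delta> * sqrt \<delta>))"
      proof -
        have "(\<integral>\<^sup>+\<omega>. J \<omega> \<partial>M) \<le> (\<integral>\<^sup>+u. ennreal (sqrt \<delta> * gauss_abs TYPE('d)) * indicator {s..s+\<delta>} u \<partial>lborel)"
          unfolding Ji using gauss_abs_nonneg[where 'd='d] by (intro nn_integral_mono) (auto split: split_indicator intro!: ennreal_leI mult_right_mono)
        also have "\<dots> = ennreal (gauss_abs TYPE('d) * (\<delta> * sqrt \<delta>))"
          using d gauss_abs_nonneg[where 'd='d] by (subst nn_integral_cmult_indicator) (auto simp: ennreal_mult[symmetric] mult_ac)
        finally show ?thesis .
      qed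
      have "ennreal (cmod (LINT \<omega>|M. g (Z \<omega>) *\<^sub>R wave_ratio N (?a \<omega>) \<xi> (\<theta> + \<delta>) (Y (s + \<delta>) \<omega>) - f (\<omega>, W \<omega>)))
        \<le> (\<integral>\<^sup>+\<omega>. ennreal (cmod (g (Z \<omega>) *\<^sub>R wave_ratio N (?a \<omega>) \<xi> (\<theta> + \<delta>) (Y (s + \<delta>) \<omega>) - f (\<omega>, W \<omega>))) \<partial>M)"
        by (rule integral_norm_bound_ennreal, rule Bochner_Integration.integrable_diff) (auto intro!: integrable_const_bound[where B=K] gK fK \<theta>)
      also have "\<dots> \<le> (\<integral>\<^sup>+\<omega>. ennreal Lp * (ennreal (6 * R ^ 3 * \<delta>\<^sup>2) + ennreal (4 * R\<^sup>2) * J \<omega>) \<partial>M)"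
        by (rule nn_integral_mono_AE[OF dif])
      also have "\<dots> \<le> ennreal (Lp * (6 * R ^ 3 + 4 * R\<^sup>2 * gauss_abs TYPE('d)) * (\<delta> * sqrt \<delta>))"
      proof -
        have "(\<integral>\<^sup>+\<omega>. ennreal Lp * (ennreal (6 * R ^ 3 * \<delta>\<^sup>2) + ennreal (4 * R\<^sup>2) * J \<omega>) \<partial>M)
          = ennreal Lp * (ennreal (6 * R ^ 3 * \<delta>\<^sup>2) + ennreal (4 * R\<^sup>2) * (\<integral>\<^sup>+\<omega>. J \<omega> \<partial>M))"
          by (simp add: nn_integral_cmult nn_integral_add emeasure_space_1)
        also have "\<dots> \<le> ennreal Lp * (ennreal (6 * R ^ 3 * \<delta>\<^sup>2) + ennreal (4 * R\<^sup>2) * ennreal (gauss_abs TYPE('d) * (\<delta> * sqrt \<delta>)))"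
          by (intro mult_left_mono add_left_mono Jint) auto
        also have "\<dots> = ennreal (Lp * (6 * R ^ 3 * \<delta>\<^sup>2 + 4 * R\<^sup>2 * (gauss_abs TYPE('d) * (\<delta> * sqrt \<delta>))))"
          using Lp R_nonneg d gauss_abs_nonneg[where 'd='d] by (simp add: ennreal_mult[symmetric] ennreal_plus[symmetric] del: ennreal_plus)
        also have "\<dots> \<le> ennreal (Lp * (6 * R ^ 3 * (\<delta> * sqrt \<delta>) + 4 * R\<^sup>2 * (gauss_abs TYPE('d) * (\<delta> * sqrt \<delta>))))"
        proof (intro ennreal_leI mult_left_mono add_right_mono)
          show "\<delta>\<^sup>2 \<le> \<delta> * sqrt \<delta>"
            using d by (auto simp: power2_eq_square real_le_rsqrt mult_left_le)
        qed (use R_nonneg Lp in auto)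
        finally show ?thesis by (simp add: algebra_simps)
      qed
      finally have "cmod (LINT \<omega>|M. g (Z \<omega>) *\<^sub>R wave_ratio N (?a \<omega>) \<xi> (\<theta> + \<delta>) (Y (s + \<delta>) \<omega>) - f (\<omega>, W \<omega>))
        \<le> Lp * (6 * R ^ 3 + 4 * R\<^sup>2 * gauss_abs TYPE('d)) * (\<delta> * sqrt \<delta>)"
        using Lp R_nonneg d gauss_abs_nonneg[where 'd='d] by (subst (asm) ennreal_le_iff) auto
      then show ?thesis
        by (subst (asm) Bochner_Integration.integral_diff) (auto intro!: integrable_const_bound[where B=K] gK fK \<theta>)
    qed
    have E4: "(LINT \<omega>|M. g (Z \<omega>) *\<^sub>R wave_ratio N (?a \<omega>) \<xi> \<theta> (V \<omega>)) = (LINT \<omega>|M. g (Z \<omega>) *\<^sub>R wave_ratio N (?a \<omega>) \<xi> \<theta> (Y s \<omega>))"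
      by (rule integral_cong_AE) (use YV in \<open>auto elim!: eventually_mono\<close>)
    show ?thesis unfolding \<theta>(3) \<theta>_def[symmetric] C_def
      using norm_triangle_ineq[of "(LINT \<omega>|M. g (Z \<omega>) *\<^sub>R wave_ratio N (?a \<omega>) \<xi> (\<theta> + \<delta>) (Y (s + \<delta>) \<omega>)) - (LINT \<omega>|M. f (\<omega>, W \<omega>))"
          "(LINT \<omega>|M. (LINT w|gauss \<delta>. f (\<omega>, w))) - (LINT \<omega>|M. g (Z \<omega>) *\<^sub>R wave_ratio N (?a \<omega>) \<xi> \<theta> (V \<omega>))"] E2 E3
      unfolding E1 E4 distrib_right by simp
  qed
  show ?thesis using main C by blast
qed

end

text \<open>For a fixed set \<open>A\<close> in the first coordinate, the sections
  \<open>C \<mapsto> m (A \<times> C)\<close> are finite measures on the space, to which the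
  uniqueness theorem applies; rectangles generate the product.\<close>

lemma pair_measure_eqI_char:
  fixes m1 m2 :: "('z \<times> (real ^ 'd)) measure"
  assumes m: "finite_measure m1" "sets m1 = sets (S \<Otimes>\<^sub>M borel)" "finite_measure m2" "sets m2 = sets (S \<Otimes>\<^sub>M borel)"
    and eq: "\<And>A \<xi>. A \<in> sets S \<Longrightarrow> (LINT x|m1. indicator A (fst x) *\<^sub>R cis (\<xi> \<bullet> snd x)) = (LINT x|m2. indicator A (fst x) *\<^sub>R cis (\<xi> \<bullet> snd x))"
  shows "m1 = m2"
proof -
  define \<mu> where "\<mu> m A = distr (density m (\<lambda>x. ennreal (indicator A (fst x)))) borel snd" for m :: "('z \<times> (real ^ 'd)) measure" and A
  have fin: "finite_measure (\<mu> m A)" and em: "C \<in> sets borel \<Longrightarrow> emeasure (\<mu> m A) C = emeasure m (A \<times> C)"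
    and ch: "(LINT x|\<mu> m A. cis (\<xi> \<bullet> x)) = (LINT x|m. indicator A (fst x) *\<^sub>R cis (\<xi> \<bullet> snd x))"
    if f: "finite_measure m" and s[measurable_cong]: "sets m = sets (S \<Otimes>\<^sub>M borel)" and A[measurable]: "A \<in> sets S" for m A C \<xi>
  proof -
    interpret finite_measure m by fact
    have sp: "space m = space S \<times> UNIV" using sets_eq_imp_space_eq[OF s] by (simp add: space_pair_measure)
    have *: "emeasure (\<mu> m A) C = emeasure m (A \<times> C)" if [measurable]: "C \<in> sets borel" for C
    proof -
      have "emeasure (\<mu> m A) C = (\<integral>\<^sup>+x. ennreal (indicator A (fst x)) * indicator (snd -` C \<inter> space m) x \<partial>m)"
        unfolding \<mu>_def by (subst emeasure_distr, simp, simp, subst emeasure_density) auto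
      also have "\<dots> = (\<integral>\<^sup>+x. indicator (A \<times> C) x \<partial>m)"
        by (intro nn_integral_cong) (auto split: split_indicator)
      also have "\<dots> = emeasure m (A \<times> C)" by simp
      finally show ?thesis .
    qed
    show "C \<in> sets borel \<Longrightarrow> emeasure (\<mu> m A) C = emeasure m (A \<times> C)" by (rule *)
    show "finite_measure (\<mu> m A)"
    proof (rule finite_measureI)
      have "space (\<mu> m A) = UNIV" by (simp add: \<mu>_def)
      then show "emeasure (\<mu> m A) (space (\<mu> m A)) \<noteq> \<infinity>" using *[of UNIV] emeasure_finite by simp
    qed
    show "(LINT x|\<mu> m A. cis (\<xi> \<bullet> x)) = (LINT x|m. indicator A (fst x) *\<^sub>R cis (\<xi> \<bullet> snd x))"
      unfolding \<mu>_def by (subst integral_distr, measurable, subst integral_density) auto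
  qed
  show ?thesis
  proof (rule measure_eqI_generator_eq[OF Int_stable_pair_measure_generator[of S borel], where \<Omega>="space S \<times> UNIV" and A="\<lambda>_. space S \<times> UNIV"])
    fix X assume "X \<in> {a \<times> b |a b. a \<in> sets S \<and> b \<in> sets (borel :: (real ^ 'd) measure)}"
    then obtain A C where X: "X = A \<times> C" and A: "A \<in> sets S" and C: "C \<in> sets borel" by auto
    have "\<mu> m1 A = \<mu> m2 A"
      by (rule measure_eqI_char) (auto simp: fin m A ch eq, simp_all add: \<mu>_def)
    then show "emeasure m1 X = emeasure m2 X"
      unfolding X using em[OF m(1,2) A C] em[OF m(3,4) A C] by simp
  next
    show "{a \<times> b |a b. a \<in> sets S \<and> b \<in> sets (borel :: (real ^ 'd) measure)} \<subseteq> Pow (space S \<times> UNIV)"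
      using sets.sets_into_space by fastforce
    show "sets m1 = sigma_sets (space S \<times> UNIV) {a \<times> b |a b. a \<in> sets S \<and> b \<in> sets borel}"
      "sets m2 = sigma_sets (space S \<times> UNIV) {a \<times> b |a b. a \<in> sets S \<and> b \<in> sets borel}"
      using m by (simp_all add: sets_pair_measure)
    show "emeasure m1 (space S \<times> UNIV) \<noteq> \<infinity>" for i :: nat
      using finite_measure.emeasure_finite[OF m(1)] by simp
    have "space S \<times> UNIV \<in> {a \<times> b |a b. a \<in> sets S \<and> b \<in> sets (borel :: (real ^ 'd) measure)}"
      using sets.top[of S] by (intro CollectI exI[of _ "space S"] exI[of _ "UNIV :: (real ^ 'd) set"]) simp
    then show "range (\<lambda>_ :: nat. space S \<times> (UNIV :: (real ^ 'd) set)) \<subseteq> {a \<times> b |a b. a \<in> sets S \<and> b \<in> sets borel}"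
      unfolding image_subset_iff by (rule ballI)
  qed simp
qed

text \<open>The transition density of the tilted diffusion from \<open>x\<close> over time
  \<open>r\<close>: a site is drawn with its weight at \<open>x\<close>, then a Brownian motion runs
  with that site as constant drift.\<close>

definition tilt_kernel :: "nat \<Rightarrow> (nat \<Rightarrow> real ^ 'd) \<Rightarrow> real \<Rightarrow> real ^ 'd \<Rightarrow> real ^ 'd \<Rightarrow> real" where
  "tilt_kernel n a r x y = (\<Sum>i\<le>n. tilt_weight n a 0 x i * gaussian_density r (y - x - r *\<^sub>R a i))"

text \<open>The same kernel in Doob's form, each summand being a tilted Gaussian. The law of the
  diffusion comes out in this form; the mixture form is the one to compare with the kernel
  estimator.\<close>

lemma tilt_kernel_eq:
  fixes a :: "nat \<Rightarrow> real ^ 'd"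
  assumes r: "0 < r"
  shows "tilt_kernel n a r x y = tilt_sum n a r y / tilt_sum n a 0 x * gaussian_density r (y - x)"
proof -
  have "tilt_sum n a r y = tilt_sum n a 0 x * (\<Sum>i\<le>n. tilt_weight n a 0 x i * exp (a i \<bullet> (y - x) - (norm (a i))\<^sup>2 * r / 2))"
    using tilt_sum_add[of n a 0 r x "y - x"] by simp
  then have "tilt_sum n a r y / tilt_sum n a 0 x * gaussian_density r (y - x)
     = (\<Sum>i\<le>n. tilt_weight n a 0 x i * (exp (a i \<bullet> (y - x) - (norm (a i))\<^sup>2 * r / 2) * gaussian_density r (y - x)))"
    using tilt_sum_pos[of n a 0 x] by (simp add: sum_distrib_right mult.assoc)
  also have "\<dots> = tilt_kernel n a r x y" unfolding tilt_kernel_def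
  proof (intro sum.cong refl arg_cong2[where f="(*)"])
    fix i
    show "exp (a i \<bullet> (y - x) - (norm (a i))\<^sup>2 * r / 2) * gaussian_density r (y - x) = gaussian_density r (y - x - r *\<^sub>R a i)"
      using gaussian_density_tilt[OF r, of "a i" "y - x - r *\<^sub>R a i"] by simp
  qed
  finally show ?thesis by simp
qed

lemma tilt_kernel_nonneg: "0 \<le> tilt_kernel n a r x y"
  unfolding tilt_kernel_def by (intro sum_nonneg mult_nonneg_nonneg tilt_weight_nonneg) simp

section \<open>The law at the end of the final period\<close>

context tilt_phase
begin

text \<open>With \<open>K\<close> steps of length \<open>r / K\<close> the errors add up to a
  multiple of \<open>r * sqrt (r / K)\<close>, which tends to 0.\<close>

lemma wave_ratio_mean_constant:
  assumes g[measurable]: "g \<in> borel_measurable SU" and g1: "\<And>z. \<bar>g z\<bar> \<le> (1::real)"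
  shows "(LINT \<omega>|M. g (Z \<omega>) *\<^sub>R wave_ratio N (\<alpha> (Z \<omega>)) \<xi> r (Y (t1 + r) \<omega>))
      = (LINT \<omega>|M. g (Z \<omega>) *\<^sub>R wave_ratio N (\<alpha> (Z \<omega>)) \<xi> 0 (Y t1 \<omega>))"
proof -
  define F where "F s = (LINT \<omega>|M. g (Z \<omega>) *\<^sub>R wave_ratio N (\<alpha> (Z \<omega>)) \<xi> (s - t1) (Y s \<omega>))" for s
  obtain C where C: "0 \<le> C" and step: "\<And>s \<delta>. t1 \<le> s \<Longrightarrow> 0 < \<delta> \<Longrightarrow> \<delta> \<le> 1 \<Longrightarrow> s + \<delta> \<le> t1 + r \<Longrightarrow> cmod (F (s + \<delta>) - F s) \<le> C * (\<delta> * sqrt \<delta>)"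
    using wave_ratio_mean_step[of \<xi>] g g1 unfolding F_def by blast
  have bnd: "cmod (F (t1 + r) - F t1) \<le> C * (r * sqrt (r / real K))" if K: "0 < K" "r \<le> real K" for K
  proof -
    define \<delta> where "\<delta> = r / real K"
    have d: "0 < \<delta>" "\<delta> \<le> 1" "real K * \<delta> = r" using K r by (auto simp: \<delta>_def)
    have "F (t1 + r) - F t1 = (\<Sum>k<K. F (t1 + real (Suc k) * \<delta>) - F (t1 + real k * \<delta>))"
      by (subst sum_lessThan_telescope) (simp add: d)
    also have "cmod \<dots> \<le> (\<Sum>k<K. C * (\<delta> * sqrt \<delta>))"
    proof (rule sum_norm_le)
      fix k assume k: "k \<in> {..<K}"
      have "real (Suc k) * \<delta> \<le> real K * \<delta>" using k d by (intro mult_right_mono) auto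
      then have le: "t1 + real k * \<delta> + \<delta> \<le> t1 + r" using d by (simp add: algebra_simps)
      have "cmod (F (t1 + real k * \<delta> + \<delta>) - F (t1 + real k * \<delta>)) \<le> C * (\<delta> * sqrt \<delta>)"
        by (rule step) (use d le in auto)
      then show "cmod (F (t1 + real (Suc k) * \<delta>) - F (t1 + real k * \<delta>)) \<le> C * (\<delta> * sqrt \<delta>)"
        by (simp add: algebra_simps)
    qed
    also have "\<dots> = C * ((real K * \<delta>) * sqrt \<delta>)" by simp
    finally show ?thesis unfolding d(3) by (simp add: \<delta>_def)
  qed
  have "(\<lambda>K. C * (r * sqrt (r / real K))) \<longlonglongrightarrow> C * (r * sqrt 0)"
    by (intro tendsto_intros lim_const_over_n)
  then have "cmod (F (t1 + r) - F t1) \<le> C * (r * sqrt 0)"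
  proof (rule LIMSEQ_le_const)
    show "\<exists>N. \<forall>n\<ge>N. cmod (F (t1 + r) - F t1) \<le> C * (r * sqrt (r / real n))"
    proof (intro exI[of _ "Suc (nat \<lceil>r\<rceil>)"] allI impI bnd)
      fix n assume "Suc (nat \<lceil>r\<rceil>) \<le> n"
      then show "0 < n" "r \<le> real n" by linarith+
    qed
  qed
  then have "F (t1 + r) = F t1" by simp
  then show ?thesis by (simp add: F_def)
qed

text \<open>Constant means of the quotients say: after weighting by \<open>1 / tilt_sum\<close>, the
  final position has, jointly with the samples and \<open>U\<close>, the characteristic function of
  the starting position plus independent Gaussian noise. Hence the weighted laws \<open>m1\<close>
  and \<open>m2\<close> agree, and removing the weight at the end multiplies the Gaussian kernel by
  a quotient of values of \<open>tilt_sum\<close>, which is Doob's form of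
  \<open>tilt_kernel\<close>.\<close>

lemma tilt_law:
  fixes F :: "((nat \<Rightarrow> real ^ 'd) \<times> real) \<times> (real ^ 'd) \<Rightarrow> ennreal"
  assumes F[measurable]: "F \<in> borel_measurable (SU \<Otimes>\<^sub>M borel)"
  shows "(\<integral>\<^sup>+\<omega>. F (Z \<omega>, Y (t1 + r) \<omega>) \<partial>M)
     = (\<integral>\<^sup>+\<omega>. (\<integral>\<^sup>+y. F (Z \<omega>, y) * ennreal (tilt_kernel N (\<alpha> (Z \<omega>)) r (Y t1 \<omega>) y) \<partial>lborel) \<partial>M)"
proof -
  let ?hr = "\<lambda>\<omega>. tilt_sum N (\<alpha> (Z \<omega>)) r (Y (t1 + r) \<omega>)" and ?h0 = "\<lambda>\<omega>. tilt_sum N (\<alpha> (Z \<omega>)) 0 (Y t1 \<omega>)"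
  have [measurable]: "Y t1 \<in> borel_measurable M" "Y (t1 + r) \<in> borel_measurable M" using r by (auto intro!: Ym)
  interpret G: prob_space "gauss r :: (real ^ 'd) measure" by (rule prob_space_gauss[OF r])
  have h1: "1 \<le> tilt_sum N (\<alpha> z) t x" for z t x by (rule tilt_sum_ge_one[OF zero])
  have h0: "0 < tilt_sum N (\<alpha> z) t x" for z t x by (rule tilt_sum_pos)
  \<comment> \<open>The weights belong to the end and to the beginning of the period; they are at
    most 1, so both measures are finite.\<close>
  define D1 where "D1 = density M (\<lambda>\<omega>. ennreal (1 / ?hr \<omega>))"
  define D2 where "D2 = density M (\<lambda>\<omega>. ennreal (1 / ?h0 \<omega>))"
  have [simp]: "sets D1 = sets M" "sets D2 = sets M" "space D1 = space M" "space D2 = space M" by (simp_all add: D1_def D2_def)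
  have sD[measurable_cong]: "sets D1 = sets M" "sets D2 = sets M" by simp_all
  have fin: "finite_measure (density M (\<lambda>\<omega>. ennreal (1 / f \<omega>)))" if [measurable]: "f \<in> borel_measurable M" and f: "\<And>\<omega>. 1 \<le> f \<omega>" for f
  proof (rule finite_measureI)
    have "(\<integral>\<^sup>+\<omega>. ennreal (1 / f \<omega>) \<partial>M) \<le> (\<integral>\<^sup>+\<omega>. 1 \<partial>M)"
    proof (intro nn_integral_mono)
      fix \<omega>
      have "1 / f \<omega> \<le> 1" using f[of \<omega>] by simp
      then show "ennreal (1 / f \<omega>) \<le> 1" using ennreal_leI by fastforce
    qed
    also have "\<dots> < \<infinity>" by (simp add: emeasure_space_1)
    finally show "emeasure (density M (\<lambda>\<omega>. ennreal (1 / f \<omega>))) (space (density M (\<lambda>\<omega>. ennreal (1 / f \<omega>)))) \<noteq> \<infinity>"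
      by (simp add: emeasure_density cong: nn_integral_cong)
  qed
  interpret D1: finite_measure D1 unfolding D1_def by (rule fin) (use h1 in auto)
  interpret D2: finite_measure D2 unfolding D2_def by (rule fin) (use h1 in auto)
  interpret DG: pair_sigma_finite D2 "gauss r :: (real ^ 'd) measure" ..
  interpret DGf: finite_measure "D2 \<Otimes>\<^sub>M (gauss r :: (real ^ 'd) measure)"
    by (rule finite_measure_pair_measure) unfold_locales
  define m1 where "m1 = distr D1 (SU \<Otimes>\<^sub>M borel) (\<lambda>\<omega>. (Z \<omega>, Y (t1 + r) \<omega>))"
  define m2 where "m2 = distr (D2 \<Otimes>\<^sub>M (gauss r :: (real ^ 'd) measure)) (SU \<Otimes>\<^sub>M borel) (\<lambda>x. (Z (fst x), Y t1 (fst x) + snd x))"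
  have t1m[measurable]: "(\<lambda>\<omega>. (Z \<omega>, Y (t1 + r) \<omega>)) \<in> measurable D1 (SU \<Otimes>\<^sub>M borel)" by measurable
  have t2m[measurable]: "(\<lambda>x. (Z (fst x), Y t1 (fst x) + snd x)) \<in> measurable (D2 \<Otimes>\<^sub>M (gauss r :: (real ^ 'd) measure)) (SU \<Otimes>\<^sub>M borel)" by measurable
  have eq: "m1 = m2"
  proof (rule pair_measure_eqI_char)
    show "finite_measure m1" unfolding m1_def by (rule D1.finite_measure_distr) measurable
    show "finite_measure m2" unfolding m2_def by (rule DGf.finite_measure_distr) measurable
    show "sets m1 = sets (SU \<Otimes>\<^sub>M borel)" "sets m2 = sets (SU \<Otimes>\<^sub>M borel)" by (simp_all add: m1_def m2_def)
    fix A and \<xi> :: "real ^ 'd" assume [measurable]: "A \<in> sets SU"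
    \<comment> \<open>Compensates the growth of the plane wave, which solves the backward equation;
      it is also the characteristic function of the added noise.\<close>
    define E where "E = complex_of_real (exp (- (norm \<xi>)\<^sup>2 * r / 2))"
    have EE: "E * complex_of_real (exp ((norm \<xi>)\<^sup>2 * r / 2)) = 1" by (simp add: E_def of_real_mult[symmetric] exp_add[symmetric] del: of_real_mult)
    have "(LINT x|m1. indicator A (fst x) *\<^sub>R cis (\<xi> \<bullet> snd x)) = (LINT \<omega>|D1. indicator A (Z \<omega>) *\<^sub>R cis (\<xi> \<bullet> Y (t1 + r) \<omega>))"
      unfolding m1_def by (subst integral_distr) auto
    also have "\<dots> = (LINT \<omega>|M. (1 / ?hr \<omega>) *\<^sub>R (indicator A (Z \<omega>) *\<^sub>R cis (\<xi> \<bullet> Y (t1 + r) \<omega>)))"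
      unfolding D1_def by (subst integral_density) (auto simp: h0 less_imp_le)
    also have "\<dots> = (LINT \<omega>|M. E * (indicator A (Z \<omega>) *\<^sub>R wave_ratio N (\<alpha> (Z \<omega>)) \<xi> r (Y (t1 + r) \<omega>)))"
    proof (rule Bochner_Integration.integral_cong[OF refl])
      fix \<omega>
      have "E * (indicator A (Z \<omega>) *\<^sub>R wave_ratio N (\<alpha> (Z \<omega>)) \<xi> r (Y (t1 + r) \<omega>))
        = (E * complex_of_real (exp ((norm \<xi>)\<^sup>2 * r / 2))) * (indicator A (Z \<omega>) * (1 / ?hr \<omega>) * cis (\<xi> \<bullet> Y (t1 + r) \<omega>))"
        by (simp add: wave_ratio_def scaleR_conv_of_real)
      then show "(1 / ?hr \<omega>) *\<^sub>R (indicator A (Z \<omega>) *\<^sub>R cis (\<xi> \<bullet> Y (t1 + r) \<omega>)) = E * (indicator A (Z \<omega>) *\<^sub>R wave_ratio N (\<alpha> (Z \<omega>)) \<xi> r (Y (t1 + r) \<omega>))"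
        unfolding EE by (simp add: scaleR_conv_of_real)
    qed
    also have "\<dots> = E * (LINT \<omega>|M. indicator A (Z \<omega>) *\<^sub>R wave_ratio N (\<alpha> (Z \<omega>)) \<xi> r (Y (t1 + r) \<omega>))"
      by (rule integral_mult_right_zero)
    also have "(LINT \<omega>|M. indicator A (Z \<omega>) *\<^sub>R wave_ratio N (\<alpha> (Z \<omega>)) \<xi> r (Y (t1 + r) \<omega>))
        = (LINT \<omega>|M. indicator A (Z \<omega>) *\<^sub>R wave_ratio N (\<alpha> (Z \<omega>)) \<xi> 0 (Y t1 \<omega>))"
      by (rule wave_ratio_mean_constant) (auto simp: indicator_def)
    also have "E * \<dots> = (LINT \<omega>|M. (1 / ?h0 \<omega>) *\<^sub>R (indicator A (Z \<omega>) *\<^sub>R (cis (\<xi> \<bullet> Y t1 \<omega>) * E)))"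
      unfolding integral_mult_right_zero[symmetric]
      by (rule Bochner_Integration.integral_cong[OF refl]) (simp add: wave_ratio_def scaleR_conv_of_real mult_ac)
    also have "\<dots> = (LINT \<omega>|D2. indicator A (Z \<omega>) *\<^sub>R (cis (\<xi> \<bullet> Y t1 \<omega>) * E))"
      unfolding D2_def by (subst integral_density) (auto simp: h0 less_imp_le)
    also have "\<dots> = (LINT \<omega>|D2. (LINT w|gauss r. indicator A (Z \<omega>) *\<^sub>R cis (\<xi> \<bullet> (Y t1 \<omega> + w))))"
    proof (rule Bochner_Integration.integral_cong[OF refl])
      fix \<omega>
      have "(LINT w|gauss r. indicator A (Z \<omega>) *\<^sub>R cis (\<xi> \<bullet> (Y t1 \<omega> + w))) = (LINT w|gauss r. (indicator A (Z \<omega>) *\<^sub>R cis (\<xi> \<bullet> Y t1 \<omega>)) * cis (\<xi> \<bullet> w))"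
        by (simp add: inner_add_right cis_mult[symmetric])
      also have "\<dots> = (indicator A (Z \<omega>) *\<^sub>R cis (\<xi> \<bullet> Y t1 \<omega>)) * E"
        unfolding integral_mult_right_zero integral_gauss_cis[OF r] E_def ..
      finally show "indicator A (Z \<omega>) *\<^sub>R (cis (\<xi> \<bullet> Y t1 \<omega>) * E) = (LINT w|gauss r. indicator A (Z \<omega>) *\<^sub>R cis (\<xi> \<bullet> (Y t1 \<omega> + w)))"
        by auto
    qed
    also have "\<dots> = (LINT x|(D2 \<Otimes>\<^sub>M gauss r). indicator A (Z (fst x)) *\<^sub>R cis (\<xi> \<bullet> (Y t1 (fst x) + snd x)))"
    proof -
      have "integrable (D2 \<Otimes>\<^sub>M (gauss r :: (real ^ 'd) measure)) (\<lambda>x. indicator A (Z (fst x)) *\<^sub>R cis (\<xi> \<bullet> (Y t1 (fst x) + snd x)))"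
        by (rule DGf.integrable_const_bound[where B=1]) (auto simp: indicator_def)
      from DG.integral_fst'[OF this] show ?thesis by simp
    qed
    also have "\<dots> = (LINT x|m2. indicator A (fst x) *\<^sub>R cis (\<xi> \<bullet> snd x))"
      unfolding m2_def by (subst integral_distr) auto
    finally show "(LINT x|m1. indicator A (fst x) *\<^sub>R cis (\<xi> \<bullet> snd x)) = (LINT x|m2. indicator A (fst x) *\<^sub>R cis (\<xi> \<bullet> snd x))" .
  qed
  \<comment> \<open>Multiplying the test function by \<open>tilt_sum\<close> cancels the weight of
    \<open>D1\<close>.\<close>
  define K where "K x = F x * ennreal (tilt_sum N (\<alpha> (fst x)) r (snd x))" for x
  have Km[measurable]: "K \<in> borel_measurable (SU \<Otimes>\<^sub>M borel)" unfolding K_def[abs_def] by measurable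
  have "(\<integral>\<^sup>+\<omega>. F (Z \<omega>, Y (t1 + r) \<omega>) \<partial>M) = (\<integral>\<^sup>+\<omega>. ennreal (1 / ?hr \<omega>) * K (Z \<omega>, Y (t1 + r) \<omega>) \<partial>M)"
  proof (rule nn_integral_cong)
    fix \<omega>
    have "ennreal (1 / ?hr \<omega>) * ennreal (?hr \<omega>) = 1" using h0[of "Z \<omega>" r "Y (t1 + r) \<omega>"] by (subst ennreal_mult[symmetric]) auto
    then show "F (Z \<omega>, Y (t1 + r) \<omega>) = ennreal (1 / ?hr \<omega>) * K (Z \<omega>, Y (t1 + r) \<omega>)"
      by (simp add: K_def mult.left_commute)
  qed
  also have "\<dots> = (\<integral>\<^sup>+\<omega>. K (Z \<omega>, Y (t1 + r) \<omega>) \<partial>D1)" unfolding D1_def by (subst nn_integral_density) auto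
  also have "\<dots> = (\<integral>\<^sup>+x. K x \<partial>m1)" unfolding m1_def by (subst nn_integral_distr) auto
  also have "\<dots> = (\<integral>\<^sup>+x. K (Z (fst x), Y t1 (fst x) + snd x) \<partial>(D2 \<Otimes>\<^sub>M gauss r))" unfolding eq m2_def by (subst nn_integral_distr) auto
  also have "\<dots> = (\<integral>\<^sup>+\<omega>. (\<integral>\<^sup>+w. K (Z \<omega>, Y t1 \<omega> + w) \<partial>gauss r) \<partial>D2)" by (subst G.nn_integral_fst[symmetric]) auto
  also have "\<dots> = (\<integral>\<^sup>+\<omega>. ennreal (1 / ?h0 \<omega>) * (\<integral>\<^sup>+w. K (Z \<omega>, Y t1 \<omega> + w) \<partial>gauss r) \<partial>M)"
    unfolding D2_def by (subst nn_integral_density) auto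
  also have "\<dots> = (\<integral>\<^sup>+\<omega>. (\<integral>\<^sup>+y. F (Z \<omega>, y) * ennreal (tilt_kernel N (\<alpha> (Z \<omega>)) r (Y t1 \<omega>) y) \<partial>lborel) \<partial>M)"
  proof (rule nn_integral_cong)
    fix \<omega> assume w: "\<omega> \<in> space M"
    have Zs: "Z \<omega> \<in> space SU" using measurable_space[OF measurable_Z w] .
    have FZ[measurable]: "(\<lambda>y. F (Z \<omega>, y)) \<in> borel_measurable borel" "(\<lambda>y. K (Z \<omega>, y)) \<in> borel_measurable borel"
      using measurable_compose[OF measurable_Pair1'[OF Zs] F] measurable_compose[OF measurable_Pair1'[OF Zs] Km] by auto
    have [measurable]: "(\<lambda>y. tilt_sum N (\<alpha> (Z \<omega>)) r y) \<in> borel_measurable borel" by (intro borel_measurable_tilt_sum) auto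
    have "(\<integral>\<^sup>+w. K (Z \<omega>, Y t1 \<omega> + w) \<partial>gauss r) = (\<integral>\<^sup>+w. ennreal (gaussian_density r ((Y t1 \<omega> + w) - Y t1 \<omega>)) * K (Z \<omega>, Y t1 \<omega> + w) \<partial>lborel)"
      by (subst nn_integral_gauss) auto
    also have "\<dots> = (\<integral>\<^sup>+y. ennreal (gaussian_density r (y - Y t1 \<omega>)) * K (Z \<omega>, y) \<partial>lborel)"
      by (rule nn_integral_lborel_shift[of "\<lambda>y. ennreal (gaussian_density r (y - Y t1 \<omega>)) * K (Z \<omega>, y)"]) measurable
    finally have "ennreal (1 / ?h0 \<omega>) * (\<integral>\<^sup>+w. K (Z \<omega>, Y t1 \<omega> + w) \<partial>gauss r) =
      (\<integral>\<^sup>+y. ennreal (1 / ?h0 \<omega>) * (ennreal (gaussian_density r (y - Y t1 \<omega>)) * K (Z \<omega>, y)) \<partial>lborel)"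
      by (simp add: nn_integral_cmult)
    also have "\<dots> = (\<integral>\<^sup>+y. F (Z \<omega>, y) * ennreal (tilt_kernel N (\<alpha> (Z \<omega>)) r (Y t1 \<omega>) y) \<partial>lborel)"
    proof (rule nn_integral_cong)
      fix y
      have "ennreal (tilt_kernel N (\<alpha> (Z \<omega>)) r (Y t1 \<omega>) y) = ennreal (1 / ?h0 \<omega>) * (ennreal (gaussian_density r (y - Y t1 \<omega>)) * ennreal (tilt_sum N (\<alpha> (Z \<omega>)) r y))"
        unfolding tilt_kernel_eq[OF r]
        using h0[of "Z \<omega>" 0 "Y t1 \<omega>"] h0[of "Z \<omega>" r y] by (simp add: ennreal_mult[symmetric] mult_ac)
      then show "ennreal (1 / ?h0 \<omega>) * (ennreal (gaussian_density r (y - Y t1 \<omega>)) * K (Z \<omega>, y)) = F (Z \<omega>, y) * ennreal (tilt_kernel N (\<alpha> (Z \<omega>)) r (Y t1 \<omega>) y)"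
        by (simp add: K_def mult_ac)
    qed
    finally show "ennreal (1 / ?h0 \<omega>) * (\<integral>\<^sup>+w. K (Z \<omega>, Y t1 \<omega> + w) \<partial>gauss r) = (\<integral>\<^sup>+y. F (Z \<omega>, y) * ennreal (tilt_kernel N (\<alpha> (Z \<omega>)) r (Y t1 \<omega>) y) \<partial>lborel)" .
  qed
  finally show ?thesis .
qed

end

section \<open>Existence of solutions\<close>

lemma set_integral_split_Icc:
  fixes g :: "real \<Rightarrow> 'a::{banach,second_countable_topology}"
  assumes g: "set_integrable lborel {a..c} g" and abc: "a \<le> b" "b \<le> c"
  shows "(LINT u:{a..c}|lborel. g u) = (LINT u:{a..b}|lborel. g u) + (LINT u:{b..c}|lborel. g u)"
proof -
  have 1: "set_integrable lborel {a..b} g" by (rule set_integrable_subset[OF g]) (use abc in auto)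
  have 2: "set_integrable lborel {b<..c} g" by (rule set_integrable_subset[OF g]) (use abc in auto)
  have "{a..c} = {a..b} \<union> {b<..c}" using abc by auto
  then have "(LINT u:{a..c}|lborel. g u) = (LINT u:{a..b}|lborel. g u) + (LINT u:{b<..c}|lborel. g u)"
    using set_integral_Un[OF _ 1 2] by (simp add: ivl_disj_int)
  also have "(LINT u:{b<..c}|lborel. g u) = (LINT u:{b..c}|lborel. g u)"
  proof (rule set_integral_cong_set)
    have [measurable]: "(\<lambda>x. indicator {a..c} x *\<^sub>R g x) \<in> borel_measurable borel"
      using g by (auto simp: set_integrable_def dest: borel_measurable_integrable)
    have "(\<lambda>x. indicator S x *\<^sub>R (indicator {a..c} x *\<^sub>R g x)) \<in> borel_measurable borel" if [measurable]: "S \<in> sets borel" for S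
      by measurable
    moreover have "(\<lambda>x. indicator S x *\<^sub>R (indicator {a..c} x *\<^sub>R g x)) = (\<lambda>x. indicator S x *\<^sub>R g x)" if "S \<subseteq> {a..c}" for S
      using that by (auto simp: fun_eq_iff indicator_def)
    ultimately have *: "(\<lambda>x. indicator S x *\<^sub>R g x) \<in> borel_measurable borel" if "S \<in> sets borel" "S \<subseteq> {a..c}" for S
      using that by metis
    show "set_borel_measurable lborel {b<..c} g" "set_borel_measurable lborel {b..c} g"
      using abc unfolding set_borel_measurable_def by (auto intro!: *)
    show "AE x in lborel. (x \<in> {b..c}) = (x \<in> {b<..c})"
      using AE_lborel_singleton[of b] by eventually_elim auto
  qed
  finally show ?thesis .
qed

lemma norm_set_integral_le:
  fixes g :: "real \<Rightarrow> 'a::{banach,second_countable_topology}"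
  assumes g: "set_integrable lborel {a..b} g" and K: "\<And>u. u \<in> {a..b} \<Longrightarrow> norm (g u) \<le> K" and ab: "a \<le> b"
  shows "norm (LINT u:{a..b}|lborel. g u) \<le> K * (b - a)"
proof -
  have "norm (LINT u:{a..b}|lborel. g u) \<le> (LINT u|lborel. norm (indicator {a..b} u *\<^sub>R g u))"
    unfolding set_lebesgue_integral_def by (rule integral_norm_bound)
  also have "\<dots> \<le> (LINT u|lborel. K * indicator {a..b} u)"
    using g K by (intro integral_mono integrable_norm)
      (auto simp: set_integrable_def emeasure_lborel_Icc_eq split: split_indicator intro!: integrable_mult_right integrable_real_indicator)
  also have "\<dots> = K * (b - a)" using ab by simp
  finally show ?thesis .
qed

lemma norm_set_integral_le_integral:
  fixes g :: "'b \<Rightarrow> 'a::{banach,second_countable_topology}"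
  assumes g: "set_integrable M S g" and k: "set_integrable M S k" and le: "\<And>u. u \<in> S \<Longrightarrow> norm (g u) \<le> k u"
  shows "norm (LINT u:S|M. g u) \<le> (LINT u:S|M. k u)"
proof -
  have "norm (LINT u:S|M. g u) \<le> (LINT u|M. norm (indicator S u *\<^sub>R g u))"
    unfolding set_lebesgue_integral_def by (rule integral_norm_bound)
  also have "\<dots> \<le> (LINT u|M. indicator S u *\<^sub>R k u)"
  proof (rule integral_mono)
    show "integrable M (\<lambda>u. norm (indicator S u *\<^sub>R g u))"
      by (rule integrable_norm) (use g in \<open>simp only: set_integrable_def\<close>)
    show "integrable M (\<lambda>u. indicator S u *\<^sub>R k u)" using k by (simp only: set_integrable_def)
  qed (use le in \<open>auto split: split_indicator\<close>)
  finally show ?thesis by (simp only: set_lebesgue_integral_def)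
qed

section \<open>Picard iteration for a Lipschitz drift and a continuous forcing\<close>

primrec picard :: "(real \<Rightarrow> 'a \<Rightarrow> 'a) \<Rightarrow> (real \<Rightarrow> 'a) \<Rightarrow> nat \<Rightarrow> real \<Rightarrow> 'a::euclidean_space" where
  "picard f c 0 t = c t"
| "picard f c (Suc k) t = c t + (LINT v:{0..t}|lborel. f v (picard f c k v))"

context
  fixes f :: "real \<Rightarrow> 'a \<Rightarrow> 'a::euclidean_space" and c :: "real \<Rightarrow> 'a" and L K h :: real
  assumes fm[measurable]: "case_prod f \<in> borel_measurable (borel \<Otimes>\<^sub>M borel)"
    and lip: "\<And>u x y. norm (f u x - f u y) \<le> L * norm (x - y)" and L: "0 < L"
    and K: "\<And>u. norm (f u 0) \<le> K" and c: "continuous_on {0..h} c" and h: "0 \<le> h"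
begin

lemma lipschitz_growth: "norm (f u x) \<le> K + L * norm x"
  using norm_triangle_ineq[of "f u x - f u 0" "f u 0"] lip[of u x 0] K[of u] by simp

lemma set_integrable_along:
  assumes y: "continuous_on {0..h} y" and t: "t \<le> h"
  shows "set_integrable lborel {0..t} (\<lambda>u. f u (y u))"
    and "\<exists>C. \<forall>u\<in>{0..h}. norm (f u (y u)) \<le> C"
proof -
  have "bounded (y ` {0..h})" by (intro compact_imp_bounded compact_continuous_image y) auto
  then obtain C where C: "\<And>u. u \<in> {0..h} \<Longrightarrow> norm (y u) \<le> C" unfolding bounded_iff by blast
  have b: "norm (f u (y u)) \<le> K + L * C" if "u \<in> {0..h}" for u
    using lipschitz_growth[of u "y u"] mult_left_mono[OF C[OF that], of L] L by linarith
  then show "\<exists>C. \<forall>u\<in>{0..h}. norm (f u (y u)) \<le> C" by blast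
  have [measurable]: "(\<lambda>u. indicator {0..h} u *\<^sub>R y u) \<in> borel_measurable borel"
    by (rule borel_measurable_continuous_on_indicator) (auto intro: y)
  have "(\<lambda>u. indicator {0..t} u *\<^sub>R case_prod f (u, indicator {0..h} u *\<^sub>R y u)) \<in> borel_measurable borel"
    by measurable
  moreover have "(\<lambda>u. indicator {0..t} u *\<^sub>R case_prod f (u, indicator {0..h} u *\<^sub>R y u)) = (\<lambda>u. indicator {0..t} u *\<^sub>R f u (y u))"
    using t by (auto simp: fun_eq_iff indicator_def)
  ultimately have m: "(\<lambda>u. indicator {0..t} u *\<^sub>R f u (y u)) \<in> borel_measurable borel" by (simp only: case_prod_conv)
  show "set_integrable lborel {0..t} (\<lambda>u. f u (y u))"
    unfolding set_integrable_def
  proof (rule Bochner_Integration.integrable_bound[where f="\<lambda>u. (K + L * C) * indicator {0..t} u"])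
    show "integrable lborel (\<lambda>u. (K + L * C) * indicat_real {0..t} u)"
      by (intro integrable_mult_right integrable_real_indicator) (auto simp: emeasure_lborel_Icc_eq)
    show "AE u in lborel. norm (indicator {0..t} u *\<^sub>R f u (y u)) \<le> norm ((K + L * C) * indicat_real {0..t} u)"
      using b t by (auto split: split_indicator intro!: AE_I2 order_trans[OF b])
  qed (use m in simp)
qed

lemma continuous_on_picard_map:
  assumes y: "continuous_on {0..h} y"
  shows "continuous_on {0..h} (\<lambda>t. c t + (LINT v:{0..t}|lborel. f v (y v)))"
proof (intro continuous_on_add c)
  obtain C where C: "\<And>u. u \<in> {0..h} \<Longrightarrow> norm (f u (y u)) \<le> C" using set_integrable_along(2)[OF y order_refl] by blast
  have C0: "0 \<le> C" using order_trans[OF norm_ge_zero C[of 0]] h by simp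
  have le: "norm ((LINT v:{0..t}|lborel. f v (y v)) - (LINT v:{0..s}|lborel. f v (y v))) \<le> C * (t - s)" if st: "0 \<le> s" "s \<le> t" "t \<le> h" for s t
  proof -
    have i: "set_integrable lborel {0..t} (\<lambda>v. f v (y v))" by (rule set_integrable_along[OF y st(3)])
    have "(LINT v:{0..t}|lborel. f v (y v)) - (LINT v:{0..s}|lborel. f v (y v)) = (LINT v:{s..t}|lborel. f v (y v))"
      using set_integral_split_Icc[OF i st(1,2)] by simp
    also have "norm \<dots> \<le> C * (t - s)"
      by (rule norm_set_integral_le) (use st C in \<open>auto intro: set_integrable_subset[OF i]\<close>)
    finally show ?thesis .
  qed
  have "dist (LINT v:{0..s}|lborel. f v (y v)) (LINT v:{0..t}|lborel. f v (y v)) \<le> C * dist s t" if "s \<in> {0..h}" "t \<in> {0..h}" for s t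
    using le[of s t] le[of t s] that by (cases "s \<le> t") (auto simp: dist_norm norm_minus_commute)
  then have "C-lipschitz_on {0..h} (\<lambda>t. LINT v:{0..t}|lborel. f v (y v))"
    using C0 by (intro lipschitz_onI) auto
  then show "continuous_on {0..h} (\<lambda>t. LINT v:{0..t}|lborel. f v (y v))" by (rule lipschitz_on_continuous_on)
qed

lemma continuous_on_picard: "continuous_on {0..h} (picard f c k)"
proof (induction k)
  case 0 then show ?case using c by (simp add: fun_eq_iff)
next
  case (Suc k) then show ?case using continuous_on_picard_map[of "picard f c k"] by (simp add: fun_eq_iff)
qed

text \<open>Successive differences are measured against the growing weight
  \<open>exp (2 * L * t)\<close>, in which the integral operator contracts by the factor 1/2. The
  iteration thus converges on the whole interval, whatever the size of \<open>L * h\<close>. The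
  convergence of the iterates is part of the claim because it transfers their measurability to the
  solution.\<close>

lemma picard_limit:
  "\<exists>y. (\<forall>t\<in>{0..h}. (\<lambda>k. picard f c k t) \<longlonglongrightarrow> y t) \<and> continuous_on {0..h} y \<and>
     set_integrable lborel {0..h} (\<lambda>u. f u (y u)) \<and>
     (\<forall>t\<in>{0..h}. y t = c t + (LINT v:{0..t}|lborel. f v (y v)))"
proof -
  let ?D = "picard f c"
  obtain C where C: "\<And>u. u \<in> {0..h} \<Longrightarrow> norm (f u (c u)) \<le> C" using set_integrable_along(2)[OF c order_refl] by blast
  have C0: "0 \<le> C" using order_trans[OF norm_ge_zero C[of 0]] h by simp
  define A where "A = C * h"
  have A0: "0 \<le> A" using C0 h by (simp add: A_def)
  \<comment> \<open>Integrating \<open>L * exp (2 * L * v)\<close> up to \<open>t\<close> gives at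
    most half of \<open>exp (2 * L * t)\<close>, which is the gain of each step.\<close>
  have diff: "norm (?D (Suc k) t - ?D k t) \<le> A * (1/2)^k * exp (2 * L * t)" if "t \<in> {0..h}" for k t
    using that
  proof (induction k arbitrary: t)
    case 0
    have "norm (LINT v:{0..t}|lborel. f v (c v)) \<le> C * (t - 0)"
      by (rule norm_set_integral_le) (use 0 C set_integrable_along(1)[OF c, of t] in auto)
    also have "\<dots> \<le> A" unfolding A_def using 0 C0 by (intro mult_left_mono) auto
    also have "\<dots> \<le> A * exp (2 * L * t)" using A0 0 L by (intro mult_le_cancel_left1[THEN iffD2]) auto
    finally show ?case by simp
  next
    case (Suc k)
    have i: "set_integrable lborel {0..t} (\<lambda>v. f v (?D j v))" for j
      by (rule set_integrable_along(1)[OF continuous_on_picard]) (use Suc.prems in auto)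
    have "?D (Suc (Suc k)) t - ?D (Suc k) t = (LINT v:{0..t}|lborel. f v (?D (Suc k) v) - f v (?D k v))"
      using set_integral_diff(2)[OF i[of "Suc k"] i[of k]] by simp
    also have "norm \<dots> \<le> (LINT v:{0..t}|lborel. A * (1/2)^k * (L * exp (2 * L * v)))"
    proof -
      have ie: "set_integrable lborel {0..t} (\<lambda>v. A * (1/2)^k * (L * exp (2 * L * v)))"
        by (rule borel_integrable_atLeastAtMost') (intro continuous_intros)
      have id: "set_integrable lborel {0..t} (\<lambda>v. f v (?D (Suc k) v) - f v (?D k v))"
        by (rule set_integral_diff(1)[OF i i])
      have b: "norm (f v (?D (Suc k) v) - f v (?D k v)) \<le> A * (1/2)^k * (L * exp (2 * L * v))" if v: "v \<in> {0..t}" for v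
      proof -
        have "norm (f v (?D (Suc k) v) - f v (?D k v)) \<le> L * norm (?D (Suc k) v - ?D k v)" by (rule lip)
        also have "\<dots> \<le> L * (A * (1/2)^k * exp (2 * L * v))" using Suc v L by (intro mult_left_mono Suc.IH) auto
        finally show ?thesis by (simp add: mult_ac)
      qed
      show ?thesis by (rule norm_set_integral_le_integral[OF id ie b])
    qed
    also have "\<dots> = A * (1/2)^k * (exp (2 * L * t) / 2 - exp (2 * L * 0) / 2)"
    proof -
      have "(LINT v:{0..t}|lborel. L * exp (2 * L * v)) = exp (2 * L * t) / 2 - exp (2 * L * 0) / 2"
      proof -
        have "((\<lambda>v. exp (2 * L * v) / 2) has_real_derivative L * exp (2 * L * v)) (at v)" for v
          by (auto intro!: derivative_eq_intros)
        then have "(LINT v|lborel. indicator {0..t} v *\<^sub>R (L * exp (2 * L * v))) = exp (2 * L * t) / 2 - exp (2 * L * 0) / 2"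
          using Suc.prems
          by (intro integral_FTC_Icc) (auto simp: has_real_derivative_iff_has_vector_derivative[symmetric]
              intro: has_field_derivative_at_within intro!: continuous_intros)
        then show ?thesis by (simp only: set_lebesgue_integral_def)
      qed
      then show ?thesis by simp
    qed
    also have "\<dots> \<le> A * (1/2)^k * (exp (2 * L * t) / 2)"
      using A0 by (intro mult_left_mono) auto
    finally show ?case by (simp add: mult_ac)
  qed
  define y where "y t = c t + (\<Sum>k. ?D (Suc k) t - ?D k t)" for t
  have D: "?D k t = c t + (\<Sum>j<k. ?D (Suc j) t - ?D j t)" for k t
    by (subst sum_lessThan_telescope) simp
  have ul: "uniform_limit {0..h} (\<lambda>k t. \<Sum>j<k. ?D (Suc j) t - ?D j t) (\<lambda>t. \<Sum>j. ?D (Suc j) t - ?D j t) sequentially"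
  proof (rule Weierstrass_m_test)
    show "norm (?D (Suc k) t - ?D k t) \<le> A * (1/2)^k * exp (2 * L * h)" if t: "t \<in> {0..h}" for k t
      by (rule order_trans[OF diff[OF t]]) (use t L A0 in \<open>auto intro!: mult_left_mono\<close>)
    show "summable (\<lambda>k. A * (1/2)^k * exp (2 * L * h))"
      by (intro summable_mult summable_mult2 summable_geometric) auto
  qed
  have ul': "uniform_limit {0..h} ?D y sequentially"
  proof -
    have "uniform_limit {0..h} (\<lambda>k t. c t + (\<Sum>j<k. ?D (Suc j) t - ?D j t)) (\<lambda>t. c t + (\<Sum>j. ?D (Suc j) t - ?D j t)) sequentially"
      by (intro uniform_limit_intros ul)
    then show ?thesis unfolding D[symmetric] y_def[abs_def] .
  qed
  have lim: "(\<lambda>k. ?D k t) \<longlonglongrightarrow> y t" if "t \<in> {0..h}" for t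
    using tendsto_uniform_limitI[OF ul' that] .
  have yc: "continuous_on {0..h} y"
    by (rule uniform_limit_theorem[OF _ ul']) (auto simp: continuous_on_picard)
  have yi: "set_integrable lborel {0..t} (\<lambda>u. f u (y u))" if "t \<le> h" for t by (rule set_integrable_along(1)[OF yc that])
  have eq: "y t = c t + (LINT v:{0..t}|lborel. f v (y v))" if t: "t \<in> {0..h}" for t
  proof -
    have "(\<lambda>k. LINT v:{0..t}|lborel. f v (?D k v)) \<longlonglongrightarrow> (LINT v:{0..t}|lborel. f v (y v))"
    proof (rule LIMSEQ_I)
      fix e :: real assume e: "0 < e"
      define e' where "e' = e / (2 * (L * h + 1))"
      have Lh: "0 < L * h + 1" using L h by (simp add: add_nonneg_pos)
      have e': "0 < e'" using e Lh by (simp add: e'_def)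
      from uniform_limitD[OF ul' e'] obtain k0 where k0: "\<And>k t. k \<ge> k0 \<Longrightarrow> t \<in> {0..h} \<Longrightarrow> dist (?D k t) (y t) < e'"
        unfolding eventually_sequentially by blast
      show "\<exists>no. \<forall>k\<ge>no. norm ((LINT v:{0..t}|lborel. f v (?D k v)) - (LINT v:{0..t}|lborel. f v (y v))) < e"
      proof (intro exI[of _ k0] allI impI)
        fix k assume k: "k0 \<le> k"
        have i: "set_integrable lborel {0..t} (\<lambda>v. f v (?D k v))"
          by (rule set_integrable_along(1)[OF continuous_on_picard]) (use t in auto)
        have "norm ((LINT v:{0..t}|lborel. f v (?D k v)) - (LINT v:{0..t}|lborel. f v (y v))) = norm (LINT v:{0..t}|lborel. f v (?D k v) - f v (y v))"
          using set_integral_diff(2)[OF i yi] t by simp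
        also have "\<dots> \<le> (L * e') * (t - 0)"
        proof (rule norm_set_integral_le)
          show "set_integrable lborel {0..t} (\<lambda>v. f v (?D k v) - f v (y v))"
            by (rule set_integral_diff(1)[OF i yi]) (use t in auto)
          fix v assume "v \<in> {0..t}"
          then have "dist (?D k v) (y v) < e'" using t by (intro k0 k) auto
          then have "norm (?D k v - y v) \<le> e'" by (simp add: dist_norm)
          then show "norm (f v (?D k v) - f v (y v)) \<le> L * e'"
            using lip[of v "?D k v" "y v"] mult_left_mono[of "norm (?D k v - y v)" e' L] L by linarith
        qed (use t in auto)
        also have "\<dots> \<le> (L * h + 1) * e'"
        proof -
          have "L * e' * t \<le> L * e' * h" using t L e' by (intro mult_left_mono) auto
          then show ?thesis using e' by (simp add: algebra_simps)
        qed
        also have "\<dots> = e / 2"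
        proof -
          have z: "z * (e / (2 * z)) = e / 2" if "z \<noteq> 0" for z :: real using that by simp
          show ?thesis unfolding e'_def by (rule z) (use Lh in linarith)
        qed
        also have "\<dots> < e" using e by simp
        finally show "norm ((LINT v:{0..t}|lborel. f v (?D k v)) - (LINT v:{0..t}|lborel. f v (y v))) < e" .
      qed
    qed
    then have "(\<lambda>k. ?D (Suc k) t) \<longlonglongrightarrow> c t + (LINT v:{0..t}|lborel. f v (y v))"
      by (simp del: picard.simps(1)) (intro tendsto_intros)
    moreover have "(\<lambda>k. ?D (Suc k) t) \<longlonglongrightarrow> y t" using lim[OF t] by (rule LIMSEQ_Suc)
    ultimately show ?thesis by (metis LIMSEQ_unique)
  qed
  show ?thesis using lim yc yi[of h] eq by (intro exI[of _ y]) auto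
qed

end

context diffusion
begin

text \<open>Since the noise is additive, each path is solved separately with initial value plus
  noise as forcing. What remains is adaptedness: by induction every iterate, at times up to
  \<open>t\<close>, is jointly measurable over \<open>H t\<close> and time, and the solution is the
  limit of the iterates.\<close>

lemma sde_solution_exists:
  fixes f :: "real \<Rightarrow> (nat \<Rightarrow> real ^ 'd) \<times> real \<Rightarrow> real ^ 'd \<Rightarrow> real ^ 'd"
  assumes f[measurable]: "(\<lambda>(u, z, x). f u z x) \<in> borel_measurable (borel \<Otimes>\<^sub>M SU \<Otimes>\<^sub>M borel)"
    and lip: "\<And>u z x y. norm (f u z x - f u z y) \<le> L * norm (x - y)" and L: "0 < L"
    and K: "\<And>u z. norm (f u z 0) \<le> K" and h: "0 \<le> h"
  shows "\<exists>Y. (\<forall>t\<in>{0..h}. Y t \<in> borel_measurable (H t)) \<and>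
     (AE \<omega> in M. continuous_on {0..h} (\<lambda>t. Y t \<omega>) \<and>
        set_integrable lborel {0..h} (\<lambda>u. f u (Z \<omega>) (Y u \<omega>)) \<and>
        (\<forall>t\<in>{0..h}. Y t \<omega> = Y0 \<omega> + (LINT u:{0..t}|lborel. f u (Z \<omega>) (Y u \<omega>)) + B t \<omega>))"
proof -
  define c where "c \<omega> u = Y0 \<omega> + path_version B \<omega> u" for \<omega> u
  define D where "D k \<omega> = picard (\<lambda>u. f u (Z \<omega>)) (c \<omega>) k" for k \<omega>
  \<comment> \<open>\<open>lim\<close> also assigns a measurable value on the null set where the
    path is not continuous.\<close>
  define Y where "Y t \<omega> = lim (\<lambda>k. D k \<omega> t)" for t \<omega>
  \<comment> \<open>Times beyond \<open>t\<close> are replaced by 0, so that the iterate reads the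
    noise only up to \<open>t\<close>.\<close>
  have Dm: "(\<lambda>x. D k (fst x) (if snd x \<in> {0..t} then snd x else 0)) \<in> borel_measurable (H t \<Otimes>\<^sub>M borel)" if t: "0 \<le> t" for k t
  proof -
    define cl where "cl u = (if u \<in> {0..t} then u else 0)" for u
    have cl: "cl u \<in> {0..t}" for u using t by (auto simp: cl_def)
    have [measurable]: "cl \<in> borel_measurable borel" unfolding cl_def by measurable
    have [measurable]: "Y0 \<in> borel_measurable (H t)" by (rule measurable_H_Y0)
    have [measurable]: "Z \<in> measurable (H t) SU" using measurable_H_samples[of t] measurable_H_U[of t] by measurable
    have "(\<lambda>x. path_version B (fst x) (cl (snd x))) \<in> borel_measurable (H t \<Otimes>\<^sub>M borel)"
      by (rule measurable_path_version[where t=t]) (use cl in \<open>auto intro!: measurable_compose[OF measurable_fst measurable_H_B]\<close>)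
    then have cm[measurable]: "(\<lambda>x. c (fst x) (cl (snd x))) \<in> borel_measurable (H t \<Otimes>\<^sub>M borel)"
      unfolding c_def by measurable
    have "(\<lambda>x. D k (fst x) (cl (snd x))) \<in> borel_measurable (H t \<Otimes>\<^sub>M borel)"
    proof (induction k)
      case 0 then show ?case by (simp add: D_def)
    next
      case (Suc k)
      note [measurable] = Suc
      have "D (Suc k) \<omega> (cl u) = c \<omega> (cl u) + (LINT v|lborel. indicator {0..cl u} v *\<^sub>R f v (Z \<omega>) (D k \<omega> (cl v)))" for \<omega> u
        unfolding D_def picard.simps set_lebesgue_integral_def
        by (intro arg_cong2[where f="(+)"] refl Bochner_Integration.integral_cong) (use cl[of u] in \<open>auto simp: cl_def indicator_def\<close>)
      moreover have "(\<lambda>x. LINT v|lborel. indicator {0..cl (snd x)} v *\<^sub>R f v (Z (fst x)) (D k (fst x) (cl v))) \<in> borel_measurable (H t \<Otimes>\<^sub>M borel)"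
      proof (rule lborel.borel_measurable_lebesgue_integral)
        have "(\<lambda>p. D k (fst (fst p)) (cl (snd p))) \<in> borel_measurable ((H t \<Otimes>\<^sub>M borel) \<Otimes>\<^sub>M lborel)"
          using measurable_compose[of "\<lambda>p. (fst (fst p), snd p)" "(H t \<Otimes>\<^sub>M borel) \<Otimes>\<^sub>M lborel" "H t \<Otimes>\<^sub>M borel", OF _ Suc] by simp
        note [measurable] = this
        have [measurable]: "(\<lambda>p. f (snd p) (Z (fst (fst p))) (D k (fst (fst p)) (cl (snd p)))) \<in> borel_measurable ((H t \<Otimes>\<^sub>M borel) \<Otimes>\<^sub>M lborel)"
          using measurable_compose[of "\<lambda>p. (snd p, Z (fst (fst p)), D k (fst (fst p)) (cl (snd p)))" "(H t \<Otimes>\<^sub>M borel) \<Otimes>\<^sub>M lborel" "borel \<Otimes>\<^sub>M SU \<Otimes>\<^sub>M borel", OF _ f] by simp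
        have [measurable]: "(\<lambda>p. indicator {0..cl (snd (fst p))} (snd p) :: real) \<in> borel_measurable ((H t \<Otimes>\<^sub>M borel) \<Otimes>\<^sub>M lborel)"
        proof -
          have "(\<lambda>p :: ('w \<times> real) \<times> real. indicator {0..cl (snd (fst p))} (snd p) :: real) = (\<lambda>p. if 0 \<le> snd p \<and> snd p \<le> cl (snd (fst p)) then 1 else 0)"
            by (auto simp: fun_eq_iff indicator_def)
          then show ?thesis by (simp only:) measurable
        qed
        show "(\<lambda>(x, v). indicator {0..cl (snd x)} v *\<^sub>R f v (Z (fst x)) (D k (fst x) (cl v))) \<in> borel_measurable ((H t \<Otimes>\<^sub>M borel) \<Otimes>\<^sub>M lborel)"
          unfolding split_beta' by measurable
      qed
      ultimately show ?case by simp
    qed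
    then show ?thesis by (simp only: cl_def)
  qed
  have DHt: "D k \<omega> t = D k \<omega> (if t \<in> {0..t} then t else 0)" if "0 \<le> t" for k \<omega> t using that by simp
  have Ym: "Y t \<in> borel_measurable (H t)" if t: "t \<in> {0..h}" for t
    unfolding Y_def[abs_def]
  proof (rule borel_measurable_lim_metric)
    fix k
    have "(\<lambda>\<omega>. (\<lambda>x. D k (fst x) (if snd x \<in> {0..t} then snd x else 0)) (\<omega>, t)) \<in> borel_measurable (H t)"
      by (rule measurable_compose[OF _ Dm]) (use t in auto)
    then show "(\<lambda>\<omega>. D k \<omega> t) \<in> borel_measurable (H t)" using t by simp
  qed
  have "AE \<omega> in M. continuous_on {0..h} (\<lambda>t. Y t \<omega>) \<and>
        set_integrable lborel {0..h} (\<lambda>u. f u (Z \<omega>) (Y u \<omega>)) \<and>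
        (\<forall>t\<in>{0..h}. Y t \<omega> = Y0 \<omega> + (LINT u:{0..t}|lborel. f u (Z \<omega>) (Y u \<omega>)) + B t \<omega>)"
    using AE_continuous_B AE_space
  proof eventually_elim
    case (elim \<omega>)
    have pv: "path_version B \<omega> u = B u \<omega>" if "0 \<le> u" for u
      by (rule path_version_eq[where B=B and \<omega>=\<omega>, OF elim(1) that])
    have cc: "continuous_on {0..h} (c \<omega>)"
    proof -
      have "continuous_on {0..h} (\<lambda>u. Y0 \<omega> + B u \<omega>)"
        by (intro continuous_intros continuous_on_subset[OF elim(1)]) auto
      then show ?thesis by (rule continuous_on_cong[THEN iffD1, rotated -1]) (auto simp: c_def pv)
    qed
    have Zs: "Z \<omega> \<in> space SU" using elim(2) measurable_space[of Z M SU] by measurable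
    have fm: "(\<lambda>(u, x). f u (Z \<omega>) x) \<in> borel_measurable (borel \<Otimes>\<^sub>M borel)"
      using measurable_compose[of "\<lambda>p. (fst p, Z \<omega>, snd p)" "borel \<Otimes>\<^sub>M borel" "borel \<Otimes>\<^sub>M SU \<Otimes>\<^sub>M borel", OF _ f] Zs
      by (simp add: split_beta')
    obtain y where y: "\<And>t. t \<in> {0..h} \<Longrightarrow> (\<lambda>k. D k \<omega> t) \<longlonglongrightarrow> y t" "continuous_on {0..h} y"
      "set_integrable lborel {0..h} (\<lambda>u. f u (Z \<omega>) (y u))" "\<And>t. t \<in> {0..h} \<Longrightarrow> y t = c \<omega> t + (LINT v:{0..t}|lborel. f v (Z \<omega>) (y v))"
      using picard_limit[OF fm lip L K cc h] unfolding D_def by blast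
    have yY: "Y t \<omega> = y t" if "t \<in> {0..h}" for t unfolding Y_def by (rule limI[OF y(1)[OF that]])
    have Li: "(LINT v:{0..t}|lborel. f v (Z \<omega>) (Y v \<omega>)) = (LINT v:{0..t}|lborel. f v (Z \<omega>) (y v))" if "t \<in> {0..h}" for t
      by (rule set_lebesgue_integral_cong) (use that yY in auto)
    show ?case
    proof (intro conjI ballI)
      show "continuous_on {0..h} (\<lambda>t. Y t \<omega>)"
        using y(2) by (rule continuous_on_cong[THEN iffD1, rotated -1]) (auto simp: yY)
      show "set_integrable lborel {0..h} (\<lambda>u. f u (Z \<omega>) (Y u \<omega>))"
        using y(3) by (rule set_integrable_cong[THEN iffD1, rotated -1]) (auto simp: yY)
      show "Y t \<omega> = Y0 \<omega> + (LINT u:{0..t}|lborel. f u (Z \<omega>) (Y u \<omega>)) + B t \<omega>" if t: "t \<in> {0..h}" for t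
        using y(4)[OF t] t by (simp add: yY[OF t] Li[OF t] c_def pv)
    qed
  qed
  then show ?thesis using Ym by blast
qed

end

section \<open>Contraction to the origin\<close>

text \<open>Variation of constants. The noise is not differentiable, so it is subtracted first and
  the formula is derived for the difference. In the result, the exponential kernel acts on
  \<open>c u - c t1\<close>, which is small where the kernel is large.\<close>

lemma linear_drift_path:
  fixes y c :: "real \<Rightarrow> 'a::euclidean_space"
  assumes \<kappa>: "0 < \<kappa>" and t1: "0 \<le> t1" and c: "continuous_on {0..t1} c" and y: "continuous_on {0..t1} y"
    and eq: "\<And>t. t \<in> {0..t1} \<Longrightarrow> y t = y0 + (LINT u:{0..t}|lborel. - \<kappa> *\<^sub>R y u) + c t"
  shows "ennreal (norm (y t1)) \<le> ennreal (exp (- \<kappa> * t1)) * (ennreal (norm y0) + ennreal (norm (c t1)))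
     + (\<integral>\<^sup>+u. ennreal (\<kappa> * exp (- \<kappa> * (t1 - u))) * (indicator {0..t1} u * ennreal (norm (c u - c t1))) \<partial>lborel)"
proof -
  have yi: "set_integrable lborel {0..t} (\<lambda>u. - \<kappa> *\<^sub>R y u)" if "t \<le> t1" for t
    by (rule borel_integrable_atLeastAtMost') (use that in \<open>auto intro!: continuous_intros continuous_on_subset[OF y]\<close>)
  \<comment> \<open>Differentiable although \<open>y\<close> is not; the noise is centred at its
    final value, so that \<open>D t1 = y t1\<close>.\<close>
  define D where "D t = y t - (c t - c t1)" for t
  have D: "D t = y0 + c t1 + integral {0..t} (\<lambda>u. - \<kappa> *\<^sub>R y u)" if t: "t \<in> {0..t1}" for t
    using eq[OF t] set_borel_integral_eq_integral(2)[OF yi, of t] t by (simp add: D_def)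
  have dD: "(D has_vector_derivative (- \<kappa> *\<^sub>R y t)) (at t within {0..t1})" if t: "t \<in> {0..t1}" for t
  proof -
    have "((\<lambda>t. integral {0..t} (\<lambda>u. - \<kappa> *\<^sub>R y u)) has_vector_derivative (- \<kappa> *\<^sub>R y t)) (at t within {0..t1})"
      by (rule integral_has_vector_derivative[OF _ t]) (intro continuous_intros y)
    then have "((\<lambda>t. (y0 + c t1) + integral {0..t} (\<lambda>u. - \<kappa> *\<^sub>R y u)) has_vector_derivative (0 + - \<kappa> *\<^sub>R y t)) (at t within {0..t1})"
      by (intro derivative_intros)
    then have "((\<lambda>t. (y0 + c t1) + integral {0..t} (\<lambda>u. - \<kappa> *\<^sub>R y u)) has_vector_derivative (- \<kappa> *\<^sub>R y t)) (at t within {0..t1})" by simp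
    then show ?thesis by (rule has_vector_derivative_transform[OF t, rotated]) (simp add: D)
  qed
  let ?g = "\<lambda>u. (\<kappa> * exp (\<kappa> * u)) *\<^sub>R (c t1 - c u)"
  have gc: "continuous_on {0..t1} ?g" by (intro continuous_intros c)
  have gi: "set_integrable lborel {0..t1} ?g" by (rule borel_integrable_atLeastAtMost'[OF gc])
  have "(?g has_integral (exp (\<kappa> * t1) *\<^sub>R D t1 - exp (\<kappa> * 0) *\<^sub>R D 0)) {0..t1}"
  proof (rule fundamental_theorem_of_calculus[OF t1])
    fix t assume t: "t \<in> {0..t1}"
    have "((\<lambda>t. exp (\<kappa> * t)) has_vector_derivative \<kappa> * exp (\<kappa> * t)) (at t within {0..t1})"
      by (auto simp: has_real_derivative_iff_has_vector_derivative[symmetric] mult.commute intro!: derivative_eq_intros)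
    then have "((\<lambda>t. exp (\<kappa> * t) *\<^sub>R D t) has_vector_derivative (exp (\<kappa> * t) *\<^sub>R (- \<kappa> *\<^sub>R y t) + (\<kappa> * exp (\<kappa> * t)) *\<^sub>R D t)) (at t within {0..t1})"
      using dD[OF t] by (intro has_vector_derivative_scaleR) (auto simp: has_real_derivative_iff_has_vector_derivative)
    moreover have "exp (\<kappa> * t) *\<^sub>R (- \<kappa> *\<^sub>R y t) + (\<kappa> * exp (\<kappa> * t)) *\<^sub>R D t = ?g t"
      by (simp add: D_def algebra_simps)
    ultimately show "((\<lambda>t. exp (\<kappa> * t) *\<^sub>R D t) has_vector_derivative ?g t) (at t within {0..t1})" by simp
  qed
  then have "exp (\<kappa> * t1) *\<^sub>R y t1 = y0 + c t1 + (LINT u:{0..t1}|lborel. ?g u)"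
    using set_borel_integral_eq_integral(2)[OF gi] D[of 0] t1 by (simp add: integral_unique D_def)
  then have "exp (- \<kappa> * t1) *\<^sub>R (exp (\<kappa> * t1) *\<^sub>R y t1) = exp (- \<kappa> * t1) *\<^sub>R (y0 + c t1 + (LINT u:{0..t1}|lborel. ?g u))" by simp
  then have ye: "y t1 = exp (- \<kappa> * t1) *\<^sub>R (y0 + c t1) + (LINT u:{0..t1}|lborel. exp (- \<kappa> * t1) *\<^sub>R ?g u)"
    by (simp add: exp_add[symmetric] scaleR_right_distrib set_integral_scaleR_right del: scaleR_scaleR) (simp add: exp_add[symmetric])
  have gi': "set_integrable lborel {0..t1} (\<lambda>u. exp (- \<kappa> * t1) *\<^sub>R ?g u)"
    by (rule borel_integrable_atLeastAtMost') (intro continuous_intros c)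
  have I: "ennreal (norm (LINT u:{0..t1}|lborel. exp (- \<kappa> * t1) *\<^sub>R ?g u)) \<le>
     (\<integral>\<^sup>+u. ennreal (\<kappa> * exp (- \<kappa> * (t1 - u))) * (indicator {0..t1} u * ennreal (norm (c u - c t1))) \<partial>lborel)"
  proof -
    have "ennreal (norm (LINT u:{0..t1}|lborel. exp (- \<kappa> * t1) *\<^sub>R ?g u)) \<le> (\<integral>\<^sup>+u. norm (indicator {0..t1} u *\<^sub>R (exp (- \<kappa> * t1) *\<^sub>R ?g u)) \<partial>lborel)"
      unfolding set_lebesgue_integral_def by (rule integral_norm_bound_ennreal) (use gi' in \<open>simp only: set_integrable_def\<close>)
    also have "\<dots> = (\<integral>\<^sup>+u. ennreal (\<kappa> * exp (- \<kappa> * (t1 - u))) * (indicator {0..t1} u * ennreal (norm (c u - c t1))) \<partial>lborel)"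
    proof (rule nn_integral_cong)
      fix u
      have e: "exp (- \<kappa> * t1) * (\<kappa> * exp (\<kappa> * u)) = \<kappa> * exp (- \<kappa> * (t1 - u))"
        by (simp add: exp_add[symmetric] algebra_simps)
      have "norm (exp (- \<kappa> * t1) *\<^sub>R ?g u) = (\<kappa> * exp (- \<kappa> * (t1 - u))) * norm (c u - c t1)"
        unfolding scaleR_scaleR e using \<kappa> by (simp add: abs_mult norm_minus_commute)
      then show "ennreal (norm (indicator {0..t1} u *\<^sub>R (exp (- \<kappa> * t1) *\<^sub>R ?g u))) = ennreal (\<kappa> * exp (- \<kappa> * (t1 - u))) * (indicator {0..t1} u * ennreal (norm (c u - c t1)))"
        using \<kappa> by (simp only: indicator_def of_bool_def) (auto simp: ennreal_mult simp del: scaleR_scaleR norm_scaleR)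
    qed
    finally show ?thesis .
  qed
  have "norm (y t1) \<le> exp (- \<kappa> * t1) * (norm y0 + norm (c t1)) + norm (LINT u:{0..t1}|lborel. exp (- \<kappa> * t1) *\<^sub>R ?g u)"
  proof -
    have "norm (exp (- \<kappa> * t1) *\<^sub>R (y0 + c t1)) \<le> exp (- \<kappa> * t1) * (norm y0 + norm (c t1))"
      by (simp add: norm_triangle_ineq)
    then show ?thesis by (subst ye) (rule order_trans[OF norm_triangle_ineq], rule add_right_mono)
  qed
  then have "ennreal (norm (y t1)) \<le> ennreal (exp (- \<kappa> * t1) * (norm y0 + norm (c t1)) + norm (LINT u:{0..t1}|lborel. exp (- \<kappa> * t1) *\<^sub>R ?g u))"
    by (rule ennreal_leI)
  also have "\<dots> = ennreal (exp (- \<kappa> * t1)) * (ennreal (norm y0) + ennreal (norm (c t1))) + ennreal (norm (LINT u:{0..t1}|lborel. exp (- \<kappa> * t1) *\<^sub>R ?g u))"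
    by (simp add: ennreal_mult ennreal_plus)
  also have "\<dots> \<le> ennreal (exp (- \<kappa> * t1)) * (ennreal (norm y0) + ennreal (norm (c t1))) +
    (\<integral>\<^sup>+u. ennreal (\<kappa> * exp (- \<kappa> * (t1 - u))) * (indicator {0..t1} u * ennreal (norm (c u - c t1))) \<partial>lborel)"
    by (intro add_left_mono I)
  finally show ?thesis .
qed

text \<open>With \<open>x = \<kappa> * (t1 - u)\<close>, the inequality
  \<open>sqrt x \<le> exp (x / 2)\<close> trades half of the decay for the square root and leaves an
  elementary integral. The order \<open>1 / sqrt \<kappa>\<close> is that of the stationary
  deviation of an Ornstein-Uhlenbeck process.\<close>

lemma nn_integral_exp_sqrt_le:
  assumes \<kappa>: "0 < \<kappa>" and t1: "0 \<le> t1" and g: "0 \<le> g"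
  shows "(\<integral>\<^sup>+u. ennreal (\<kappa> * exp (- \<kappa> * (t1 - u))) * (indicator {0..t1} u * ennreal (sqrt \<bar>u - t1\<bar> * g)) \<partial>lborel) \<le> ennreal (2 * g / sqrt \<kappa>)"
proof -
  have le: "\<kappa> * exp (- \<kappa> * (t1 - u)) * sqrt (t1 - u) \<le> sqrt \<kappa> * exp (- \<kappa> / 2 * (t1 - u))" if "u \<le> t1" for u
  proof -
    define x where "x = \<kappa> * (t1 - u)"
    have x: "0 \<le> x" using that \<kappa> by (simp add: x_def)
    have "x \<le> exp x" using exp_ge_add_one_self[of x] by linarith
    then have "sqrt x \<le> sqrt (exp x)" by simp
    also have "sqrt (exp x) = exp (x / 2)" by (rule real_sqrt_unique) (simp_all add: power2_eq_square exp_add[symmetric])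
    finally have sx: "sqrt x \<le> exp (x / 2)" .
    have "\<kappa> * exp (- x) * sqrt (t1 - u) = sqrt \<kappa> * (exp (- x) * sqrt x)"
      using \<kappa> by (simp add: x_def real_sqrt_mult)
    also have "\<dots> \<le> sqrt \<kappa> * (exp (- x) * exp (x / 2))" using sx \<kappa> by (intro mult_left_mono) auto
    also have "\<dots> = sqrt \<kappa> * exp (- x / 2)" by (simp add: exp_add[symmetric])
    finally show ?thesis by (simp add: x_def)
  qed
  have "(\<integral>\<^sup>+u. ennreal (\<kappa> * exp (- \<kappa> * (t1 - u))) * (indicator {0..t1} u * ennreal (sqrt \<bar>u - t1\<bar> * g)) \<partial>lborel)
     \<le> (\<integral>\<^sup>+u. ennreal (g * (sqrt \<kappa> * exp (- \<kappa> / 2 * (t1 - u)))) * indicator {0..t1} u \<partial>lborel)"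
  proof (rule nn_integral_mono)
    fix u
    show "ennreal (\<kappa> * exp (- \<kappa> * (t1 - u))) * (indicator {0..t1} u * ennreal (sqrt \<bar>u - t1\<bar> * g)) \<le> ennreal (g * (sqrt \<kappa> * exp (- \<kappa> / 2 * (t1 - u)))) * indicator {0..t1} u"
    proof (cases "u \<in> {0..t1}")
      case True
      then have "ennreal (\<kappa> * exp (- \<kappa> * (t1 - u))) * ennreal (sqrt \<bar>u - t1\<bar> * g) = ennreal (g * (\<kappa> * exp (- \<kappa> * (t1 - u)) * sqrt (t1 - u)))"
        using \<kappa> g by (simp add: ennreal_mult[symmetric] mult_ac)
      also have "\<dots> \<le> ennreal (g * (sqrt \<kappa> * exp (- \<kappa> / 2 * (t1 - u))))"
        using True g by (intro ennreal_leI mult_left_mono le) auto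
      finally show ?thesis using True by simp
    qed simp
  qed
  also have "\<dots> = ennreal (2 * g / sqrt \<kappa> * exp (- \<kappa> / 2 * (t1 - t1)) - 2 * g / sqrt \<kappa> * exp (- \<kappa> / 2 * (t1 - 0)))"
  proof (rule nn_integral_FTC_Icc)
    fix u
    have "((\<lambda>u. k * exp (- \<kappa> / 2 * (t1 - u))) has_real_derivative (k * (exp (- \<kappa> / 2 * (t1 - u)) * (\<kappa> / 2)))) (at u)" for k
      by (auto intro!: derivative_eq_intros)
    from this[of "2 * g / sqrt \<kappa>"]
    have "((\<lambda>u. 2 * g / sqrt \<kappa> * exp (- \<kappa> / 2 * (t1 - u))) has_real_derivative (2 * g / sqrt \<kappa> * (exp (- \<kappa> / 2 * (t1 - u)) * (\<kappa> / 2)))) (at u)" .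
    moreover have "\<kappa> / sqrt \<kappa> = sqrt \<kappa>" using \<kappa> by (rule real_div_sqrt[OF less_imp_le])
    then have "2 * g / sqrt \<kappa> * (exp (- \<kappa> / 2 * (t1 - u)) * (\<kappa> / 2)) = g * (sqrt \<kappa> * exp (- \<kappa> / 2 * (t1 - u)))"
    proof -
      have "2 * g / sqrt \<kappa> * (exp (- \<kappa> / 2 * (t1 - u)) * (\<kappa> / 2)) = g * ((\<kappa> / sqrt \<kappa>) * exp (- \<kappa> / 2 * (t1 - u)))" by simp
      then show ?thesis using \<open>\<kappa> / sqrt \<kappa> = sqrt \<kappa>\<close> by simp
    qed
    ultimately show "((\<lambda>u. 2 * g / sqrt \<kappa> * exp (- \<kappa> / 2 * (t1 - u))) has_real_derivative g * (sqrt \<kappa> * exp (- \<kappa> / 2 * (t1 - u)))) (at u)"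
      by simp
  qed (use g \<kappa> t1 in auto)
  also have "\<dots> \<le> ennreal (2 * g / sqrt \<kappa>)" using g \<kappa> by (intro ennreal_leI) auto
  finally show ?thesis .
qed

context diffusion
begin

text \<open>The memory of the initial value and of the noise at \<open>t1\<close> decays
  exponentially; recent noise leaves the order \<open>1 / sqrt \<kappa>\<close>. A first moment
  suffices, as the later dependence on the starting point is linear.\<close>

lemma linear_drift_moment:
  assumes \<kappa>: "0 < \<kappa>" and t1: "0 < t1" and T: "0 < T"
    and Y: "Y \<in> borel_measurable M"
    and sol: "AE \<omega> in M. \<exists>y. y t1 = Y \<omega> \<and> continuous_on {0..t1} y \<and>
       (\<forall>t\<in>{0..t1}. y t = Y0 \<omega> + (LINT u:{0..t}|lborel. - \<kappa> *\<^sub>R y u) + B t \<omega>)"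
  shows "(\<integral>\<^sup>+\<omega>. ennreal (norm (Y \<omega>)) \<partial>M) \<le> ennreal (gauss_abs TYPE('d) * (exp (- \<kappa> * t1) * (sqrt T + sqrt t1) + 2 / sqrt \<kappa>))"
proof -
  let ?g = "gauss_abs TYPE('d)"
  have [measurable]: "B t1 \<in> borel_measurable M" "B 0 \<in> borel_measurable M" using t1 by (auto intro!: measurable_B)
  obtain J where J[measurable]: "J \<in> borel_measurable M"
    and JAE: "AE \<omega> in M. (\<integral>\<^sup>+u. ennreal (\<kappa> * exp (- \<kappa> * (t1 - u))) * (indicator {0..t1} u * ennreal (norm (B u \<omega> - B t1 \<omega>))) \<partial>lborel) = J \<omega>"
    and Ji: "(\<integral>\<^sup>+\<omega>. J \<omega> \<partial>M) = (\<integral>\<^sup>+u. ennreal (\<kappa> * exp (- \<kappa> * (t1 - u))) * (indicator {0..t1} u * ennreal (sqrt \<bar>u - t1\<bar> * ?g)) \<partial>lborel)"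
    using nn_integral_path_diff[of "\<lambda>u. ennreal (\<kappa> * exp (- \<kappa> * (t1 - u)))" 0 t1 t1] t1 by auto
  have "(\<integral>\<^sup>+\<omega>. ennreal (norm (Y \<omega>)) \<partial>M) \<le> (\<integral>\<^sup>+\<omega>. ennreal (exp (- \<kappa> * t1)) * (ennreal (norm (Y0 \<omega>)) + ennreal (norm (B t1 \<omega> - B 0 \<omega>))) + J \<omega> \<partial>M)"
  proof (rule nn_integral_mono_AE)
    show "AE \<omega> in M. ennreal (norm (Y \<omega>)) \<le> ennreal (exp (- \<kappa> * t1)) * (ennreal (norm (Y0 \<omega>)) + ennreal (norm (B t1 \<omega> - B 0 \<omega>))) + J \<omega>"
      using sol AE_continuous_B JAE AE_B0
    proof eventually_elim
      case (elim \<omega>)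
      then obtain y where y: "y t1 = Y \<omega>" "continuous_on {0..t1} y"
         "\<And>t. t \<in> {0..t1} \<Longrightarrow> y t = Y0 \<omega> + (LINT u:{0..t}|lborel. - \<kappa> *\<^sub>R y u) + B t \<omega>" by blast
      show ?case
        using linear_drift_path[OF \<kappa> less_imp_le[OF t1] continuous_on_subset[OF elim(2)] y(2,3)] elim y(1) by auto
    qed
  qed
  also have "\<dots> = ennreal (exp (- \<kappa> * t1)) * ((\<integral>\<^sup>+\<omega>. ennreal (norm (Y0 \<omega>)) \<partial>M) + (\<integral>\<^sup>+\<omega>. ennreal (norm (B t1 \<omega> - B 0 \<omega>)) \<partial>M)) + (\<integral>\<^sup>+\<omega>. J \<omega> \<partial>M)"
    by (simp add: nn_integral_add nn_integral_cmult)
  also have "(\<integral>\<^sup>+\<omega>. ennreal (norm (Y0 \<omega>)) \<partial>M) = ennreal (sqrt T * ?g)"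
  proof -
    have "distributed M lborel Y0 (\<lambda>x. ennreal (gaussian_density T x))" using input unfolding diffusion_input_def by blast
    then have "distr M lborel Y0 = gauss T" by (simp add: distributed_def gauss_def)
    then have "(\<integral>\<^sup>+x. ennreal (norm x) \<partial>distr M lborel Y0) = ennreal (sqrt T * ?g)" using nn_integral_gauss_norm[OF T, where 'd='d] by simp
    then show ?thesis by (subst (asm) nn_integral_distr) auto
  qed
  also have "(\<integral>\<^sup>+\<omega>. ennreal (norm (B t1 \<omega> - B 0 \<omega>)) \<partial>M) = ennreal (sqrt t1 * ?g)"
  proof -
    have "(\<integral>\<^sup>+x. ennreal (norm x) \<partial>distr M borel (\<lambda>\<omega>. B t1 \<omega> - B 0 \<omega>)) = ennreal (sqrt t1 * ?g)"
      using distr_increment[of 0 t1] t1 nn_integral_gauss_norm[OF t1, where 'd='d] by simp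
    then show ?thesis by (subst (asm) nn_integral_distr) auto
  qed
  also have "(\<integral>\<^sup>+\<omega>. J \<omega> \<partial>M) \<le> ennreal (2 * ?g / sqrt \<kappa>)"
    unfolding Ji by (rule nn_integral_exp_sqrt_le[OF \<kappa> less_imp_le[OF t1] gauss_abs_nonneg])
  also have "ennreal (exp (- \<kappa> * t1)) * (ennreal (sqrt T * ?g) + ennreal (sqrt t1 * ?g)) + ennreal (2 * ?g / sqrt \<kappa>)
     = ennreal (exp (- \<kappa> * t1) * (sqrt T * ?g + sqrt t1 * ?g) + 2 * ?g / sqrt \<kappa>)"
    using T t1 \<kappa> gauss_abs_nonneg[where 'd='d] by (simp add: ennreal_mult ennreal_plus)
  finally show ?thesis by (simp add: algebra_simps add_left_mono)
qed

end

section \<open>Smoothing bias\<close>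

locale borel_prob = prob_space P for P :: "(real ^ 'd::finite) measure" +
  assumes sets_P[measurable_cong, simp]: "sets P = sets borel"
begin

lemma space_P[simp]: "space P = UNIV"
  using sets_eq_imp_space_eq[OF sets_P] by simp

text \<open>The density of the convolution of \<open>P\<close> with a Gaussian of variance
  \<open>t\<close>, and thus the mean of the kernel estimator with this bandwidth.\<close>

definition smooth :: "real \<Rightarrow> real ^ 'd \<Rightarrow> real" where
  "smooth t x = (LINT y|P. gaussian_density t (x - y))"

text \<open>The sign is that of \<open>fourier\<close>, so that the two agree when \<open>P\<close>
  has a density.\<close>

definition chr :: "real ^ 'd \<Rightarrow> complex" where
  "chr \<xi> = (LINT x|P. cis ((- \<xi>) \<bullet> x))"

lemma integrable_gaussian_density_diff: "0 < t \<Longrightarrow> integrable P (\<lambda>y. gaussian_density t (x - y))"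
  by (rule integrable_const_bound[where B="(1 / sqrt (2 * pi * t)) ^ CARD('d)"])
     (auto simp: gaussian_density_le)

lemma borel_measurable_smooth[measurable]: "smooth t \<in> borel_measurable borel"
  unfolding smooth_def[abs_def] by measurable

lemma smooth_nonneg: "0 \<le> smooth t x"
  unfolding smooth_def by (rule integral_nonneg_AE) auto

lemma ennreal_smooth: "0 < t \<Longrightarrow> ennreal (smooth t x) = (\<integral>\<^sup>+y. ennreal (gaussian_density t (x - y)) \<partial>P)"
  unfolding smooth_def by (rule nn_integral_eq_integral[symmetric]) (auto simp: integrable_gaussian_density_diff)

lemma nn_integral_smooth:
  assumes "0 < t" and [measurable]: "f \<in> borel_measurable borel"
  shows "(\<integral>\<^sup>+x. f x * ennreal (smooth t x) \<partial>lborel) = (\<integral>\<^sup>+y. (\<integral>\<^sup>+w. f (y + w) \<partial>gauss t) \<partial>P)"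
  unfolding ennreal_smooth[OF assms(1)]
  by (rule nn_integral_gauss_smoothing[symmetric]) (auto simp: sigma_finite_measure_axioms)

lemma nn_integral_smooth_1: "0 < t \<Longrightarrow> (\<integral>\<^sup>+x. ennreal (smooth t x) \<partial>lborel) = 1"
proof -
  assume t: "0 < t"
  interpret G: prob_space "gauss t :: (real ^ 'd) measure" by (rule prob_space_gauss[OF t])
  have "emeasure (gauss t :: (real ^ 'd) measure) UNIV = 1" using G.emeasure_space_1 by simp
  then show ?thesis using nn_integral_smooth[OF t, of "\<lambda>_. 1"] emeasure_space_1 by simp
qed

lemma integrable_smooth: "0 < t \<Longrightarrow> integrable lborel (smooth t)"
  by (rule integrableI_nonneg) (auto simp: smooth_nonneg nn_integral_smooth_1)

text \<open>Semigroup property of the Gaussian kernels, averaged over \<open>P\<close>.\<close>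

lemma nn_integral_smooth_gauss:
  assumes a: "0 < a" and b: "0 < b"
  shows "(\<integral>\<^sup>+w. ennreal (smooth a (y + w)) \<partial>gauss b) = ennreal (smooth (a + b) y)"
proof -
  interpret G: prob_space "gauss b :: (real ^ 'd) measure" by (rule prob_space_gauss[OF b])
  interpret pair_sigma_finite "gauss b :: (real ^ 'd) measure" P ..
  have "(\<integral>\<^sup>+w. ennreal (smooth a (y + w)) \<partial>gauss b) = (\<integral>\<^sup>+w. (\<integral>\<^sup>+x. ennreal (gaussian_density a (y + w - x)) \<partial>P) \<partial>gauss b)"
    by (simp add: ennreal_smooth a)
  also have "\<dots> = (\<integral>\<^sup>+x. (\<integral>\<^sup>+w. ennreal (gaussian_density a (y + w - x)) \<partial>gauss b) \<partial>P)"
    by (rule Fubini'[symmetric]) measurable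
  also have "\<dots> = (\<integral>\<^sup>+x. ennreal (gaussian_density (a + b) (y - x)) \<partial>P)"
  proof (rule nn_integral_cong)
    fix x
    have "(\<integral>\<^sup>+w. ennreal (gaussian_density a (y + w - x)) \<partial>gauss b) = (\<integral>\<^sup>+w. ennreal (gaussian_density a ((x - y) - w) * gaussian_density b w) \<partial>lborel)"
    proof (subst nn_integral_gauss, measurable, intro nn_integral_cong)
      fix w
      have "gaussian_density a (y + w - x) = gaussian_density a ((x - y) - w)"
        using gaussian_density_uminus[of a "(x - y) - w"] by (simp add: algebra_simps)
      then show "ennreal (gaussian_density b w) * ennreal (gaussian_density a (y + w - x)) = ennreal (gaussian_density a ((x - y) - w) * gaussian_density b w)"
        by (simp add: ennreal_mult mult.commute)
    qed
    also have "\<dots> = ennreal (gaussian_density (a + b) (x - y))" by (rule nn_integral_gaussian_conv[OF a b])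
    finally show "(\<integral>\<^sup>+w. ennreal (gaussian_density a (y + w - x)) \<partial>gauss b) = ennreal (gaussian_density (a + b) (y - x))"
      by (simp add: gaussian_density_minus_commute[of "a + b" x])
  qed
  also have "\<dots> = ennreal (smooth (a + b) y)" using a b by (simp add: ennreal_smooth)
  finally show ?thesis .
qed

lemma smooth_le: "0 < t \<Longrightarrow> smooth t x \<le> (1 / sqrt (2 * pi * t)) ^ CARD('d)"
  unfolding smooth_def by (rule integral_le_const[OF integrable_gaussian_density_diff]) (auto simp: gaussian_density_le)

lemma integrable_smooth_P: "0 < t \<Longrightarrow> integrable P (smooth t)"
  by (rule integrable_const_bound[where B="(1 / sqrt (2 * pi * t)) ^ CARD('d)"])
     (auto simp: smooth_nonneg smooth_le)

text \<open>By the semigroup property, the scalar product of two smoothings is the mean of a third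
  one under \<open>P\<close>. Plancherel's identity for smoothings is thereby reduced to
  \<open>integral_smooth_P\<close>.\<close>

lemma smooth_prod:
  assumes a: "0 < a" and b: "0 < b"
  shows "integrable lborel (\<lambda>x. smooth a x * smooth b x)"
    and "(LINT x|lborel. smooth a x * smooth b x) = (LINT y|P. smooth (a + b) y)"
proof -
  have "(\<integral>\<^sup>+x. ennreal (smooth a x * smooth b x) \<partial>lborel) = (\<integral>\<^sup>+x. ennreal (smooth a x) * ennreal (smooth b x) \<partial>lborel)"
    by (simp add: ennreal_mult smooth_nonneg)
  also have "\<dots> = (\<integral>\<^sup>+y. ennreal (smooth (a + b) y) \<partial>P)"
    by (subst nn_integral_smooth[OF b]) (simp_all add: nn_integral_smooth_gauss a b)
  also have "\<dots> = ennreal (LINT y|P. smooth (a + b) y)"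
    by (rule nn_integral_eq_integral) (use a b in \<open>auto simp: integrable_smooth_P smooth_nonneg\<close>)
  finally have *: "(\<integral>\<^sup>+x. ennreal (smooth a x * smooth b x) \<partial>lborel) = ennreal (LINT y|P. smooth (a + b) y)" .
  show i: "integrable lborel (\<lambda>x. smooth a x * smooth b x)"
    by (rule integrableI_nonneg) (auto simp: smooth_nonneg *)
  have "ennreal (LINT x|lborel. smooth a x * smooth b x) = ennreal (LINT y|P. smooth (a + b) y)"
    using * nn_integral_eq_integral[OF i] by (simp add: smooth_nonneg)
  moreover have "0 \<le> (LINT x|lborel. smooth a x * smooth b x)" "0 \<le> (LINT y|P. smooth (a + b) y)"
    by (auto intro!: integral_nonneg_AE simp: smooth_nonneg)
  ultimately show "(LINT x|lborel. smooth a x * smooth b x) = (LINT y|P. smooth (a + b) y)" by simp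
qed

lemma borel_measurable_chr[measurable]: "chr \<in> borel_measurable borel"
  unfolding chr_def[abs_def] by measurable

lemma cmod_chr_le: "cmod (chr \<xi>) \<le> 1"
proof -
  have "cmod (chr \<xi>) \<le> (LINT x|P. cmod (cis ((- \<xi>) \<bullet> x)))" unfolding chr_def by (rule integral_norm_bound)
  then show ?thesis using prob_space by simp
qed

lemma integrable_exp_chr:
  assumes "0 < s" shows "integrable lborel (\<lambda>\<xi>. exp (- (norm \<xi>)\<^sup>2 * s / 2) * (cmod (chr \<xi>))\<^sup>2)"
  by (rule Bochner_Integration.integrable_bound[OF gaussian_density_fourier(1)[OF assms]])
     (auto simp: abs_mult cmod_chr_le power_le_one mult_left_le)

text \<open>The smoothing is a Fourier integral of \<open>chr\<close>; integrating it once more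
  under \<open>P\<close> produces the conjugate of \<open>chr\<close>, hence the squared
  modulus.\<close>

lemma integral_smooth_P:
  assumes s: "0 < s"
  shows "(LINT y|P. smooth s y) = (LINT \<xi>|lborel. exp (- (norm \<xi>)\<^sup>2 * s / 2) * (cmod (chr \<xi>))\<^sup>2) / (2 * pi) ^ CARD('d)"
proof -
  interpret pair_sigma_finite P "lborel :: (real ^ 'd) measure" ..
  have E: "integrable lborel (\<lambda>\<xi>::real ^ 'd. exp (- (norm \<xi>)\<^sup>2 * s / 2))" by (rule gaussian_density_fourier(1)[OF s])
  let ?f = "\<lambda>y \<xi>. complex_of_real (exp (- (norm \<xi>)\<^sup>2 * s / 2)) * (cis (y \<bullet> \<xi>) * chr \<xi>)"
  have [measurable]: "case_prod ?f \<in> borel_measurable (P \<Otimes>\<^sub>M lborel)" by measurable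
  have nf: "norm (?f y \<xi>) \<le> exp (- (norm \<xi>)\<^sup>2 * s / 2)" for y \<xi>
    using cmod_chr_le[of \<xi>] by (simp add: norm_mult mult_left_le)
  have int: "integrable (P \<Otimes>\<^sub>M lborel) (case_prod ?f)"
  proof (rule Fubini_integrable)
    have "integrable P (\<lambda>x. LINT \<xi>|lborel. exp (- (norm (\<xi> :: real ^ 'd))\<^sup>2 * s / 2))" by simp
    have ix: "integrable lborel (?f x)" for x
      by (rule Bochner_Integration.integrable_bound[OF E]) (use nf in auto)
    show "integrable P (\<lambda>x. LINT \<xi>|lborel. norm (case_prod ?f (x, \<xi>)))"
    proof (rule integrable_const_bound[where B="LINT \<xi>|lborel. exp (- (norm (\<xi> :: real ^ 'd))\<^sup>2 * s / 2)"])
      show "AE x in P. norm (LINT \<xi>|lborel. norm (case_prod ?f (x, \<xi>))) \<le> (LINT \<xi>|lborel. exp (- (norm (\<xi> :: real ^ 'd))\<^sup>2 * s / 2))"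
      proof (rule AE_I2)
        fix x
        have "(LINT \<xi>|lborel. norm (?f x \<xi>)) \<le> (LINT \<xi>|lborel. exp (- (norm (\<xi> :: real ^ 'd))\<^sup>2 * s / 2))"
          by (rule integral_mono[OF integrable_norm[OF ix] E nf])
        moreover have "0 \<le> (LINT \<xi>|lborel. norm (?f x \<xi>))" by (rule integral_nonneg_AE) auto
        ultimately show "norm (LINT \<xi>|lborel. norm (case_prod ?f (x, \<xi>))) \<le> (LINT \<xi>|lborel. exp (- (norm (\<xi> :: real ^ 'd))\<^sup>2 * s / 2))"
          by simp
      qed
    qed measurable
    show "AE x in P. integrable lborel (\<lambda>\<xi>. case_prod ?f (x, \<xi>))" using ix by auto
  qed measurable
  have cc: "(LINT y|P. cis (y \<bullet> \<xi>)) = cnj (chr \<xi>)" for \<xi>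
    unfolding chr_def Bochner_Integration.integral_cnj[symmetric] by (simp add: cis_cnj inner_commute)
  have "complex_of_real (LINT y|P. smooth s y) = (LINT y|P. complex_of_real (smooth s y))"
    by (rule integral_complex_of_real[symmetric])
  also have "\<dots> = (LINT y|P. (LINT \<xi>|lborel. ?f y \<xi>)) / (2 * pi) ^ CARD('d)"
    unfolding smooth_def gaussian_transform_char[OF finite_measure_axioms sets_P s] chr_def by (rule integral_divide_zero)
  also have "(LINT y|P. (LINT \<xi>|lborel. ?f y \<xi>)) = (LINT \<xi>|lborel. (LINT y|P. ?f y \<xi>))"
    by (rule Fubini_integral[OF int, symmetric])
  also have "\<dots> = (LINT \<xi>|lborel. complex_of_real (exp (- (norm \<xi>)\<^sup>2 * s / 2)) * ((LINT y|P. cis (y \<bullet> \<xi>)) * chr \<xi>))"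
    by (simp only: integral_mult_right_zero integral_mult_left_zero)
  also have "\<dots> = (LINT \<xi>|lborel. complex_of_real (exp (- (norm \<xi>)\<^sup>2 * s / 2) * (cmod (chr \<xi>))\<^sup>2))"
    unfolding cc by (intro Bochner_Integration.integral_cong refl) (simp add: complex_norm_square mult.commute del: of_real_power)
  also have "\<dots> = complex_of_real (LINT \<xi>|lborel. exp (- (norm \<xi>)\<^sup>2 * s / 2) * (cmod (chr \<xi>))\<^sup>2)"
    by (rule integral_complex_of_real)
  finally have "complex_of_real (LINT y|P. smooth s y) = complex_of_real ((LINT \<xi>|lborel. exp (- (norm \<xi>)\<^sup>2 * s / 2) * (cmod (chr \<xi>))\<^sup>2) / (2 * pi) ^ CARD('d))"
    by simp
  then show ?thesis by (simp only: of_real_eq_iff)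
qed

text \<open>Plancherel's identity for a difference: the square is expanded, each scalar product is
  transformed, and the three Gaussian factors recombine to a square.\<close>

lemma smooth_diff_sq:
  assumes a: "0 < a" and b: "0 < b"
  shows "integrable lborel (\<lambda>x. (smooth a x - smooth b x)\<^sup>2)"
    and "(LINT x|lborel. (smooth a x - smooth b x)\<^sup>2) =
      (LINT \<xi>|lborel. (exp (- (norm \<xi>)\<^sup>2 * a / 2) - exp (- (norm \<xi>)\<^sup>2 * b / 2))\<^sup>2 * (cmod (chr \<xi>))\<^sup>2) / (2 * pi) ^ CARD('d)" (is ?eq)
    and "integrable lborel (\<lambda>\<xi>. (exp (- (norm \<xi>)\<^sup>2 * a / 2) - exp (- (norm \<xi>)\<^sup>2 * b / 2))\<^sup>2 * (cmod (chr \<xi>))\<^sup>2)"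
proof -
  have sq: "(\<lambda>x. (smooth a x - smooth b x)\<^sup>2) = (\<lambda>x. (smooth a x * smooth a x - 2 * (smooth a x * smooth b x)) + smooth b x * smooth b x)"
    by (auto simp: fun_eq_iff power2_eq_square algebra_simps)
  show "integrable lborel (\<lambda>x. (smooth a x - smooth b x)\<^sup>2)"
    unfolding sq by (intro Bochner_Integration.integrable_add Bochner_Integration.integrable_diff integrable_mult_right smooth_prod a b)
  have ex: "(\<lambda>\<xi>. (exp (- (norm \<xi>)\<^sup>2 * a / 2) - exp (- (norm \<xi>)\<^sup>2 * b / 2))\<^sup>2 * (cmod (chr \<xi>))\<^sup>2)
    = (\<lambda>\<xi>. (exp (- (norm \<xi>)\<^sup>2 * (a + a) / 2) * (cmod (chr \<xi>))\<^sup>2 - 2 * (exp (- (norm \<xi>)\<^sup>2 * (a + b) / 2) * (cmod (chr \<xi>))\<^sup>2)) + exp (- (norm \<xi>)\<^sup>2 * (b + b) / 2) * (cmod (chr \<xi>))\<^sup>2)"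
  proof
    fix \<xi> :: "real ^ 'd"
    have e: "exp (- (norm \<xi>)\<^sup>2 * (s + t) / 2) = exp (- (norm \<xi>)\<^sup>2 * s / 2) * exp (- (norm \<xi>)\<^sup>2 * t / 2)" for s t
      by (simp add: exp_add[symmetric] algebra_simps add_divide_distrib diff_divide_distrib)
    show "(exp (- (norm \<xi>)\<^sup>2 * a / 2) - exp (- (norm \<xi>)\<^sup>2 * b / 2))\<^sup>2 * (cmod (chr \<xi>))\<^sup>2 =
      (exp (- (norm \<xi>)\<^sup>2 * (a + a) / 2) * (cmod (chr \<xi>))\<^sup>2 - 2 * (exp (- (norm \<xi>)\<^sup>2 * (a + b) / 2) * (cmod (chr \<xi>))\<^sup>2)) + exp (- (norm \<xi>)\<^sup>2 * (b + b) / 2) * (cmod (chr \<xi>))\<^sup>2"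
      unfolding e by (simp add: power2_diff power2_eq_square algebra_simps)
  qed
  have i: "integrable lborel (\<lambda>\<xi>. exp (- (norm \<xi>)\<^sup>2 * (a + a) / 2) * (cmod (chr \<xi>))\<^sup>2)"
    "integrable lborel (\<lambda>\<xi>. exp (- (norm \<xi>)\<^sup>2 * (a + b) / 2) * (cmod (chr \<xi>))\<^sup>2)"
    "integrable lborel (\<lambda>\<xi>. exp (- (norm \<xi>)\<^sup>2 * (b + b) / 2) * (cmod (chr \<xi>))\<^sup>2)"
    by (rule integrable_exp_chr, use a b in simp)+
  show "integrable lborel (\<lambda>\<xi>. (exp (- (norm \<xi>)\<^sup>2 * a / 2) - exp (- (norm \<xi>)\<^sup>2 * b / 2))\<^sup>2 * (cmod (chr \<xi>))\<^sup>2)"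
    unfolding ex by (intro Bochner_Integration.integrable_add Bochner_Integration.integrable_diff integrable_mult_right i)
  have l: "(LINT x|lborel. (smooth a x - smooth b x)\<^sup>2) = (LINT x|lborel. smooth a x * smooth a x) - 2 * (LINT x|lborel. smooth a x * smooth b x) + (LINT x|lborel. smooth b x * smooth b x)"
    unfolding sq
    by (subst Bochner_Integration.integral_add, intro Bochner_Integration.integrable_diff integrable_mult_right smooth_prod a b, intro smooth_prod b,
        subst Bochner_Integration.integral_diff, intro smooth_prod a, intro integrable_mult_right smooth_prod a b) simp
  have r: "(LINT \<xi>|lborel. (exp (- (norm \<xi>)\<^sup>2 * a / 2) - exp (- (norm \<xi>)\<^sup>2 * b / 2))\<^sup>2 * (cmod (chr \<xi>))\<^sup>2) =
    (LINT \<xi>|lborel. exp (- (norm \<xi>)\<^sup>2 * (a + a) / 2) * (cmod (chr \<xi>))\<^sup>2) - 2 * (LINT \<xi>|lborel. exp (- (norm \<xi>)\<^sup>2 * (a + b) / 2) * (cmod (chr \<xi>))\<^sup>2)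
     + (LINT \<xi>|lborel. exp (- (norm \<xi>)\<^sup>2 * (b + b) / 2) * (cmod (chr \<xi>))\<^sup>2)"
    unfolding ex
    by (subst Bochner_Integration.integral_add, intro Bochner_Integration.integrable_diff integrable_mult_right i, rule i,
        subst Bochner_Integration.integral_diff, rule i, intro integrable_mult_right i) (simp only: integral_mult_right_zero)
  have "0 < a + a" "0 < a + b" "0 < b + b" using a b by auto
  then show ?eq
    unfolding l r smooth_prod(2)[OF a a] smooth_prod(2)[OF a b] smooth_prod(2)[OF b b]
    by (simp only: integral_smooth_P) (simp add: diff_divide_distrib add_divide_distrib)
qed

end

text \<open>The difference is at most the minimum of 1 and \<open>t * y\<close>, and its square is
  at most the power \<beta> of \<open>t * y\<close> as long as \<open>\<beta> \<le> 2\<close>. This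
  is the usual saturation of a kernel of second order.\<close>

lemma heat_multiplier_le:
  fixes \<beta> e t y :: real
  assumes \<beta>: "0 < \<beta>" "\<beta> \<le> 2" and e: "0 \<le> e" "e \<le> t" and y: "0 \<le> y"
  shows "(exp (- y * e) - exp (- y * t))\<^sup>2 \<le> (t * y) powr \<beta>"
proof (cases "t * y = 0")
  \<comment> \<open>In HOL \<open>0 powr \<beta>\<close> is 0, so the left-hand side has to vanish
    as well; it does, both exponents being 0.\<close>
  case True
  then have "y * e = 0 \<and> y * t = 0" using e by (cases "y = 0") auto
  then show ?thesis using True by auto
next
  case False
  then have ty: "0 < t * y" using e y by (simp add: less_le)
  have "exp (- y * t) \<le> exp (- y * e)" using e y by (simp add: mult_left_mono)
  moreover have "exp (- y * e) \<le> 1" using e y by simp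
  ultimately have a: "0 \<le> exp (- y * e) - exp (- y * t)" "exp (- y * e) - exp (- y * t) \<le> 1 - exp (- y * t)" by auto
  have "1 - exp (- y * t) \<le> t * y" using exp_ge_add_one_self[of "- y * t"] by (simp add: mult.commute)
  moreover have "1 - exp (- y * t) \<le> 1" by simp
  ultimately have b: "exp (- y * e) - exp (- y * t) \<le> min 1 (t * y)" using a by linarith
  have "(exp (- y * e) - exp (- y * t))\<^sup>2 \<le> (min 1 (t * y))\<^sup>2" using a b by (intro power_mono) auto
  also have "\<dots> \<le> (t * y) powr \<beta>"
  proof (cases "t * y \<le> 1")
    case True
    then have "(min 1 (t * y))\<^sup>2 = (t * y) powr 2" using ty by (simp add: powr_numeral)
    also have "\<dots> \<le> (t * y) powr \<beta>" using True ty \<beta> by (intro powr_mono') auto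
    finally show ?thesis .
  next
    case False
    then show ?thesis using \<beta> by (simp add: ge_one_powr_ge_zero)
  qed
  finally show ?thesis .
qed

text \<open>The largest coordinate dominates: the squared norm is at most d times its square. This
  reduces the isotropic weight to the multi-indices \<beta> e_j, which the Sobolev class
  admits.\<close>

lemma norm_powr_le_sum:
  fixes \<xi> :: "real ^ 'd"
  assumes \<beta>: "0 < \<beta>"
  shows "((norm \<xi>)\<^sup>2) powr \<beta> \<le> real CARD('d) powr \<beta> * (\<Sum>j\<in>UNIV. (abs_monomial (axis j \<beta>) \<xi>)\<^sup>2)"
proof -
  have am: "(abs_monomial (axis j \<beta>) \<xi>)\<^sup>2 = (\<bar>\<xi> $ j\<bar>\<^sup>2) powr \<beta>" for j
  proof -
    have "abs_monomial (axis j \<beta>) \<xi> = (\<Prod>i\<in>UNIV. if i = j then \<bar>\<xi> $ j\<bar> powr \<beta> else 1)"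
      unfolding abs_monomial_def by (rule prod.cong) (use \<beta> in \<open>auto simp: axis_def\<close>)
    also have "\<dots> = \<bar>\<xi> $ j\<bar> powr \<beta>" by simp
    finally show ?thesis by (simp only: power2_eq_square powr_mult abs_ge_zero)
  qed
  obtain j where j: "\<And>i. \<bar>\<xi> $ i\<bar> \<le> \<bar>\<xi> $ j\<bar>"
  proof -
    have "Max (range (\<lambda>i. \<bar>\<xi> $ i\<bar>)) \<in> range (\<lambda>i. \<bar>\<xi> $ i\<bar>)" by (rule Max_in) auto
    then obtain j where j: "Max (range (\<lambda>i. \<bar>\<xi> $ i\<bar>)) = \<bar>\<xi> $ j\<bar>" by (rule rangeE)
    have "\<bar>\<xi> $ i\<bar> \<le> \<bar>\<xi> $ j\<bar>" for i unfolding j[symmetric] by (rule Max_ge) auto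
    then show ?thesis by (rule that)
  qed
  have "(norm \<xi>)\<^sup>2 = (\<Sum>i\<in>UNIV. \<bar>\<xi> $ i\<bar>\<^sup>2)" by (simp add: norm_vec_def L2_set_def sum_nonneg)
  also have "\<dots> \<le> (\<Sum>i\<in>(UNIV :: 'd set). \<bar>\<xi> $ j\<bar>\<^sup>2)" by (intro sum_mono power_mono j) auto
  also have "\<dots> = real CARD('d) * \<bar>\<xi> $ j\<bar>\<^sup>2" by simp
  finally have "((norm \<xi>)\<^sup>2) powr \<beta> \<le> (real CARD('d) * \<bar>\<xi> $ j\<bar>\<^sup>2) powr \<beta>" using \<beta> by (intro powr_mono2) auto
  also have "\<dots> = real CARD('d) powr \<beta> * (abs_monomial (axis j \<beta>) \<xi>)\<^sup>2" unfolding am by (rule powr_mult)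
  also have "\<dots> \<le> real CARD('d) powr \<beta> * (\<Sum>j\<in>UNIV. (abs_monomial (axis j \<beta>) \<xi>)\<^sup>2)"
    by (intro mult_left_mono member_le_sum) auto
  finally show ?thesis .
qed

lemma borel_measurable_abs_monomial[measurable]: "abs_monomial \<alpha> \<in> borel_measurable borel"
  unfolding abs_monomial_def[abs_def] by measurable

context borel_prob
begin

text \<open>The multiplier bound is integrated against the Sobolev condition. The result does not
  depend on \<open>e\<close>, which permits the limit \<open>e \<rightarrow> 0\<close>
  below.\<close>

lemma smooth_diff_L2:
  assumes \<beta>: "0 < \<beta>" "\<beta> \<le> 2" and et: "0 < e" "e \<le> t"
    and sob: "\<And>j. (\<integral>\<^sup>+ \<xi>. ennreal ((abs_monomial (axis j \<beta>) \<xi>)\<^sup>2 * (cmod (chr \<xi>))\<^sup>2) \<partial>lborel) \<le> ennreal ((2 * pi) ^ CARD('d) * L\<^sup>2)"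
  shows "(LINT x|lborel. (smooth e x - smooth t x)\<^sup>2) \<le> t powr \<beta> * (real CARD('d) powr \<beta> * real CARD('d) * L\<^sup>2)"
proof -
  let ?d = "real CARD('d)"
  have t: "0 < t" using et by simp
  let ?f = "\<lambda>\<xi>. (exp (- (norm \<xi>)\<^sup>2 * e / 2) - exp (- (norm \<xi>)\<^sup>2 * t / 2))\<^sup>2 * (cmod (chr \<xi>))\<^sup>2"
  let ?g = "\<lambda>j \<xi>. (abs_monomial (axis j \<beta>) \<xi>)\<^sup>2 * (cmod (chr \<xi>))\<^sup>2"
  have pw: "?f \<xi> \<le> t powr \<beta> * ?d powr \<beta> * (\<Sum>j\<in>UNIV. ?g j \<xi>)" for \<xi>
  proof -
    have "(exp (- (norm \<xi>)\<^sup>2 * e / 2) - exp (- (norm \<xi>)\<^sup>2 * t / 2))\<^sup>2 \<le> (t * ((norm \<xi>)\<^sup>2 / 2)) powr \<beta>"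
      using heat_multiplier_le[OF \<beta>, of e t "(norm \<xi>)\<^sup>2 / 2"] et by simp
    also have "\<dots> \<le> (t * (norm \<xi>)\<^sup>2) powr \<beta>" using t \<beta> by (intro powr_mono2) auto
    also have "\<dots> = t powr \<beta> * ((norm \<xi>)\<^sup>2) powr \<beta>" by (rule powr_mult)
    also have "\<dots> \<le> t powr \<beta> * (?d powr \<beta> * (\<Sum>j\<in>UNIV. (abs_monomial (axis j \<beta>) \<xi>)\<^sup>2))"
      by (intro mult_left_mono norm_powr_le_sum \<beta>) auto
    finally have "?f \<xi> \<le> t powr \<beta> * (?d powr \<beta> * (\<Sum>j\<in>UNIV. (abs_monomial (axis j \<beta>) \<xi>)\<^sup>2)) * (cmod (chr \<xi>))\<^sup>2"
      by (rule mult_right_mono) simp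
    then show ?thesis by (simp add: sum_distrib_right mult.assoc)
  qed
  have "ennreal (LINT \<xi>|lborel. ?f \<xi>) = (\<integral>\<^sup>+\<xi>. ennreal (?f \<xi>) \<partial>lborel)"
    by (rule nn_integral_eq_integral[symmetric, OF smooth_diff_sq(3)[OF et(1) t]]) auto
  also have "\<dots> \<le> (\<integral>\<^sup>+\<xi>. ennreal (t powr \<beta> * ?d powr \<beta>) * (\<Sum>j\<in>UNIV. ennreal (?g j \<xi>)) \<partial>lborel)"
  proof (rule nn_integral_mono)
    fix \<xi>
    have "ennreal (?f \<xi>) \<le> ennreal (t powr \<beta> * ?d powr \<beta> * (\<Sum>j\<in>UNIV. ?g j \<xi>))" by (rule ennreal_leI[OF pw])
    also have "\<dots> = ennreal (t powr \<beta> * ?d powr \<beta>) * (\<Sum>j\<in>UNIV. ennreal (?g j \<xi>))"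
      by (subst ennreal_mult) (simp_all add: sum_nonneg sum_ennreal)
    finally show "ennreal (?f \<xi>) \<le> ennreal (t powr \<beta> * ?d powr \<beta>) * (\<Sum>j\<in>UNIV. ennreal (?g j \<xi>))" .
  qed
  also have "\<dots> = ennreal (t powr \<beta> * ?d powr \<beta>) * (\<Sum>j\<in>UNIV. (\<integral>\<^sup>+\<xi>. ennreal (?g j \<xi>) \<partial>lborel))"
    by (subst nn_integral_cmult, measurable, subst nn_integral_sum) auto
  also have "\<dots> \<le> ennreal (t powr \<beta> * ?d powr \<beta>) * (\<Sum>j\<in>(UNIV :: 'd set). ennreal ((2 * pi) ^ CARD('d) * L\<^sup>2))"
    by (intro mult_left_mono sum_mono sob) auto
  also have "\<dots> = ennreal (t powr \<beta> * ?d powr \<beta> * (?d * ((2 * pi) ^ CARD('d) * L\<^sup>2)))"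
    by (simp add: ennreal_mult sum_ennreal ennreal_of_nat_eq_real_of_nat)
  finally have "(LINT \<xi>|lborel. ?f \<xi>) \<le> t powr \<beta> * ?d powr \<beta> * (?d * ((2 * pi) ^ CARD('d) * L\<^sup>2))"
    by (subst (asm) ennreal_le_iff) auto
  then show ?thesis unfolding smooth_diff_sq(2)[OF et(1) t]
    by (subst pos_divide_le_eq) (auto simp: mult_ac)
qed

end

text \<open>Cauchy-Schwarz, derived from the pointwise bound
  \<open>\<bar>h x\<bar> \<le> l / 2 * (h x)\<^sup>2 + 1 / (2 * l)\<close>. In this form it stays
  within nonnegative integrals.\<close>

lemma nn_integral_abs_le_sqrt:
  fixes h :: "'a \<Rightarrow> real"
  assumes [measurable]: "h \<in> borel_measurable N" "A \<in> sets N"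
    and I: "(\<integral>\<^sup>+x. ennreal ((h x)\<^sup>2) \<partial>N) \<le> ennreal I" "0 < I" and v: "emeasure N A \<le> ennreal v" "0 < v"
  shows "(\<integral>\<^sup>+x. indicator A x * ennreal \<bar>h x\<bar> \<partial>N) \<le> ennreal (sqrt (v * I))"
proof -
  \<comment> \<open>The minimiser of \<open>l / 2 * I + v / (2 * l)\<close>.\<close>
  define l where "l = sqrt (v / I)"
  have l: "0 < l" using I v by (simp add: l_def)
  have "\<bar>h x\<bar> \<le> l / 2 * (h x)\<^sup>2 + 1 / (2 * l)" for x
  proof -
    have "0 \<le> (l * \<bar>h x\<bar> - 1)\<^sup>2 / (2 * l)" using l by simp
    also have "\<dots> = l / 2 * (h x)\<^sup>2 + 1 / (2 * l) - \<bar>h x\<bar>" using l by (simp add: power2_eq_square field_simps)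
    finally show ?thesis by simp
  qed
  then have "(\<integral>\<^sup>+x. indicator A x * ennreal \<bar>h x\<bar> \<partial>N) \<le> (\<integral>\<^sup>+x. ennreal (l / 2) * ennreal ((h x)\<^sup>2) + ennreal (1 / (2 * l)) * indicator A x \<partial>N)"
    using l by (intro nn_integral_mono) (auto simp: ennreal_mult[symmetric] ennreal_plus[symmetric] simp del: ennreal_plus split: split_indicator intro!: ennreal_leI)
  also have "\<dots> = ennreal (l / 2) * (\<integral>\<^sup>+x. ennreal ((h x)\<^sup>2) \<partial>N) + ennreal (1 / (2 * l)) * emeasure N A"
    by (simp add: nn_integral_add nn_integral_cmult)
  also have "\<dots> \<le> ennreal (l / 2) * ennreal I + ennreal (1 / (2 * l)) * ennreal v"
    by (intro add_mono mult_left_mono I v) auto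
  also have "\<dots> = ennreal (l / 2 * I + 1 / (2 * l) * v)"
    using l I v by (simp add: ennreal_mult[symmetric] ennreal_plus[symmetric] del: ennreal_plus)
  also have "l / 2 * I + 1 / (2 * l) * v = sqrt (v * I)"
  proof -
    have "l * I = sqrt (v * I)"
      using I v by (simp add: l_def real_sqrt_divide real_sqrt_mult real_div_sqrt field_simps)
    moreover have "v / l = sqrt (v * I)"
      using I v by (simp add: l_def real_sqrt_divide real_sqrt_mult field_simps)
    ultimately show ?thesis using l by (simp add: field_simps)
  qed
  finally show ?thesis .
qed

section \<open>Localisation to a cube and exponential tails\<close>

definition cube :: "real \<Rightarrow> (real ^ 'd) set" where
  "cube \<rho> = cbox (\<chi> i. - \<rho>) (\<chi> i. \<rho>)"

lemma mem_cube: "x \<in> cube \<rho> \<longleftrightarrow> (\<forall>j. \<bar>x $ j\<bar> \<le> \<rho>)"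
  by (auto simp: cube_def mem_box_cart abs_le_iff minus_le_iff)

lemma cube_borel[measurable]: "cube \<rho> \<in> sets borel"
  by (simp add: cube_def)

lemma emeasure_cube:
  assumes "0 \<le> \<rho>" shows "emeasure lborel (cube \<rho> :: (real ^ 'd) set) = ennreal ((2 * \<rho>) ^ CARD('d))"
proof -
  have "emeasure lborel (cube \<rho> :: (real ^ 'd) set) = ennreal (\<Prod>b\<in>Basis. ((\<chi> i. \<rho>) - (\<chi> i. - \<rho>) :: real ^ 'd) \<bullet> b)"
    unfolding cube_def by (rule emeasure_lborel_cbox) (use assms in \<open>auto simp: Basis_vec_range inner_axis\<close>)
  also have "(\<Prod>b\<in>Basis. ((\<chi> i. \<rho>) - (\<chi> i. - \<rho>) :: real ^ 'd) \<bullet> b) = (2 * \<rho>) ^ CARD('d)"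
    by (simp add: prod_Basis_vec inner_axis)
  finally show ?thesis .
qed

definition gauss_exp :: "'d::finite itself \<Rightarrow> real" where
  "gauss_exp _ = (LINT z|(gauss 1 :: (real ^ 'd) measure). exp (norm z))"

lemma gauss_exp_nonneg: "0 \<le> gauss_exp TYPE('d::finite)"
  unfolding gauss_exp_def by (rule integral_nonneg_AE) auto

lemma nn_integral_gauss_exp_le:
  assumes "0 < t" "t \<le> 1"
  shows "(\<integral>\<^sup>+w. ennreal (exp \<bar>w $ j\<bar>) \<partial>(gauss t :: (real ^ 'd) measure)) \<le> ennreal (gauss_exp TYPE('d))"
proof -
  have "(\<integral>\<^sup>+w. ennreal (exp \<bar>w $ j\<bar>) \<partial>(gauss t :: (real ^ 'd) measure)) = (\<integral>\<^sup>+z. ennreal (exp \<bar>(sqrt t *\<^sub>R z) $ j\<bar>) \<partial>(gauss 1 :: (real ^ 'd) measure))"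
    unfolding distr_gauss_scale[OF assms(1), symmetric] by (subst nn_integral_distr) auto
  also have "\<dots> \<le> (\<integral>\<^sup>+z. ennreal (exp (norm z)) \<partial>(gauss 1 :: (real ^ 'd) measure))"
  proof (intro nn_integral_mono ennreal_leI exp_le_cancel_iff[THEN iffD2])
    fix z :: "real ^ 'd"
    have "\<bar>(sqrt t *\<^sub>R z) $ j\<bar> \<le> norm (sqrt t *\<^sub>R z)" by (rule component_le_norm_cart)
    also have "\<dots> = sqrt t * norm z" using assms by simp
    also have "\<dots> \<le> 1 * norm z" using assms by (intro mult_right_mono) auto
    finally show "\<bar>(sqrt t *\<^sub>R z) $ j\<bar> \<le> norm z" by simp
  qed
  also have "\<dots> = ennreal (gauss_exp TYPE('d))"
    unfolding gauss_exp_def using integrable_gauss_exp_norm[of 1, where 'd='d] by (intro nn_integral_eq_integral) auto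
  finally show ?thesis .
qed

context borel_prob
begin

text \<open>Outside the cube some coordinate exceeds \<rho>, so Markov's inequality with
  \<open>exp \<bar>x $ j\<bar>\<close> applies. The exponential moment of the convolution factorises
  by the triangle inequality, and \<open>t \<le> 1\<close> makes its Gaussian factor a
  constant.\<close>

lemma smooth_tail:
  assumes t: "0 < t" "t \<le> 1" and A: "\<And>j. (\<integral>\<^sup>+x. ennreal (exp \<bar>x $ j\<bar>) \<partial>P) \<le> ennreal A" "0 \<le> A"
  shows "(\<integral>\<^sup>+x. indicator (- cube \<rho>) x * ennreal (smooth t x) \<partial>lborel) \<le> ennreal (real CARD('d) * A * gauss_exp TYPE('d) * exp (- \<rho>))"
proof -
  interpret G: prob_space "gauss t :: (real ^ 'd) measure" by (rule prob_space_gauss[OF t(1)])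
  have "(\<integral>\<^sup>+x. indicator (- cube \<rho>) x * ennreal (smooth t x) \<partial>lborel) \<le> (\<integral>\<^sup>+x. (\<Sum>j\<in>UNIV. ennreal (exp (- \<rho>)) * ennreal (exp \<bar>x $ j\<bar>)) * ennreal (smooth t x) \<partial>lborel)"
  proof (intro nn_integral_mono mult_right_mono)
    fix x :: "real ^ 'd"
    show "indicator (- cube \<rho>) x \<le> (\<Sum>j\<in>UNIV. ennreal (exp (- \<rho>)) * ennreal (exp \<bar>x $ j\<bar>))"
    proof (cases "x \<in> cube \<rho>")
      case False
      then obtain j where j: "\<rho> < \<bar>x $ j\<bar>" by (auto simp: mem_cube not_le)
      have "1 \<le> ennreal (exp (- \<rho>) * exp \<bar>x $ j\<bar>)"
        using j by (simp add: exp_add[symmetric])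
      also have "\<dots> = ennreal (exp (- \<rho>)) * ennreal (exp \<bar>x $ j\<bar>)" by (rule ennreal_mult) auto
      also have "\<dots> \<le> (\<Sum>j\<in>UNIV. ennreal (exp (- \<rho>)) * ennreal (exp \<bar>x $ j\<bar>))"
        by (rule member_le_sum) auto
      finally show ?thesis using False by simp
    qed simp
  qed simp
  also have "\<dots> = (\<integral>\<^sup>+y. (\<integral>\<^sup>+w. (\<Sum>j\<in>UNIV. ennreal (exp (- \<rho>)) * ennreal (exp \<bar>(y + w) $ j\<bar>)) \<partial>gauss t) \<partial>P)"
    by (rule nn_integral_smooth[OF t(1)]) measurable
  also have "\<dots> \<le> (\<integral>\<^sup>+y. (\<Sum>j\<in>UNIV. ennreal (exp (- \<rho>)) * (ennreal (exp \<bar>y $ j\<bar>) * ennreal (gauss_exp TYPE('d)))) \<partial>P)"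
  proof (rule nn_integral_mono)
    fix y :: "real ^ 'd"
    have inn: "(\<integral>\<^sup>+w. ennreal (exp \<bar>(y + w) $ j\<bar>) \<partial>gauss t) \<le> ennreal (exp \<bar>y $ j\<bar>) * ennreal (gauss_exp TYPE('d))" for j
    proof -
      have "(\<integral>\<^sup>+w. ennreal (exp \<bar>(y + w) $ j\<bar>) \<partial>gauss t) \<le> (\<integral>\<^sup>+w. ennreal (exp \<bar>y $ j\<bar>) * ennreal (exp \<bar>w $ j\<bar>) \<partial>gauss t)"
        by (intro nn_integral_mono) (simp add: ennreal_mult[symmetric] exp_add[symmetric] ennreal_leI)
      also have "\<dots> = ennreal (exp \<bar>y $ j\<bar>) * (\<integral>\<^sup>+w. ennreal (exp \<bar>w $ j\<bar>) \<partial>gauss t)" by (rule nn_integral_cmult) measurable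
      also have "\<dots> \<le> ennreal (exp \<bar>y $ j\<bar>) * ennreal (gauss_exp TYPE('d))"
        by (intro mult_left_mono nn_integral_gauss_exp_le t) auto
      finally show ?thesis .
    qed
    show "(\<integral>\<^sup>+w. (\<Sum>j\<in>UNIV. ennreal (exp (- \<rho>)) * ennreal (exp \<bar>(y + w) $ j\<bar>)) \<partial>gauss t)
      \<le> (\<Sum>j\<in>UNIV. ennreal (exp (- \<rho>)) * (ennreal (exp \<bar>y $ j\<bar>) * ennreal (gauss_exp TYPE('d))))"
      by (simp add: nn_integral_sum nn_integral_cmult) (intro sum_mono mult_left_mono, use inn in auto)
  qed
  also have "\<dots> = (\<Sum>j\<in>UNIV. ennreal (exp (- \<rho>)) * ((\<integral>\<^sup>+y. ennreal (exp \<bar>y $ j\<bar>) \<partial>P) * ennreal (gauss_exp TYPE('d))))"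
    by (simp add: nn_integral_sum nn_integral_cmult nn_integral_multc)
  also have "\<dots> \<le> (\<Sum>j\<in>(UNIV :: 'd set). ennreal (exp (- \<rho>)) * (ennreal A * ennreal (gauss_exp TYPE('d))))"
    by (intro sum_mono mult_left_mono mult_right_mono A) auto
  also have "\<dots> = ennreal (real CARD('d) * A * gauss_exp TYPE('d) * exp (- \<rho>))"
    using A gauss_exp_nonneg[where 'd='d]
    by (simp add: ennreal_mult[symmetric] ennreal_of_nat_eq_real_of_nat mult_ac)
  finally show ?thesis .
qed

lemma smooth_diff_L1:
  assumes et: "0 < e" "e \<le> t" "t \<le> 1" and A: "\<And>j. (\<integral>\<^sup>+x. ennreal (exp \<bar>x $ j\<bar>) \<partial>P) \<le> ennreal A" "0 \<le> A"
    and I: "(LINT x|lborel. (smooth e x - smooth t x)\<^sup>2) \<le> I" "0 < I" and \<rho>: "0 < \<rho>"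
  shows "(\<integral>\<^sup>+x. ennreal \<bar>smooth e x - smooth t x\<bar> \<partial>lborel) \<le> ennreal (sqrt ((2 * \<rho>) ^ CARD('d) * I) + 2 * (real CARD('d) * A * gauss_exp TYPE('d) * exp (- \<rho>)))"
proof -
  let ?K = "real CARD('d) * A * gauss_exp TYPE('d) * exp (- \<rho>)"
  have K: "0 \<le> ?K" using A gauss_exp_nonneg[where 'd='d] by simp
  have t: "0 < t" "e \<le> 1" using et by auto
  have "(\<integral>\<^sup>+x. ennreal \<bar>smooth e x - smooth t x\<bar> \<partial>lborel) \<le>
    (\<integral>\<^sup>+x. indicator (cube \<rho>) x * ennreal \<bar>smooth e x - smooth t x\<bar> + (indicator (- cube \<rho>) x * ennreal (smooth e x) + indicator (- cube \<rho>) x * ennreal (smooth t x)) \<partial>lborel)"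
  proof (rule nn_integral_mono)
    fix x
    have "\<bar>smooth e x - smooth t x\<bar> \<le> smooth e x + smooth t x"
      using smooth_nonneg[of e x] smooth_nonneg[of t x] by linarith
    then have "ennreal \<bar>smooth e x - smooth t x\<bar> \<le> ennreal (smooth e x) + ennreal (smooth t x)"
      by (simp add: smooth_nonneg ennreal_plus[symmetric] ennreal_leI del: ennreal_plus)
    then show "ennreal \<bar>smooth e x - smooth t x\<bar> \<le> indicator (cube \<rho>) x * ennreal \<bar>smooth e x - smooth t x\<bar> + (indicator (- cube \<rho>) x * ennreal (smooth e x) + indicator (- cube \<rho>) x * ennreal (smooth t x))"
      by (auto split: split_indicator)
  qed
  also have "\<dots> = (\<integral>\<^sup>+x. indicator (cube \<rho>) x * ennreal \<bar>smooth e x - smooth t x\<bar> \<partial>lborel) +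
     ((\<integral>\<^sup>+x. indicator (- cube \<rho>) x * ennreal (smooth e x) \<partial>lborel) + (\<integral>\<^sup>+x. indicator (- cube \<rho>) x * ennreal (smooth t x) \<partial>lborel))"
    by (simp add: nn_integral_add)
  also have "\<dots> \<le> ennreal (sqrt ((2 * \<rho>) ^ CARD('d) * I)) + (ennreal ?K + ennreal ?K)"
  proof (intro add_mono smooth_tail A et t nn_integral_abs_le_sqrt)
    show "(\<integral>\<^sup>+x. ennreal ((smooth e x - smooth t x)\<^sup>2) \<partial>lborel) \<le> ennreal I"
      using nn_integral_eq_integral[OF smooth_diff_sq(1)[OF et(1) t(1)]] I by (simp add: ennreal_leI)
  qed (use I \<rho> in \<open>auto simp: emeasure_cube\<close>)
  also have "\<dots> = ennreal (sqrt ((2 * \<rho>) ^ CARD('d) * I) + 2 * ?K)"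
  proof -
    have "ennreal u + (ennreal k + ennreal k) = ennreal (u + 2 * k)" if "0 \<le> u" "0 \<le> k" for u k :: real
      using that by (simp add: ennreal_plus[symmetric] del: ennreal_plus)
    then show ?thesis using K I \<rho> by simp
  qed
  finally show ?thesis .
qed

text \<open>The passage \<open>e \<rightarrow> 0\<close>. The smoothings tend to \<open>P\<close>
  only weakly, so the bound is first tested on the functions \<open>bump\<close>; it then passes to
  closed sets, and to Borel sets by inner regularity.\<close>

lemma measure_le_smooth:
  assumes t: "0 < t" and b: "\<And>e. 0 < e \<Longrightarrow> e \<le> t \<Longrightarrow> (\<integral>\<^sup>+x. ennreal \<bar>smooth e x - smooth t x\<bar> \<partial>lborel) \<le> ennreal b" "0 \<le> b"
    and S[measurable]: "S \<in> sets borel"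
  shows "measure P S \<le> (LINT x|lborel. indicator S x * smooth t x) + b"
proof -
  define \<nu> where "\<nu> = density lborel (\<lambda>x. ennreal (smooth t x))"
  interpret \<nu>: prob_space \<nu>
    unfolding \<nu>_def by (rule prob_spaceI) (simp add: emeasure_density nn_integral_smooth_1[OF t])
  have s\<nu>: "sets \<nu> = sets borel" by (simp add: \<nu>_def)
  have m\<nu>: "measure \<nu> S = (LINT x|lborel. indicator S x * smooth t x)" if [measurable]: "S \<in> sets borel" for S
  proof -
    have "ennreal (measure \<nu> S) = (\<integral>\<^sup>+x. ennreal (indicator S x * smooth t x) \<partial>lborel)"
      unfolding \<nu>.emeasure_eq_measure[symmetric]
      by (subst \<nu>_def, subst emeasure_density) (auto intro!: nn_integral_cong split: split_indicator)
    also have "\<dots> = ennreal (LINT x|lborel. indicator S x * smooth t x)"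
      by (rule nn_integral_eq_integral)
        (auto simp: smooth_nonneg split: split_indicator intro!: Bochner_Integration.integrable_bound[OF integrable_smooth[OF t]])
    finally show ?thesis by (simp add: integral_nonneg_AE smooth_nonneg)
  qed
  have cl: "measure P K \<le> measure \<nu> K + b" if K: "closed K" for K
  proof (cases "K = {}")
    case False
    have "(LINT x|P. bump K k x) \<le> (LINT x|\<nu>. bump K k x) + b" for k
    proof -
      let ?f = "bump K k"
      \<comment> \<open>A null sequence not exceeding \<open>t\<close>, so that the assumed L1 bound
        is available at every level.\<close>
      define v where "v m = t / real (Suc m)" for m
      have v: "0 < v m" "v m \<le> t" for m using t by (auto simp: v_def divide_le_eq mult_le_cancel_left1)
      have v0: "v \<longlonglongrightarrow> 0" unfolding v_def by (rule LIMSEQ_Suc[OF lim_const_over_n])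
      define F where "F m y = (LINT w|gauss (v m). ?f (y + w))" for m y
      have F: "0 \<le> F m y" "F m y \<le> 1" "ennreal (F m y) = (\<integral>\<^sup>+w. ennreal (?f (y + w)) \<partial>gauss (v m))" for m y
      proof -
        interpret G: prob_space "gauss (v m) :: (real ^ 'd) measure" by (rule prob_space_gauss[OF v(1)])
        have i: "integrable (gauss (v m)) (\<lambda>w. ?f (y + w))"
          by (rule G.integrable_const_bound[where B=1]) (auto simp: bump_bounds)
        show "0 \<le> F m y" unfolding F_def by (rule integral_nonneg_AE) (auto simp: bump_bounds)
        show "F m y \<le> 1" unfolding F_def by (rule G.integral_le_const[OF i]) (auto simp: bump_bounds)
        show "ennreal (F m y) = (\<integral>\<^sup>+w. ennreal (?f (y + w)) \<partial>gauss (v m))"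
          unfolding F_def by (rule nn_integral_eq_integral[symmetric, OF i]) (auto simp: bump_bounds)
      qed
      have [measurable]: "F m \<in> borel_measurable borel" for m
      proof -
        interpret G: prob_space "gauss (v m) :: (real ^ 'd) measure" by (rule prob_space_gauss[OF v(1)])
        show ?thesis unfolding F_def[abs_def] by measurable
      qed
      have lim: "(\<lambda>m. LINT y|P. F m y) \<longlonglongrightarrow> (LINT y|P. ?f y)"
      proof (rule integral_dominated_convergence[where w="\<lambda>_. 1"])
        show "AE y in P. (\<lambda>m. F m y) \<longlonglongrightarrow> ?f y"
          unfolding F_def by (intro AE_I2 gauss_smoothing_tendsto[where K=1]) (auto simp: bump_bounds continuous_on_bump v v0)
      qed (use F in auto)
      have le: "(LINT y|P. F m y) \<le> (LINT x|\<nu>. ?f x) + b" for m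
      proof -
        have "ennreal (LINT y|P. F m y) = (\<integral>\<^sup>+y. ennreal (F m y) \<partial>P)"
          by (rule nn_integral_eq_integral[symmetric]) (use F in \<open>auto intro!: integrable_const_bound[where B=1]\<close>)
        also have "\<dots> = (\<integral>\<^sup>+x. ennreal (?f x) * ennreal (smooth (v m) x) \<partial>lborel)"
          unfolding F(3) by (rule nn_integral_smooth[OF v(1), symmetric]) measurable
        also have "\<dots> \<le> (\<integral>\<^sup>+x. ennreal (smooth t x) * ennreal (?f x) + ennreal \<bar>smooth (v m) x - smooth t x\<bar> \<partial>lborel)"
        proof (rule nn_integral_mono)
          fix x
          have "?f x * smooth (v m) x \<le> ?f x * smooth t x + ?f x * \<bar>smooth (v m) x - smooth t x\<bar>"
            unfolding distrib_left[symmetric] by (intro mult_left_mono) (auto simp: bump_bounds)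
          also have "\<dots> \<le> smooth t x * ?f x + \<bar>smooth (v m) x - smooth t x\<bar>"
            using bump_bounds[of K k x] by (simp add: mult.commute[of "smooth t x"] mult_left_le_one_le)
          finally show "ennreal (?f x) * ennreal (smooth (v m) x) \<le> ennreal (smooth t x) * ennreal (?f x) + ennreal \<bar>smooth (v m) x - smooth t x\<bar>"
            using bump_bounds[of K k x] smooth_nonneg[of t x] smooth_nonneg[of "v m" x]
            by (simp add: ennreal_mult[symmetric] ennreal_plus[symmetric] ennreal_leI del: ennreal_plus)
        qed
        also have "\<dots> = (\<integral>\<^sup>+x. ennreal (?f x) \<partial>\<nu>) + (\<integral>\<^sup>+x. ennreal \<bar>smooth (v m) x - smooth t x\<bar> \<partial>lborel)"
          unfolding \<nu>_def by (subst nn_integral_add) (auto simp: nn_integral_density)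
        also have "\<dots> \<le> (\<integral>\<^sup>+x. ennreal (?f x) \<partial>\<nu>) + ennreal b" by (intro add_left_mono b v)
        also have "(\<integral>\<^sup>+x. ennreal (?f x) \<partial>\<nu>) = ennreal (LINT x|\<nu>. ?f x)"
          by (rule nn_integral_eq_integral) (auto simp: bump_bounds \<nu>_def intro!: \<nu>.integrable_const_bound[where B=1, unfolded \<nu>_def])
        finally have "ennreal (LINT y|P. F m y) \<le> ennreal ((LINT x|\<nu>. ?f x) + b)"
          using b by (simp add: ennreal_plus integral_nonneg_AE bump_bounds)
        then show ?thesis
          using b by (subst (asm) ennreal_le_iff) (auto intro!: add_nonneg_nonneg integral_nonneg_AE simp: bump_bounds)
      qed
      show ?thesis by (rule LIMSEQ_le_const2[OF lim]) (use le in auto)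
    qed
    then show ?thesis
      by (intro LIMSEQ_le[OF integral_bump_LIMSEQ[OF finite_measure_axioms sets_P K False]
          tendsto_add[OF integral_bump_LIMSEQ[OF \<nu>.finite_measure_axioms s\<nu> K False] tendsto_const]]) auto
  qed (use b in simp)
  have "emeasure P S = (SUP K \<in> {K. K \<subseteq> S \<and> compact K}. emeasure P K)"
    by (rule inner_regular) (auto simp: emeasure_eq_measure)
  also have "\<dots> \<le> ennreal (measure \<nu> S + b)"
  proof (rule SUP_least)
    fix K assume "K \<in> {K. K \<subseteq> S \<and> compact K}"
    then have K: "K \<subseteq> S" "closed K" by (auto dest: compact_imp_closed)
    have "measure \<nu> K \<le> measure \<nu> S" using K by (intro \<nu>.finite_measure_mono) (auto simp: s\<nu>)
    then show "emeasure P K \<le> ennreal (measure \<nu> S + b)"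
      unfolding emeasure_eq_measure using cl[OF K(2)] by (intro ennreal_leI) simp
  qed
  finally have "measure P S \<le> measure \<nu> S + b"
    unfolding emeasure_eq_measure using b by (subst (asm) ennreal_le_iff) auto
  then show ?thesis by (simp add: m\<nu>)
qed

text \<open>Two probability densities differ in L1 by twice the excess of one over the other on the
  set where it is larger. This excess is a difference of measures of one Borel set, as bounded in
  \<open>measure_le_smooth\<close>.\<close>

lemma density_smooth_L1:
  assumes p: "integrable lborel p" "AE x in lborel. 0 \<le> p x" "(LINT x|lborel. p x) = 1" "P = density lborel (\<lambda>x. ennreal (p x))"
    and t: "0 < t" and b: "\<And>e. 0 < e \<Longrightarrow> e \<le> t \<Longrightarrow> (\<integral>\<^sup>+x. ennreal \<bar>smooth e x - smooth t x\<bar> \<partial>lborel) \<le> ennreal b" "0 \<le> b"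
  shows "(\<integral>\<^sup>+x. ennreal \<bar>p x - smooth t x\<bar> \<partial>lborel) \<le> ennreal (2 * b)"
proof -
  have [measurable]: "p \<in> borel_measurable borel" using borel_measurable_integrable[OF p(1)] by simp
  define S where "S = {x. smooth t x \<le> p x}"
  have S[measurable]: "S \<in> sets borel" unfolding S_def by measurable
  have i1: "integrable lborel (\<lambda>x. indicator S x * p x)"
    by (rule Bochner_Integration.integrable_bound[OF p(1)]) (auto split: split_indicator)
  have i2: "integrable lborel (\<lambda>x. indicator S x * smooth t x)"
    by (rule Bochner_Integration.integrable_bound[OF integrable_smooth[OF t]]) (auto split: split_indicator)
  have PS: "measure P S = (LINT x|lborel. indicator S x * p x)"
  proof -
    have "ennreal (measure P S) = (\<integral>\<^sup>+x. ennreal (indicator S x * p x) \<partial>lborel)"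
      unfolding emeasure_eq_measure[symmetric]
      by (subst p(4), subst emeasure_density) (auto intro!: nn_integral_cong split: split_indicator)
    also have "\<dots> = ennreal (LINT x|lborel. indicator S x * p x)"
      by (rule nn_integral_eq_integral[OF i1]) (use p(2) in \<open>auto elim!: eventually_mono split: split_indicator\<close>)
    finally show ?thesis
      by (subst (asm) ennreal_inj) (use p(2) in \<open>auto intro!: integral_nonneg_AE elim!: eventually_mono split: split_indicator\<close>)
  qed
  have i: "integrable lborel (\<lambda>x. \<bar>p x - smooth t x\<bar>)"
    by (intro integrable_abs Bochner_Integration.integrable_diff p integrable_smooth t)
  have s1: "(LINT x|lborel. smooth t x) = 1"
    using nn_integral_eq_integral[OF integrable_smooth[OF t]] nn_integral_smooth_1[OF t] by (simp add: smooth_nonneg)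
  have "(LINT x|lborel. \<bar>p x - smooth t x\<bar>) = (LINT x|lborel. 2 * (indicator S x * p x - indicator S x * smooth t x) - (p x - smooth t x))"
    by (intro Bochner_Integration.integral_cong) (auto simp: S_def indicator_def)
  also have "\<dots> = 2 * ((LINT x|lborel. indicator S x * p x) - (LINT x|lborel. indicator S x * smooth t x)) - ((LINT x|lborel. p x) - (LINT x|lborel. smooth t x))"
    by (simp add: i1 i2 p(1) integrable_smooth[OF t])
  also have "\<dots> \<le> 2 * b" using measure_le_smooth[OF t b S] by (simp add: s1 p(3) PS)
  finally have "(LINT x|lborel. \<bar>p x - smooth t x\<bar>) \<le> 2 * b" .
  then show ?thesis by (subst nn_integral_eq_integral[OF i]) (auto intro: ennreal_leI)
qed

end

section \<open>Kernel density estimation\<close>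

lemma (in prob_space) expectation_sum_square_indep:
  fixes Z :: "nat \<Rightarrow> 'a \<Rightarrow> real"
  assumes ind: "indep_vars (\<lambda>_. borel) Z {..<n}"
    and bnd: "\<And>i \<omega>. i < n \<Longrightarrow> \<bar>Z i \<omega>\<bar> \<le> K" and mean: "\<And>i. i < n \<Longrightarrow> expectation (Z i) = 0"
  shows "expectation (\<lambda>\<omega>. (\<Sum>i<n. Z i \<omega>)\<^sup>2) = (\<Sum>i<n. expectation (\<lambda>\<omega>. (Z i \<omega>)\<^sup>2))"
proof -
  have m: "Z i \<in> borel_measurable M" if "i < n" for i using ind that by (auto simp: indep_vars_def)
  have int: "integrable M (Z i)" if "i < n" for i
    by (rule integrable_const_bound[where B=K]) (use m bnd that in auto)
  have int2: "integrable M (\<lambda>\<omega>. Z i \<omega> * Z j \<omega>)" if "i < n" "j < n" for i j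
  proof (rule integrable_const_bound[where B="K * K"])
    show "AE \<omega> in M. norm (Z i \<omega> * Z j \<omega>) \<le> K * K"
      using bnd that by (intro AE_I2) (auto simp: abs_mult intro!: mult_mono intro: order_trans[OF abs_ge_zero])
  qed (use m that in auto)
  have z: "expectation (\<lambda>\<omega>. Z i \<omega> * Z j \<omega>) = 0" if ij: "i < n" "j < n" "i \<noteq> j" for i j
  proof -
    have "expectation (\<lambda>\<omega>. \<Prod>k\<in>{i, j}. Z k \<omega>) = (\<Prod>k\<in>{i, j}. expectation (Z k))"
      by (rule indep_vars_lebesgue_integral) (use ij int in \<open>auto intro: indep_vars_subset[OF ind]\<close>)
    then show ?thesis using ij mean by simp
  qed
  have "expectation (\<lambda>\<omega>. (\<Sum>i<n. Z i \<omega>)\<^sup>2) = expectation (\<lambda>\<omega>. \<Sum>i<n. \<Sum>j<n. Z i \<omega> * Z j \<omega>)"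
    by (simp add: power2_eq_square sum_product)
  also have "\<dots> = (\<Sum>i<n. \<Sum>j<n. expectation (\<lambda>\<omega>. Z i \<omega> * Z j \<omega>))"
  proof -
    have "expectation (\<lambda>\<omega>. \<Sum>j<n. Z i \<omega> * Z j \<omega>) = (\<Sum>j<n. expectation (\<lambda>\<omega>. Z i \<omega> * Z j \<omega>))" if "i < n" for i
      by (rule Bochner_Integration.integral_sum) (use int2 that in auto)
    moreover have "expectation (\<lambda>\<omega>. \<Sum>i<n. \<Sum>j<n. Z i \<omega> * Z j \<omega>) = (\<Sum>i<n. expectation (\<lambda>\<omega>. \<Sum>j<n. Z i \<omega> * Z j \<omega>))"
      by (rule Bochner_Integration.integral_sum) (use int2 in auto)
    ultimately show ?thesis by simp
  qed
  also have "\<dots> = (\<Sum>i<n. \<Sum>j<n. if j = i then expectation (\<lambda>\<omega>. (Z i \<omega>)\<^sup>2) else 0)"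
    by (intro sum.cong refl) (auto simp: z power2_eq_square)
  finally show ?thesis by simp
qed

text \<open>The pointwise variance is at most 1/n times the second moment of the kernel, and one of
  its two factors is bounded by the supremum \<open>?c\<close>. What is left integrates to 1 over
  the whole space, so the volume of the cube enters only through Cauchy-Schwarz on the product of
  sample space and cube.\<close>

lemma (in prob_space) kernel_estimator_deviation:
  fixes X :: "nat \<Rightarrow> 'a \<Rightarrow> real ^ 'd::finite"
  assumes P: "borel_prob P" and n: "0 < n" and ind: "indep_vars (\<lambda>_. borel) X {..<n}"
    and X: "\<And>i. i < n \<Longrightarrow> distr M borel (X i) = P" and t: "0 < t" and \<rho>: "0 < \<rho>"
  shows "(\<integral>\<^sup>+\<omega>. (\<integral>\<^sup>+x. indicator (cube \<rho>) x * ennreal \<bar>(\<Sum>i<n. gaussian_density t (x - X i \<omega>)) / real n - borel_prob.smooth P t x\<bar> \<partial>lborel) \<partial>M)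
    \<le> ennreal (sqrt ((2 * \<rho>) ^ CARD('d) * ((1 / sqrt (2 * pi * t)) ^ CARD('d) / real n)))"
proof -
  interpret P: borel_prob P by fact
  interpret pair_sigma_finite M "lborel :: (real ^ 'd) measure" ..
  let ?c = "(1 / sqrt (2 * pi * t)) ^ CARD('d)"
  have c: "0 < ?c" using t by simp
  have Xm: "X i \<in> borel_measurable M" if "i < n" for i using ind that by (auto simp: indep_vars_def)
  define h where "h z = (\<Sum>i<n. gaussian_density t (snd z - X i (fst z))) / real n - P.smooth t (snd z)" for z
  have gm: "(\<lambda>z. gaussian_density t (snd z - X i (fst z))) \<in> borel_measurable (M \<Otimes>\<^sub>M lborel)" if "i < n" for i
    using measurable_compose[OF measurable_fst Xm[OF that]] by measurable
  have hm[measurable]: "h \<in> borel_measurable (M \<Otimes>\<^sub>M lborel)"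
  proof -
    have "(\<lambda>z. \<Sum>i<n. gaussian_density t (snd z - X i (fst z))) \<in> borel_measurable (M \<Otimes>\<^sub>M lborel)"
      by (intro borel_measurable_sum gm) auto
    then show ?thesis unfolding h_def[abs_def] by measurable
  qed
  have sq: "(\<integral>\<^sup>+\<omega>. ennreal ((h (\<omega>, x))\<^sup>2) \<partial>M) \<le> ennreal (?c / real n) * ennreal (P.smooth t x)" for x
  proof -
    define Z where "Z i \<omega> = gaussian_density t (x - X i \<omega>) - P.smooth t x" for i \<omega>
    have gb: "0 \<le> gaussian_density t (x - y)" "gaussian_density t (x - y) \<le> ?c" for y
      using gaussian_density_le[OF t, of "x - y"] by auto
    have sb: "0 \<le> P.smooth t x" "P.smooth t x \<le> ?c" using P.smooth_nonneg[of t x] P.smooth_le[OF t, of x] by auto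
    have Zb: "\<bar>Z i \<omega>\<bar> \<le> ?c" for i \<omega> unfolding Z_def using gb[of "X i \<omega>"] sb by linarith
    have E: "expectation (\<lambda>\<omega>. f (X i \<omega>)) = (LINT y|P. f y)" if "i < n" and [measurable]: "f \<in> borel_measurable borel" for i and f :: "_ \<Rightarrow> real"
      unfolding X[OF that(1), symmetric] by (rule integral_distr[symmetric]) (use Xm that in auto)
    have ind': "indep_vars (\<lambda>_. borel) Z {..<n}"
      unfolding Z_def by (rule indep_vars_compose2[OF ind]) measurable
    have i1: "integrable P (\<lambda>y. gaussian_density t (x - y))" by (rule P.integrable_gaussian_density_diff[OF t])
    have i2: "integrable P (\<lambda>y. (gaussian_density t (x - y))\<^sup>2)"
    proof (rule P.integrable_const_bound[where B="?c\<^sup>2"])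
      show "AE y in P. norm ((gaussian_density t (x - y))\<^sup>2) \<le> ?c\<^sup>2"
        using power_mono[OF gb(2) gb(1), of _ 2] by (intro AE_I2) simp
    qed measurable
    have "expectation (Z i) = 0" if "i < n" for i
      using E[OF that, of "\<lambda>y. gaussian_density t (x - y) - P.smooth t x"] i1 P.prob_space
      by (simp add: Z_def[abs_def] P.smooth_def)
    then have "expectation (\<lambda>\<omega>. (\<Sum>i<n. Z i \<omega>)\<^sup>2) = (\<Sum>i<n. expectation (\<lambda>\<omega>. (Z i \<omega>)\<^sup>2))"
      by (intro expectation_sum_square_indep[OF ind' Zb])
    also have "\<dots> \<le> (\<Sum>i<n. ?c * P.smooth t x)"
    proof (rule sum_mono)
      fix i assume "i \<in> {..<n}"
      then have i: "i < n" by simp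
      have "expectation (\<lambda>\<omega>. (Z i \<omega>)\<^sup>2) = (LINT y|P. (gaussian_density t (x - y) - P.smooth t x)\<^sup>2)"
        unfolding Z_def by (rule E[OF i]) measurable
      also have "\<dots> = (LINT y|P. (gaussian_density t (x - y))\<^sup>2 - 2 * P.smooth t x * gaussian_density t (x - y) + (P.smooth t x)\<^sup>2)"
        by (intro Bochner_Integration.integral_cong refl) (simp add: power2_eq_square algebra_simps)
      also have "\<dots> = (LINT y|P. (gaussian_density t (x - y))\<^sup>2) - 2 * P.smooth t x * (LINT y|P. gaussian_density t (x - y)) + (P.smooth t x)\<^sup>2"
        using i1 i2 P.prob_space by simp
      also have "\<dots> = (LINT y|P. (gaussian_density t (x - y))\<^sup>2) - (P.smooth t x)\<^sup>2"
        by (simp add: P.smooth_def power2_eq_square)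
      also have "\<dots> \<le> (LINT y|P. (gaussian_density t (x - y))\<^sup>2)" by simp
      also have "\<dots> \<le> (LINT y|P. ?c * gaussian_density t (x - y))"
        by (rule integral_mono[OF i2]) (use i1 gb in \<open>auto simp: power2_eq_square intro!: mult_right_mono\<close>)
      also have "\<dots> = ?c * P.smooth t x" by (simp add: P.smooth_def)
      finally show "expectation (\<lambda>\<omega>. (Z i \<omega>)\<^sup>2) \<le> ?c * P.smooth t x" .
    qed
    also have "\<dots> = real n * (?c * P.smooth t x)" by simp
    finally have E2: "expectation (\<lambda>\<omega>. (\<Sum>i<n. Z i \<omega>)\<^sup>2) \<le> real n * (?c * P.smooth t x)" .
    have hZ: "h (\<omega>, x) = (\<Sum>i<n. Z i \<omega>) / real n" for \<omega>
      using n by (simp add: h_def Z_def sum_subtractf diff_divide_distrib)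
    have Zm: "Z i \<in> borel_measurable M" if "i < n" for i using ind' that by (auto simp: indep_vars_def)
    have iS: "integrable M (\<lambda>\<omega>. (\<Sum>i<n. Z i \<omega>)\<^sup>2)"
    proof (rule integrable_const_bound[where B="(real n * ?c)\<^sup>2"])
      have S: "\<bar>\<Sum>i<n. Z i \<omega>\<bar> \<le> real n * ?c" for \<omega>
        by (rule order_trans[OF sum_abs]) (use sum_bounded_above[of "{..<n}" "\<lambda>i. \<bar>Z i \<omega>\<bar>" ?c] Zb in auto)
      show "AE \<omega> in M. norm ((\<Sum>i<n. Z i \<omega>)\<^sup>2) \<le> (real n * ?c)\<^sup>2"
        using power_mono[OF S abs_ge_zero, of _ 2] by (intro AE_I2) (simp add: norm_power)
      show "(\<lambda>\<omega>. (\<Sum>i<n. Z i \<omega>)\<^sup>2) \<in> borel_measurable M" using Zm by (intro borel_measurable_power borel_measurable_sum) auto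
    qed
    have "(\<integral>\<^sup>+\<omega>. ennreal ((h (\<omega>, x))\<^sup>2) \<partial>M) = (\<integral>\<^sup>+\<omega>. ennreal ((\<Sum>i<n. Z i \<omega>)\<^sup>2 / (real n)\<^sup>2) \<partial>M)"
      by (simp add: hZ power_divide)
    also have "\<dots> = ennreal (expectation (\<lambda>\<omega>. (\<Sum>i<n. Z i \<omega>)\<^sup>2) / (real n)\<^sup>2)"
      by (subst nn_integral_eq_integral) (use iS in auto)
    also have "\<dots> \<le> ennreal (real n * (?c * P.smooth t x) / (real n)\<^sup>2)"
      by (intro ennreal_leI divide_right_mono E2) auto
    also have "\<dots> = ennreal (?c / real n) * ennreal (P.smooth t x)"
      using n c by (subst ennreal_mult[symmetric]) (auto simp: power2_eq_square P.smooth_nonneg)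
    finally show ?thesis .
  qed
  let ?A = "space M \<times> cube \<rho> :: ('a \<times> (real ^ 'd)) set"
  have Am[measurable]: "?A \<in> sets (M \<Otimes>\<^sub>M lborel)" by measurable
  have "(\<integral>\<^sup>+\<omega>. (\<integral>\<^sup>+x. indicator (cube \<rho>) x * ennreal \<bar>(\<Sum>i<n. gaussian_density t (x - X i \<omega>)) / real n - P.smooth t x\<bar> \<partial>lborel) \<partial>M)
     = (\<integral>\<^sup>+\<omega>. (\<integral>\<^sup>+x. indicator ?A (\<omega>, x) * ennreal \<bar>h (\<omega>, x)\<bar> \<partial>lborel) \<partial>M)"
    by (intro nn_integral_cong) (auto simp: h_def split: split_indicator)
  also have "\<dots> = (\<integral>\<^sup>+z. indicator ?A z * ennreal \<bar>h z\<bar> \<partial>(M \<Otimes>\<^sub>M lborel))"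
    by (rule lborel.nn_integral_fst) measurable
  also have "\<dots> \<le> ennreal (sqrt ((2 * \<rho>) ^ CARD('d) * (?c / real n)))"
  proof (rule nn_integral_abs_le_sqrt)
    have "(\<integral>\<^sup>+z. ennreal ((h z)\<^sup>2) \<partial>(M \<Otimes>\<^sub>M lborel)) = (\<integral>\<^sup>+x. (\<integral>\<^sup>+\<omega>. ennreal ((h (\<omega>, x))\<^sup>2) \<partial>M) \<partial>lborel)"
      by (rule nn_integral_snd[symmetric]) measurable
    also have "\<dots> \<le> (\<integral>\<^sup>+x. ennreal (?c / real n) * ennreal (P.smooth t x) \<partial>lborel)" by (intro nn_integral_mono sq)
    also have "\<dots> = ennreal (?c / real n)" by (simp add: nn_integral_cmult P.nn_integral_smooth_1[OF t])
    finally show "(\<integral>\<^sup>+z. ennreal ((h z)\<^sup>2) \<partial>(M \<Otimes>\<^sub>M lborel)) \<le> ennreal (?c / real n)" .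
    show "emeasure (M \<Otimes>\<^sub>M lborel) ?A \<le> ennreal ((2 * \<rho>) ^ CARD('d))"
      by (subst lborel.emeasure_pair_measure_Times) (use \<rho> in \<open>auto simp: emeasure_space_1 emeasure_cube\<close>)
  qed (use c n \<rho> in auto)
  finally show ?thesis .
qed

text \<open>For shifts up to \<open>sqrt r\<close>, Cauchy-Schwarz is applied to the likelihood
  ratio \<open>E\<close>, whose second moment is \<open>exp ((norm h)\<^sup>2 / r)\<close>. For
  longer shifts the trivial bound 2 is below the claim.\<close>

lemma gaussian_shift_L1:
  fixes h :: "real ^ 'd"
  assumes r: "0 < r"
  shows "(\<integral>\<^sup>+y. ennreal \<bar>gaussian_density r (y - h) - gaussian_density r y\<bar> \<partial>lborel) \<le> ennreal (2 * norm h / sqrt r)"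
proof (cases "h = 0")
  case False
  interpret G: prob_space "gauss r :: (real ^ 'd) measure" by (rule prob_space_gauss[OF r])
  define b where "b = (1 / r) *\<^sub>R h"
  have rb: "r *\<^sub>R b = h" using r by (simp add: b_def)
  define E where "E w = exp (b \<bullet> w - (norm b)\<^sup>2 * r / 2)" for w
  have [measurable]: "E \<in> borel_measurable borel" unfolding E_def[abs_def] by measurable
  have eq: "gaussian_density r (y - h) = E y * gaussian_density r y" for y
    using gaussian_density_tilt[OF r, of b "y - h"] by (simp add: rb E_def)
  have one: "(\<integral>\<^sup>+y. ennreal (gaussian_density r (y - k)) \<partial>lborel) = 1" for k :: "real ^ 'd"
    using nn_integral_lborel_shift[of "\<lambda>y. ennreal (gaussian_density r y)" "- k"] G.emeasure_space_1
    by (simp add: gauss_def emeasure_density)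
  show ?thesis
  proof (cases "norm h \<le> sqrt r")
    case True
    have nb: "(norm b)\<^sup>2 * r = (norm h)\<^sup>2 / r" using r by (simp add: b_def power_divide power2_eq_square field_simps)
    have hr: "(norm h)\<^sup>2 / r \<le> 1"
    proof -
      have "(norm h)\<^sup>2 \<le> (sqrt r)\<^sup>2" using True by (intro power_mono) auto
      then show ?thesis using r by simp
    qed
    have i1: "integrable (gauss r) E" and I1: "(LINT w|gauss r. E w) = 1"
      using integrable_gauss_tilt[OF r, of "\<lambda>_. 1 :: real" b] integral_gauss_tilt[OF r, of "\<lambda>_. 1 :: real" b] G.prob_space
      by (simp_all add: E_def[abs_def])
    \<comment> \<open>The square of a tilt by \<open>b\<close> is the tilt by
      \<open>2 *\<^sub>R b\<close> up to a constant factor, so its mean is that factor.\<close>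
    have E2: "E w * E w = exp ((norm b)\<^sup>2 * r) *\<^sub>R (exp ((2 *\<^sub>R b) \<bullet> w - (norm (2 *\<^sub>R b))\<^sup>2 * r / 2) *\<^sub>R 1)" for w
      by (simp add: E_def exp_add[symmetric] power_mult_distrib)
    have i2: "integrable (gauss r) (\<lambda>w. E w * E w)"
      unfolding E2 by (intro integrable_scaleR_right) (subst integrable_gauss_tilt[OF r], auto)
    have I2: "(LINT w|gauss r. E w * E w) = exp ((norm h)\<^sup>2 / r)"
      unfolding E2 by (subst integral_scaleR_right, subst integral_gauss_tilt[OF r]) (use G.prob_space nb in auto)
    have i3: "integrable (gauss r) (\<lambda>w. (E w - 1)\<^sup>2)"
      using i1 i2 by (simp add: power2_diff) (simp add: power2_eq_square)
    have "(LINT w|gauss r. (E w - 1)\<^sup>2) = (LINT w|gauss r. E w * E w - 2 * E w + 1)"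
      by (intro Bochner_Integration.integral_cong refl) (simp add: power2_eq_square algebra_simps)
    also have "\<dots> = exp ((norm h)\<^sup>2 / r) - 1"
      using i1 i2 G.prob_space by (simp add: I1 I2)
    also have "\<dots> \<le> 2 * ((norm h)\<^sup>2 / r)"
      using exp_le_one_plus_double[of "(norm h)\<^sup>2 / r"] hr r by simp
    finally have I: "(\<integral>\<^sup>+w. ennreal ((E w - 1)\<^sup>2) \<partial>gauss r) \<le> ennreal (2 * ((norm h)\<^sup>2 / r))"
      by (subst nn_integral_eq_integral[OF i3]) (auto intro: ennreal_leI)
    have "(\<integral>\<^sup>+y. ennreal \<bar>gaussian_density r (y - h) - gaussian_density r y\<bar> \<partial>lborel) = (\<integral>\<^sup>+w. indicator UNIV w * ennreal \<bar>E w - 1\<bar> \<partial>gauss r)"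
    proof (subst nn_integral_gauss, measurable, intro nn_integral_cong)
      fix y
      have "\<bar>gaussian_density r (y - h) - gaussian_density r y\<bar> = gaussian_density r y * \<bar>E y - 1\<bar>"
        unfolding eq by (subst abs_of_nonneg[OF gaussian_density_nonneg, symmetric], subst abs_mult[symmetric]) (simp add: algebra_simps)
      then show "ennreal \<bar>gaussian_density r (y - h) - gaussian_density r y\<bar> = ennreal (gaussian_density r y) * (indicator UNIV y * ennreal \<bar>E y - 1\<bar>)"
        by (simp add: ennreal_mult)
    qed
    also have "\<dots> \<le> ennreal (sqrt (1 * (2 * ((norm h)\<^sup>2 / r))))"
      by (rule nn_integral_abs_le_sqrt) (use I r False G.emeasure_space_1 in auto)
    also have "\<dots> \<le> ennreal (2 * norm h / sqrt r)"
    proof (rule ennreal_leI)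
      have "sqrt (1 * (2 * ((norm h)\<^sup>2 / r))) = sqrt 2 * (norm h / sqrt r)" by (simp add: real_sqrt_mult real_sqrt_divide)
      also have "\<dots> \<le> 2 * (norm h / sqrt r)" using sqrt2_less_2 by (intro mult_right_mono) (use r in auto)
      finally show "sqrt (1 * (2 * ((norm h)\<^sup>2 / r))) \<le> 2 * norm h / sqrt r" by simp
    qed
    finally show ?thesis .
  next
    case False
    have "(\<integral>\<^sup>+y. ennreal \<bar>gaussian_density r (y - h) - gaussian_density r y\<bar> \<partial>lborel) \<le> (\<integral>\<^sup>+y. ennreal (gaussian_density r (y - h)) + ennreal (gaussian_density r (y - 0)) \<partial>lborel)"
    proof (rule nn_integral_mono)
      fix y
      have "\<bar>gaussian_density r (y - h) - gaussian_density r y\<bar> \<le> gaussian_density r (y - h) + gaussian_density r y"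
        using gaussian_density_nonneg[of r "y - h"] gaussian_density_nonneg[of r y] by linarith
      then show "ennreal \<bar>gaussian_density r (y - h) - gaussian_density r y\<bar> \<le> ennreal (gaussian_density r (y - h)) + ennreal (gaussian_density r (y - 0))"
        by (simp add: ennreal_plus[symmetric] ennreal_leI del: ennreal_plus)
    qed
    also have "\<dots> = 2" by (subst nn_integral_add) (simp_all only: one, auto)
    also have "\<dots> \<le> ennreal (2 * norm h / sqrt r)"
    proof -
      have "2 \<le> 2 * norm h / sqrt r" using False r by (simp add: pos_le_divide_eq)
      then show ?thesis by (metis ennreal_leI ennreal_numeral zero_le_numeral)
    qed
    finally show ?thesis .
  qed
qed simp

text \<open>Applied to the coordinate directions, the norm bounds a mean of
  \<open>exp (y\<^sup>2 / C\<^sup>2)\<close>, and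
  \<open>\<bar>y\<bar> \<le> y\<^sup>2 / C\<^sup>2 + C\<^sup>2 / 4\<close> bounds the exponential
  moment by it.\<close>

lemma sub_gaussian_exp_moment:
  fixes p :: "real ^ 'd::finite \<Rightarrow> real"
  assumes sg: "sub_gaussian_density \<sigma> p" and P: "prob_space (density lborel (\<lambda>x. ennreal (p x)))"
  shows "\<exists>A\<ge>0. \<forall>j. (\<integral>\<^sup>+x. ennreal (exp \<bar>x $ j\<bar>) \<partial>density lborel (\<lambda>x. ennreal (p x))) \<le> ennreal A"
proof -
  let ?P = "density lborel (\<lambda>x. ennreal (p x))"
  have s: "0 \<le> \<sigma>" "psi2_norm_vec ?P (\<lambda>x. x) = ennreal \<sigma>" using sg by (auto simp: sub_gaussian_density_def)
  have b: "(\<integral>\<^sup>+x. ennreal (exp \<bar>x $ j\<bar>) \<partial>?P) \<le> ennreal (exp ((\<sigma> + 1)\<^sup>2 / 4)) * (1 + emeasure ?P UNIV)" for j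
  proof -
    have "psi2_norm ?P (\<lambda>x. x \<bullet> axis j 1) \<le> psi2_norm_vec ?P (\<lambda>x. x)"
      unfolding psi2_norm_vec_def by (rule SUP_upper) (simp add: norm_axis_1)
    also have "\<dots> < ennreal (\<sigma> + 1)" using s by (simp add: ennreal_lessI)
    \<comment> \<open>The norm is an infimum, so an admissible constant is taken strictly below
      \<sigma> + 1; this also covers \<sigma> = 0.\<close>
    finally obtain C where C: "0 < C" "C < \<sigma> + 1" "(\<integral>\<^sup>+x. ennreal (exp ((x \<bullet> axis j 1)\<^sup>2 / C\<^sup>2) - 1) \<partial>?P) \<le> 1"
      unfolding psi2_norm_def Inf_less_iff by (auto simp: ennreal_less_iff)
    have le: "ennreal (exp \<bar>x $ j\<bar>) \<le> ennreal (exp ((\<sigma> + 1)\<^sup>2 / 4)) * (ennreal (exp ((x \<bullet> axis j 1)\<^sup>2 / C\<^sup>2) - 1) + 1)" for x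
    proof -
      have "\<bar>x $ j\<bar> \<le> (x $ j)\<^sup>2 / C\<^sup>2 + C\<^sup>2 / 4"
      proof -
        have "0 \<le> (\<bar>x $ j\<bar> / C - C / 2)\<^sup>2" by simp
        also have "\<dots> = (x $ j)\<^sup>2 / C\<^sup>2 + C\<^sup>2 / 4 - \<bar>x $ j\<bar>" using C by (simp add: power2_diff power_divide)
        finally show ?thesis by simp
      qed
      moreover have "C\<^sup>2 \<le> (\<sigma> + 1)\<^sup>2" using C by (intro power_mono) auto
      ultimately have "exp \<bar>x $ j\<bar> \<le> exp ((\<sigma> + 1)\<^sup>2 / 4 + (x $ j)\<^sup>2 / C\<^sup>2)" by simp
      also have "\<dots> = exp ((\<sigma> + 1)\<^sup>2 / 4) * ((exp ((x \<bullet> axis j 1)\<^sup>2 / C\<^sup>2) - 1) + 1)" by (simp add: exp_add inner_axis)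
      finally have "ennreal (exp \<bar>x $ j\<bar>) \<le> ennreal (exp ((\<sigma> + 1)\<^sup>2 / 4) * ((exp ((x \<bullet> axis j 1)\<^sup>2 / C\<^sup>2) - 1) + 1))" by (rule ennreal_leI)
      also have "\<dots> = ennreal (exp ((\<sigma> + 1)\<^sup>2 / 4)) * (ennreal (exp ((x \<bullet> axis j 1)\<^sup>2 / C\<^sup>2) - 1) + 1)"
        by (subst ennreal_mult, simp, simp, subst ennreal_plus) auto
      finally show ?thesis .
    qed
    have "(\<integral>\<^sup>+x. ennreal (exp \<bar>x $ j\<bar>) \<partial>?P) \<le> (\<integral>\<^sup>+x. ennreal (exp ((\<sigma> + 1)\<^sup>2 / 4)) * (ennreal (exp ((x \<bullet> axis j 1)\<^sup>2 / C\<^sup>2) - 1) + 1) \<partial>?P)"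
      by (intro nn_integral_mono le)
    also have "\<dots> = ennreal (exp ((\<sigma> + 1)\<^sup>2 / 4)) * ((\<integral>\<^sup>+x. ennreal (exp ((x \<bullet> axis j 1)\<^sup>2 / C\<^sup>2) - 1) \<partial>?P) + emeasure ?P UNIV)"
      by (simp add: nn_integral_cmult nn_integral_add)
    also have "\<dots> \<le> ennreal (exp ((\<sigma> + 1)\<^sup>2 / 4)) * (1 + emeasure ?P UNIV)" by (intro mult_left_mono add_right_mono C) auto
    finally show ?thesis .
  qed
  have "emeasure ?P UNIV = 1" using prob_space.emeasure_space_1[OF P] by simp
  then have "ennreal (exp ((\<sigma> + 1)\<^sup>2 / 4)) * (1 + emeasure ?P UNIV) = ennreal (exp ((\<sigma> + 1)\<^sup>2 / 4) * 2)"
    by (simp add: ennreal_mult)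
  then show ?thesis using b by (intro exI[of _ "exp ((\<sigma> + 1)\<^sup>2 / 4) * 2"]) simp
qed

section \<open>The conditional density of the output\<close>

text \<open>
  Averaging the kernel \<open>k\<close> over the position of the diffusion at the switch to get the density \<open>q\<close> does not
  increase the distance to \<open>g\<close>: the sign of \<open>g - q\<close> does not depend on what is averaged.
\<close>

lemma nn_integral_abs_diff_transfer:
  fixes g q k :: "'a \<Rightarrow> real"
  assumes [measurable]: "g \<in> borel_measurable N" "q \<in> borel_measurable N" "k \<in> borel_measurable N"
    and nn: "\<And>x. 0 \<le> g x" "\<And>x. 0 \<le> q x" "\<And>x. 0 \<le> k x"
    and le: "(\<integral>\<^sup>+x. indicator {x. q x \<le> g x} x * ennreal (q x) \<partial>N) = (\<integral>\<^sup>+x. indicator {x. q x \<le> g x} x * ennreal (k x) \<partial>N)"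
    and gt: "(\<integral>\<^sup>+x. indicator {x. g x < q x} x * ennreal (q x) \<partial>N) = (\<integral>\<^sup>+x. indicator {x. g x < q x} x * ennreal (k x) \<partial>N)"
    and fin: "(\<integral>\<^sup>+x. ennreal (q x) \<partial>N) < \<infinity>"
  shows "(\<integral>\<^sup>+x. ennreal \<bar>g x - q x\<bar> \<partial>N) \<le> (\<integral>\<^sup>+x. ennreal \<bar>g x - k x\<bar> \<partial>N)"
proof -
  let ?i = "\<lambda>x. indicator {x. q x \<le> g x} x :: ennreal" and ?j = "\<lambda>x. indicator {x. g x < q x} x :: ennreal"
  have [measurable]: "?i \<in> borel_measurable N" "?j \<in> borel_measurable N" by (auto simp: indicator_def)
  have 1: "(\<integral>\<^sup>+x. ?i x * ennreal \<bar>g x - q x\<bar> \<partial>N) \<le> (\<integral>\<^sup>+x. ?i x * ennreal \<bar>g x - k x\<bar> \<partial>N)"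
  proof -
    have f: "(\<integral>\<^sup>+x. ?i x * ennreal (q x) \<partial>N) < \<infinity>"
      by (rule le_less_trans[OF nn_integral_mono fin]) (auto split: split_indicator)
    have "(\<integral>\<^sup>+x. ?i x * ennreal (q x) \<partial>N) + (\<integral>\<^sup>+x. ?i x * ennreal \<bar>g x - q x\<bar> \<partial>N) = (\<integral>\<^sup>+x. ?i x * ennreal (g x) \<partial>N)"
      by (subst nn_integral_add[symmetric], measurable)
        (auto intro!: nn_integral_cong split: split_indicator simp: ennreal_plus[symmetric] nn simp del: ennreal_plus)
    also have "\<dots> \<le> (\<integral>\<^sup>+x. ?i x * ennreal (k x) + ?i x * ennreal \<bar>g x - k x\<bar> \<partial>N)"
      by (intro nn_integral_mono) (auto split: split_indicator simp: ennreal_plus[symmetric] nn simp del: ennreal_plus intro!: ennreal_leI)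
    also have "\<dots> = (\<integral>\<^sup>+x. ?i x * ennreal (q x) \<partial>N) + (\<integral>\<^sup>+x. ?i x * ennreal \<bar>g x - k x\<bar> \<partial>N)"
      unfolding le by (rule nn_integral_add) measurable
    finally show ?thesis using f by (auto simp: ennreal_add_left_cancel_le)
  qed
  have 2: "(\<integral>\<^sup>+x. ?j x * ennreal \<bar>g x - q x\<bar> \<partial>N) \<le> (\<integral>\<^sup>+x. ?j x * ennreal \<bar>g x - k x\<bar> \<partial>N)"
  proof -
    have f: "(\<integral>\<^sup>+x. ?j x * ennreal (g x) \<partial>N) < \<infinity>"
      by (rule le_less_trans[OF nn_integral_mono fin]) (auto split: split_indicator intro: ennreal_leI)
    have "(\<integral>\<^sup>+x. ?j x * ennreal (g x) \<partial>N) + (\<integral>\<^sup>+x. ?j x * ennreal \<bar>g x - q x\<bar> \<partial>N) = (\<integral>\<^sup>+x. ?j x * ennreal (q x) \<partial>N)"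
      by (subst nn_integral_add[symmetric], measurable)
        (auto intro!: nn_integral_cong split: split_indicator simp: ennreal_plus[symmetric] nn simp del: ennreal_plus)
    also have "\<dots> \<le> (\<integral>\<^sup>+x. ?j x * ennreal (g x) + ?j x * ennreal \<bar>g x - k x\<bar> \<partial>N)"
      unfolding gt by (intro nn_integral_mono) (auto split: split_indicator simp: ennreal_plus[symmetric] nn simp del: ennreal_plus intro!: ennreal_leI)
    also have "\<dots> = (\<integral>\<^sup>+x. ?j x * ennreal (g x) \<partial>N) + (\<integral>\<^sup>+x. ?j x * ennreal \<bar>g x - k x\<bar> \<partial>N)"
      by (rule nn_integral_add) measurable
    finally show ?thesis using f by (auto simp: ennreal_add_left_cancel_le)
  qed
  have split: "(\<integral>\<^sup>+x. ennreal \<bar>g x - h x\<bar> \<partial>N) = (\<integral>\<^sup>+x. ?i x * ennreal \<bar>g x - h x\<bar> \<partial>N) + (\<integral>\<^sup>+x. ?j x * ennreal \<bar>g x - h x\<bar> \<partial>N)"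
    if [measurable]: "h \<in> borel_measurable N" for h
    by (subst nn_integral_add[symmetric], measurable) (auto intro!: nn_integral_cong split: split_indicator)
  show ?thesis unfolding split[OF assms(2)] split[OF assms(3)] by (intro add_mono 1 2)
qed

context tilt_phase
begin

lemma measurable_tilt_kernel[measurable (raw)]:
  assumes [measurable]: "f \<in> measurable N' SU" "g \<in> borel_measurable N'" "h \<in> borel_measurable N'"
  shows "(\<lambda>z. tilt_kernel N (\<alpha> (f z)) r (g z) (h z)) \<in> borel_measurable N'"
  unfolding tilt_kernel_eq[OF r] by measurable

text \<open>\<open>tilt_law\<close> represents the output by kernels that still depend on
  \<open>Y t1\<close>, which is not a function of the samples and \<open>U\<close>. The density
  given these is the conditional mean of the kernels, obtained as a Radon-Nikodym derivative on the
  product with Lebesgue measure.\<close>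

lemma conditional_density_exists:
  "\<exists>q. conditional_density M SU Z (Y (t1 + r)) q \<and>
    (\<forall>g :: real ^ 'd \<Rightarrow> real. g \<in> borel_measurable borel \<longrightarrow> (\<forall>y. 0 \<le> g y) \<longrightarrow>
      (\<integral>\<^sup>+\<omega>. (\<integral>\<^sup>+y. ennreal \<bar>g y - q (Z \<omega>) y\<bar> \<partial>lborel) \<partial>M)
      \<le> (\<integral>\<^sup>+\<omega>. (\<integral>\<^sup>+y. ennreal \<bar>g y - tilt_kernel N (\<alpha> (Z \<omega>)) r (Y t1 \<omega>) y\<bar> \<partial>lborel) \<partial>M))"
proof -
  have [measurable]: "Y t1 \<in> borel_measurable M" "Y (t1 + r) \<in> borel_measurable M" using r by (auto intro!: Ym)
  define D where "D = distr M SU Z"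
  interpret D: prob_space D unfolding D_def by (rule prob_space_distr) measurable
  interpret DL: pair_sigma_finite D "lborel :: (real ^ 'd) measure" ..
  have sD[measurable_cong]: "sets D = sets SU" by (simp add: D_def)
  have sDL: "sets (D \<Otimes>\<^sub>M (lborel :: (real ^ 'd) measure)) = sets (SU \<Otimes>\<^sub>M borel)"
    by (rule sets_pair_measure_cong) (auto simp: sD)
  define \<mu> where "\<mu> = distr M (D \<Otimes>\<^sub>M (lborel :: (real ^ 'd) measure)) (\<lambda>\<omega>. (Z \<omega>, Y (t1 + r) \<omega>))"
  have ZY[measurable]: "(\<lambda>\<omega>. (Z \<omega>, Y (t1 + r) \<omega>)) \<in> measurable M (D \<Otimes>\<^sub>M (lborel :: (real ^ 'd) measure))" by measurable
  interpret \<mu>: prob_space \<mu> unfolding \<mu>_def by (rule prob_space_distr) measurable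
  define k where "k x = tilt_kernel N (\<alpha> (Z (fst x))) r (Y t1 (fst x)) (snd x)" for x
  have k0: "0 \<le> k x" for x by (simp add: k_def tilt_kernel_nonneg)
  have [measurable]: "k \<in> borel_measurable (M \<Otimes>\<^sub>M lborel)" unfolding k_def[abs_def] by measurable
  have law: "(\<integral>\<^sup>+x. F x \<partial>\<mu>) = (\<integral>\<^sup>+x. F (Z (fst x), snd x) * ennreal (k x) \<partial>(M \<Otimes>\<^sub>M lborel))"
    if F: "F \<in> borel_measurable (SU \<Otimes>\<^sub>M borel)" for F
  proof -
    note [measurable] = F
    have F': "F \<in> borel_measurable (D \<Otimes>\<^sub>M lborel)" using F by (simp cong: measurable_cong_sets add: measurable_cong_sets[OF sDL refl])
    have "(\<integral>\<^sup>+x. F x \<partial>\<mu>) = (\<integral>\<^sup>+\<omega>. F (Z \<omega>, Y (t1 + r) \<omega>) \<partial>M)"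
      unfolding \<mu>_def by (subst nn_integral_distr[OF ZY]) (use F' in simp_all)
    also have "\<dots> = (\<integral>\<^sup>+\<omega>. (\<integral>\<^sup>+y. F (Z \<omega>, y) * ennreal (k (\<omega>, y)) \<partial>lborel) \<partial>M)"
      unfolding tilt_law[OF F] by (simp add: k_def)
    also have "\<dots> = (\<integral>\<^sup>+x. F (Z (fst x), snd x) * ennreal (k x) \<partial>(M \<Otimes>\<^sub>M lborel))"
    proof -
      have "(\<lambda>x. F (Z (fst x), snd x) * ennreal (k x)) \<in> borel_measurable (M \<Otimes>\<^sub>M lborel)" by measurable
      from lborel.nn_integral_fst[OF this] show ?thesis by simp
    qed
    finally show ?thesis .
  qed
  have DLi: "(\<integral>\<^sup>+x. F x \<partial>(D \<Otimes>\<^sub>M lborel)) = (\<integral>\<^sup>+x. F (Z (fst x), snd x) \<partial>(M \<Otimes>\<^sub>M lborel))"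
    if F: "F \<in> borel_measurable (SU \<Otimes>\<^sub>M borel)" for F :: "_ \<Rightarrow> ennreal"
  proof -
    note [measurable] = F
    have F': "F \<in> borel_measurable (D \<Otimes>\<^sub>M lborel)" using F by (simp cong: measurable_cong_sets add: measurable_cong_sets[OF sDL refl])
    have "(\<integral>\<^sup>+x. F x \<partial>(D \<Otimes>\<^sub>M lborel)) = (\<integral>\<^sup>+z. (\<integral>\<^sup>+y. F (z, y) \<partial>lborel) \<partial>D)"
      by (rule lborel.nn_integral_fst[OF F', symmetric])
    also have "\<dots> = (\<integral>\<^sup>+\<omega>. (\<integral>\<^sup>+y. F (Z \<omega>, y) \<partial>lborel) \<partial>M)"
      unfolding D_def by (rule nn_integral_distr) (use lborel.borel_measurable_nn_integral_fst[OF F'] in \<open>auto simp: D_def\<close>)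
    also have "\<dots> = (\<integral>\<^sup>+x. F (Z (fst x), snd x) \<partial>(M \<Otimes>\<^sub>M lborel))"
    proof -
      have "(\<lambda>x. F (Z (fst x), snd x)) \<in> borel_measurable (M \<Otimes>\<^sub>M lborel)" by measurable
      from lborel.nn_integral_fst[OF this] show ?thesis by simp
    qed
    finally show ?thesis .
  qed
  \<comment> \<open>A null set of the product pulls back along \<open>Z\<close> to a null set of
    \<open>M \<Otimes>\<^sub>M lborel\<close>, where the kernel cannot give it mass.\<close>
  have ac: "absolutely_continuous (D \<Otimes>\<^sub>M (lborel :: (real ^ 'd) measure)) \<mu>"
    unfolding absolutely_continuous_def
  proof
    fix E assume E: "E \<in> null_sets (D \<Otimes>\<^sub>M (lborel :: (real ^ 'd) measure))"
    have Es[measurable]: "E \<in> sets (SU \<Otimes>\<^sub>M borel)" using null_setsD2[OF E] by (simp only: sDL)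
    have "(\<integral>\<^sup>+x. indicator E (Z (fst x), snd x) \<partial>(M \<Otimes>\<^sub>M lborel)) = (\<integral>\<^sup>+x. indicator E x \<partial>(D \<Otimes>\<^sub>M lborel))"
      by (rule DLi[symmetric]) measurable
    also have "\<dots> = 0" using E by (simp add: null_sets_def)
    finally have "AE x in M \<Otimes>\<^sub>M lborel. indicator E (Z (fst x), snd x) = (0 :: ennreal)"
      by (subst (asm) nn_integral_0_iff_AE) auto
    then have "AE x in M \<Otimes>\<^sub>M lborel. indicator E (Z (fst x), snd x) * ennreal (k x) = 0"
      by eventually_elim simp
    then have "(\<integral>\<^sup>+x. indicator E (Z (fst x), snd x) * ennreal (k x) \<partial>(M \<Otimes>\<^sub>M lborel)) = 0"
      by (subst nn_integral_0_iff_AE) auto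
    then have "(\<integral>\<^sup>+x. indicator E x \<partial>\<mu>) = 0" by (subst law) auto
    moreover have "E \<in> sets \<mu>" using E by (auto simp: null_sets_def \<mu>_def)
    ultimately show "E \<in> null_sets \<mu>" by (simp add: null_sets_def)
  qed
  have s\<mu>: "sets \<mu> = sets (D \<Otimes>\<^sub>M (lborel :: (real ^ 'd) measure))" by (simp add: \<mu>_def)
  obtain f where f: "f \<in> borel_measurable (D \<Otimes>\<^sub>M (lborel :: (real ^ 'd) measure))" "density (D \<Otimes>\<^sub>M lborel) f = \<mu>"
    using DL.P.Radon_Nikodym[OF ac s\<mu>] by blast
  note fm[measurable] = f(1)
  have "(\<integral>\<^sup>+x. f x \<partial>(D \<Otimes>\<^sub>M lborel)) = emeasure (density (D \<Otimes>\<^sub>M lborel) f) (space (D \<Otimes>\<^sub>M (lborel :: (real ^ 'd) measure)))"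
    unfolding emeasure_density[OF fm sets.top] by (intro nn_integral_cong) simp
  also have "\<dots> = 1" unfolding f(2) using \<mu>.emeasure_space_1 by (simp add: \<mu>_def)
  finally have f1: "(\<integral>\<^sup>+x. f x \<partial>(D \<Otimes>\<^sub>M lborel)) = 1" .
  have ffin: "AE x in D \<Otimes>\<^sub>M lborel. f x \<noteq> \<infinity>" by (rule nn_integral_PInf_AE[OF fm]) (simp add: f1)
  \<comment> \<open>The derivative may be infinite on a null set; \<open>enn2real\<close> replaces
    it by a real version.\<close>
  define q where "q z y = enn2real (f (z, y))" for z y
  have q0: "0 \<le> q z y" for z y by (simp add: q_def)
  have fq: "AE x in D \<Otimes>\<^sub>M lborel. f x = ennreal (case_prod q x)"
    using ffin by eventually_elim (auto simp: q_def ennreal_enn2real_if top_unique split: prod.split)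
  have qm': "case_prod q \<in> borel_measurable (D \<Otimes>\<^sub>M lborel)"
  proof -
    have "case_prod q = (\<lambda>x. enn2real (f x))" by (auto simp: fun_eq_iff q_def)
    then show ?thesis by simp
  qed
  then have qm[measurable]: "case_prod q \<in> borel_measurable (SU \<Otimes>\<^sub>M borel)"
    by (simp add: measurable_cong_sets[OF sDL refl])
  have dq: "density (D \<Otimes>\<^sub>M lborel) (\<lambda>x. ennreal (case_prod q x)) = \<mu>"
    unfolding f(2)[symmetric] using qm' fq by (intro density_cong) (auto elim!: eventually_mono)
  have lawq: "(\<integral>\<^sup>+x. F (Z (fst x), snd x) * ennreal (q (Z (fst x)) (snd x)) \<partial>(M \<Otimes>\<^sub>M lborel)) = (\<integral>\<^sup>+x. F (Z (fst x), snd x) * ennreal (k x) \<partial>(M \<Otimes>\<^sub>M lborel))"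
    if F[measurable]: "F \<in> borel_measurable (SU \<Otimes>\<^sub>M borel)" for F
  proof -
    have F': "F \<in> borel_measurable (D \<Otimes>\<^sub>M lborel)" using F by (simp add: measurable_cong_sets[OF sDL refl])
    have "(\<integral>\<^sup>+x. F (Z (fst x), snd x) * ennreal (q (Z (fst x)) (snd x)) \<partial>(M \<Otimes>\<^sub>M lborel)) = (\<integral>\<^sup>+x. F x * ennreal (case_prod q x) \<partial>(D \<Otimes>\<^sub>M lborel))"
      using DLi[of "\<lambda>x. F x * ennreal (case_prod q x)"] by simp
    also have "\<dots> = (\<integral>\<^sup>+x. F x \<partial>\<mu>)"
      unfolding dq[symmetric] using qm' F' by (subst nn_integral_density) (auto simp: mult.commute)
    finally show ?thesis by (simp add: law)
  qed
  have qM[measurable]: "(\<lambda>x. q (Z (fst x)) (snd x)) \<in> borel_measurable (M \<Otimes>\<^sub>M lborel)"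
    using measurable_compose[of "\<lambda>x. (Z (fst x), snd x)" "M \<Otimes>\<^sub>M lborel" "SU \<Otimes>\<^sub>M borel", OF _ qm] by simp
  have "conditional_density M SU Z (Y (t1 + r)) q"
    unfolding conditional_density_def distributed_def
  proof (intro conjI allI)
    show "(\<lambda>(z, y). q z y) \<in> borel_measurable (SU \<Otimes>\<^sub>M lborel)"
      using qm by (simp cong: measurable_cong_sets sets_pair_measure_cong)
    show "distr M (distr M SU Z \<Otimes>\<^sub>M lborel) (\<lambda>\<omega>. (Z \<omega>, Y (t1 + r) \<omega>)) = density (distr M SU Z \<Otimes>\<^sub>M lborel) (\<lambda>(z, y). ennreal (q z y))"
      using dq by (simp add: \<mu>_def D_def split_beta')
    show "(\<lambda>(z, y). ennreal (q z y)) \<in> borel_measurable (distr M SU Z \<Otimes>\<^sub>M lborel)"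
      using measurable_compose[OF qm' measurable_ennreal] by (simp add: D_def split_beta')
    show "(\<lambda>\<omega>. (Z \<omega>, Y (t1 + r) \<omega>)) \<in> measurable M (distr M SU Z \<Otimes>\<^sub>M lborel)" using ZY by (simp add: D_def)
  qed (use q0 in auto)
  moreover have "(\<integral>\<^sup>+\<omega>. (\<integral>\<^sup>+y. ennreal \<bar>g y - q (Z \<omega>) y\<bar> \<partial>lborel) \<partial>M)
      \<le> (\<integral>\<^sup>+\<omega>. (\<integral>\<^sup>+y. ennreal \<bar>g y - tilt_kernel N (\<alpha> (Z \<omega>)) r (Y t1 \<omega>) y\<bar> \<partial>lborel) \<partial>M)"
    if [measurable]: "g \<in> borel_measurable borel" and g0: "\<And>y. 0 \<le> g y" for g
  proof -
    have "(\<integral>\<^sup>+x. ennreal \<bar>g (snd x) - q (Z (fst x)) (snd x)\<bar> \<partial>(M \<Otimes>\<^sub>M lborel)) \<le> (\<integral>\<^sup>+x. ennreal \<bar>g (snd x) - k x\<bar> \<partial>(M \<Otimes>\<^sub>M lborel))"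
    proof (rule nn_integral_abs_diff_transfer)
      \<comment> \<open>The sets where \<open>q\<close> is below or above \<open>g\<close> are
        described by \<open>Z\<close> and \<open>y\<close> alone, hence are admissible test
        functions for \<open>lawq\<close>.\<close>
      have m1: "(\<lambda>x. indicator {x. case_prod q x \<le> g (snd x)} x :: ennreal) \<in> borel_measurable (SU \<Otimes>\<^sub>M borel)"
        and m2: "(\<lambda>x. indicator {x. g (snd x) < case_prod q x} x :: ennreal) \<in> borel_measurable (SU \<Otimes>\<^sub>M borel)"
        unfolding indicator_def mem_Collect_eq by measurable
      show "(\<integral>\<^sup>+x. indicator {x. q (Z (fst x)) (snd x) \<le> g (snd x)} x * ennreal (q (Z (fst x)) (snd x)) \<partial>(M \<Otimes>\<^sub>M lborel)) = (\<integral>\<^sup>+x. indicator {x. q (Z (fst x)) (snd x) \<le> g (snd x)} x * ennreal (k x) \<partial>(M \<Otimes>\<^sub>M lborel))"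
        using lawq[OF m1] by (simp add: indicator_def)
      show "(\<integral>\<^sup>+x. indicator {x. g (snd x) < q (Z (fst x)) (snd x)} x * ennreal (q (Z (fst x)) (snd x)) \<partial>(M \<Otimes>\<^sub>M lborel)) = (\<integral>\<^sup>+x. indicator {x. g (snd x) < q (Z (fst x)) (snd x)} x * ennreal (k x) \<partial>(M \<Otimes>\<^sub>M lborel))"
        using lawq[OF m2] by (simp add: indicator_def)
      have "(\<integral>\<^sup>+x. ennreal (q (Z (fst x)) (snd x)) \<partial>(M \<Otimes>\<^sub>M lborel)) = (\<integral>\<^sup>+x. 1 \<partial>\<mu>)"
        using lawq[of "\<lambda>_. 1"] law[of "\<lambda>_. 1"] by simp
      then show "(\<integral>\<^sup>+x. ennreal (q (Z (fst x)) (snd x)) \<partial>(M \<Otimes>\<^sub>M lborel)) < \<infinity>" using \<mu>.emeasure_space_1 by simp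
    qed (use g0 q0 k0 in auto)
    moreover have "(\<integral>\<^sup>+x. ennreal \<bar>g (snd x) - q (Z (fst x)) (snd x)\<bar> \<partial>(M \<Otimes>\<^sub>M lborel)) = (\<integral>\<^sup>+\<omega>. (\<integral>\<^sup>+y. ennreal \<bar>g y - q (Z \<omega>) y\<bar> \<partial>lborel) \<partial>M)"
      by (subst lborel.nn_integral_fst[symmetric]) auto
    moreover have "(\<integral>\<^sup>+x. ennreal \<bar>g (snd x) - k x\<bar> \<partial>(M \<Otimes>\<^sub>M lborel)) = (\<integral>\<^sup>+\<omega>. (\<integral>\<^sup>+y. ennreal \<bar>g y - tilt_kernel N (\<alpha> (Z \<omega>)) r (Y t1 \<omega>) y\<bar> \<partial>lborel) \<partial>M)"
      by (subst lborel.nn_integral_fst[symmetric]) (auto simp: k_def)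
    ultimately show ?thesis by simp
  qed
  ultimately show ?thesis by blast
qed

end

section \<open>Dependence of the kernel on its starting point and on the sites\<close>

lemma integral_gaussian_density_shift:
  fixes c :: "real ^ 'd"
  assumes "0 < r" shows "(\<integral>\<^sup>+y. ennreal (gaussian_density r (y - c)) \<partial>lborel) = 1"
proof -
  interpret G: prob_space "gauss r :: (real ^ 'd) measure" by (rule prob_space_gauss[OF assms])
  show ?thesis
    using nn_integral_lborel_shift[of "\<lambda>y. ennreal (gaussian_density r y)" "- c"] G.emeasure_space_1
    by (simp add: gauss_def emeasure_density)
qed

text \<open>Starting at \<open>x\<close> instead of 0 has two effects: the weights change, by at
  most \<open>4 * R * norm x\<close> in total, and all centres are shifted by \<open>x\<close>,
  which costs \<open>2 * norm x / sqrt r\<close>.\<close>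

lemma tilt_kernel_start_diff:
  fixes a :: "nat \<Rightarrow> real ^ 'd"
  assumes r: "0 < r" and a: "\<And>i. i \<le> n \<Longrightarrow> norm (a i) \<le> R"
  shows "(\<integral>\<^sup>+y. ennreal \<bar>tilt_kernel n a r 0 y - tilt_kernel n a r x y\<bar> \<partial>lborel) \<le> ennreal ((4 * R + 2 / sqrt r) * norm x)"
proof -
  let ?w = "tilt_weight n a 0"
  have R: "0 \<le> R" using a[of 0] norm_ge_zero[of "a 0"] by linarith
  let ?A = "\<lambda>i y. ennreal \<bar>?w 0 i - ?w x i\<bar> * ennreal (gaussian_density r (y - (x + r *\<^sub>R a i)))"
  let ?B = "\<lambda>i y. ennreal (?w 0 i) * ennreal \<bar>gaussian_density r (y - r *\<^sub>R a i - x) - gaussian_density r (y - r *\<^sub>R a i)\<bar>"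
  have "(\<integral>\<^sup>+y. ennreal \<bar>tilt_kernel n a r 0 y - tilt_kernel n a r x y\<bar> \<partial>lborel) \<le> (\<integral>\<^sup>+y. (\<Sum>i\<le>n. ?A i y + ?B i y) \<partial>lborel)"
  proof (rule nn_integral_mono)
    fix y
    have e: "tilt_kernel n a r 0 y - tilt_kernel n a r x y = (\<Sum>i\<le>n. (?w 0 i - ?w x i) * gaussian_density r (y - (x + r *\<^sub>R a i)) + ?w 0 i * (gaussian_density r (y - r *\<^sub>R a i) - gaussian_density r (y - r *\<^sub>R a i - x)))"
      unfolding tilt_kernel_def sum_subtractf[symmetric] by (intro sum.cong refl) (simp add: algebra_simps)
    have "\<bar>tilt_kernel n a r 0 y - tilt_kernel n a r x y\<bar> \<le> (\<Sum>i\<le>n. \<bar>?w 0 i - ?w x i\<bar> * gaussian_density r (y - (x + r *\<^sub>R a i)) + ?w 0 i * \<bar>gaussian_density r (y - r *\<^sub>R a i - x) - gaussian_density r (y - r *\<^sub>R a i)\<bar>)"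
      unfolding e by (rule order_trans[OF sum_abs], rule sum_mono, rule order_trans[OF abs_triangle_ineq])
        (simp add: abs_mult tilt_weight_nonneg abs_minus_commute)
    then have "ennreal \<bar>tilt_kernel n a r 0 y - tilt_kernel n a r x y\<bar> \<le> ennreal (\<Sum>i\<le>n. \<bar>?w 0 i - ?w x i\<bar> * gaussian_density r (y - (x + r *\<^sub>R a i)) + ?w 0 i * \<bar>gaussian_density r (y - r *\<^sub>R a i - x) - gaussian_density r (y - r *\<^sub>R a i)\<bar>)"
      by (rule ennreal_leI)
    also have "\<dots> = (\<Sum>i\<le>n. ?A i y + ?B i y)"
      by (subst sum_ennreal[symmetric]) (auto simp: tilt_weight_nonneg ennreal_plus ennreal_mult intro!: sum.cong)
    finally show "ennreal \<bar>tilt_kernel n a r 0 y - tilt_kernel n a r x y\<bar> \<le> (\<Sum>i\<le>n. ?A i y + ?B i y)" .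
  qed
  also have "\<dots> = (\<Sum>i\<le>n. ennreal \<bar>?w 0 i - ?w x i\<bar> * (\<integral>\<^sup>+y. ennreal (gaussian_density r (y - (x + r *\<^sub>R a i))) \<partial>lborel)
     + ennreal (?w 0 i) * (\<integral>\<^sup>+y. ennreal \<bar>gaussian_density r (y - r *\<^sub>R a i - x) - gaussian_density r (y - r *\<^sub>R a i)\<bar> \<partial>lborel))"
    by (simp add: nn_integral_sum nn_integral_add nn_integral_cmult)
  also have "\<dots> \<le> (\<Sum>i\<le>n. ennreal \<bar>?w 0 i - ?w x i\<bar> * 1 + ennreal (?w 0 i) * ennreal (2 * norm x / sqrt r))"
  proof (intro sum_mono add_mono mult_left_mono)
    fix i
    show "(\<integral>\<^sup>+y. ennreal (gaussian_density r (y - (x + r *\<^sub>R a i))) \<partial>lborel) \<le> 1" by (simp add: integral_gaussian_density_shift[OF r])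
    have "(\<integral>\<^sup>+y. ennreal \<bar>gaussian_density r (y - r *\<^sub>R a i - x) - gaussian_density r (y - r *\<^sub>R a i)\<bar> \<partial>lborel) = (\<integral>\<^sup>+y. ennreal \<bar>gaussian_density r (y - x) - gaussian_density r y\<bar> \<partial>lborel)"
      using nn_integral_lborel_shift[of "\<lambda>y. ennreal \<bar>gaussian_density r (y - x) - gaussian_density r y\<bar>" "- r *\<^sub>R a i"] by simp
    then show "(\<integral>\<^sup>+y. ennreal \<bar>gaussian_density r (y - r *\<^sub>R a i - x) - gaussian_density r (y - r *\<^sub>R a i)\<bar> \<partial>lborel) \<le> ennreal (2 * norm x / sqrt r)"
      using gaussian_shift_L1[OF r, of x] by simp
  qed auto
  also have "\<dots> = ennreal (\<Sum>i\<le>n. \<bar>?w 0 i - ?w x i\<bar> + ?w 0 i * (2 * norm x / sqrt r))"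
    using r by (subst sum_ennreal[symmetric]) (auto simp: tilt_weight_nonneg ennreal_mult[symmetric] intro!: sum.cong)
  also have "\<dots> \<le> ennreal ((4 * R + 2 / sqrt r) * norm x)"
  proof (rule ennreal_leI)
    have "(\<Sum>i\<le>n. \<bar>?w 0 i - ?w x i\<bar>) \<le> 4 * (R * norm (0 - x) + R\<^sup>2 * \<bar>0 - 0\<bar> / 2)"
      by (rule tilt_weight_diff_le) (rule a)
    moreover have "(\<Sum>i\<le>n. ?w 0 i * (2 * norm x / sqrt r)) = 2 * norm x / sqrt r"
      by (simp only: sum_distrib_right[symmetric] sum_tilt_weight mult_1)
    ultimately show "(\<Sum>i\<le>n. \<bar>?w 0 i - ?w x i\<bar> + ?w 0 i * (2 * norm x / sqrt r)) \<le> (4 * R + 2 / sqrt r) * norm x"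
      by (simp add: sum.distrib algebra_simps)
  qed
  finally show ?thesis .
qed

text \<open>The site with index \<open>n\<close> is always 0, so that \<^const>\<open>tilt_sum\<close> is at least 1; see \<open>tilt_sum_ge_one\<close>.\<close>

definition site :: "nat \<Rightarrow> real \<Rightarrow> (nat \<Rightarrow> real ^ 'd) \<times> real \<Rightarrow> nat \<Rightarrow> real ^ 'd" where
  "site n r z i = (if i < n \<and> norm (fst z i) \<le> real n then (1 / r) *\<^sub>R fst z i else 0)"

lemma norm_site_le: "0 < r \<Longrightarrow> norm (site n r z i) \<le> real n / r"
  by (auto simp: site_def divide_right_mono)

lemma zero_site: "0 \<in> site n r z ` {..n}"
  by (rule image_eqI[where x=n]) (auto simp: site_def)

lemma borel_measurable_site[measurable]:
  "(\<lambda>z. site n r z i) \<in> borel_measurable ((\<Pi>\<^sub>M i\<in>{..<n}. borel) \<Otimes>\<^sub>M borel)"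
proof (cases "i < n")
  case True
  then have [measurable]: "(\<lambda>z. fst z i) \<in> borel_measurable ((\<Pi>\<^sub>M i\<in>{..<n}. (borel :: (real ^ 'd) measure)) \<Otimes>\<^sub>M (borel :: real measure))"
    by (intro measurable_compose[OF measurable_fst measurable_component_singleton]) auto
  show ?thesis unfolding site_def by measurable
qed (simp add: site_def)

text \<open>At the origin and time 0 all exponents vanish, so the weights are equal. Three
  differences to the kernel estimator remain: the weights are 1/(n+1) instead of 1/n, the additional
  site puts a Gaussian at 0, and samples of norm above \<open>n\<close> have been moved to 0. The
  first two cost \<open>2 / n\<close> together.\<close>

lemma tilt_kernel_site_diff:
  fixes x :: "nat \<Rightarrow> real ^ 'd"
  assumes r: "0 < r" and n: "0 < n"
  shows "(\<integral>\<^sup>+y. ennreal \<bar>(\<Sum>i<n. gaussian_density r (y - x i)) / real n - tilt_kernel n (site n r (x, u)) r 0 y\<bar> \<partial>lborel)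
    \<le> ennreal (2 / real n) + (\<Sum>i<n. ennreal (2 / real n) * indicator {y. real n < norm y} (x i))"
proof -
  let ?a = "site n r (x, u)"
  define m where "m i = r *\<^sub>R ?a i" for i
  have m: "m i = (if norm (x i) \<le> real n then x i else 0)" if "i < n" for i using that r by (simp add: m_def site_def)
  have mn: "m n = 0" by (simp add: m_def site_def)
  have tk: "tilt_kernel n ?a r 0 y = (\<Sum>i<n. gaussian_density r (y - m i) / real (n + 1)) + gaussian_density r y / real (n + 1)" for y
    using mn by (simp add: tilt_kernel_def tilt_weight_def tilt_sum_def m_def[symmetric] lessThan_Suc_atMost[symmetric])
  let ?f = "\<lambda>i y. ennreal (1 / real n - 1 / real (n + 1)) * ennreal (gaussian_density r (y - m i)) +
      indicator {y. real n < norm y} (x i) * (ennreal (1 / real n) * (ennreal (gaussian_density r (y - x i)) + ennreal (gaussian_density r (y - m i))))"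
  have n1: "0 \<le> 1 / real n - 1 / real (n + 1)" using n by (simp add: field_simps)
  have one: "(\<integral>\<^sup>+y. ennreal (gaussian_density r (y - c)) \<partial>lborel) = 1" for c :: "real ^ 'd" by (rule integral_gaussian_density_shift[OF r])
  have "(\<integral>\<^sup>+y. ennreal \<bar>(\<Sum>i<n. gaussian_density r (y - x i)) / real n - tilt_kernel n ?a r 0 y\<bar> \<partial>lborel)
     \<le> (\<integral>\<^sup>+y. (\<Sum>i<n. ?f i y) + ennreal (1 / real (n + 1)) * ennreal (gaussian_density r (y - 0)) \<partial>lborel)"
  proof (rule nn_integral_mono)
    fix y
    let ?g = "gaussian_density r"
    have e: "(\<Sum>i<n. ?g (y - x i)) / real n - tilt_kernel n ?a r 0 y = (\<Sum>i<n. ?g (y - x i) / real n - ?g (y - m i) / real (n + 1)) - ?g y / real (n + 1)"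
      unfolding tk by (simp add: sum_subtractf sum_divide_distrib)
    have "\<bar>(\<Sum>i<n. ?g (y - x i)) / real n - tilt_kernel n ?a r 0 y\<bar> \<le> (\<Sum>i<n. \<bar>?g (y - x i) / real n - ?g (y - m i) / real (n + 1)\<bar>) + ?g y / real (n + 1)"
      unfolding e by (rule order_trans[OF abs_triangle_ineq4], rule add_mono, rule sum_abs) simp
    then have "ennreal \<bar>(\<Sum>i<n. ?g (y - x i)) / real n - tilt_kernel n ?a r 0 y\<bar> \<le> ennreal ((\<Sum>i<n. \<bar>?g (y - x i) / real n - ?g (y - m i) / real (n + 1)\<bar>) + ?g y / real (n + 1))"
      by (rule ennreal_leI)
    also have "\<dots> = (\<Sum>i<n. ennreal \<bar>?g (y - x i) / real n - ?g (y - m i) / real (n + 1)\<bar>) + ennreal (1 / real (n + 1)) * ennreal (?g (y - 0))"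
      by (simp add: ennreal_plus sum_nonneg sum_ennreal ennreal_mult[symmetric])
    also have "\<dots> \<le> (\<Sum>i<n. ?f i y) + ennreal (1 / real (n + 1)) * ennreal (?g (y - 0))"
    proof (intro add_right_mono sum_mono)
      fix i assume i: "i \<in> {..<n}"
      show "ennreal \<bar>?g (y - x i) / real n - ?g (y - m i) / real (n + 1)\<bar> \<le> ?f i y"
      proof (cases "norm (x i) \<le> real n")
        case True
        then have "\<bar>?g (y - x i) / real n - ?g (y - m i) / real (n + 1)\<bar> = (1 / real n - 1 / real (n + 1)) * ?g (y - m i)"
        proof -
          have mi: "m i = x i" using True i m[of i] by simp
          have "?g (y - x i) / real n - ?g (y - x i) / real (n + 1) = (1 / real n - 1 / real (n + 1)) * ?g (y - x i)"
            by (simp add: left_diff_distrib)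
          then show ?thesis unfolding mi using n1 by (simp only: abs_of_nonneg mult_nonneg_nonneg gaussian_density_nonneg)
        qed
        then show ?thesis using n1 True by (simp add: ennreal_mult)
      next
        case False
        have "\<bar>?g (y - x i) / real n - ?g (y - m i) / real (n + 1)\<bar> \<le> ?g (y - x i) / real n + ?g (y - m i) / real (n + 1)"
          by (rule order_trans[OF abs_triangle_ineq4]) simp
        also have "\<dots> \<le> ?g (y - x i) / real n + ?g (y - m i) / real n"
          using n by (intro add_left_mono divide_left_mono) auto
        also have "\<dots> = 1 / real n * (?g (y - x i) + ?g (y - m i))" by (simp add: add_divide_distrib)
        finally have "ennreal \<bar>?g (y - x i) / real n - ?g (y - m i) / real (n + 1)\<bar> \<le> ennreal (1 / real n) * (ennreal (?g (y - x i)) + ennreal (?g (y - m i)))"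
          by (subst ennreal_plus[symmetric], simp, simp, subst ennreal_mult[symmetric]) (auto intro: ennreal_leI)
        then show ?thesis using False by (simp add: add_increasing)
      qed
    qed
    finally show "ennreal \<bar>(\<Sum>i<n. ?g (y - x i)) / real n - tilt_kernel n ?a r 0 y\<bar> \<le> (\<Sum>i<n. ?f i y) + ennreal (1 / real (n + 1)) * ennreal (?g (y - 0))" .
  qed
  also have "\<dots> = (\<Sum>i<n. ennreal (1 / real n - 1 / real (n + 1)) + indicator {y. real n < norm y} (x i) * (ennreal (1 / real n) * 2)) + ennreal (1 / real (n + 1))"
    by (simp add: nn_integral_add nn_integral_sum nn_integral_cmult one one[of 0, simplified])
  also have "\<dots> = ennreal (real n * (1 / real n - 1 / real (n + 1)) + 1 / real (n + 1)) + (\<Sum>i<n. ennreal (2 / real n) * indicator {y. real n < norm y} (x i))"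
  proof -
    have "(\<Sum>i<n. ennreal (1 / real n - 1 / real (n + 1))) = ennreal (real n * (1 / real n - 1 / real (n + 1)))"
      using n1 by (simp add: ennreal_of_nat_eq_real_of_nat ennreal_mult[symmetric])
    moreover have "ennreal (1 / real n) * 2 = ennreal (2 / real n)"
      by (metis ennreal_mult' ennreal_numeral mult.commute times_divide_eq_right mult.right_neutral zero_le_numeral)
    ultimately show ?thesis using n1 by (simp add: sum.distrib ennreal_plus mult.commute add_ac)
  qed
  also have "\<dots> \<le> ennreal (2 / real n) + (\<Sum>i<n. ennreal (2 / real n) * indicator {y. real n < norm y} (x i))"
  proof (intro add_right_mono ennreal_leI)
    have "real n * (1 / real n) = 1" "real n * (1 / real (n + 1)) = 1 - 1 / real (n + 1)" using n by (simp_all add: field_simps)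
    then have "real n * (1 / real n - 1 / real (n + 1)) + 1 / real (n + 1) = 2 * (1 / real (n + 1))" by (simp only: right_diff_distrib)
    also have "\<dots> = 2 / real (n + 1)" by simp
    also have "\<dots> \<le> 2 / real n" using n by (intro divide_left_mono) auto
    finally show "real n * (1 / real n - 1 / real (n + 1)) + 1 / real (n + 1) \<le> 2 / real n" .
  qed
  finally show ?thesis .
qed

section \<open>The mean L1 error of the kernel\<close>

context diffusion
begin

lemma distr_X:
  assumes "i < n" shows "distr M borel (X i) = density lborel (\<lambda>x. ennreal (p x))"
proof -
  have "distributed M lborel (X i) (\<lambda>x. ennreal (p x))" using input assms unfolding diffusion_input_def by blast
  then have "distr M lborel (X i) = density lborel (\<lambda>x. ennreal (p x))" by (simp add: distributed_def)
  moreover have "distr M borel (X i) = distr M lborel (X i)" by (rule distr_cong) auto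
  ultimately show ?thesis by simp
qed

lemma indep_X: "indep_vars (\<lambda>_. borel) X {..<n}"
  using input unfolding diffusion_input_def by blast

text \<open>A chain of comparisons from \<open>g\<close> to its smoothing, to the kernel estimator,
  to the kernel started at the origin, and to the kernel started at \<open>Y1\<close>. In the second
  link Cauchy-Schwarz is available only on the cube; outside, both sides are bounded by their
  tails.\<close>

lemma kernel_L1_bound:
  fixes P :: "(real ^ 'd) measure"
  defines "P \<equiv> density lborel (\<lambda>x. ennreal (p x))"
  assumes bp: "borel_prob P" and n: "0 < n" and r: "0 < r" "r \<le> 1" and \<rho>: "0 < \<rho>"
    and A: "\<And>j. (\<integral>\<^sup>+x. ennreal (exp \<bar>x $ j\<bar>) \<partial>P) \<le> ennreal A" "0 \<le> A"
    and g[measurable]: "g \<in> borel_measurable borel"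
    and b1: "(\<integral>\<^sup>+y. ennreal \<bar>g y - borel_prob.smooth P r y\<bar> \<partial>lborel) \<le> ennreal b1" "0 \<le> b1"
    and Y1[measurable]: "Y1 \<in> borel_measurable M" and e1: "(\<integral>\<^sup>+\<omega>. ennreal (norm (Y1 \<omega>)) \<partial>M) \<le> ennreal e1" "0 \<le> e1"
  shows "(\<integral>\<^sup>+\<omega>. (\<integral>\<^sup>+y. ennreal \<bar>g y - tilt_kernel n (site n r (Z \<omega>)) r (Y1 \<omega>) y\<bar> \<partial>lborel) \<partial>M) \<le>
    ennreal (b1 + (sqrt ((2 * \<rho>) ^ CARD('d) * ((1 / sqrt (2 * pi * r)) ^ CARD('d) / real n))
       + 2 * (real CARD('d) * A * gauss_exp TYPE('d) * exp (- \<rho>)))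
       + (2 / real n + 2 * real CARD('d) * A / real n) + (4 * real n / r + 2 / sqrt r) * e1)"
proof -
  interpret P: borel_prob P by fact
  interpret pr: pair_sigma_finite M "lborel :: (real ^ 'd) measure" ..
  let ?N = "M \<Otimes>\<^sub>M (lborel :: (real ^ 'd) measure)"
  let ?K0 = "real CARD('d) * A * gauss_exp TYPE('d) * exp (- \<rho>)"
  have K0: "0 \<le> ?K0" using A gauss_exp_nonneg[where 'd='d] by simp
  define pt where "pt x = (\<Sum>i<n. gaussian_density r (snd x - X i (fst x))) / real n" for x
  define k0 where "k0 x = tilt_kernel n (site n r (Z (fst x))) r 0 (snd x)" for x
  define k where "k x = tilt_kernel n (site n r (Z (fst x))) r (Y1 (fst x)) (snd x)" for x
  let ?s = "P.smooth r"
  have gm: "(\<lambda>x. gaussian_density r (snd x - X i (fst x))) \<in> borel_measurable ?N" if "i < n" for i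
    using measurable_compose[OF measurable_fst measurable_X[OF that]] by measurable
  have ptm[measurable]: "pt \<in> borel_measurable ?N"
  proof -
    have "(\<lambda>x. \<Sum>i<n. gaussian_density r (snd x - X i (fst x))) \<in> borel_measurable ?N"
      by (intro borel_measurable_sum gm) auto
    then show ?thesis unfolding pt_def[abs_def] by measurable
  qed
  have Zm[measurable]: "(\<lambda>x. Z (fst x)) \<in> measurable ?N SU" by measurable
  have sm: "(\<lambda>x. site n r (Z (fst x)) i) \<in> borel_measurable ?N" for i
    by (rule measurable_compose[OF Zm borel_measurable_site])
  have [measurable]: "k0 \<in> borel_measurable ?N" "k \<in> borel_measurable ?N"
    unfolding k0_def[abs_def] k_def[abs_def] tilt_kernel_eq[OF r(1)]
    by (intro borel_measurable_times borel_measurable_divide borel_measurable_tilt_sum sm; measurable)+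
  have fst: "(\<integral>\<^sup>+\<omega>. (\<integral>\<^sup>+y. f (\<omega>, y) \<partial>lborel) \<partial>M) = (\<integral>\<^sup>+x. f x \<partial>?N)" if "f \<in> borel_measurable ?N" for f :: "_ \<Rightarrow> ennreal"
    by (rule lborel.nn_integral_fst[OF that])
  \<comment> \<open>In order: bias, deviation on the cube, the two tails, the change of the sites,
    and the displacement of the starting point.\<close>
  let ?t1 = "\<lambda>x. ennreal \<bar>g (snd x) - ?s (snd x)\<bar>"
  let ?t2 = "\<lambda>x. indicator (cube \<rho>) (snd x) * ennreal \<bar>pt x - ?s (snd x)\<bar>"
  let ?t3 = "\<lambda>x. indicator (- cube \<rho>) (snd x) * ennreal (?s (snd x))"
  let ?t4 = "\<lambda>x. indicator (- cube \<rho>) (snd x) * ennreal (pt x)"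
  let ?t5 = "\<lambda>x. ennreal \<bar>pt x - k0 x\<bar>"
  let ?t6 = "\<lambda>x. ennreal \<bar>k0 x - k x\<bar>"
  have pt0: "0 \<le> pt x" for x by (auto simp: pt_def intro!: divide_nonneg_nonneg sum_nonneg)
  have s0: "0 \<le> ?s y" for y by (rule P.smooth_nonneg)
  have "(\<integral>\<^sup>+\<omega>. (\<integral>\<^sup>+y. ennreal \<bar>g y - tilt_kernel n (site n r (Z \<omega>)) r (Y1 \<omega>) y\<bar> \<partial>lborel) \<partial>M) = (\<integral>\<^sup>+x. ennreal \<bar>g (snd x) - k x\<bar> \<partial>?N)"
    using fst[of "\<lambda>x. ennreal \<bar>g (snd x) - k x\<bar>"] by (simp add: k_def[abs_def, symmetric]) (simp add: k_def)
  also have "\<dots> \<le> (\<integral>\<^sup>+x. ?t1 x + (?t2 x + (?t3 x + (?t4 x + (?t5 x + ?t6 x)))) \<partial>?N)"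
  proof (rule nn_integral_mono)
    fix x
    have "\<bar>g (snd x) - k x\<bar> \<le> \<bar>g (snd x) - ?s (snd x)\<bar> + (\<bar>pt x - ?s (snd x)\<bar> + (\<bar>pt x - k0 x\<bar> + \<bar>k0 x - k x\<bar>))" by linarith
    then have "ennreal \<bar>g (snd x) - k x\<bar> \<le> ?t1 x + (ennreal \<bar>pt x - ?s (snd x)\<bar> + (?t5 x + ?t6 x))"
      by (simp add: ennreal_plus[symmetric] ennreal_leI del: ennreal_plus)
    also have "ennreal \<bar>pt x - ?s (snd x)\<bar> \<le> ?t2 x + (?t3 x + ?t4 x)"
    proof -
      have "\<bar>pt x - ?s (snd x)\<bar> \<le> ?s (snd x) + pt x" using pt0[of x] s0[of "snd x"] by linarith
      then have "ennreal \<bar>pt x - ?s (snd x)\<bar> \<le> ennreal (?s (snd x)) + ennreal (pt x)"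
        using pt0 s0 by (simp add: ennreal_plus[symmetric] ennreal_leI del: ennreal_plus)
      then show ?thesis by (auto split: split_indicator)
    qed
    finally show "ennreal \<bar>g (snd x) - k x\<bar> \<le> ?t1 x + (?t2 x + (?t3 x + (?t4 x + (?t5 x + ?t6 x))))"
      by (simp add: add.assoc add_left_mono add_right_mono)
  qed
  also have "\<dots> = (\<integral>\<^sup>+x. ?t1 x \<partial>?N) + ((\<integral>\<^sup>+x. ?t2 x \<partial>?N) + ((\<integral>\<^sup>+x. ?t3 x \<partial>?N) + ((\<integral>\<^sup>+x. ?t4 x \<partial>?N) + ((\<integral>\<^sup>+x. ?t5 x \<partial>?N) + (\<integral>\<^sup>+x. ?t6 x \<partial>?N)))))"
    by (simp add: nn_integral_add)
  also have "\<dots> \<le> ennreal b1 + (ennreal (sqrt ((2 * \<rho>) ^ CARD('d) * ((1 / sqrt (2 * pi * r)) ^ CARD('d) / real n))) +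
     (ennreal ?K0 + (ennreal ?K0 + (ennreal (2 / real n + 2 * real CARD('d) * A / real n) + ennreal ((4 * (real n / r) + 2 / sqrt r) * e1)))))"
  proof (intro add_mono)
    show "(\<integral>\<^sup>+x. ?t1 x \<partial>?N) \<le> ennreal b1"
      using b1 by (subst fst[symmetric]) (simp_all add: emeasure_space_1)
    show "(\<integral>\<^sup>+x. ?t2 x \<partial>?N) \<le> ennreal (sqrt ((2 * \<rho>) ^ CARD('d) * ((1 / sqrt (2 * pi * r)) ^ CARD('d) / real n)))"
    proof -
      have "(\<integral>\<^sup>+x. ?t2 x \<partial>?N) = (\<integral>\<^sup>+\<omega>. (\<integral>\<^sup>+y. ?t2 (\<omega>, y) \<partial>lborel) \<partial>M)" by (rule fst[symmetric]) measurable
      then show ?thesis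
        using kernel_estimator_deviation[OF bp n indep_X _ r(1) \<rho>] distr_X by (simp add: pt_def P_def)
    qed
    \<comment> \<open>Serves both tails: the mean of the kernel estimator over the samples is the
      smoothing of \<open>P\<close>.\<close>
    have tail: "(\<integral>\<^sup>+y. indicator (- cube \<rho>) y * ennreal (?s y) \<partial>lborel) \<le> ennreal ?K0"
      by (rule P.smooth_tail[OF r A])
    then show "(\<integral>\<^sup>+x. ?t3 x \<partial>?N) \<le> ennreal ?K0"
      by (subst fst[symmetric]) (simp_all add: emeasure_space_1)
    have E: "(\<integral>\<^sup>+\<omega>. f (X i \<omega>) \<partial>M) = (\<integral>\<^sup>+x. f x \<partial>P)" if "i < n" and [measurable]: "f \<in> borel_measurable borel" for i and f :: "_ \<Rightarrow> ennreal"
      unfolding P_def distr_X[OF that(1), symmetric] by (rule nn_integral_distr[symmetric]) (use measurable_X that in auto)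
    show "(\<integral>\<^sup>+x. ?t4 x \<partial>?N) \<le> ennreal ?K0"
    proof -
      have "(\<integral>\<^sup>+x. ?t4 x \<partial>?N) = (\<integral>\<^sup>+y. (\<integral>\<^sup>+\<omega>. ?t4 (\<omega>, y) \<partial>M) \<partial>lborel)"
        by (rule pr.nn_integral_snd[symmetric]) measurable
      also have "\<dots> = (\<integral>\<^sup>+y. indicator (- cube \<rho>) y * ennreal (?s y) \<partial>lborel)"
      proof (rule nn_integral_cong)
        fix y
        have m: "(\<lambda>\<omega>. ennreal (gaussian_density r (y - X i \<omega>))) \<in> borel_measurable M" if "i < n" for i
          using measurable_X[OF that] by measurable
        have "(\<integral>\<^sup>+\<omega>. ennreal (pt (\<omega>, y)) \<partial>M) = (\<integral>\<^sup>+\<omega>. ennreal (1 / real n) * (\<Sum>i<n. ennreal (gaussian_density r (y - X i \<omega>))) \<partial>M)"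
          by (intro nn_integral_cong) (simp add: pt_def sum_ennreal ennreal_mult[symmetric] sum_nonneg)
        also have "\<dots> = ennreal (1 / real n) * (\<Sum>i<n. (\<integral>\<^sup>+\<omega>. ennreal (gaussian_density r (y - X i \<omega>)) \<partial>M))"
          using m by (subst nn_integral_cmult, intro borel_measurable_sum, simp, subst nn_integral_sum) auto
        also have "\<dots> = ennreal (1 / real n) * (\<Sum>i<n. ennreal (?s y))"
          using E[of _ "\<lambda>x. ennreal (gaussian_density r (y - x))"] by (simp add: P.ennreal_smooth[OF r(1)])
        also have "\<dots> = ennreal (?s y)"
          using n s0 by (simp add: ennreal_of_nat_eq_real_of_nat ennreal_mult[symmetric])
        finally have pi: "(\<integral>\<^sup>+\<omega>. ennreal (pt (\<omega>, y)) \<partial>M) = ennreal (?s y)" .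
        have "(\<lambda>\<omega>. ennreal (pt (\<omega>, y))) \<in> borel_measurable M" by measurable
        from nn_integral_cmult[OF this, of "indicator (- cube \<rho>) y"]
        show "(\<integral>\<^sup>+\<omega>. ?t4 (\<omega>, y) \<partial>M) = indicator (- cube \<rho>) y * ennreal (?s y)" by (simp add: pi)
      qed
      finally show ?thesis using tail by simp
    qed
    show "(\<integral>\<^sup>+x. ?t5 x \<partial>?N) \<le> ennreal (2 / real n + 2 * real CARD('d) * A / real n)"
    proof -
      \<comment> \<open>Markov's inequality, with the norm bounded by the sum of the coordinates and
        each coordinate by its exponential.\<close>
      have Pn: "(\<integral>\<^sup>+x. indicator {y. real n < norm y} x \<partial>P) \<le> ennreal (real CARD('d) * A / real n)"
      proof -
        have "(\<integral>\<^sup>+x. indicator {y. real n < norm y} x \<partial>P) \<le> (\<integral>\<^sup>+x. ennreal (1 / real n) * (\<Sum>j\<in>UNIV. ennreal (exp \<bar>x $ j\<bar>)) \<partial>P)"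
        proof (rule nn_integral_mono)
          fix x :: "real ^ 'd"
          show "indicator {y. real n < norm y} x \<le> ennreal (1 / real n) * (\<Sum>j\<in>UNIV. ennreal (exp \<bar>x $ j\<bar>))"
          proof (cases "real n < norm x")
            case True
            also have "norm x \<le> (\<Sum>j\<in>UNIV. \<bar>x $ j\<bar>)" by (rule norm_le_l1_cart)
            also have "\<dots> \<le> (\<Sum>j\<in>UNIV. exp \<bar>x $ j\<bar>)" by (intro sum_mono) (metis abs_ge_self abs_of_pos add.commute exp_ge_add_one_self less_add_one less_imp_le order_trans exp_gt_zero)
            finally have "1 \<le> 1 / real n * (\<Sum>j\<in>UNIV. exp \<bar>x $ j\<bar>)" using n by (simp add: field_simps)
            then have "ennreal 1 \<le> ennreal (1 / real n * (\<Sum>j\<in>UNIV. exp \<bar>x $ j\<bar>))" by (rule ennreal_leI)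
            also have "\<dots> = ennreal (1 / real n) * (\<Sum>j\<in>UNIV. ennreal (exp \<bar>x $ j\<bar>))"
              by (subst ennreal_mult) (auto simp: sum_nonneg)
            finally show ?thesis using True by simp
          qed simp
        qed
        also have "\<dots> = ennreal (1 / real n) * (\<Sum>j\<in>UNIV. (\<integral>\<^sup>+x. ennreal (exp \<bar>x $ j\<bar>) \<partial>P))"
          by (subst nn_integral_cmult, simp, subst nn_integral_sum) auto
        also have "\<dots> \<le> ennreal (1 / real n) * (\<Sum>j\<in>(UNIV :: 'd set). ennreal A)" by (intro mult_left_mono sum_mono A) auto
        also have "\<dots> = ennreal (real CARD('d) * A / real n)" using A by (simp add: ennreal_of_nat_eq_real_of_nat ennreal_mult[symmetric])
        finally show ?thesis .
      qed
      have "(\<integral>\<^sup>+x. ?t5 x \<partial>?N) = (\<integral>\<^sup>+\<omega>. (\<integral>\<^sup>+y. ?t5 (\<omega>, y) \<partial>lborel) \<partial>M)" by (rule fst[symmetric]) measurable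
      also have "\<dots> \<le> (\<integral>\<^sup>+\<omega>. ennreal (2 / real n) + (\<Sum>i<n. ennreal (2 / real n) * indicator {y. real n < norm y} (X i \<omega>)) \<partial>M)"
      proof (rule nn_integral_mono)
        fix \<omega>
        show "(\<integral>\<^sup>+y. ?t5 (\<omega>, y) \<partial>lborel) \<le> ennreal (2 / real n) + (\<Sum>i<n. ennreal (2 / real n) * indicator {y. real n < norm y} (X i \<omega>))"
          using tilt_kernel_site_diff[OF r(1) n, of "samples n X \<omega>" "U \<omega>"] by (simp add: pt_def k0_def samples_def)
      qed
      also have "\<dots> = ennreal (2 / real n) + (\<Sum>i<n. ennreal (2 / real n) * (\<integral>\<^sup>+\<omega>. indicator {y. real n < norm y} (X i \<omega>) \<partial>M))"
      proof -
        have m: "(\<lambda>\<omega>. indicator {y. real n < norm y} (X i \<omega>) :: ennreal) \<in> borel_measurable M" if "i < n" for i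
          using measurable_X[OF that] by measurable
        then show ?thesis
          by (subst nn_integral_add, simp, intro borel_measurable_sum, simp, subst nn_integral_sum, simp)
            (auto simp: emeasure_space_1 nn_integral_cmult intro!: sum.cong)
      qed
      also have "\<dots> \<le> ennreal (2 / real n) + (\<Sum>i<n. ennreal (2 / real n) * ennreal (real CARD('d) * A / real n))"
        by (intro add_left_mono sum_mono mult_left_mono) (use E Pn in auto)
      also have "\<dots> = ennreal (2 / real n + 2 * real CARD('d) * A / real n)"
        using n A by (simp add: ennreal_of_nat_eq_real_of_nat ennreal_mult[symmetric] ennreal_plus[symmetric] del: ennreal_plus)
      finally show ?thesis .
    qed
    show "(\<integral>\<^sup>+x. ?t6 x \<partial>?N) \<le> ennreal ((4 * (real n / r) + 2 / sqrt r) * e1)"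
    proof -
      have c: "0 \<le> 4 * (real n / r) + 2 / sqrt r" using r by simp
      have "(\<integral>\<^sup>+x. ?t6 x \<partial>?N) = (\<integral>\<^sup>+\<omega>. (\<integral>\<^sup>+y. ?t6 (\<omega>, y) \<partial>lborel) \<partial>M)" by (rule fst[symmetric]) measurable
      also have "\<dots> \<le> (\<integral>\<^sup>+\<omega>. ennreal (4 * (real n / r) + 2 / sqrt r) * ennreal (norm (Y1 \<omega>)) \<partial>M)"
      proof (rule nn_integral_mono)
        fix \<omega>
        have "(\<integral>\<^sup>+y. ?t6 (\<omega>, y) \<partial>lborel) \<le> ennreal ((4 * (real n / r) + 2 / sqrt r) * norm (Y1 \<omega>))"
          unfolding k0_def k_def fst_conv snd_conv by (rule tilt_kernel_start_diff[OF r(1)]) (rule norm_site_le[OF r(1)])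
        then show "(\<integral>\<^sup>+y. ?t6 (\<omega>, y) \<partial>lborel) \<le> ennreal (4 * (real n / r) + 2 / sqrt r) * ennreal (norm (Y1 \<omega>))"
          using c by (simp add: ennreal_mult)
      qed
      also have "\<dots> = ennreal (4 * (real n / r) + 2 / sqrt r) * (\<integral>\<^sup>+\<omega>. ennreal (norm (Y1 \<omega>)) \<partial>M)" by (rule nn_integral_cmult) measurable
      also have "\<dots> \<le> ennreal (4 * (real n / r) + 2 / sqrt r) * ennreal e1" by (intro mult_left_mono e1) auto
      also have "\<dots> = ennreal ((4 * (real n / r) + 2 / sqrt r) * e1)" using c e1 by (simp add: ennreal_mult)
      finally show ?thesis .
    qed
  qed
  also have "\<dots> = ennreal (b1 + (sqrt ((2 * \<rho>) ^ CARD('d) * ((1 / sqrt (2 * pi * r)) ^ CARD('d) / real n)) + 2 * ?K0)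
       + (2 / real n + 2 * real CARD('d) * A / real n) + (4 * real n / r + 2 / sqrt r) * e1)"
  proof -
    have sum6: "ennreal a + (ennreal b + (ennreal c + (ennreal c + (ennreal e + ennreal f)))) = ennreal (a + (b + 2 * c) + e + f)"
      if "0 \<le> a" "0 \<le> b" "0 \<le> c" "0 \<le> e" "0 \<le> f" for a b c e f :: real
      using that by (simp add: ennreal_plus[symmetric] del: ennreal_plus)
    have "0 \<le> (4 * (real n / r) + 2 / sqrt r) * e1" using r e1 by simp
    moreover have "0 \<le> 2 / real n + 2 * real CARD('d) * A / real n" using A by simp
    moreover have "0 \<le> sqrt ((2 * \<rho>) ^ CARD('d) * ((1 / sqrt (2 * pi * r)) ^ CARD('d) / real n))" using \<rho> r by simp
    ultimately show ?thesis using sum6[OF b1(2) _ K0] by simp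
  qed
  finally show ?thesis .
qed

end

section \<open>The score estimator\<close>

definition early_time :: "real \<Rightarrow> real \<Rightarrow> nat \<Rightarrow> real" where
  "early_time \<beta> d n = real n powr (- (2 / (2 * \<beta> + d)))"

definition horizon :: "real \<Rightarrow> real \<Rightarrow> nat \<Rightarrow> real" where
  "horizon \<beta> d n = real n powr (2 * \<beta> / (2 * \<beta> + d))"

text \<open>
  The factor is small enough for two periods of length \<open>tilt_time\<close> to fit between 0 and
  \<^term>\<open>horizon \<beta> d n - early_time \<beta> d n\<close>, because \<^term>\<open>horizon \<beta> d n\<close> is at least
  \<^term>\<open>2 powr ((2 * \<beta> + 2) / (2 * \<beta> + d)) * early_time \<beta> d n\<close>.
\<close>

definition time_fraction :: "real \<Rightarrow> real \<Rightarrow> real" where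
  "time_fraction \<beta> d = min 1 (2 powr ((2 * \<beta> + 2) / (2 * \<beta> + d)) - 1) / 2"

definition tilt_time :: "real \<Rightarrow> real \<Rightarrow> nat \<Rightarrow> real" where
  "tilt_time \<beta> d n = time_fraction \<beta> d * early_time \<beta> d n"

definition switch_time :: "real \<Rightarrow> real \<Rightarrow> nat \<Rightarrow> real" where
  "switch_time \<beta> d n = horizon \<beta> d n - early_time \<beta> d n - tilt_time \<beta> d n"

text \<open>The bounds of \<open>early_time\<close> and \<open>horizon\<close> by powers of
  \<open>n\<close> are crude but suffice, as they enter only into the error of the starting point.
  That the switch comes no earlier than \<open>tilt_time\<close> leaves the contraction enough
  time.\<close>

lemma time_schedule:
  fixes \<beta> d :: real
  assumes \<beta>: "0 < \<beta>" and d: "1 \<le> d" and n: "2 \<le> n"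
  defines "c \<equiv> time_fraction \<beta> d"
  shows "0 < c" "c \<le> 1 / 2" "1 / (real n)\<^sup>2 \<le> early_time \<beta> d n" "early_time \<beta> d n \<le> 1" "1 \<le> horizon \<beta> d n" "horizon \<beta> d n \<le> real n"
    "tilt_time \<beta> d n \<le> switch_time \<beta> d n" "0 < tilt_time \<beta> d n" "tilt_time \<beta> d n \<le> early_time \<beta> d n" "switch_time \<beta> d n \<le> horizon \<beta> d n"
proof -
  have n1: "1 \<le> real n" "2 \<le> real n" using n by auto
  have D: "0 < 2 * \<beta> + d" using \<beta> d by simp
  let ?\<gamma> = "(2 * \<beta> + 2) / (2 * \<beta> + d)"
  have g: "0 < ?\<gamma>" using \<beta> D by simp
  have "1 < 2 powr ?\<gamma>" using g by (simp add: gr_one_powr)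
  then show c: "0 < c" and c2: "c \<le> 1 / 2" by (auto simp: c_def time_fraction_def)
  have e: "2 / (2 * \<beta> + d) \<le> 2" using \<beta> d by (simp add: divide_le_eq)
  have "1 / (real n)\<^sup>2 = real n powr (- 2)" using n1 by (simp add: powr_minus powr_numeral divide_inverse)
  also have "\<dots> \<le> real n powr (- (2 / (2 * \<beta> + d)))" using n1 e by (intro powr_mono) auto
  finally show "1 / (real n)\<^sup>2 \<le> early_time \<beta> d n" by (simp add: early_time_def)
  have "real n powr (- (2 / (2 * \<beta> + d))) \<le> real n powr 0" using n1 D by (intro powr_mono) auto
  then show e1: "early_time \<beta> d n \<le> 1" using n1 by (simp add: early_time_def)
  have e0: "0 < early_time \<beta> d n" using n1 by (simp add: early_time_def)
  have "real n powr 0 \<le> real n powr (2 * \<beta> / (2 * \<beta> + d))" using n1 D \<beta> by (intro powr_mono) auto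
  then show "1 \<le> horizon \<beta> d n" using n1 by (simp add: horizon_def)
  have "real n powr (2 * \<beta> / (2 * \<beta> + d)) \<le> real n powr 1" using n1 D d by (intro powr_mono) auto
  then show "horizon \<beta> d n \<le> real n" using n1 by (simp add: horizon_def)
  have "horizon \<beta> d n = early_time \<beta> d n * real n powr ?\<gamma>"
    using n1 by (simp add: horizon_def early_time_def powr_add[symmetric] add_divide_distrib)
  moreover have "2 powr ?\<gamma> \<le> real n powr ?\<gamma>" using n1 g by (intro powr_mono2) auto
  moreover have "2 * c \<le> 2 powr ?\<gamma> - 1" by (simp add: c_def time_fraction_def)
  ultimately have "horizon \<beta> d n = early_time \<beta> d n * real n powr ?\<gamma>" "1 + 2 * c \<le> real n powr ?\<gamma>" by simp_all
  then have "early_time \<beta> d n * (1 + 2 * c) \<le> horizon \<beta> d n" using e0 by simp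
  then show "tilt_time \<beta> d n \<le> switch_time \<beta> d n"
    by (simp add: switch_time_def tilt_time_def c_def[symmetric] algebra_simps)
  show t0: "0 < tilt_time \<beta> d n" using c e0 by (simp add: tilt_time_def c_def)
  show "tilt_time \<beta> d n \<le> early_time \<beta> d n"
    using c c2 e0 by (simp add: tilt_time_def c_def[symmetric] mult_left_le_one_le)
  show "switch_time \<beta> d n \<le> horizon \<beta> d n" using e0 t0 by (simp add: switch_time_def)
qed

text \<open>
  The exponent 10 is generous: the distance to the origin at the switch, of order \<open>n\<^sup>-\<^sup>5\<close>, is amplified by at
  most a multiple of \<open>n\<^sup>3\<close> afterwards.
\<close>

definition est_drift :: "real \<Rightarrow> nat \<Rightarrow> real \<Rightarrow> (nat \<Rightarrow> real ^ 'd) \<times> real \<Rightarrow> real ^ 'd \<Rightarrow> real ^ 'd" where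
  "est_drift \<beta> n u z x =
     (if u < switch_time \<beta> (real CARD('d)) n then - (real n ^ 10) *\<^sub>R x
      else tilt_drift n (site n (tilt_time \<beta> (real CARD('d)) n) z) (u - switch_time \<beta> (real CARD('d)) n) x)"

definition est_score :: "real \<Rightarrow> 'd::finite score_rule" where
  "est_score \<beta> n t xs v x = est_drift \<beta> n (horizon \<beta> (real CARD('d)) n - t) (xs, v) x"

lemma measurable_est_drift:
  "(\<lambda>(u, z, x). est_drift \<beta> n u z x :: real ^ 'd::finite) \<in> borel_measurable
     (borel \<Otimes>\<^sub>M ((\<Pi>\<^sub>M i\<in>{..<n}. borel) \<Otimes>\<^sub>M borel) \<Otimes>\<^sub>M borel)"
proof -
  let ?N = "(borel :: real measure) \<Otimes>\<^sub>M ((\<Pi>\<^sub>M i\<in>{..<n}. (borel :: (real ^ 'd) measure)) \<Otimes>\<^sub>M (borel :: real measure)) \<Otimes>\<^sub>M (borel :: (real ^ 'd) measure)"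
  have [measurable]: "(\<lambda>p. site n r (fst (snd p)) i) \<in> borel_measurable ?N" for r i
    by (rule measurable_compose[OF _ borel_measurable_site]) measurable
  have "(\<lambda>p. tilt_drift n (site n r (fst (snd p))) (fst p - s) (snd (snd p))) \<in> borel_measurable ?N" for r s
    by (rule borel_measurable_tilt_drift) measurable
  note [measurable] = this
  show ?thesis unfolding est_drift_def split_beta' by measurable
qed

text \<open>The rule is deterministic, which the point mass at 0 encodes.\<close>

lemma score_estimator_est_score: "score_estimator (return borel 0) (est_score \<beta> :: 'd::finite score_rule)"
  unfolding score_estimator_def
proof (intro conjI allI impI)
  show "prob_space (return borel (0 :: real))" by (rule prob_space_return) simp
  fix n :: nat
  let ?N = "restrict_space borel {0::real<..} \<Otimes>\<^sub>M (\<Pi>\<^sub>M i\<in>{..<n}. (borel :: (real ^ 'd) measure)) \<Otimes>\<^sub>M (borel :: real measure) \<Otimes>\<^sub>M (borel :: (real ^ 'd) measure)"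
  have [measurable]: "(\<lambda>p. fst p) \<in> borel_measurable ?N"
    by (rule measurable_compose[OF measurable_fst]) (rule measurable_restrict_space1, simp)
  have "(\<lambda>p. (horizon \<beta> (real CARD('d)) n - fst p, (fst (snd p), fst (snd (snd p))), snd (snd (snd p))))
     \<in> measurable ?N (borel \<Otimes>\<^sub>M ((\<Pi>\<^sub>M i\<in>{..<n}. borel) \<Otimes>\<^sub>M borel) \<Otimes>\<^sub>M borel)"
    by measurable
  from measurable_compose[OF this measurable_est_drift[of \<beta> n]]
  show "(\<lambda>(t, xs, u, x). est_score \<beta> n t xs u x :: real ^ 'd) \<in> borel_measurable ?N"
    by (simp add: est_score_def split_beta')
qed simp

text \<open>One constant in space for both periods. The jump in time at the switch is harmless, as
  Picard iteration asks only for measurability in time.\<close>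

lemma est_drift_lipschitz:
  fixes x y :: "real ^ 'd::finite"
  assumes \<beta>: "0 < \<beta>" and n: "2 \<le> n"
  defines "R \<equiv> real n / tilt_time \<beta> (real CARD('d)) n"
  shows "norm (est_drift \<beta> n u z x - est_drift \<beta> n u z y) \<le> (real n ^ 10 + 4 * R\<^sup>2) * norm (x - y)"
    and "norm (est_drift \<beta> n u z (0 :: real ^ 'd)) \<le> R"
proof -
  have d: "1 \<le> real CARD('d)" by (simp add: Suc_le_eq)
  have r: "0 < tilt_time \<beta> (real CARD('d)) n" by (rule time_schedule(8)[OF \<beta> d n])
  have R: "0 \<le> R" using r by (simp add: R_def)
  have s: "norm (site n (tilt_time \<beta> (real CARD('d)) n) z i) \<le> R" for i unfolding R_def by (rule norm_site_le[OF r])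
  show "norm (est_drift \<beta> n u z x - est_drift \<beta> n u z y) \<le> (real n ^ 10 + 4 * R\<^sup>2) * norm (x - y)"
  proof (cases "u < switch_time \<beta> (real CARD('d)) n")
    case True
    then have "est_drift \<beta> n u z x - est_drift \<beta> n u z y = - (real n ^ 10) *\<^sub>R (x - y)"
      by (simp add: est_drift_def algebra_simps)
    then show ?thesis by (simp add: distrib_right)
  next
    case False
    have "norm (tilt_drift n (site n (tilt_time \<beta> (real CARD('d)) n) z) (u - switch_time \<beta> (real CARD('d)) n) x
       - tilt_drift n (site n (tilt_time \<beta> (real CARD('d)) n) z) (u - switch_time \<beta> (real CARD('d)) n) y)
       \<le> 4 * R\<^sup>2 * norm (x - y) + 2 * R ^ 3 * \<bar>(u - switch_time \<beta> (real CARD('d)) n) - (u - switch_time \<beta> (real CARD('d)) n)\<bar>"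
      by (rule tilt_drift_diff_le) (rule s)
    then show ?thesis using False by (simp add: est_drift_def distrib_right add_increasing)
  qed
  have "norm (tilt_drift n (site n (tilt_time \<beta> (real CARD('d)) n) z) (u - switch_time \<beta> (real CARD('d)) n) 0) \<le> R"
    by (rule norm_tilt_drift_le) (rule s)
  then show "norm (est_drift \<beta> n u z (0 :: real ^ 'd)) \<le> R" using R by (simp add: est_drift_def)
qed

context diffusion
begin

lemma est_solution_exists:
  assumes \<beta>: "0 < \<beta>" and n: "2 \<le> n" and T: "T = horizon \<beta> (real CARD('d)) n"
  shows "\<exists>Y. diffusion_solution M n (est_score \<beta>) T (T - early_time \<beta> (real CARD('d)) n) X U Y0 B Y"
proof -
  let ?H = "T - early_time \<beta> (real CARD('d)) n"
  have d: "1 \<le> real CARD('d)" by (simp add: Suc_le_eq)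
  note sch = time_schedule[OF \<beta> d n]
  let ?R = "real n / tilt_time \<beta> (real CARD('d)) n"
  have h: "0 \<le> ?H" using sch T by simp
  have L: "0 < real n ^ 10 + 4 * ?R\<^sup>2" using n by (intro add_pos_nonneg) auto
  obtain Y where Y: "\<And>t. t \<in> {0..?H} \<Longrightarrow> Y t \<in> borel_measurable (H t)"
    and sol: "AE \<omega> in M. continuous_on {0..?H} (\<lambda>t. Y t \<omega>) \<and>
        set_integrable lborel {0..?H} (\<lambda>u. est_drift \<beta> n u (Z \<omega>) (Y u \<omega>)) \<and>
        (\<forall>t\<in>{0..?H}. Y t \<omega> = Y0 \<omega> + (LINT u:{0..t}|lborel. est_drift \<beta> n u (Z \<omega>) (Y u \<omega>)) + B t \<omega>)"
    using sde_solution_exists[OF measurable_est_drift est_drift_lipschitz(1)[OF \<beta> n] L est_drift_lipschitz(2)[OF \<beta> n] h] by blast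
  have "diffusion_solution M n (est_score \<beta>) T ?H X U Y0 B Y"
    unfolding diffusion_solution_def
  proof (intro conjI ballI)
    fix t assume t: "t \<in> {0..?H}"
    show "Y t \<in> borel_measurable M" by (rule measurable_from_H[OF Y[OF t]])
    show "\<exists>Z\<in>borel_measurable (H t). AE \<omega> in M. Y t \<omega> = Z \<omega>" by (rule bexI[OF _ Y[OF t]]) simp
  qed (use sol in \<open>simp add: est_score_def T\<close>)
  then show ?thesis by blast
qed

text \<open>Splits an arbitrary solution at the switch. The second period is expressed by
  increments, as \<open>tilt_phase\<close> demands, the first by a pathwise linear equation.\<close>

lemma est_solution_phases:
  assumes \<beta>: "0 < \<beta>" and n: "2 \<le> n" and T: "T = horizon \<beta> (real CARD('d)) n"
    and Y: "diffusion_solution M n (est_score \<beta>) T (T - early_time \<beta> (real CARD('d)) n) X U Y0 B Y"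
  defines "r \<equiv> tilt_time \<beta> (real CARD('d)) n" and "t1 \<equiv> switch_time \<beta> (real CARD('d)) n"
  shows "tilt_phase M n p Q T X U Y0 B n (real n / r) r t1 (site n r) Y"
    and "AE \<omega> in M. \<exists>y. y t1 = Y t1 \<omega> \<and> continuous_on {0..t1} y \<and>
       (\<forall>t\<in>{0..t1}. y t = Y0 \<omega> + (LINT u:{0..t}|lborel. - (real n ^ 10) *\<^sub>R y u) + B t \<omega>)"
proof -
  let ?H = "T - early_time \<beta> (real CARD('d)) n"
  have d: "1 \<le> real CARD('d)" by (simp add: Suc_le_eq)
  note sch = time_schedule[OF \<beta> d n]
  have r: "0 < r" and t1: "0 < t1" using sch by (auto simp: r_def t1_def)
  have H: "t1 + r = ?H" by (simp add: r_def t1_def T switch_time_def)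
  have sol: "AE \<omega> in M. continuous_on {0..?H} (\<lambda>t. Y t \<omega>) \<and>
        set_integrable lborel {0..?H} (\<lambda>u. est_drift \<beta> n u (Z \<omega>) (Y u \<omega>)) \<and>
        (\<forall>t\<in>{0..?H}. Y t \<omega> = Y0 \<omega> + (LINT u:{0..t}|lborel. est_drift \<beta> n u (Z \<omega>) (Y u \<omega>)) + B t \<omega>)"
    using Y unfolding diffusion_solution_def by (simp add: est_score_def T)
  show "tilt_phase M n p Q T X U Y0 B n (real n / r) r t1 (site n r) Y"
  proof
    show "0 < r" "0 \<le> t1" using r t1 by auto
    show "norm (site n r z i) \<le> real n / r" if "i \<le> n" for z :: "(nat \<Rightarrow> real ^ 'd) \<times> real" and i by (rule norm_site_le[OF r])
    show "0 \<in> site n r z ` {..n}" for z :: "(nat \<Rightarrow> real ^ 'd) \<times> real" by (rule zero_site)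
    show "(\<lambda>z. site n r z i) \<in> borel_measurable SU" if "i \<le> n" for i by (rule borel_measurable_site)
    fix t assume t: "t1 \<le> t" "t \<le> t1 + r"
    then have t': "t \<in> {0..?H}" using t1 H by auto
    show "Y t \<in> borel_measurable M" "\<exists>V\<in>borel_measurable (H t). AE \<omega> in M. Y t \<omega> = V \<omega>"
      using Y t' unfolding diffusion_solution_def by blast+
  next
    show "AE \<omega> in M. continuous_on {t1..t1 + r} (\<lambda>t. Y t \<omega>) \<and>
       (\<forall>s t. t1 \<le> s \<and> s \<le> t \<and> t \<le> t1 + r \<longrightarrow>
          Y t \<omega> - Y s \<omega> = (LINT u:{s..t}|lborel. tilt_drift n (site n r (Z \<omega>)) (u - t1) (Y u \<omega>)) + (B t \<omega> - B s \<omega>))"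
      using sol
    proof eventually_elim
      case (elim \<omega>)
      then have c: "continuous_on {0..?H} (\<lambda>t. Y t \<omega>)"
        and i: "set_integrable lborel {0..?H} (\<lambda>u. est_drift \<beta> n u (Z \<omega>) (Y u \<omega>))"
        and e: "\<And>t. t \<in> {0..?H} \<Longrightarrow> Y t \<omega> = Y0 \<omega> + (LINT u:{0..t}|lborel. est_drift \<beta> n u (Z \<omega>) (Y u \<omega>)) + B t \<omega>" by auto
      show ?case
      proof (intro conjI allI impI)
        show "continuous_on {t1..t1 + r} (\<lambda>t. Y t \<omega>)" by (rule continuous_on_subset[OF c]) (use t1 H in auto)
        fix s t assume st: "t1 \<le> s \<and> s \<le> t \<and> t \<le> t1 + r"
        have "(LINT u:{0..t}|lborel. est_drift \<beta> n u (Z \<omega>) (Y u \<omega>)) = (LINT u:{0..s}|lborel. est_drift \<beta> n u (Z \<omega>) (Y u \<omega>)) + (LINT u:{s..t}|lborel. est_drift \<beta> n u (Z \<omega>) (Y u \<omega>))"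
          by (rule set_integral_split_Icc) (use st t1 H in \<open>auto intro: set_integrable_subset[OF i]\<close>)
        moreover have "(LINT u:{s..t}|lborel. est_drift \<beta> n u (Z \<omega>) (Y u \<omega>)) = (LINT u:{s..t}|lborel. tilt_drift n (site n r (Z \<omega>)) (u - t1) (Y u \<omega>))"
          by (rule set_lebesgue_integral_cong) (use st in \<open>auto simp: est_drift_def r_def t1_def\<close>)
        ultimately show "Y t \<omega> - Y s \<omega> = (LINT u:{s..t}|lborel. tilt_drift n (site n r (Z \<omega>)) (u - t1) (Y u \<omega>)) + (B t \<omega> - B s \<omega>)"
          using e[of t] e[of s] st t1 H by simp
      qed
    qed
  qed
  show "AE \<omega> in M. \<exists>y. y t1 = Y t1 \<omega> \<and> continuous_on {0..t1} y \<and>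
       (\<forall>t\<in>{0..t1}. y t = Y0 \<omega> + (LINT u:{0..t}|lborel. - (real n ^ 10) *\<^sub>R y u) + B t \<omega>)"
    using sol
  proof eventually_elim
    case (elim \<omega>)
    then have c: "continuous_on {0..?H} (\<lambda>t. Y t \<omega>)"
      and i: "set_integrable lborel {0..?H} (\<lambda>u. est_drift \<beta> n u (Z \<omega>) (Y u \<omega>))"
      and e: "\<And>t. t \<in> {0..?H} \<Longrightarrow> Y t \<omega> = Y0 \<omega> + (LINT u:{0..t}|lborel. est_drift \<beta> n u (Z \<omega>) (Y u \<omega>)) + B t \<omega>" by auto
    have c1: "continuous_on {0..t1} (\<lambda>t. Y t \<omega>)" by (rule continuous_on_subset[OF c]) (use r H in auto)
    show ?case
    proof (intro exI[of _ "\<lambda>t. Y t \<omega>"] conjI ballI c1 refl)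
      fix t assume t: "t \<in> {0..t1}"
      have "(LINT u:{0..t}|lborel. est_drift \<beta> n u (Z \<omega>) (Y u \<omega>)) = (LINT u:{0..t}|lborel. - (real n ^ 10) *\<^sub>R Y u \<omega>)"
        unfolding set_lebesgue_integral_def
      proof (rule integral_cong_AE)
        have "set_integrable lborel {0..t} (\<lambda>u. est_drift \<beta> n u (Z \<omega>) (Y u \<omega>))"
          by (rule set_integrable_subset[OF i]) (use t r H in auto)
        then show "(\<lambda>u. indicator {0..t} u *\<^sub>R est_drift \<beta> n u (Z \<omega>) (Y u \<omega>)) \<in> borel_measurable lborel"
          unfolding set_integrable_def by (rule borel_measurable_integrable)
        have "set_integrable lborel {0..t} (\<lambda>u. - (real n ^ 10) *\<^sub>R Y u \<omega>)"
          by (rule borel_integrable_atLeastAtMost') (use t in \<open>auto intro!: continuous_intros continuous_on_subset[OF c1]\<close>)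
        then show "(\<lambda>u. indicator {0..t} u *\<^sub>R - (real n ^ 10) *\<^sub>R Y u \<omega>) \<in> borel_measurable lborel"
          unfolding set_integrable_def by (rule borel_measurable_integrable)
        \<comment> \<open>At the switch itself the drift is already the tilted one; a single time is
          a null set.\<close>
        show "AE u in lborel. indicator {0..t} u *\<^sub>R est_drift \<beta> n u (Z \<omega>) (Y u \<omega>) = indicator {0..t} u *\<^sub>R - (real n ^ 10) *\<^sub>R Y u \<omega>"
          using AE_lborel_singleton[of t1] by eventually_elim (use t in \<open>auto simp: est_drift_def t1_def split: split_indicator\<close>)
      qed
      then show "Y t \<omega> = Y0 \<omega> + (LINT u:{0..t}|lborel. - (real n ^ 10) *\<^sub>R Y u \<omega>) + B t \<omega>"
        using e[of t] t r H by auto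
    qed
  qed
qed

end

section \<open>The rate\<close>

lemma rate_power:
  fixes \<beta> d :: real
  assumes \<beta>: "0 < \<beta>" and d: "0 < d" and n: "2 \<le> n"
  shows "early_time \<beta> d n powr \<beta> = (real n powr (- (\<beta> / (2 * \<beta> + d))))\<^sup>2"
  using n by (simp add: early_time_def powr_powr powr_power)

text \<open>With a bandwidth proportional to \<open>early_time\<close>, the exponent is d / (2
  \<beta> + d) - 1 = - 2 \<beta> / (2 \<beta> + d), the same as for the squared bias in
  \<open>rate_power\<close>.\<close>

lemma variance_rate:
  fixes \<beta> c :: real and d :: nat
  assumes \<beta>: "0 < \<beta>" and n: "2 \<le> n" and c: "0 < c"
  shows "(1 / sqrt (2 * pi * (c * early_time \<beta> (real d) n))) ^ d / real n
    = (1 / sqrt (2 * pi * c)) ^ d * (real n powr (- (\<beta> / (2 * \<beta> + real d))))\<^sup>2"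
proof -
  let ?D = "2 * \<beta> + real d"
  have D: "0 < ?D" using \<beta> by simp
  have n0: "0 < real n" using n by simp
  have "early_time \<beta> (real d) n = (real n powr (- (1 / ?D)))\<^sup>2" using n0 by (simp add: early_time_def powr_power)
  then have "sqrt (early_time \<beta> (real d) n) = real n powr (- (1 / ?D))" by simp
  then have "1 / sqrt (early_time \<beta> (real d) n) = real n powr (1 / ?D)" using n0 by (simp add: powr_minus_divide)
  then have e: "(1 / sqrt (early_time \<beta> (real d) n)) ^ d = real n powr (real d / ?D)" using n0 by (simp add: powr_power)
  have "(1 / sqrt (2 * pi * (c * early_time \<beta> (real d) n))) ^ d
      = (1 / sqrt (2 * pi * c)) ^ d * (1 / sqrt (early_time \<beta> (real d) n)) ^ d"
    by (simp add: real_sqrt_mult power_mult_distrib power_divide)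
  also have "\<dots> / real n = (1 / sqrt (2 * pi * c)) ^ d * (real n powr (real d / ?D) * real n powr (- 1))"
    unfolding e using n0 by (simp add: powr_minus_divide del: powr_add)
  also have "real n powr (real d / ?D) * real n powr (- 1) = real n powr (real d / ?D - 1)" by (simp only: powr_add[symmetric] add_uminus_conv_diff)
  also have "real d / ?D - 1 = - (2 * \<beta> / ?D)" using D by (simp add: field_simps)
  also have "real n powr (- (2 * \<beta> / ?D)) = (real n powr (- (\<beta> / ?D)))\<^sup>2" using n0 by (simp add: powr_power)
  finally show ?thesis .
qed

text \<open>Absorbs all errors of order 1/n into the main rate. The logarithmic factor is at least 1
  because \<open>2 * ln 2 \<ge> 1\<close>.\<close>

lemma inverse_le_rate:
  fixes \<beta> :: real
  assumes \<beta>: "0 < \<beta>" and n: "2 \<le> n"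
  shows "1 / real n \<le> sqrt ((2 * ln (real n)) ^ d) * real n powr (- (\<beta> / (2 * \<beta> + real d)))"
proof -
  have D: "\<beta> / (2 * \<beta> + real d) \<le> 1" using \<beta> by (simp add: divide_le_eq)
  have "1 / 2 \<le> ln (2 :: real)" using ln2_ge_two_thirds by simp
  also have "ln 2 \<le> ln (real n)" using n by simp
  finally have "1 \<le> sqrt ((2 * ln (real n)) ^ d)" using one_le_power[of "2 * ln (real n)" d] by simp
  then have "1 * real n powr (- (\<beta> / (2 * \<beta> + real d))) \<le> sqrt ((2 * ln (real n)) ^ d) * real n powr (- (\<beta> / (2 * \<beta> + real d)))"
    by (intro mult_right_mono) auto
  moreover have "real n powr (- 1) \<le> real n powr (- (\<beta> / (2 * \<beta> + real d)))" using n D by (intro powr_mono) auto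
  moreover have "real n powr (- 1) = 1 / real n" by (simp add: powr_minus_divide)
  ultimately show ?thesis by simp
qed

text \<open>The amplification is at most \<open>6 * n ^ 3 / c\<close>, and the mean distance at the
  switch at most \<open>4 * g / (n ^ 5 * c)\<close>; the product is of order n to the power
  -2.\<close>

lemma initial_error_le:
  fixes \<beta> d g :: real
  assumes \<beta>: "0 < \<beta>" and d: "1 \<le> d" and n: "2 \<le> n" and g: "0 \<le> g"
  defines "c \<equiv> time_fraction \<beta> d" and "r \<equiv> tilt_time \<beta> d n" and "t1 \<equiv> switch_time \<beta> d n" and "T \<equiv> horizon \<beta> d n"
  shows "(4 * real n / r + 2 / sqrt r) * (g * (exp (- (real n ^ 10) * t1) * (sqrt T + sqrt t1) + 2 / sqrt (real n ^ 10)))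
    \<le> 24 * g / c\<^sup>2 * (1 / real n)"
proof -
  note sch = time_schedule[OF \<beta> d n]
  define m where "m = real n"
  have m: "2 \<le> m" "1 \<le> m" using n by (auto simp: m_def)
  have c: "0 < c" "c \<le> 1" using sch(1,2) by (auto simp: c_def)
  have r0: "0 < r" using sch by (simp add: r_def)
  have r1: "r \<le> 1" using sch(4,9) unfolding r_def by linarith
  have "c * (1 / m\<^sup>2) \<le> c * early_time \<beta> d n" using c sch(3) by (intro mult_left_mono) (auto simp: m_def)
  then have rm: "c / m\<^sup>2 \<le> r" by (simp add: r_def tilt_time_def c_def)
  have t1: "r \<le> t1" "t1 \<le> T" "T \<le> m" using sch by (auto simp: r_def t1_def T_def m_def)
  have "1 / r \<le> 1 / (c / m\<^sup>2)" using rm c m r0 by (intro divide_left_mono) auto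
  then have ir: "1 / r \<le> m\<^sup>2 / c" by simp
  have "m\<^sup>2 * 1 \<le> m\<^sup>2 * m" using m by (intro mult_left_mono) auto
  then have "m\<^sup>2 / c \<le> m ^ 3 / c" using c by (intro divide_right_mono) (auto simp: power2_eq_square power3_eq_cube)
  then have ir2: "1 / r \<le> m ^ 3 / c" using ir by simp
  have rs: "r \<le> sqrt r" using r0 r1 by (intro real_le_rsqrt) (simp add: power2_eq_square mult_left_le)
  have "1 / sqrt r \<le> 1 / r" using rs r0 by (intro divide_left_mono) auto
  then have f1: "2 / sqrt r \<le> 2 * (m ^ 3 / c)" using ir2 by simp
  have "4 * m * (1 / r) \<le> 4 * m * (m\<^sup>2 / c)" using ir m by (intro mult_left_mono) auto
  then have f2: "4 * m / r \<le> 4 * (m ^ 3 / c)" by (simp add: power2_eq_square power3_eq_cube)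
  have F: "4 * m / r + 2 / sqrt r \<le> 6 * (m ^ 3 / c)" using f1 f2 by linarith
  \<comment> \<open>The contraction lasts at least \<open>c / m\<^sup>2\<close>, so the exponent is
    at least \<open>m ^ 8 * c\<close>; then even the inverse of the exponent bounds the exponential
    well enough.\<close>
  have "m ^ 10 * (c / m\<^sup>2) \<le> m ^ 10 * t1" using rm t1 m by (intro mult_left_mono) auto
  moreover have "m ^ 10 * (c / m\<^sup>2) = m ^ 8 * c" 
  proof -
    have "m ^ 10 = m ^ 8 * m\<^sup>2" by (simp add: power_add[symmetric])
    then have "m ^ 10 * (c / m\<^sup>2) = m ^ 8 * m\<^sup>2 * (c / m\<^sup>2)" by (simp only:)
    also have "\<dots> = m ^ 8 * (m\<^sup>2 * (c / m\<^sup>2))" by (rule mult.assoc)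
    also have "m\<^sup>2 * (c / m\<^sup>2) = c" using m by simp
    finally show ?thesis .
  qed
  ultimately have x: "m ^ 8 * c \<le> m ^ 10 * t1" by simp
  have x0: "0 < m ^ 8 * c" using m c by simp
  have "m ^ 10 * t1 \<le> exp (m ^ 10 * t1)" using exp_ge_add_one_self[of "m ^ 10 * t1"] by linarith
  then have "m ^ 8 * c \<le> exp (m ^ 10 * t1)" using x by linarith
  then have ex: "exp (- (m ^ 10) * t1) \<le> 1 / (m ^ 8 * c)" using x0
    using le_imp_inverse_le[of "m ^ 8 * c" "exp (m ^ 10 * t1)"] by (simp only: exp_minus inverse_eq_divide mult_minus_left)
  have "sqrt T \<le> m" "sqrt t1 \<le> m"
  proof -
    have "m \<le> m\<^sup>2" using m by (simp add: power2_eq_square)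
    then have "T \<le> m\<^sup>2" "t1 \<le> m\<^sup>2" using t1 by auto
    then show "sqrt T \<le> m" "sqrt t1 \<le> m" using m by (auto intro: real_le_lsqrt)
  qed
  then have "exp (- (m ^ 10) * t1) * (sqrt T + sqrt t1) \<le> 1 / (m ^ 8 * c) * (2 * m)"
    using ex t1 r0 x0 by (intro mult_mono) auto
  also have "\<dots> = 2 / (m ^ 7 * c)" using m c power_add[of m 7 1] by simp
  also have "\<dots> \<le> 2 / (m ^ 5 * c)" using m c by (intro divide_left_mono mult_right_mono power_increasing) auto
  finally have e1: "exp (- (m ^ 10) * t1) * (sqrt T + sqrt t1) \<le> 2 / (m ^ 5 * c)" .
  have "sqrt (m ^ 10) = m ^ 5" using m by (intro real_sqrt_unique) (auto simp: power_mult[symmetric])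
  moreover have "2 / m ^ 5 \<le> 2 / (m ^ 5 * c)" using m c by (intro divide_left_mono) (auto simp: mult_left_le)
  ultimately have e2: "2 / sqrt (m ^ 10) \<le> 2 / (m ^ 5 * c)" by simp
  have e: "g * (exp (- (m ^ 10) * t1) * (sqrt T + sqrt t1) + 2 / sqrt (m ^ 10)) \<le> g * (4 / (m ^ 5 * c))"
    using add_mono[OF e1 e2] by (intro mult_left_mono g) (simp add: mult.commute)
  have "(4 * m / r + 2 / sqrt r) * (g * (exp (- (m ^ 10) * t1) * (sqrt T + sqrt t1) + 2 / sqrt (m ^ 10)))
      \<le> (6 * (m ^ 3 / c)) * (g * (4 / (m ^ 5 * c)))"
    using t1 r0 m c g by (intro mult_mono[OF F e]) auto
  also have "\<dots> = 24 * g / c\<^sup>2 * (1 / m\<^sup>2)" using m c power_add[of m 3 2] by (simp add: power2_eq_square)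
  also have "\<dots> \<le> 24 * g / c\<^sup>2 * (1 / m)" using m c g by (intro mult_left_mono divide_left_mono) (auto simp: power2_eq_square)
  finally show ?thesis by (simp add: m_def)
qed

section \<open>Assembly for a sub-Gaussian density of the Sobolev class\<close>

lemma borel_prob_density:
  fixes p :: "real ^ 'd::finite \<Rightarrow> real"
  assumes "integrable lborel p" "AE x in lborel. 0 \<le> p x" "(LINT x|lborel. p x) = 1"
  shows "borel_prob (density lborel (\<lambda>x. ennreal (p x)))"
proof -
  have [measurable]: "p \<in> borel_measurable borel" using borel_measurable_integrable[OF assms(1)] by simp
  have "emeasure (density lborel (\<lambda>x. ennreal (p x))) UNIV = (\<integral>\<^sup>+x. ennreal (p x) \<partial>lborel)" by (simp add: emeasure_density)
  also have "\<dots> = 1" using nn_integral_eq_integral[OF assms(1,2)] assms(3) by simp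
  finally have "prob_space (density lborel (\<lambda>x. ennreal (p x)))" by (intro prob_spaceI) simp
  then show ?thesis by (simp add: borel_prob_def borel_prob_axioms_def)
qed

lemma chr_density:
  fixes p :: "real ^ 'd::finite \<Rightarrow> real"
  assumes "integrable lborel p" "AE x in lborel. 0 \<le> p x" "(LINT x|lborel. p x) = 1"
  shows "borel_prob.chr (density lborel (\<lambda>x. ennreal (p x))) \<xi> = fourier p \<xi>"
proof -
  interpret borel_prob "density lborel (\<lambda>x. ennreal (p x))" by (rule borel_prob_density[OF assms])
  have [measurable]: "p \<in> borel_measurable borel" using borel_measurable_integrable[OF assms(1)] by simp
  have "chr \<xi> = (LINT x|lborel. p x *\<^sub>R cis ((- \<xi>) \<bullet> x))"
    unfolding chr_def by (rule integral_density) (use assms(2) in auto)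
  also have "\<dots> = fourier p \<xi>" unfolding fourier_def
    by (intro Bochner_Integration.integral_cong refl) (simp add: scaleR_conv_of_real cis_conv_exp)
  finally show ?thesis .
qed

lemma tv_dist_le:
  assumes "AE x in lborel. p x = g x" shows "tv_dist p q \<le> (\<integral>\<^sup>+x. ennreal \<bar>g x - q x\<bar> \<partial>lborel)"
proof -
  have "(\<integral>\<^sup>+x. ennreal \<bar>p x - q x\<bar> \<partial>lborel) = (\<integral>\<^sup>+x. ennreal \<bar>g x - q x\<bar> \<partial>lborel)"
    by (rule nn_integral_cong_AE) (use assms in auto)
  moreover have "a / 2 \<le> a" for a :: ennreal
  proof (cases a)
    case (real x)
    then show ?thesis using ennreal_divide_numeral[of x "num.Bit0 num.One"] by (simp add: ennreal_leI)
  qed simp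
  ultimately show ?thesis by (simp add: tv_dist_def)
qed

text \<open>The half-side \<open>ln n\<close> of the cube makes the tail factor
  \<open>exp (- \<rho>)\<close> equal to 1/n, while the volume costs only a power of the
  logarithm.\<close>

lemma smooth_bias_le:
  fixes p :: "real ^ 'd::finite \<Rightarrow> real" and \<beta> L :: real
  defines "P \<equiv> density lborel (\<lambda>x. ennreal (p x))"
  assumes \<beta>: "0 < \<beta>" "\<beta> \<le> 2" and L: "0 < L" and p: "p \<in> sobolev_densities \<beta> L"
    and A: "\<And>j. (\<integral>\<^sup>+x. ennreal (exp \<bar>x $ j\<bar>) \<partial>P) \<le> ennreal A" "0 \<le> A" and n: "2 \<le> n"
    and r: "0 < r" "r \<le> early_time \<beta> (real CARD('d)) n"
  shows "(\<integral>\<^sup>+x. ennreal \<bar>p x - borel_prob.smooth P r x\<bar> \<partial>lborel) \<le> ennreal (2 * (sqrt ((2 * ln (real n)) ^ CARD('d)) *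
     real n powr (- (\<beta> / (2 * \<beta> + real CARD('d)))) * (sqrt (real CARD('d) powr \<beta> * real CARD('d)) * L)
     + 2 * (real CARD('d) * A * gauss_exp TYPE('d) / real n)))"
proof -
  let ?d = "real CARD('d)"
  define \<nu> where "\<nu> = real n powr (- (\<beta> / (2 * \<beta> + ?d)))"
  have d: "1 \<le> ?d" by (simp add: Suc_le_eq)
  have sp: "integrable lborel p" "AE x in lborel. 0 \<le> p x" "(LINT x|lborel. p x) = 1" using p by (auto simp: sobolev_densities_def)
  interpret P: borel_prob P unfolding P_def by (rule borel_prob_density[OF sp])
  have r1: "r \<le> 1" using time_schedule(4)[OF \<beta>(1) d n] r by linarith
  have \<nu>: "0 < \<nu>" using n by (simp add: \<nu>_def)
  have ln: "0 < ln (real n)" using n by simp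
  define I where "I = \<nu>\<^sup>2 * (?d powr \<beta> * ?d * L\<^sup>2)"
  have sob: "(\<integral>\<^sup>+ \<xi>. ennreal ((abs_monomial (axis j \<beta>) \<xi>)\<^sup>2 * (cmod (P.chr \<xi>))\<^sup>2) \<partial>lborel) \<le> ennreal ((2 * pi) ^ CARD('d) * L\<^sup>2)" for j :: 'd
  proof -
    have "(\<Sum>i\<in>UNIV. axis j \<beta> $ i) = \<beta>" by (simp add: axis_def)
    moreover have "\<forall>i. 0 \<le> axis j \<beta> $ i" using \<beta> by (simp add: axis_def)
    ultimately show ?thesis using p unfolding P_def chr_density[OF sp] by (auto simp: sobolev_densities_def)
  qed
  have rI: "r powr \<beta> * (?d powr \<beta> * ?d * L\<^sup>2) \<le> I"
    unfolding I_def \<nu>_def using rate_power[OF \<beta>(1) _ n, of ?d] powr_mono2[of \<beta> r "early_time \<beta> ?d n"] r \<beta>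
    by (intro mult_right_mono) auto
  have I0: "0 < I" using \<nu> L d by (simp add: I_def)
  have b: "(\<integral>\<^sup>+x. ennreal \<bar>P.smooth e x - P.smooth r x\<bar> \<partial>lborel) \<le> ennreal (sqrt ((2 * ln (real n)) ^ CARD('d) * I)
      + 2 * (?d * A * gauss_exp TYPE('d) * exp (- ln (real n))))" if "0 < e" "e \<le> r" for e
    by (rule P.smooth_diff_L1[OF that r1 A order_trans[OF P.smooth_diff_L2[OF \<beta> that sob] rI] I0 ln])
  have "(\<integral>\<^sup>+x. ennreal \<bar>p x - P.smooth r x\<bar> \<partial>lborel) \<le> ennreal (2 * (sqrt ((2 * ln (real n)) ^ CARD('d) * I)
      + 2 * (?d * A * gauss_exp TYPE('d) * exp (- ln (real n)))))"
    by (rule P.density_smooth_L1[OF sp P_def[THEN meta_eq_to_obj_eq] r(1) b])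
      (use ln I0 A gauss_exp_nonneg[where 'd='d] in auto)
  also have "sqrt ((2 * ln (real n)) ^ CARD('d) * I) = sqrt ((2 * ln (real n)) ^ CARD('d)) * \<nu> * (sqrt (?d powr \<beta> * ?d) * L)"
    using \<nu> L by (simp add: I_def real_sqrt_mult)
  also have "exp (- ln (real n)) = 1 / real n" using n by (simp add: exp_minus inverse_eq_divide)
  finally show ?thesis by (simp add: \<nu>_def)
qed


text \<open>The summands of \<open>K\<close> belong, in this order, to the bias, the tails, the
  deviation of the estimator, the change of the sites (\<open>2 + 2 * (d * A)\<close>), and the
  distance from the origin at the switch.\<close>

lemma (in diffusion) tilted_density_L1_rate:
  fixes \<beta> L :: real
  assumes \<beta>: "0 < \<beta>" "\<beta> \<le> 2" and L: "0 < L" and p: "p \<in> sobolev_densities \<beta> L"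
    and A: "\<And>j. (\<integral>\<^sup>+x. ennreal (exp \<bar>x $ j\<bar>) \<partial>density lborel (\<lambda>x. ennreal (p x))) \<le> ennreal A" "0 \<le> A" and n: "2 \<le> n"
    and T: "T = horizon \<beta> (real CARD('d)) n"
    and Y: "diffusion_solution M n (est_score \<beta>) T (T - early_time \<beta> (real CARD('d)) n) X U Y0 B Y"
  defines "K \<equiv> 2 * (sqrt (real CARD('d) powr \<beta> * real CARD('d)) * L) + 6 * (real CARD('d) * A * gauss_exp TYPE('d))
      + sqrt ((1 / sqrt (2 * pi * time_fraction \<beta> (real CARD('d)))) ^ CARD('d)) + 2 + 2 * (real CARD('d) * A)
      + 24 * gauss_abs TYPE('d) / (time_fraction \<beta> (real CARD('d)))\<^sup>2"
  shows "\<exists>q. conditional_density M SU Z (Y (T - early_time \<beta> (real CARD('d)) n)) q \<and>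
    (\<integral>\<^sup>+\<omega>. tv_dist p (q (Z \<omega>)) \<partial>M) \<le>
      ennreal (K * (sqrt ((2 * ln (real n)) ^ CARD('d)) * real n powr (- (\<beta> / (2 * \<beta> + real CARD('d))))))"
proof -
  let ?d = "real CARD('d)"
  define P where "P = density lborel (\<lambda>x. ennreal (p x))"
  define r where "r = tilt_time \<beta> ?d n"
  define t1 where "t1 = switch_time \<beta> ?d n"
  define c where "c = time_fraction \<beta> ?d"
  define \<nu> where "\<nu> = real n powr (- (\<beta> / (2 * \<beta> + ?d)))"
  define S where "S = sqrt ((2 * ln (real n)) ^ CARD('d))"
  \<comment> \<open>\<open>p\<close> is nonnegative only almost everywhere, whereas
    \<open>conditional_density_exists\<close> compares with functions that are nonnegative
    throughout.\<close>
  define g where "g y = max 0 (p y)" for y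
  define b0 where "b0 = sqrt (?d powr \<beta> * ?d) * L"
  define k0 where "k0 = ?d * A * gauss_exp TYPE('d)"
  define e1 where "e1 = gauss_abs TYPE('d) * (exp (- (real n ^ 10) * t1) * (sqrt T + sqrt t1) + 2 / sqrt (real n ^ 10))"
  have d: "1 \<le> ?d" by (simp add: Suc_le_eq)
  note sch = time_schedule[OF \<beta>(1) d n]
  have sp: "integrable lborel p" "AE x in lborel. 0 \<le> p x" "(LINT x|lborel. p x) = 1" using p by (auto simp: sobolev_densities_def)
  have [measurable]: "p \<in> borel_measurable borel" using borel_measurable_integrable[OF sp(1)] by simp
  have gm[measurable]: "g \<in> borel_measurable borel" unfolding g_def[abs_def] by measurable
  have pg: "AE x in lborel. p x = g x" using sp(2) by (auto simp: g_def)
  have bp: "borel_prob P" unfolding P_def by (rule borel_prob_density[OF sp])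
  have r: "0 < r" "r \<le> early_time \<beta> ?d n" using sch by (auto simp: r_def)
  have r1: "r \<le> 1" using sch(4) r by linarith
  have t1: "0 < t1" using sch by (simp add: t1_def)
  have T0: "0 < T" using sch by (simp add: T)
  have H: "t1 + r = T - early_time \<beta> ?d n" by (simp add: t1_def r_def T switch_time_def)
  have c: "0 < c" using sch by (simp add: c_def)
  have ln: "0 < ln (real n)" using n by simp
  have n0: "0 < n" "0 < real n" using n by auto
  have \<nu>: "0 < \<nu>" using n by (simp add: \<nu>_def)
  have S0: "0 < S" using ln by (simp add: S_def)
  have k0: "0 \<le> k0" using A gauss_exp_nonneg[where 'd='d] by (simp add: k0_def)
  have b0: "0 \<le> b0" using L by (simp add: b0_def)
  have g0: "0 \<le> gauss_abs TYPE('d)" by (rule gauss_abs_nonneg)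
  have e10: "0 \<le> e1" using T0 t1 g0 by (simp add: e1_def)
  interpret ph: tilt_phase M n p Q T X U Y0 B n "real n / r" r t1 "site n r" Y
    using est_solution_phases(1)[OF \<beta>(1) n T Y] by (simp add: r_def t1_def)
  obtain q where q: "conditional_density M SU Z (Y (t1 + r)) q"
    and qb: "\<And>g :: real ^ 'd \<Rightarrow> real. g \<in> borel_measurable borel \<Longrightarrow> (\<And>y. 0 \<le> g y) \<Longrightarrow>
      (\<integral>\<^sup>+\<omega>. (\<integral>\<^sup>+y. ennreal \<bar>g y - q (Z \<omega>) y\<bar> \<partial>lborel) \<partial>M)
      \<le> (\<integral>\<^sup>+\<omega>. (\<integral>\<^sup>+y. ennreal \<bar>g y - tilt_kernel n (site n r (Z \<omega>)) r (Y t1 \<omega>) y\<bar> \<partial>lborel) \<partial>M)"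
    using ph.conditional_density_exists by blast
  have Y1: "Y t1 \<in> borel_measurable M" using Y t1 r H by (auto simp: diffusion_solution_def)
  have "0 < real n ^ 10" using n by simp
  from linear_drift_moment[OF this t1 T0 Y1 est_solution_phases(2)[OF \<beta>(1) n T Y, folded t1_def]]
  have e1: "(\<integral>\<^sup>+\<omega>. ennreal (norm (Y t1 \<omega>)) \<partial>M) \<le> ennreal e1" by (simp add: e1_def)
  have bias: "(\<integral>\<^sup>+y. ennreal \<bar>g y - borel_prob.smooth P r y\<bar> \<partial>lborel) \<le> ennreal (2 * (S * \<nu> * b0 + 2 * (k0 / real n)))"
  proof -
    have "(\<integral>\<^sup>+y. ennreal \<bar>g y - borel_prob.smooth P r y\<bar> \<partial>lborel) = (\<integral>\<^sup>+y. ennreal \<bar>p y - borel_prob.smooth P r y\<bar> \<partial>lborel)"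
      by (rule nn_integral_cong_AE) (use pg in auto)
    then show ?thesis using smooth_bias_le[OF \<beta> L p A n r] by (simp add: P_def S_def \<nu>_def b0_def k0_def)
  qed
  have "(\<integral>\<^sup>+\<omega>. tv_dist p (q (Z \<omega>)) \<partial>M) \<le> (\<integral>\<^sup>+\<omega>. (\<integral>\<^sup>+y. ennreal \<bar>g y - q (Z \<omega>) y\<bar> \<partial>lborel) \<partial>M)"
    by (intro nn_integral_mono tv_dist_le pg)
  also have "\<dots> \<le> (\<integral>\<^sup>+\<omega>. (\<integral>\<^sup>+y. ennreal \<bar>g y - tilt_kernel n (site n r (Z \<omega>)) r (Y t1 \<omega>) y\<bar> \<partial>lborel) \<partial>M)"
    by (rule qb) (auto simp: g_def)
  also have "\<dots> \<le> ennreal (2 * (S * \<nu> * b0 + 2 * (k0 / real n)) + (sqrt ((2 * ln (real n)) ^ CARD('d) * ((1 / sqrt (2 * pi * r)) ^ CARD('d) / real n))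
       + 2 * (real CARD('d) * A * gauss_exp TYPE('d) * exp (- ln (real n))))
       + (2 / real n + 2 * real CARD('d) * A / real n) + (4 * real n / r + 2 / sqrt r) * e1)"
    by (rule kernel_L1_bound[OF bp[unfolded P_def] n0(1) r(1) r1 ln A gm bias[unfolded P_def] _ Y1 e1 e10])
      (use S0 \<nu> b0 k0 in auto)
  also have "\<dots> \<le> ennreal (K * (S * \<nu>))"
  proof (rule ennreal_leI)
    let ?v = "sqrt ((1 / sqrt (2 * pi * c)) ^ CARD('d))"
    have v: "sqrt ((2 * ln (real n)) ^ CARD('d) * ((1 / sqrt (2 * pi * r)) ^ CARD('d) / real n)) = ?v * (S * \<nu>)"
      unfolding r_def tilt_time_def variance_rate[OF \<beta>(1) n c, unfolded c_def]
      using \<nu> by (simp add: real_sqrt_mult S_def \<nu>_def c_def)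
    have inv: "1 / real n \<le> S * \<nu>" unfolding S_def \<nu>_def by (rule inverse_le_rate[OF \<beta>(1) n])
    \<comment> \<open>Of the 6, the part 4 stems from the tails in the bias, doubled in
      \<open>smooth_bias_le\<close>, and 2 from those of the estimator and its mean.\<close>
    have i1: "6 * k0 * (1 / real n) \<le> 6 * k0 * (S * \<nu>)" using k0 inv by (intro mult_left_mono) auto
    have i2: "(2 + 2 * (?d * A)) * (1 / real n) \<le> (2 + 2 * (?d * A)) * (S * \<nu>)" using A inv by (intro mult_left_mono) auto
    have "(4 * real n / r + 2 / sqrt r) * e1 \<le> 24 * gauss_abs TYPE('d) / c\<^sup>2 * (1 / real n)"
      unfolding e1_def r_def t1_def T c_def by (rule initial_error_le[OF \<beta>(1) d n g0])
    also have "\<dots> \<le> 24 * gauss_abs TYPE('d) / c\<^sup>2 * (S * \<nu>)" using g0 inv by (intro mult_left_mono) auto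
    finally have i3: "(4 * real n / r + 2 / sqrt r) * e1 \<le> 24 * gauss_abs TYPE('d) / c\<^sup>2 * (S * \<nu>)" .
    have "2 * (S * \<nu> * b0 + 2 * (k0 / real n)) + (?v * (S * \<nu>) + 2 * (k0 * exp (- ln (real n))))
       + (2 / real n + 2 * ?d * A / real n) + (4 * real n / r + 2 / sqrt r) * e1
       = 2 * b0 * (S * \<nu>) + ?v * (S * \<nu>) + 6 * k0 * (1 / real n) + (2 + 2 * (?d * A)) * (1 / real n) + (4 * real n / r + 2 / sqrt r) * e1"
      using n0 by (simp add: exp_minus field_simps)
    also have "\<dots> \<le> 2 * b0 * (S * \<nu>) + ?v * (S * \<nu>) + 6 * k0 * (S * \<nu>) + (2 + 2 * (?d * A)) * (S * \<nu>) + 24 * gauss_abs TYPE('d) / c\<^sup>2 * (S * \<nu>)"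
      using i1 i2 i3 by linarith
    also have "\<dots> = K * (S * \<nu>)" unfolding K_def b0_def[symmetric] k0_def[symmetric] c_def[symmetric] by (simp only: algebra_simps)
    finally show "2 * (S * \<nu> * b0 + 2 * (k0 / real n)) + (sqrt ((2 * ln (real n)) ^ CARD('d) * ((1 / sqrt (2 * pi * r)) ^ CARD('d) / real n))
       + 2 * (real CARD('d) * A * gauss_exp TYPE('d) * exp (- ln (real n))))
       + (2 / real n + 2 * real CARD('d) * A / real n) + (4 * real n / r + 2 / sqrt r) * e1 \<le> K * (S * \<nu>)"
      unfolding v by (simp add: k0_def)
  qed
  finally show ?thesis using q unfolding H S_def \<nu>_def by blast
qed

theorem theorem3p8:
  fixes \<beta> L :: real
  assumes "0 < \<beta>" and "\<beta> \<le> 2" and "0 < L"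
  shows "\<exists>(Q :: real measure) (s :: 'd::finite score_rule). score_estimator Q s \<and>
    (\<forall>(p0 :: real ^ 'd \<Rightarrow> real) \<sigma>0.
      sub_gaussian_density \<sigma>0 p0 \<and> p0 \<in> sobolev_densities \<beta> L \<longrightarrow>
      (\<exists>K C :: real. \<forall>n\<ge>2.
        let d = real CARD('d);
            t0 = real n powr (- (2 / (2 * \<beta> + d)));
            T = real n powr (2 * \<beta> / (2 * \<beta> + d))
        in \<forall>(M :: 'w measure) X U Y0 B. diffusion_input M n p0 Q T X U Y0 B \<longrightarrow>
          (\<exists>Y. diffusion_solution M n s T (T - t0) X U Y0 B Y) \<and>
          (\<forall>Y. diffusion_solution M n s T (T - t0) X U Y0 B Y \<longrightarrow>
            (\<exists>q. conditional_density M ((\<Pi>\<^sub>M i\<in>{..<n}. borel) \<Otimes>\<^sub>M borel)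
                   (\<lambda>\<omega>. (samples n X \<omega>, U \<omega>)) (Y (T - t0)) q \<and>
                 (\<integral>\<^sup>+ \<omega>. tv_dist p0 (q (samples n X \<omega>, U \<omega>)) \<partial>M)
                   \<le> ennreal (K * ln (real n) powr C * real n powr (- (\<beta> / (2 * \<beta> + d))))))))"
proof (rule exI[of _ "return borel 0"], rule exI[of _ "est_score \<beta> :: 'd score_rule"], rule conjI, rule score_estimator_est_score, intro allI impI)
  fix p0 :: "real ^ 'd \<Rightarrow> real" and \<sigma>0
  assume p0: "sub_gaussian_density \<sigma>0 p0 \<and> p0 \<in> sobolev_densities \<beta> L"
  let ?d = "real CARD('d)"
  have sob: "p0 \<in> sobolev_densities \<beta> L" and "prob_space (density lborel (\<lambda>x. ennreal (p0 x)))"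
    using p0 borel_prob_density[of p0] by (auto simp: sobolev_densities_def borel_prob_def)
  with p0 obtain A where A: "0 \<le> A"
    "\<And>j. (\<integral>\<^sup>+x. ennreal (exp \<bar>x $ j\<bar>) \<partial>density lborel (\<lambda>x. ennreal (p0 x))) \<le> ennreal A"
    using sub_gaussian_exp_moment by blast
  define K where "K = 2 * (sqrt (?d powr \<beta> * ?d) * L) + 6 * (?d * A * gauss_exp TYPE('d))
      + sqrt ((1 / sqrt (2 * pi * time_fraction \<beta> ?d)) ^ CARD('d)) + 2 + 2 * (?d * A)
      + 24 * gauss_abs TYPE('d) / (time_fraction \<beta> ?d)\<^sup>2"
  \<comment> \<open>The logarithmic exponent d/2 is the square root of the volume of the cube, taken
    by Cauchy-Schwarz; \<open>2 powr (d / 2)\<close> goes into the constant.\<close>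
  have S: "sqrt ((2 * ln (real n)) ^ CARD('d)) = 2 powr (?d / 2) * ln (real n) powr (?d / 2)" if "2 \<le> n" for n
  proof -
    have "sqrt ((2 * ln (real n)) ^ CARD('d)) = ((2 * ln (real n)) powr ?d) powr (1 / 2)"
      using that by (simp add: powr_half_sqrt powr_realpow)
    also have "\<dots> = (2 * ln (real n)) powr (?d / 2)" by (simp add: powr_powr)
    finally show ?thesis by (simp add: powr_mult)
  qed
  show "\<exists>K C :: real. \<forall>n\<ge>2.
        let d = real CARD('d);
            t0 = real n powr (- (2 / (2 * \<beta> + d)));
            T = real n powr (2 * \<beta> / (2 * \<beta> + d))
        in \<forall>(M :: 'w measure) X U Y0 B. diffusion_input M n p0 (return borel 0) T X U Y0 B \<longrightarrow>
          (\<exists>Y. diffusion_solution M n (est_score \<beta>) T (T - t0) X U Y0 B Y) \<and>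
          (\<forall>Y. diffusion_solution M n (est_score \<beta>) T (T - t0) X U Y0 B Y \<longrightarrow>
            (\<exists>q. conditional_density M ((\<Pi>\<^sub>M i\<in>{..<n}. borel) \<Otimes>\<^sub>M borel)
                   (\<lambda>\<omega>. (samples n X \<omega>, U \<omega>)) (Y (T - t0)) q \<and>
                 (\<integral>\<^sup>+ \<omega>. tv_dist p0 (q (samples n X \<omega>, U \<omega>)) \<partial>M)
                   \<le> ennreal (K * ln (real n) powr C * real n powr (- (\<beta> / (2 * \<beta> + d))))))"
    unfolding Let_def early_time_def[symmetric] horizon_def[symmetric]
  proof (rule exI[of _ "K * 2 powr (?d / 2)"], rule exI[of _ "?d / 2"], intro allI impI conjI)
    fix n :: nat and M :: "'w measure" and X U Y0 B
    assume n: "2 \<le> n" and "diffusion_input M n p0 (return borel 0) (horizon \<beta> ?d n) X U Y0 B"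
    then interpret diffusion M n p0 "return borel 0" "horizon \<beta> ?d n" X U Y0 B
      by (simp add: diffusion_def diffusion_axioms_def diffusion_input_def)
    show "\<exists>Y. diffusion_solution M n (est_score \<beta>) (horizon \<beta> ?d n) (horizon \<beta> ?d n - early_time \<beta> ?d n) X U Y0 B Y"
      by (rule est_solution_exists[OF assms(1) n refl])
    fix Y
    assume "diffusion_solution M n (est_score \<beta>) (horizon \<beta> ?d n) (horizon \<beta> ?d n - early_time \<beta> ?d n) X U Y0 B Y"
    from tilted_density_L1_rate[OF assms sob A(2,1) n refl this, folded K_def, unfolded S[OF n]]
    show "\<exists>q. conditional_density M SU Z (Y (horizon \<beta> ?d n - early_time \<beta> ?d n)) q \<and>
      (\<integral>\<^sup>+ \<omega>. tv_dist p0 (q (Z \<omega>)) \<partial>M)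
        \<le> ennreal (K * 2 powr (?d / 2) * ln (real n) powr (?d / 2) * real n powr (- (\<beta> / (2 * \<beta> + ?d))))"
      by (simp add: mult.assoc)
  qed
qed

end
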